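(* Let $t_0>0$, $\mathcal I=[0,t_0]$, $|\mathcal I|=t_0$. For all $1<p,q<\infty$ and $n\in\mathbb N$ (positive integer), the second order embedding $E_2:W^{2,p}_{\mathrm D}(\mathcal I)\to L^q(\mathcal I)$, $E_2u=u$, has s-numbers obeying the following relations. (i) If $p<q$, then $$i_n(E_2)\ge \mathrm{sn}_n^{-1/q}=\frac{|\mathcal I|^{1/q+2-1/p}}{n^2\lambda_1^{1/q}}.$$ (ii) If $p\ge q$, then $$a_n(E_2)\le \mathrm{sn}_n^{-1/q}=\frac{|\mathcal I|^{1/q+2-1/p}}{n^2\lambda_1^{1/q}}.$$
   Context: $W^{2,p}_{\mathrm D}(\mathcal I)=\{u\in W^{2,p}(\mathcal I): u(0)=u(t_0)=0\}$ (real Sobolev space), with norm $\|u\|_{W^{2,p}_{\mathrm D}}=\|u''\|_{L^p(\mathcal I)}$. Let $B(X,Y)$ denote the bounded linear operators between Banach spaces $X,Y$. For $T\in B(X,Y)$ and $n\in\mathbb N$: the approximation numbers are $a_n(T)=\inf\{\|T-F\|: F\in B(X,Y),\ \operatorname{rank}(F)<n\}$; the isomorphism numbers are $i_n(T)=\sup\{\|A\|^{-1}\|B\|^{-1}\}$, the supremum being over all Banach spaces $G$ with $\dim G\ge n$ and maps $A\in B(Y,G)$, $B\in B(G,X)$ such that $ATB$ is the identity on $G$. On an interval $[0,t_0]$ consider the eigenvalue problem $(\operatorname{sgn}(u'')|u''|^{p-1})''=\lambda\operatorname{sgn}(u)|u|^{q-1}$ on $[0,t_0]$, $u(0)=u(t_0)=u''(0)=u''(t_0)=0$,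 with $u\not\equiv0$ and $\lambda>0$; solutions are such that $u$, $u'$, $\operatorname{sgn}(u'')|u''|^{p-1}$ and $(\operatorname{sgn}(u'')|u''|^{p-1})'$ are $C^1$ on $[0,t_0]$. A spectral couple on $[0,t_0]$ is an eigenpair $(f,\lambda)$ normalized by $\|f''\|_{L^p}=1$ and $f'(0)>0$; $\lambda$ is then called a spectral number. $\lambda_1$ denotes the first spectral number on the unit interval $[0,1]$ (the one whose spectral function $f$ has no zeros in $(0,1)$; it is the smallest), and $\mathrm{sn}_n=n^{2q}t_0^{q/p-1-2q}\lambda_1$ is the $n$-th spectral number on $\mathcal I=[0,t_0]$ (the one whose spectral function has exactly $n-1$ distinct zeros in $(0,t_0)$). *)

theory Defs
  imports "HOL-Analysis.Analysis"
begin

section \<open>Normed spaces and s-numbers\<close>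

text \<open>
  The spaces depend on real parameters (exponents, interval length), so they are carriers, that is
  linear subspaces of a real vector space type, equipped with their own norm. Operators only
  matter on the carrier of their domain.
\<close>

record 'a nspace =
  carr :: "'a set"
  nrm :: "'a \<Rightarrow> real"

definition normed_space :: "'a::real_vector nspace \<Rightarrow> bool" where
  "normed_space X \<longleftrightarrow> subspace (carr X) \<and>
     (\<forall>x\<in>carr X. 0 \<le> nrm X x \<and> (nrm X x = 0 \<longleftrightarrow> x = 0)) \<and>
     (\<forall>c. \<forall>x\<in>carr X. nrm X (c *\<^sub>R x) = \<bar>c\<bar> * nrm X x) \<and>
     (\<forall>x\<in>carr X. \<forall>y\<in>carr X. nrm X (x + y) \<le> nrm X x + nrm X y)"

definition banach_space :: "'a::real_vector nspace \<Rightarrow> bool" where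
  "banach_space X \<longleftrightarrow> normed_space X \<and>
     (\<forall>s::nat \<Rightarrow> 'a. (\<forall>k. s k \<in> carr X) \<and>
        (\<forall>e>0. \<exists>N. \<forall>j\<ge>N. \<forall>k\<ge>N. nrm X (s j - s k) < e) \<longrightarrow>
        (\<exists>x\<in>carr X. (\<lambda>k. nrm X (s k - x)) \<longlonglongrightarrow> 0))"

definition bounded_op ::
  "'a::real_vector nspace \<Rightarrow> 'b::real_vector nspace \<Rightarrow> ('a \<Rightarrow> 'b) \<Rightarrow> bool" where
  "bounded_op X Y T \<longleftrightarrow>
     (\<forall>x\<in>carr X. T x \<in> carr Y) \<and>
     (\<forall>x\<in>carr X. \<forall>y\<in>carr X. T (x + y) = T x + T y) \<and>
     (\<forall>c. \<forall>x\<in>carr X. T (c *\<^sub>R x) = c *\<^sub>R T x) \<and>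
     (\<exists>C. \<forall>x\<in>carr X. nrm Y (T x) \<le> C * nrm X x)"

definition op_norm :: "'a nspace \<Rightarrow> 'b nspace \<Rightarrow> ('a \<Rightarrow> 'b) \<Rightarrow> real" where
  "op_norm X Y T = (SUP x\<in>{x \<in> carr X. nrm X x \<le> 1}. nrm Y (T x))"

text \<open>The library's \<^const>\<open>dim\<close> is 0 on infinite-dimensional spaces, hence the following.\<close>

definition dim_ge :: "'a::real_vector set \<Rightarrow> nat \<Rightarrow> bool" where
  "dim_ge V n \<longleftrightarrow> (\<exists>B\<subseteq>V. finite B \<and> independent B \<and> card B = n)"

definition approx_number ::
  "'a::real_vector nspace \<Rightarrow> 'b::real_vector nspace \<Rightarrow> ('a \<Rightarrow> 'b) \<Rightarrow> nat \<Rightarrow> ennreal" where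
  "approx_number X Y T n =
     (INF F\<in>{F. bounded_op X Y F \<and> \<not> dim_ge (F ` carr X) n}.
        ennreal (op_norm X Y (\<lambda>x. T x - F x)))"

definition id_factorization ::
  "'a::real_vector nspace \<Rightarrow> 'b::real_vector nspace \<Rightarrow> ('a \<Rightarrow> 'b) \<Rightarrow>
   'g::real_vector nspace \<Rightarrow> ('b \<Rightarrow> 'g) \<Rightarrow> ('g \<Rightarrow> 'a) \<Rightarrow> bool" where
  "id_factorization X Y T G A B \<longleftrightarrow>
     banach_space G \<and> bounded_op Y G A \<and> bounded_op G X B \<and> (\<forall>g\<in>carr G. A (T (B g)) = g)"

text \<open>
  A formula cannot quantify over types, so \<open>G\<close> ranges over the Banach spaces carried by the type
  underlying \<open>X\<close>. Since \<open>B\<close> is injective, every \<open>G\<close> has an isometric copy there; lemma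
  \<open>iso_number_universal\<close> below shows that Banach spaces over any other type
  contribute nothing new. The supremum is taken in \<open>[0, \<infinity>]\<close>, so it is 0 if there is no factorization.
\<close>

definition iso_number ::
  "'a::real_vector nspace \<Rightarrow> 'b::real_vector nspace \<Rightarrow> ('a \<Rightarrow> 'b) \<Rightarrow> nat \<Rightarrow> ennreal" where
  "iso_number X Y T n =
     Sup {ennreal (inverse (op_norm Y G A) * inverse (op_norm G X B)) | (G :: 'a nspace) A B.
            id_factorization X Y T G A B \<and> dim_ge (carr G) n}"

lemma iso_number_universal:
  fixes X :: "'a::real_vector nspace" and Y :: "'b::real_vector nspace"
    and G :: "'g::real_vector nspace"
  assumes fac: "id_factorization X Y T G A B" and dim: "dim_ge (carr G) n"
  shows "ennreal (inverse (op_norm Y G A) * inverse (op_norm G X B)) \<le> iso_number X Y T n"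
proof -
  have ban: "banach_space G" and A: "bounded_op Y G A" and B: "bounded_op G X B"
    and id: "\<And>g. g \<in> carr G \<Longrightarrow> A (T (B g)) = g"
    using fac by (auto simp: id_factorization_def)
  have nG: "normed_space G" using ban by (simp add: banach_space_def)
  have sG: "subspace (carr G)" using nG by (simp add: normed_space_def)
  have BX: "\<And>g. g \<in> carr G \<Longrightarrow> B g \<in> carr X"
    and Badd: "\<And>g h. g \<in> carr G \<Longrightarrow> h \<in> carr G \<Longrightarrow> B (g + h) = B g + B h"
    and Bscale: "\<And>c g. g \<in> carr G \<Longrightarrow> B (c *\<^sub>R g) = c *\<^sub>R B g"
    using B by (auto simp: bounded_op_def)
  have AG: "\<And>y. y \<in> carr Y \<Longrightarrow> A y \<in> carr G"
    and Aadd: "\<And>g h. g \<in> carr Y \<Longrightarrow> h \<in> carr Y \<Longrightarrow> A (g + h) = A g + A h"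
    and Ascale: "\<And>c g. g \<in> carr Y \<Longrightarrow> A (c *\<^sub>R g) = c *\<^sub>R A g"
    using A by (auto simp: bounded_op_def)
  have B0: "B 0 = 0" using Bscale[of 0 0] subspace_0[OF sG] by simp
  have Bdiff: "B (g - h) = B g - B h" if "g \<in> carr G" "h \<in> carr G" for g h
    using Badd[of g "(-1) *\<^sub>R h"] Bscale[of h "-1"] that subspace_scale[OF sG, of h "-1"] by simp
  have B_eq_0: "B g = 0 \<longleftrightarrow> g = 0" if "g \<in> carr G" for g
    using id[OF that] id[OF subspace_0[OF sG]] B0 by metis
  define G' where "G' = \<lparr>carr = B ` carr G, nrm = (\<lambda>x. nrm G (A (T x)))\<rparr>"
  have c': "carr G' = B ` carr G" by (simp add: G'_def)
  have n': "nrm G' (B g) = nrm G g" if "g \<in> carr G" for g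
    using id[OF that] by (simp add: G'_def)
  have s': "subspace (carr G')"
    unfolding c'
  proof (rule subspaceI)
    show "0 \<in> B ` carr G" using B0 subspace_0[OF sG] by (metis imageI)
    show "x + y \<in> B ` carr G" if "x \<in> B ` carr G" "y \<in> B ` carr G" for x y
      using that Badd subspace_add[OF sG] by (metis (no_types, lifting) imageE imageI)
    show "c *\<^sub>R x \<in> B ` carr G" if "x \<in> B ` carr G" for c x
      using that Bscale subspace_scale[OF sG] by (metis (no_types, lifting) imageE imageI)
  qed
  have nG': "normed_space G'"
    unfolding normed_space_def
  proof (intro conjI ballI allI s')
    fix x assume "x \<in> carr G'"
    then obtain g where g: "g \<in> carr G" "x = B g" by (auto simp: c')
    show "0 \<le> nrm G' x" "nrm G' x = 0 \<longleftrightarrow> x = 0"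
      using nG g n' B_eq_0 by (auto simp: normed_space_def)
    show "nrm G' (c *\<^sub>R x) = \<bar>c\<bar> * nrm G' x" for c
      using nG g n'[of g] n'[of "c *\<^sub>R g"] subspace_scale[OF sG g(1), of c] Bscale[of g c]
      by (simp add: normed_space_def)
    fix y assume "y \<in> carr G'"
    then obtain h where h: "h \<in> carr G" "y = B h" by (auto simp: c')
    show "nrm G' (x + y) \<le> nrm G' x + nrm G' y"
      using nG g h n'[of g] n'[of h] n'[of "g + h"] subspace_add[OF sG g(1) h(1)] Badd[of g h]
      by (simp add: normed_space_def)
  qed
  have bG': "banach_space G'"
    unfolding banach_space_def
  proof (intro conjI nG' allI impI)
    fix s :: "nat \<Rightarrow> 'a"
    assume s: "(\<forall>k. s k \<in> carr G') \<and> (\<forall>e>0. \<exists>N. \<forall>j\<ge>N. \<forall>k\<ge>N. nrm G' (s j - s k) < e)"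
    then have "\<forall>k. \<exists>g. g \<in> carr G \<and> s k = B g" by (auto simp: c')
    then obtain r where r: "\<And>k. r k \<in> carr G" "\<And>k. s k = B (r k)" by metis
    have "nrm G' (s j - s k) = nrm G (r j - r k)" for j k
      using r Bdiff[of "r j" "r k"] n'[of "r j - r k"] subspace_diff[OF sG] by simp
    then have "\<forall>e>0. \<exists>N. \<forall>j\<ge>N. \<forall>k\<ge>N. nrm G (r j - r k) < e" using s by simp
    then obtain g where g: "g \<in> carr G" "(\<lambda>k. nrm G (r k - g)) \<longlonglongrightarrow> 0"
      using ban r(1) unfolding banach_space_def by blast
    have "nrm G' (s k - B g) = nrm G (r k - g)" for k
      using r g Bdiff[of "r k" g] n'[of "r k - g"] subspace_diff[OF sG] by simp
    then show "\<exists>x\<in>carr G'. (\<lambda>k. nrm G' (s k - x)) \<longlonglongrightarrow> 0"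
      using g by (intro bexI[of _ "B g"]) (auto simp: c')
  qed
  have A': "bounded_op Y G' (B \<circ> A)"
    using A AG Aadd Ascale Badd Bscale n' by (auto simp: bounded_op_def c')
  have B': "bounded_op G' X id"
    using B BX n' by (auto simp: bounded_op_def c')
  have fac': "id_factorization X Y T G' (B \<circ> A) id"
    using bG' A' B' id by (auto simp: id_factorization_def c')
  have opA: "op_norm Y G' (B \<circ> A) = op_norm Y G A"
    unfolding op_norm_def by (intro SUP_cong) (auto simp: n' AG)
  have "(\<lambda>x. nrm X (id x)) ` {x \<in> carr G'. nrm G' x \<le> 1} =
        (\<lambda>x. nrm X (B x)) ` {x \<in> carr G. nrm G x \<le> 1}"
    by (auto simp: c' n' image_iff)
  then have opB: "op_norm G' X id = op_norm G X B"
    unfolding op_norm_def by (rule arg_cong)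
  obtain S where S: "S \<subseteq> carr G" "finite S" "independent S" "card S = n"
    using dim by (auto simp: dim_ge_def)
  have inj: "inj_on B S" using S(1) id by (metis inj_onI subsetD)
  have Bsum: "(\<Sum>v\<in>R. c v *\<^sub>R B v) = B (\<Sum>v\<in>R. c v *\<^sub>R v)" if "finite R" "R \<subseteq> carr G" for c R
    using that
  proof (induction R rule: finite_induct)
    case (insert v R)
    have "(\<Sum>v\<in>R. c v *\<^sub>R v) \<in> carr G"
      using insert.prems by (intro subspace_sum[OF sG] subspace_scale[OF sG]) auto
    then show ?case using insert Badd Bscale subspace_scale[OF sG] by auto
  qed (simp add: B0)
  have "independent (B ` S)"
  proof
    assume "dependent (B ` S)"
    then obtain u where u: "\<exists>v\<in>B ` S. u v \<noteq> 0" "(\<Sum>v\<in>B ` S. u v *\<^sub>R v) = 0"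
      using dependent_finite[of "B ` S"] S(2) by auto
    have "B (\<Sum>v\<in>S. u (B v) *\<^sub>R v) = 0"
      using u(2) Bsum[OF S(2,1), of "\<lambda>v. u (B v)"] sum.reindex[OF inj, of "\<lambda>v. u v *\<^sub>R v"]
      by (simp add: o_def)
    moreover have "(\<Sum>v\<in>S. u (B v) *\<^sub>R v) \<in> carr G"
      using S(1) by (intro subspace_sum[OF sG] subspace_scale[OF sG]) auto
    ultimately have "(\<Sum>v\<in>S. u (B v) *\<^sub>R v) = 0" using B_eq_0 by blast
    moreover have "\<exists>v\<in>S. u (B v) \<noteq> 0" using u(1) by auto
    ultimately have "\<exists>c. (\<exists>v\<in>S. c v \<noteq> 0) \<and> (\<Sum>v\<in>S. c v *\<^sub>R v) = 0"
      by (intro exI[of _ "\<lambda>v. u (B v)"]) simp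
    then have "dependent S"
      using dependent_finite[OF S(2)] by simp
    then show False using S(3) by simp
  qed
  then have "dim_ge (carr G') n"
    using S card_image[OF inj] unfolding dim_ge_def c' by (intro exI[of _ "B ` S"]) auto
  with fac' have "ennreal (inverse (op_norm Y G' (B \<circ> A)) * inverse (op_norm G' X id))
      \<le> iso_number X Y T n"
    unfolding iso_number_def by (intro Sup_upper) blast
  then show ?thesis by (simp add: opA opB)
qed


section \<open>Lebesgue and Sobolev spaces on an interval\<close>

definition ae_eq :: "(real \<Rightarrow> real) \<Rightarrow> (real \<Rightarrow> real) \<Rightarrow> bool" where
  "ae_eq f g \<longleftrightarrow> f \<in> borel_measurable lborel \<and> g \<in> borel_measurable lborel \<and>
     (AE x in lborel. f x = g x)"

quotient_type L0 = "real \<Rightarrow> real" / partial: ae_eq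
proof (rule part_equivpI)
  show "\<exists>f. ae_eq f f" by (rule exI[of _ "\<lambda>_. 0"]) (simp add: ae_eq_def)
  show "symp ae_eq" by (rule sympI) (auto simp: ae_eq_def)
  show "transp ae_eq" by (rule transpI) (auto simp: ae_eq_def elim: AE_mp)
qed

instantiation L0 :: real_vector
begin

lift_definition zero_L0 :: L0 is "\<lambda>_. 0" by (simp add: ae_eq_def)

lift_definition plus_L0 :: "L0 \<Rightarrow> L0 \<Rightarrow> L0" is "\<lambda>f g x. f x + g x"
  by (auto simp: ae_eq_def)

lift_definition minus_L0 :: "L0 \<Rightarrow> L0 \<Rightarrow> L0" is "\<lambda>f g x. f x - g x"
  by (auto simp: ae_eq_def)

lift_definition uminus_L0 :: "L0 \<Rightarrow> L0" is "\<lambda>f x. - f x"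
  by (auto simp: ae_eq_def)

lift_definition scaleR_L0 :: "real \<Rightarrow> L0 \<Rightarrow> L0" is "\<lambda>c f x. c * f x"
  by (auto simp: ae_eq_def)

instance
  by standard (transfer; auto simp: ae_eq_def algebra_simps)+

end

text \<open>
  \<open>L\<^sup>p(0, t)\<close> consists of the classes that vanish a.e. outside \<open>[0, t]\<close> (extension by zero),
  so that all these spaces are subspaces of the single type \<^typ>\<open>L0\<close>.
\<close>

lift_definition in_Lp :: "real \<Rightarrow> real \<Rightarrow> L0 \<Rightarrow> bool" is
  "\<lambda>p t f. (AE x in lborel. x \<notin> {0..t} \<longrightarrow> f x = 0) \<and> integrable lborel (\<lambda>x. \<bar>f x\<bar> powr p)"
proof -
  fix p t :: real and f g :: "real \<Rightarrow> real"
  assume "ae_eq f g"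
  then have m: "f \<in> borel_measurable lborel" "g \<in> borel_measurable lborel"
    and eq: "AE x in lborel. f x = g x" by (auto simp: ae_eq_def)
  have "integrable lborel (\<lambda>x. \<bar>f x\<bar> powr p) = integrable lborel (\<lambda>x. \<bar>g x\<bar> powr p)"
    using m eq by (intro integrable_cong_AE) auto
  moreover have "(AE x in lborel. x \<notin> {0..t} \<longrightarrow> f x = 0) = (AE x in lborel. x \<notin> {0..t} \<longrightarrow> g x = 0)"
    using eq by (intro iffI) (auto elim: AE_mp)
  ultimately show "((AE x in lborel. x \<notin> {0..t} \<longrightarrow> f x = 0) \<and> integrable lborel (\<lambda>x. \<bar>f x\<bar> powr p)) =
      ((AE x in lborel. x \<notin> {0..t} \<longrightarrow> g x = 0) \<and> integrable lborel (\<lambda>x. \<bar>g x\<bar> powr p))"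
    by blast
qed

lift_definition Lp_norm :: "real \<Rightarrow> L0 \<Rightarrow> real" is
  "\<lambda>p f. (LINT x|lborel. \<bar>f x\<bar> powr p) powr (1 / p)"
proof -
  fix p :: real and f g :: "real \<Rightarrow> real"
  assume "ae_eq f g"
  then have "(LINT x|lborel. \<bar>f x\<bar> powr p) = (LINT x|lborel. \<bar>g x\<bar> powr p)"
    by (intro integral_cong_AE) (auto simp: ae_eq_def)
  then show "(LINT x|lborel. \<bar>f x\<bar> powr p) powr (1 / p) = (LINT x|lborel. \<bar>g x\<bar> powr p) powr (1 / p)"
    by simp
qed

definition Lp :: "real \<Rightarrow> real \<Rightarrow> L0 nspace" where
  "Lp p t = \<lparr>carr = {u. in_Lp p t u}, nrm = Lp_norm p\<rparr>"

definition test_fun :: "real \<Rightarrow> (real \<Rightarrow> real) \<Rightarrow> bool" where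
  "test_fun t \<phi> \<longleftrightarrow> (\<forall>k. (deriv ^^ k) \<phi> differentiable_on UNIV) \<and>
     (\<exists>a b. 0 < a \<and> b < t \<and> (\<forall>x. x \<notin> {a..b} \<longrightarrow> \<phi> x = 0))"

lift_definition weak_deriv :: "real \<Rightarrow> nat \<Rightarrow> L0 \<Rightarrow> L0 \<Rightarrow> bool" is
  "\<lambda>t k f g. \<forall>\<phi>. test_fun t \<phi> \<longrightarrow>
     (LINT x:{0<..<t}|lborel. f x * (deriv ^^ k) \<phi> x) =
     (-1) ^ k * (LINT x:{0<..<t}|lborel. g x * \<phi> x)"
proof -
  fix t :: real and k :: nat and f f' g g' :: "real \<Rightarrow> real"
  assume ae: "ae_eq f f'" "ae_eq g g'"
  have *: "(LINT x:{0<..<t}|lborel. h x * \<psi> x) = (LINT x:{0<..<t}|lborel. h' x * \<psi> x)"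
    if "ae_eq h h'" "\<psi> differentiable_on UNIV" for h h' \<psi> :: "real \<Rightarrow> real"
  proof -
    have [measurable]: "\<psi> \<in> borel_measurable borel"
      using that(2) by (intro borel_measurable_continuous_onI differentiable_imp_continuous_on)
    have [measurable]: "h \<in> borel_measurable borel" "h' \<in> borel_measurable borel"
      using that(1) by (auto simp: ae_eq_def)
    have eq: "AE x in lborel. h x = h' x" using that(1) by (auto simp: ae_eq_def)
    show ?thesis
      unfolding set_lebesgue_integral_def
      by (intro integral_cong_AE) (use eq in \<open>auto elim: AE_mp\<close>)
  qed
  have "(LINT x:{0<..<t}|lborel. f x * (deriv ^^ k) \<phi> x) = (LINT x:{0<..<t}|lborel. f' x * (deriv ^^ k) \<phi> x)"
       "(LINT x:{0<..<t}|lborel. g x * \<phi> x) = (LINT x:{0<..<t}|lborel. g' x * \<phi> x)"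
    if "test_fun t \<phi>" for \<phi>
  proof -
    have d: "(deriv ^^ j) \<phi> differentiable_on UNIV" for j
      using that by (simp add: test_fun_def)
    show "(LINT x:{0<..<t}|lborel. f x * (deriv ^^ k) \<phi> x) = (LINT x:{0<..<t}|lborel. f' x * (deriv ^^ k) \<phi> x)"
      by (rule *[OF ae(1) d])
    show "(LINT x:{0<..<t}|lborel. g x * \<phi> x) = (LINT x:{0<..<t}|lborel. g' x * \<phi> x)"
      using d[of 0] by (intro *[OF ae(2)]) simp
  qed
  then show "(\<forall>\<phi>. test_fun t \<phi> \<longrightarrow> (LINT x:{0<..<t}|lborel. f x * (deriv ^^ k) \<phi> x) =
        (-1) ^ k * (LINT x:{0<..<t}|lborel. g x * \<phi> x)) =
      (\<forall>\<phi>. test_fun t \<phi> \<longrightarrow> (LINT x:{0<..<t}|lborel. f' x * (deriv ^^ k) \<phi> x) =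
        (-1) ^ k * (LINT x:{0<..<t}|lborel. g' x * \<phi> x))"
    by simp
qed

text \<open>Boundary values are those of the continuous representative.\<close>

lift_definition dirichlet :: "real \<Rightarrow> L0 \<Rightarrow> bool" is
  "\<lambda>t f. \<exists>c. continuous_on {0..t} c \<and> (AE x in lborel. x \<in> {0..t} \<longrightarrow> f x = c x) \<and>
     c 0 = 0 \<and> c t = 0"
proof -
  fix t :: real and f g :: "real \<Rightarrow> real"
  assume "ae_eq f g"
  then have eq: "AE x in lborel. f x = g x" by (auto simp: ae_eq_def)
  have "(AE x in lborel. x \<in> {0..t} \<longrightarrow> f x = c x) = (AE x in lborel. x \<in> {0..t} \<longrightarrow> g x = c x)" for c
    using eq by (intro iffI) (auto elim: AE_mp)
  then show "(\<exists>c. continuous_on {0..t} c \<and> (AE x in lborel. x \<in> {0..t} \<longrightarrow> f x = c x) \<and> c 0 = 0 \<and> c t = 0) =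
      (\<exists>c. continuous_on {0..t} c \<and> (AE x in lborel. x \<in> {0..t} \<longrightarrow> g x = c x) \<and> c 0 = 0 \<and> c t = 0)"
    by simp
qed

definition sobolev :: "nat \<Rightarrow> real \<Rightarrow> real \<Rightarrow> L0 set" where
  "sobolev m p t = {u \<in> carr (Lp p t). \<forall>k\<in>{1..m}. \<exists>v\<in>carr (Lp p t). weak_deriv t k u v}"

definition W2D :: "real \<Rightarrow> real \<Rightarrow> L0 nspace" where
  "W2D p t = \<lparr>carr = {u \<in> sobolev 2 p t. dirichlet t u},
     nrm = (\<lambda>u. Lp_norm p (THE w. w \<in> carr (Lp p t) \<and> weak_deriv t 2 u w))\<rparr>"

definition E2 :: "L0 \<Rightarrow> L0" where
  "E2 u = u"


section \<open>Spectral numbers\<close>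

definition C1_deriv :: "real \<Rightarrow> (real \<Rightarrow> real) \<Rightarrow> (real \<Rightarrow> real) \<Rightarrow> bool" where
  "C1_deriv t f f' \<longleftrightarrow>
     (\<forall>x\<in>{0..t}. (f has_real_derivative f' x) (at x within {0..t})) \<and> continuous_on {0..t} f'"

definition eigenpair ::
  "real \<Rightarrow> real \<Rightarrow> real \<Rightarrow> (real \<Rightarrow> real) \<Rightarrow> (real \<Rightarrow> real) \<Rightarrow> (real \<Rightarrow> real) \<Rightarrow> real \<Rightarrow> bool" where
  "eigenpair p q t u u' u'' l \<longleftrightarrow>
     0 < l \<and> (\<exists>x\<in>{0..t}. u x \<noteq> 0) \<and>
     C1_deriv t u u' \<and> C1_deriv t u' u'' \<and>
     (\<exists>w'. C1_deriv t (\<lambda>x. sgn (u'' x) * \<bar>u'' x\<bar> powr (p - 1)) w' \<and>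
           C1_deriv t w' (\<lambda>x. l * sgn (u x) * \<bar>u x\<bar> powr (q - 1))) \<and>
     u 0 = 0 \<and> u t = 0 \<and> u'' 0 = 0 \<and> u'' t = 0"

definition spectral_couple ::
  "real \<Rightarrow> real \<Rightarrow> real \<Rightarrow> (real \<Rightarrow> real) \<Rightarrow> real \<Rightarrow> bool" where
  "spectral_couple p q t f l \<longleftrightarrow>
     (\<exists>f' f''. eigenpair p q t f f' f'' l \<and>
        (LINT x:{0..t}|lborel. \<bar>f'' x\<bar> powr p) powr (1 / p) = 1 \<and> f' 0 > 0)"

definition spectral_number :: "real \<Rightarrow> real \<Rightarrow> real \<Rightarrow> nat \<Rightarrow> real" where
  "spectral_number p q t n =
     (THE l. \<exists>f. spectral_couple p q t f l \<and>
        finite {x \<in> {0<..<t}. f x = 0} \<and> card {x \<in> {0<..<t}. f x = 0} = n - 1)"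

definition lambda1 :: "real \<Rightarrow> real \<Rightarrow> real" where
  "lambda1 p q = (THE l. \<exists>f. spectral_couple p q 1 f l \<and> (\<forall>x\<in>{0<..<1}. f x \<noteq> 0))"

end

(*
  Let Sigma be the maximum of the q-th power of the L^q norm of G g over the unit ball of L^p[0,1], G being
  the Green operator of -u'' with Dirichlet conditions. A maximizer is an eigenfunction without zeros for the
  eigenvalue 1/Sigma. The eigenvalue equation is a cooperative first order system, and comparison with the odd
  periodic continuation shows that every eigenpair arises from this one by antiperiodic continuation and
  scaling; so lambda_1 = 1/Sigma, and the spectral numbers scale as stated.

  For p >= q, piecewise linear interpolation at the nodes i t/n has rank n - 1, its error on each of the n cells
  is a rescaled Green potential, and the inequality defining Sigma is summed over the cells by the power mean
  inequality.

  For p < q, an n-dimensional space of C^1 functions is built from multiples of the eigenfunction on each cell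
  plus affine functions. Their second derivative is read off from the coefficients, and integration against the
  dual eigenfunction on each cell recovers the parameters through a tridiagonal accretive system.
*)

theory Submission
  imports Defs "HOL-Complex_Analysis.Great_Picard"
begin

section \<open>The extremal problem for the Green operator\<close>

text \<open>An odd power with exponent below 1 is not Lipschitz at 0, so the standard uniqueness
  theorem does not apply to the system. The uniqueness proved here asks for simple zeros of one of
  the two solutions only, and the continuation of the positive solution has them. The initial slope
  of the second unknown is forced by boundedness: two solutions with the same slope of
  \<open>u\<close> and different slopes of \<open>w\<close> would separate linearly. For p < q,
  multiples of the eigenfunction have kinks at the nodes, and cancelling them by an affine function
  on each cell couples all cells. Coefficients and nodal values both become local in a parameter y:
  with D the second difference under reflection at the ends, the coefficients are (4 + D) y and the
  nodal values are alternating multiples of the first differences of y. Then (4 + D) y averages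
  values of 4 y and does not increase the l^p norm, while the moments are 4 y - \<nu> D y with \<nu>
  = - f1(0) g1(0) - 1. Since \<nu> \<ge> 0, 4 y is recovered without increase of the l^q norm, so
  nothing is lost beyond the factor comparing l^p with l^q on n points.\<close>

definition spow :: "real \<Rightarrow> real \<Rightarrow> real" where
  "spow r a = sgn a * \<bar>a\<bar> powr r"

lemma spow_0 [simp]: "spow r 0 = 0"
  by (simp add: spow_def)

lemma spow_minus [simp]: "spow r (- a) = - spow r a"
  by (simp add: spow_def sgn_minus)

lemma spow_nonneg: "0 \<le> a \<Longrightarrow> spow r a = a powr r"
  by (cases "a = 0") (auto simp: spow_def)

lemma spow_eq_0_iff [simp]: "spow r a = 0 \<longleftrightarrow> a = 0"
  by (simp add: spow_def sgn_eq_0_iff)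

lemma abs_spow: "\<bar>spow r a\<bar> = \<bar>a\<bar> powr r"
  by (cases "a = 0") (simp_all add: spow_def abs_mult)

lemma spow_pos: "0 < a \<Longrightarrow> 0 < spow r a"
  by (simp add: spow_def)

lemma spow_neg: "a < 0 \<Longrightarrow> spow r a < 0"
  by (simp add: spow_def)

lemma mult_spow: "a * spow r a = \<bar>a\<bar> powr (r + 1)"
  by (cases "a = 0") (auto simp: spow_def powr_add sgn_if)

lemma spow_mult: "0 < c \<Longrightarrow> spow r (c * a) = c powr r * spow r a"
  by (simp add: spow_def sgn_mult abs_mult powr_mult)

lemma spow_spow: "spow r (spow s a) = spow (r * s) a"
  by (cases "a = 0") (auto simp: spow_def sgn_mult abs_mult powr_powr mult.commute)

lemma spow_1 [simp]: "spow 1 a = a"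
  by (simp add: spow_def sgn_if)

text \<open>With r = p - 1 these identities pass between u'' and w = \<open>spow (p - 1)\<close>
  u'', which turns the fourth order equation into a system of two second order ones.\<close>

lemma spow_inverse:
  assumes "r \<noteq> 0" shows "spow (1 / r) (spow r a) = a" "spow r (spow (1 / r) a) = a"
  using assms by (simp_all add: spow_spow)

lemma spow_mono:
  assumes "0 < r" "a \<le> b" shows "spow r a \<le> spow r b"
proof (cases "0 \<le> a")
  case True
  then show ?thesis using assms by (simp add: spow_nonneg powr_mono2)
next
  case False
  show ?thesis
  proof (cases "0 \<le> b")
    case True
    have "spow r b \<ge> 0" using True by (simp add: spow_nonneg)
    then show ?thesis using spow_neg[of a r] False by simp
  next
    case b: False
    have "spow r (-b) \<le> spow r (-a)"
      using assms False b unfolding spow_nonneg[of "-a"]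
      by (subst (1 2) spow_nonneg) (auto intro!: powr_mono2)
    then show ?thesis by simp
  qed
qed

lemma isCont_spow:
  assumes "0 < r" shows "isCont (spow r) x"
  proof (cases "x = 0")
    case True
    have "((\<lambda>x. \<bar>x\<bar> powr r) \<longlongrightarrow> \<bar>0\<bar> powr r) (at (0::real))"
      using assms(1) by (intro tendsto_intros) auto
    then have "((\<lambda>x. \<bar>spow r x\<bar>) \<longlongrightarrow> 0) (at (0::real))"
      by (simp add: abs_spow)
    then have "(spow r \<longlongrightarrow> 0) (at 0)" by (simp add: tendsto_rabs_zero_iff)
    then show ?thesis using True by (simp add: isCont_def)
  next
    case False
    then show ?thesis unfolding spow_def isCont_def by (intro tendsto_intros) auto
  qed

lemma continuous_on_spow [continuous_intros]:
  assumes "0 < r" "continuous_on S f" shows "continuous_on S (\<lambda>x. spow r (f x))"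
proof -
  have "continuous_on UNIV (spow r)" by (simp add: continuous_at_imp_continuous_on isCont_spow assms)
  then show ?thesis
    using continuous_on_compose2[OF _ assms(2)] by blast
qed

lemma borel_measurable_spow [measurable]:
  assumes [measurable]: "f \<in> borel_measurable M"
  shows "(\<lambda>x. spow r (f x)) \<in> borel_measurable M"
  unfolding spow_def by measurable

lemma has_real_derivative_abs_powr:
  assumes "0 < a"
  shows "((\<lambda>x. \<bar>x\<bar> powr (a + 1) / (a + 1)) has_real_derivative spow a x) (at x)"
proof -
  consider "x = 0" | "0 < x" | "x < 0" by linarith
  then show ?thesis
  proof cases
    case 1
    have "((\<lambda>h. spow a h / (a + 1)) \<longlongrightarrow> spow a 0 / (a + 1)) (at 0)"
      using isCont_spow[OF assms, of 0] assms
      by (intro tendsto_intros) (auto simp: isCont_def)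
    moreover have "\<forall>\<^sub>F h in at 0. spow a h / (a + 1) = \<bar>h\<bar> powr (a + 1) / (a + 1) / h"
      by (rule eventually_at_filter[THEN iffD2]) (auto simp: mult_spow[symmetric])
    ultimately have "((\<lambda>h. \<bar>h\<bar> powr (a + 1) / (a + 1) / h) \<longlongrightarrow> 0) (at 0)"
      by (simp add: filterlim_cong)
    then show ?thesis using 1 assms by (simp add: DERIV_def)
  next
    case 2
    have "((\<lambda>x. x powr (a + 1) / (a + 1)) has_real_derivative spow a x) (at x)"
      using 2 assms by (auto intro!: derivative_eq_intros simp: spow_nonneg)
    then show ?thesis
      by (rule has_field_derivative_transform_within_open[where S = "{0<..}"]) (use 2 in auto)
  next
    case 3
    have "((\<lambda>x. (- x) powr (a + 1) / (a + 1)) has_real_derivative spow a x) (at x)"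
      using 3 assms by (auto intro!: derivative_eq_intros simp: spow_def)
    then show ?thesis
      by (rule has_field_derivative_transform_within_open[where S = "{..<0}"]) (use 3 in auto)
  qed
qed

section \<open>Difference quotients of powers and Young's inequality\<close>

lemma powr_diff_le:
  fixes a b r M :: real
  assumes "1 \<le> r" "0 \<le> b" "b \<le> a" "a \<le> M"
  shows "a powr r - b powr r \<le> r * M powr (r - 1) * (a - b)"
proof (cases "b = a")
  case False
  show ?thesis
  proof (cases "b = 0")
    case True
    have "a powr r = a powr (r - 1) * a"
      using False True assms by (simp add: powr_diff)
    also have "\<dots> \<le> (1 * M powr (r - 1)) * a"
      using assms by (intro mult_right_mono) (auto intro: powr_mono2)
    also have "\<dots> \<le> (r * M powr (r - 1)) * a"
      using assms by (intro mult_right_mono) auto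
    finally show ?thesis using True assms by simp
  next
    case b: False
    then have "\<exists>z. b < z \<and> z < a \<and> a powr r - b powr r = (a - b) * (r * z powr (r - 1))"
      using False assms by (intro MVT2) (auto intro!: derivative_eq_intros)
    then obtain z where z: "b < z" "z < a" "a powr r - b powr r = (a - b) * (r * z powr (r - 1))"
      by blast
    have "r * z powr (r - 1) \<le> r * M powr (r - 1)"
      using z assms by (intro mult_left_mono powr_mono2) auto
    then show ?thesis using z assms by (simp add: mult.commute mult_right_mono)
  qed
qed auto

text \<open>Homogeneity reduces to a = 1 and b = c, where c powr r lies between 1 and c because r
  \<le> 1.\<close>

lemma powr_diff_le_concave:
  fixes a b r :: real
  assumes "0 < r" "r \<le> 1" "0 < a" "0 \<le> b"
  shows "\<bar>a powr r - b powr r\<bar> \<le> a powr (r - 1) * \<bar>a - b\<bar>"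
proof -
  define c where "c = b / a"
  have c: "0 \<le> c" "b = a * c" using assms by (auto simp: c_def)
  have "\<bar>1 - c powr r\<bar> \<le> \<bar>1 - c\<bar>"
  proof (cases "c \<le> 1")
    case True
    then have "c powr 1 \<le> c powr r" "c powr r \<le> 1"
      using assms c powr_mono'[of r 1 c] by (auto intro: powr_le1)
    then show ?thesis using True c by (cases "c = 0") auto
  next
    case False
    then have "c powr r \<le> c powr 1" "1 \<le> c powr r"
      using assms c powr_mono[of r 1 c] by (auto intro: ge_one_powr_ge_zero)
    then show ?thesis using False by auto
  qed
  then have "a powr r * \<bar>1 - c powr r\<bar> \<le> a powr r * \<bar>1 - c\<bar>" by (intro mult_left_mono) auto
  moreover have "a powr r * \<bar>1 - c powr r\<bar> = \<bar>a powr r - b powr r\<bar>"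
  proof -
    have "a powr r - b powr r = a powr r * (1 - c powr r)"
      using c assms by (simp add: powr_mult right_diff_distrib)
    then show ?thesis by (simp add: abs_mult)
  qed
  moreover have "a powr r * \<bar>1 - c\<bar> = a powr (r - 1) * \<bar>a - b\<bar>"
  proof -
    have "a - b = a * (1 - c)" using c by (simp add: right_diff_distrib)
    then have "\<bar>a - b\<bar> = a * \<bar>1 - c\<bar>" using assms by (simp add: abs_mult)
    then show ?thesis using assms by (simp add: powr_diff)
  qed
  ultimately show ?thesis by simp
qed

text \<open>The estimate is asymmetric on purpose: \<open>a\<close> must be nonzero, while
  \<open>b\<close> may vanish or have the other sign. The factor \<bar>a\<bar> powr (min r 1 - 1) is
  1 for r \<ge> 1 and is the size of the singular slope at \<open>a\<close> for r < 1. The two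
  solutions compared in \<open>sol_unique\<close> enter in these unequal roles.\<close>

lemma spow_diff_le:
  fixes a b r M :: real
  assumes "0 < r" "a \<noteq> 0" "\<bar>a\<bar> \<le> M" "\<bar>b\<bar> \<le> M"
  shows "\<bar>spow r a - spow r b\<bar> \<le> (2 + r * M powr (r - 1)) * \<bar>a\<bar> powr (min r 1 - 1) * \<bar>a - b\<bar>"
proof -
  have *: "\<bar>spow r a - spow r b\<bar> \<le> (2 + r * M powr (r - 1)) * \<bar>a\<bar> powr (min r 1 - 1) * \<bar>a - b\<bar>"
    if a: "0 < a" and M: "a \<le> M" "\<bar>b\<bar> \<le> M" for a b
  proof (cases "1 \<le> r")
    case True
    have "\<bar>spow r a - spow r b\<bar> \<le> (r * M powr (r - 1)) * \<bar>a - b\<bar>"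
    proof (cases "0 \<le> b")
      case b: True
      show ?thesis
        using powr_diff_le[of r b a M] powr_diff_le[of r a b M] powr_mono2[of r a b] powr_mono2[of r b a] True a b M
        by (cases "b \<le> a") (auto simp: spow_nonneg abs_if)
    next
      case b: False
      have "\<bar>spow r a - spow r b\<bar> = a powr r + (-b) powr r"
        using a b by (auto simp: spow_def)
      also have "\<dots> \<le> r * M powr (r - 1) * a + r * M powr (r - 1) * (-b)"
        using powr_diff_le[of r 0 a M] powr_diff_le[of r 0 "-b" M] True a b M by simp
      finally show ?thesis using a b by (simp add: algebra_simps)
    qed
    also have "\<dots> \<le> (2 + r * M powr (r - 1)) * \<bar>a - b\<bar>"
      by (intro mult_right_mono) auto
    finally show ?thesis using True a by simp
  next
    case False
    have "\<bar>spow r a - spow r b\<bar> \<le> 2 * a powr (r - 1) * \<bar>a - b\<bar>"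
    proof (cases "0 \<le> b")
      case b: True
      have "a powr (r - 1) * \<bar>a - b\<bar> \<ge> 0" by simp
      with powr_diff_le_concave[of r a b] False a b assms(1) show ?thesis by (simp add: spow_nonneg)
    next
      case b: False
      have "\<bar>spow r a - spow r b\<bar> = a powr r + (-b) powr r"
        using a b by (auto simp: spow_def)
      \<comment> \<open>For signs apart, both terms of the sum are compared with a powr (r - 1) * (a
        - b), since a and -b are at most a - b; this is the origin of the constant 2.\<close>
      also have "(-b) powr r \<le> a powr (r - 1) * (a - b)"
      proof (cases "- b \<le> a")
        case True
        then have "(-b) powr r \<le> a powr r" using b assms(1) by (intro powr_mono2) auto
        also have "\<dots> = a powr (r - 1) * a" using a by (simp add: powr_diff)
        also have "\<dots> \<le> a powr (r - 1) * (a - b)" using b by (intro mult_left_mono) auto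
        finally show ?thesis .
      next
        case F: False
        have "(-b) powr r = (-b) powr (r - 1) * (-b)" using b by (simp add: powr_diff)
        also have "\<dots> \<le> a powr (r - 1) * (a - b)"
          using F a b False by (intro mult_mono powr_mono2') auto
        finally show ?thesis .
      qed
      also have "a powr r = a powr (r - 1) * a" using a by (simp add: powr_diff)
      also have "\<dots> \<le> a powr (r - 1) * (a - b)" using b by (intro mult_left_mono) auto
      finally show ?thesis using a b by (simp add: mult_ac)
    qed
    also have "\<dots> \<le> (2 + r * M powr (r - 1)) * a powr (r - 1) * \<bar>a - b\<bar>"
      using assms(1) by (intro mult_right_mono) auto
    finally show ?thesis using False a by simp
  qed
  show ?thesis
  proof (cases "0 < a")
    case False
    then show ?thesis using *[of "-a" "-b"] assms by (simp add: abs_minus_commute)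
  qed (use * assms in auto)
qed

text \<open>After division by a powr q it says that t powr q / q - t, with t = b / a, has its strict
  minimum at t = 1. The strictness off the diagonal is what later identifies a maximizer with its
  image under the power iteration.\<close>

lemma young_strict:
  fixes a b q :: real
  assumes "1 < q" "0 \<le> a" "0 \<le> b" "a \<noteq> b"
  shows "a powr (q - 1) * b < (1 - 1 / q) * a powr q + b powr q / q"
proof (cases "a = 0")
  case True
  then show ?thesis using assms by simp
next
  case a: False
  define t where "t = b / a"
  have t: "0 \<le> t" "t \<noteq> 1" "b = a * t" using assms a by (auto simp: t_def)
  have *: "t < (1 - 1 / q) + t powr q / q"
  proof (cases "t = 0")
    case True
    then show ?thesis using assms by (simp add: field_simps)
  next
    case False
    define h where "h = (\<lambda>t. t powr q / q - t)"
    have der: "(h has_real_derivative x powr (q - 1) - 1) (at x)" if "0 < x" for x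
      unfolding h_def using that assms(1) by (auto intro!: derivative_eq_intros)
    have "h 1 < h t"
    proof (cases "t < 1")
      case True
      then obtain z where z: "t < z" "z < 1" "h 1 - h t = (1 - t) * (z powr (q - 1) - 1)"
        using MVT2[of t 1 h "\<lambda>x. x powr (q - 1) - 1"] der t False by force
      have "z powr (q - 1) < 1" using z t assms(1) powr_less_mono2[of "q - 1" z 1] by simp
      then show ?thesis using z(3) True by (smt (verit) mult_pos_neg)
    next
      case False
      then obtain z where z: "1 < z" "z < t" "h t - h 1 = (t - 1) * (z powr (q - 1) - 1)"
        using MVT2[of 1 t h "\<lambda>x. x powr (q - 1) - 1"] der t by force
      have "1 < z powr (q - 1)" using z assms(1) by simp
      then show ?thesis using z(3) False t by (smt (verit) mult_pos_pos)
    qed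
    then show ?thesis by (simp add: h_def)
  qed
  have ap: "0 < a" using a assms by simp
  have "a powr (q - 1) * b = a powr q * t" using ap t by (simp add: powr_diff)
  also have "\<dots> < a powr q * ((1 - 1 / q) + t powr q / q)" using * ap by simp
  also have "\<dots> = (1 - 1 / q) * a powr q + b powr q / q"
    using ap t by (simp add: powr_mult algebra_simps)
  finally show ?thesis .
qed

lemma young:
  fixes a b q :: real
  assumes "1 < q" "0 \<le> a" "0 \<le> b"
  shows "a powr (q - 1) * b \<le> (1 - 1 / q) * a powr q + b powr q / q"
proof (cases "a = b")
  case True
  have "a powr (q - 1) * a = a powr q" using assms by (cases "a = 0") (auto simp: powr_diff)
  then show ?thesis using True by (simp add: algebra_simps)
qed (use young_strict[OF assms] in simp)

section \<open>The Dirichlet Green operator on the unit interval\<close>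

definition unitm :: "real measure" where
  "unitm = restrict_space lborel {0..1}"

lemma space_unitm [simp]: "space unitm = {0..1}"
  by (simp add: unitm_def space_restrict_space)

lemma measurable_unitm_id: "(\<lambda>x. x) \<in> borel_measurable unitm"
  unfolding unitm_def by (rule measurable_restrict_space1) simp

lemma measurable_unitm: "f \<in> borel_measurable borel \<Longrightarrow> f \<in> borel_measurable unitm"
  unfolding unitm_def by (rule measurable_restrict_space1) simp

interpretation unitm: finite_measure unitm
  by (rule finite_measureI) (simp add: unitm_def emeasure_restrict_space space_restrict_space)

interpretation unitm2: pair_sigma_finite unitm unitm ..

lemma measure_unitm [simp]: "measure unitm {0..1} = 1"
  by (simp add: unitm_def measure_restrict_space)

lemma integral_unitm: "integral\<^sup>L unitm f = (LINT x:{0..1}|lborel. f x)" for f :: "real \<Rightarrow> real"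
  unfolding unitm_def set_lebesgue_integral_def by (rule integral_restrict_space) simp

lemma integrable_unitm: "integrable unitm f \<longleftrightarrow> set_integrable lborel {0..1} f" for f :: "real \<Rightarrow> real"
  unfolding unitm_def set_integrable_def by (rule integrable_restrict_space) simp

lemma borel_measurable_unitm_continuous:
  fixes f :: "real \<Rightarrow> real"
  assumes "continuous_on {0..1} f" shows "f \<in> borel_measurable unitm"
proof -
  have "sets unitm = sets (restrict_space borel {0..1})"
    unfolding unitm_def by (rule sets_restrict_space_cong) simp
  then show ?thesis
    using borel_measurable_continuous_on_restrict[OF assms] by (simp cong: measurable_cong_sets)
qed

lemma integrable_unitm_continuous:
  fixes f :: "real \<Rightarrow> real"
  assumes "continuous_on {0..1} f" shows "integrable unitm f"
  unfolding integrable_unitm by (rule borel_integrable_atLeastAtMost'[OF assms])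

lemma integral_unitm_continuous:
  fixes f :: "real \<Rightarrow> real"
  assumes "continuous_on {0..1} f" shows "integral\<^sup>L unitm f = integral {0..1} f"
  unfolding integral_unitm
  by (rule set_borel_integral_eq_integral) (use integrable_unitm_continuous[OF assms] in \<open>simp add: integrable_unitm\<close>)

lemma integral_unitm_eq_0_imp:
  fixes f :: "real \<Rightarrow> real"
  assumes "continuous_on {0..1} f" "\<And>x. x \<in> {0..1} \<Longrightarrow> 0 \<le> f x" "integral\<^sup>L unitm f \<le> 0" "x \<in> {0..1}"
  shows "f x = 0"
proof -
  have "0 \<le> integral\<^sup>L unitm f" using assms(2) by (intro integral_nonneg_AE AE_I2) simp
  then show ?thesis
    using integral_eq_0_iff[OF assms(1) _ assms(2)] assms by (simp add: integral_unitm_continuous)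
qed

text \<open>The kernel is x (1 - s) for x \<le> s and s (1 - x) for s \<le> x, the Green function of
  -u'' with zero boundary values.\<close>

definition green :: "(real \<Rightarrow> real) \<Rightarrow> real \<Rightarrow> real" where
  "green g x = (\<integral>s. (min x s - x * s) * g s \<partial>unitm)"

lemma green_kernel:
  fixes x y s :: real
  assumes "x \<in> {0..1}" "y \<in> {0..1}" "s \<in> {0..1}"
  shows "0 \<le> min x s - x * s" "\<bar>min x s - x * s\<bar> \<le> 1"
    "\<bar>(min x s - x * s) - (min y s - y * s)\<bar> \<le> 2 * \<bar>x - y\<bar>"
proof -
  have "x * s \<le> x * 1" "x * s \<le> 1 * s" "0 \<le> x * s" 
    using assms mult_left_mono[of s 1 x] mult_right_mono[of x 1 s] by auto
  then show "0 \<le> min x s - x * s" "\<bar>min x s - x * s\<bar> \<le> 1" using assms by auto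
  have "\<bar>x * s - y * s\<bar> \<le> \<bar>x - y\<bar> * 1"
    using assms by (auto simp: abs_mult simp flip: left_diff_distrib intro!: mult_right_le_one_le)
  moreover have "\<bar>min x s - min y s\<bar> \<le> \<bar>x - y\<bar>" by linarith
  moreover have "\<bar>(min x s - x * s) - (min y s - y * s)\<bar> \<le> \<bar>min x s - min y s\<bar> + \<bar>x * s - y * s\<bar>"
    using abs_triangle_ineq4[of "min x s - min y s" "x * s - y * s"] by (simp add: algebra_simps)
  ultimately show "\<bar>(min x s - x * s) - (min y s - y * s)\<bar> \<le> 2 * \<bar>x - y\<bar>" by simp
qed

lemma green_integrable:
  assumes g: "integrable unitm g" and x: "x \<in> {0..1}"
  shows "integrable unitm (\<lambda>s. (min x s - x * s) * g s)"
proof (rule Bochner_Integration.integrable_bound[OF g])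
  have [measurable]: "g \<in> borel_measurable unitm" using g by auto
  note measurable_unitm_id [measurable]
  show "(\<lambda>s. (min x s - x * s) * g s) \<in> borel_measurable unitm" by measurable
  show "AE s in unitm. norm ((min x s - x * s) * g s) \<le> norm (g s)"
    by (rule AE_I2) (use green_kernel(2)[OF x x] in \<open>auto simp: abs_mult intro!: mult_left_le_one_le\<close>)
qed

lemma green_lipschitz:
  assumes g: "integrable unitm g" and x: "x \<in> {0..1}" "y \<in> {0..1}"
  shows "\<bar>green g x - green g y\<bar> \<le> 2 * \<bar>x - y\<bar> * (\<integral>s. \<bar>g s\<bar> \<partial>unitm)"
proof -
  have eq: "green g x - green g y = (\<integral>s. ((min x s - x * s) - (min y s - y * s)) * g s \<partial>unitm)"
    unfolding green_def Bochner_Integration.integral_diff[OF green_integrable[OF g x(1)] green_integrable[OF g x(2)], symmetric]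
    by (simp add: left_diff_distrib)
  have "\<bar>green g x - green g y\<bar> \<le> (\<integral>s. \<bar>((min x s - x * s) - (min y s - y * s)) * g s\<bar> \<partial>unitm)"
    unfolding eq by (rule integral_abs_bound)
  also have "\<dots> \<le> (\<integral>s. 2 * \<bar>x - y\<bar> * \<bar>g s\<bar> \<partial>unitm)"
  proof (rule integral_mono)
    have "integrable unitm (\<lambda>s. (min x s - x * s) * g s - (min y s - y * s) * g s)"
      by (rule Bochner_Integration.integrable_diff[OF green_integrable[OF g x(1)] green_integrable[OF g x(2)]])
    then have "integrable unitm (\<lambda>s. ((min x s - x * s) - (min y s - y * s)) * g s)"
      by (subst left_diff_distrib)
    then show "integrable unitm (\<lambda>s. \<bar>((min x s - x * s) - (min y s - y * s)) * g s\<bar>)"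
      by (rule integrable_abs)
    have "integrable unitm (\<lambda>s. \<bar>g s\<bar>)" using g by (rule integrable_abs)
    then show "integrable unitm (\<lambda>s. 2 * \<bar>x - y\<bar> * \<bar>g s\<bar>)" by (rule integrable_mult_right)
  next
    fix s assume "s \<in> space unitm"
    then have s: "s \<in> {0..1}" by simp
    have 1: "\<bar>(min x s - x * s) - (min y s - y * s)\<bar> * \<bar>g s\<bar> \<le> (2 * \<bar>x - y\<bar>) * \<bar>g s\<bar>"
      by (rule mult_right_mono[OF green_kernel(3)[OF x s]]) (rule abs_ge_zero)
    have "\<bar>((min x s - x * s) - (min y s - y * s)) * g s\<bar> = \<bar>(min x s - x * s) - (min y s - y * s)\<bar> * \<bar>g s\<bar>"
      by (rule abs_mult)
    then show "\<bar>((min x s - x * s) - (min y s - y * s)) * g s\<bar> \<le> 2 * \<bar>x - y\<bar> * \<bar>g s\<bar>"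
      using 1 by (rule ord_eq_le_trans)
  qed
  finally show ?thesis by simp
qed

lemma green_bound:
  assumes g: "integrable unitm g" and x: "x \<in> {0..1}"
  shows "\<bar>green g x\<bar> \<le> (\<integral>s. \<bar>g s\<bar> \<partial>unitm)"
proof -
  have "\<bar>green g x\<bar> \<le> (\<integral>s. \<bar>(min x s - x * s) * g s\<bar> \<partial>unitm)"
    unfolding green_def by (rule integral_abs_bound)
  also have "\<dots> \<le> (\<integral>s. \<bar>g s\<bar> \<partial>unitm)"
    by (rule integral_mono[OF integrable_abs[OF green_integrable[OF g x]] integrable_abs[OF g]])
       (use green_kernel(2)[OF x x] in \<open>auto simp: abs_mult intro!: mult_left_le_one_le\<close>)
  finally show ?thesis .
qed

lemma green_continuous:
  assumes g: "integrable unitm g" shows "continuous_on {0..1} (green g)"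
proof -
  define L where "L = 2 * (\<integral>s. \<bar>g s\<bar> \<partial>unitm)"
  have "\<bar>green g x - green g y\<bar> \<le> L * \<bar>x - y\<bar>" if "x \<in> {0..1}" "y \<in> {0..1}" for x y
    using green_lipschitz[OF g that] by (simp add: L_def mult_ac)
  moreover have "0 \<le> L" by (simp add: L_def)
  ultimately have "L-lipschitz_on {0..1} (green g)"
    by (intro lipschitz_onI) (auto simp: dist_real_def)
  then show ?thesis by (rule lipschitz_on_continuous_on)
qed

lemma green_cmult: "green (\<lambda>x. c * g x) y = c * green g y"
proof -
  have "green (\<lambda>x. c * g x) y = (\<integral>s. c * ((min y s - y * s) * g s) \<partial>unitm)"
    unfolding green_def by (rule Bochner_Integration.integral_cong[OF refl]) (rule mult.left_commute)
  then show ?thesis by (simp add: green_def)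
qed

lemma green_nonneg:
  assumes "\<And>s. s \<in> {0..1} \<Longrightarrow> 0 \<le> g s" "x \<in> {0..1}"
  shows "0 \<le> green g x"
  unfolding green_def using assms green_kernel(1)[OF assms(2) assms(2)]
  by (intro integral_nonneg_AE AE_I2) auto

lemma green_abs_le:
  assumes g: "integrable unitm g" and x: "x \<in> {0..1}"
  shows "\<bar>green g x\<bar> \<le> green (\<lambda>s. \<bar>g s\<bar>) x"
proof -
  have "\<bar>green g x\<bar> \<le> (\<integral>s. \<bar>(min x s - x * s) * g s\<bar> \<partial>unitm)"
    unfolding green_def by (rule integral_abs_bound)
  also have "\<dots> = green (\<lambda>s. \<bar>g s\<bar>) x"
    unfolding green_def using green_kernel(1)[OF x x] by (intro Bochner_Integration.integral_cong) (auto simp: abs_mult)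
  finally show ?thesis .
qed

lemma green_pos:
  assumes g: "continuous_on {0..1} g" "\<And>s. s \<in> {0..1} \<Longrightarrow> 0 \<le> g s"
    and y: "y \<in> {0..1}" "0 < y" "y < 1" "g y \<noteq> 0" and x: "0 < x" "x < 1"
  shows "0 < green g x"
proof (rule ccontr)
  assume "\<not> 0 < green g x"
  then have "(min x y - x * y) * g y = 0"
    using green_kernel(1)[of x x] x g y unfolding green_def
    by (intro integral_unitm_eq_0_imp[of "\<lambda>s. (min x s - x * s) * g s"]) (auto intro!: continuous_intros)
  moreover have "x * y < x * 1" "x * y < 1 * y" using x y by auto
  ultimately show False using y by (auto simp: min_def split: if_splits)
qed

text \<open>The bound concerns the product and not the kernel alone, so that the rule also covers
  max 0 (x - s), which is unbounded on the line and is controlled only through the supports of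
  \<open>a\<close> and \<open>b\<close>. It makes the product integrable on the product space, and
  Fubini applies.\<close>

lemma kernel_fubini:
  fixes a b :: "'a \<Rightarrow> real"
  assumes M: "sigma_finite_measure M" and a: "integrable M a" and b: "integrable M b"
    and K: "case_prod K \<in> borel_measurable (M \<Otimes>\<^sub>M M)"
    and bound: "\<And>x s. x \<in> space M \<Longrightarrow> s \<in> space M \<Longrightarrow> \<bar>a x * (K x s * b s)\<bar> \<le> C * \<bar>a x\<bar> * \<bar>b s\<bar>"
  shows "(\<integral>x. a x * (\<integral>s. K x s * b s \<partial>M) \<partial>M) = (\<integral>s. (\<integral>x. a x * K x s \<partial>M) * b s \<partial>M)"
proof -
  interpret pair_sigma_finite M M using M by (simp add: pair_sigma_finite_def)
  have [measurable]: "a \<in> borel_measurable M" "b \<in> borel_measurable M" using a b by auto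
  have K' [measurable]: "(\<lambda>z. K (fst z) (snd z)) \<in> borel_measurable (M \<Otimes>\<^sub>M M)"
    using K by (simp add: case_prod_beta)
  define h where "h = (\<lambda>z. a (fst z) * (K (fst z) (snd z) * b (snd z)))"
  have h [measurable]: "h \<in> borel_measurable (M \<Otimes>\<^sub>M M)" unfolding h_def by measurable
  have ih: "integrable M (\<lambda>y. h (x, y))" if x: "x \<in> space M" for x
  proof (rule Bochner_Integration.integrable_bound)
    show "integrable M (\<lambda>s. C * \<bar>a x\<bar> * \<bar>b s\<bar>)" using b by simp
    show "(\<lambda>y. h (x, y)) \<in> borel_measurable M" by (rule measurable_compose_Pair1[OF x h])
    show "AE s in M. norm (h (x, s)) \<le> norm (C * \<bar>a x\<bar> * \<bar>b s\<bar>)"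
      using bound[OF x] by (intro AE_I2) (simp add: h_def order.trans[OF _ abs_ge_self])
  qed
  have int: "integrable (M \<Otimes>\<^sub>M M) h"
  proof (rule Fubini_integrable[OF h])
    show "integrable M (\<lambda>x. \<integral>y. norm (h (x, y)) \<partial>M)"
    proof (rule Bochner_Integration.integrable_bound)
      show "integrable M (\<lambda>x. C * \<bar>a x\<bar> * (\<integral>s. \<bar>b s\<bar> \<partial>M))" using a by simp
      show "(\<lambda>x. \<integral>y. norm (h (x, y)) \<partial>M) \<in> borel_measurable M" by measurable
      show "AE x in M. norm (\<integral>y. norm (h (x, y)) \<partial>M) \<le> norm (C * \<bar>a x\<bar> * (\<integral>s. \<bar>b s\<bar> \<partial>M))"
      proof (rule AE_I2)
        fix x assume x: "x \<in> space M"
        have "(\<integral>y. norm (h (x, y)) \<partial>M) \<le> (\<integral>s. C * \<bar>a x\<bar> * \<bar>b s\<bar> \<partial>M)"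
          using ih[OF x] b bound[OF x] by (intro integral_mono) (auto simp: h_def)
        then show "norm (\<integral>y. norm (h (x, y)) \<partial>M) \<le> norm (C * \<bar>a x\<bar> * (\<integral>s. \<bar>b s\<bar> \<partial>M))" by simp
      qed
    qed
    show "AE x in M. integrable M (\<lambda>y. h (x, y))" using ih by (intro AE_I2)
  qed
  have "(\<integral>x. a x * (\<integral>s. K x s * b s \<partial>M) \<partial>M) = (\<integral>x. (\<integral>s. h (x, s) \<partial>M) \<partial>M)"
    by (simp add: h_def)
  also have "\<dots> = (\<integral>s. (\<integral>x. h (x, s) \<partial>M) \<partial>M)"
    using Fubini_integral[of "\<lambda>x s. h (x, s)"] int by simp
  also have "\<dots> = (\<integral>s. (\<integral>x. a x * K x s * b s \<partial>M) \<partial>M)"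
    by (simp add: h_def mult.assoc)
  also have "\<dots> = (\<integral>s. (\<integral>x. a x * K x s \<partial>M) * b s \<partial>M)" by simp
  finally show ?thesis .
qed

lemma green_symmetric:
  assumes a: "integrable unitm a" and b: "integrable unitm b"
  shows "(\<integral>x. a x * green b x \<partial>unitm) = (\<integral>x. green a x * b x \<partial>unitm)"
proof -
  have "(\<integral>x. a x * (\<integral>s. (min x s - x * s) * b s \<partial>unitm) \<partial>unitm) = (\<integral>s. (\<integral>x. a x * (min x s - x * s) \<partial>unitm) * b s \<partial>unitm)"
  proof (rule kernel_fubini[OF _ a b, where C = 1])
    show "sigma_finite_measure unitm" ..
    show "(\<lambda>(x, s). min x s - x * s) \<in> borel_measurable (unitm \<Otimes>\<^sub>M unitm)"
      unfolding case_prod_beta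
      by (intro borel_measurable_diff borel_measurable_min borel_measurable_times
          measurable_compose[OF measurable_fst measurable_unitm_id] measurable_compose[OF measurable_snd measurable_unitm_id])
    fix x s assume "x \<in> space unitm" "s \<in> space unitm"
    then have "\<bar>min x s - x * s\<bar> * \<bar>b s\<bar> \<le> \<bar>b s\<bar>" using green_kernel[of x s] by (intro mult_left_le_one_le) auto
    then show "\<bar>a x * ((min x s - x * s) * b s)\<bar> \<le> 1 * \<bar>a x\<bar> * \<bar>b s\<bar>" by (simp add: abs_mult mult_left_mono)
  qed
  then show ?thesis by (simp add: green_def min.commute mult_ac)
qed

text \<open>Writing the kernel as x (1 - s) - max 0 (x - s) expresses \<open>green g\<close> by a
  linear term and integrals over [0, x], which the fundamental theorem of calculus
  differentiates.\<close>

lemma green_derivative: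
  assumes g: "continuous_on {0..1} g"
  obtains G where "\<And>x. x \<in> {0..1} \<Longrightarrow> (green g has_real_derivative G x) (at x within {0..1})"
    "\<And>x. x \<in> {0..1} \<Longrightarrow> (G has_real_derivative - g x) (at x within {0..1})"
proof -
  \<comment> \<open>The value C is the slope of \<open>green g\<close> at 0.\<close>
  define C where "C = integral {0..1} (\<lambda>s. (1 - s) * g s)"
  define G where "G = (\<lambda>x. C - integral {0..x} g)"
  have green_eq: "green g x = x * C - (x * integral {0..x} g - integral {0..x} (\<lambda>s. s * g s))" if x: "x \<in> {0..1}" for x
  proof -
    have c: "continuous_on {0..1} (\<lambda>s. (min x s - x * s) * g s)"
      "continuous_on {0..1} (\<lambda>s. x * ((1 - s) * g s))"
      "continuous_on {0..1} (\<lambda>s. max 0 (x - s) * g s)"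
      by (intro continuous_intros g)+
    have cx: "continuous_on {0..x} g" by (rule continuous_on_subset[OF g]) (use x in auto)
    have "green g x = integral {0..1} (\<lambda>s. (min x s - x * s) * g s)"
      unfolding green_def by (rule integral_unitm_continuous[OF c(1)])
    also have "\<dots> = integral {0..1} (\<lambda>s. x * ((1 - s) * g s) - max 0 (x - s) * g s)"
      by (intro integral_cong) (auto simp: min_def max_def algebra_simps)
    also have "\<dots> = integral {0..1} (\<lambda>s. x * ((1 - s) * g s)) - integral {0..1} (\<lambda>s. max 0 (x - s) * g s)"
      by (intro integral_diff integrable_continuous_real c)
    also have "integral {0..1} (\<lambda>s. x * ((1 - s) * g s)) = x * C"
      by (simp add: C_def)
    also have "integral {0..1} (\<lambda>s. max 0 (x - s) * g s)
        = integral {0..x} (\<lambda>s. max 0 (x - s) * g s) + integral {x..1} (\<lambda>s. max 0 (x - s) * g s)"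
      by (rule Henstock_Kurzweil_Integration.integral_combine[symmetric])
         (use x in \<open>auto intro!: integrable_continuous_real c(3)\<close>)
    also have "integral {x..1} (\<lambda>s. max 0 (x - s) * g s) = integral {x..1} (\<lambda>s. 0)"
      by (intro integral_cong) auto
    also have "integral {0..x} (\<lambda>s. max 0 (x - s) * g s) = integral {0..x} (\<lambda>s. x * g s - s * g s)"
      by (intro integral_cong) (auto simp: algebra_simps)
    also have "\<dots> = integral {0..x} (\<lambda>s. x * g s) - integral {0..x} (\<lambda>s. s * g s)"
      by (intro integral_diff integrable_continuous_real continuous_intros cx)
    finally show ?thesis by simp
  qed
  show ?thesis
  proof (rule that[of G])
    fix x :: real assume x: "x \<in> {0..1}"
    have "((\<lambda>x. x * C - (x * integral {0..x} g - integral {0..x} (\<lambda>s. s * g s))) has_real_derivative G x) (at x within {0..1})"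
      unfolding G_def
      by (auto intro!: derivative_eq_intros integral_has_real_derivative[OF g x]
          integral_has_real_derivative[of 0 1 "\<lambda>s. s * g s", OF _ x] continuous_intros g)
    then show "(green g has_real_derivative G x) (at x within {0..1})"
      by (rule has_field_derivative_transform_within[OF _ zero_less_one x]) (simp add: green_eq)
    show "(G has_real_derivative - g x) (at x within {0..1})"
      unfolding G_def by (auto intro!: derivative_eq_intros integral_has_real_derivative[OF g x])
  qed
qed

lemma green_ends: "green g 0 = 0" "green g 1 = 0"
proof -
  have "(\<integral>s. (min 1 s - 1 * s) * g s \<partial>unitm) = (\<integral>s. 0 \<partial>unitm)"
    by (intro Bochner_Integration.integral_cong) auto
  moreover have "(\<integral>s. (min 0 s - 0 * s) * g s \<partial>unitm) = (\<integral>s. 0 \<partial>unitm)"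
    by (intro Bochner_Integration.integral_cong) auto
  ultimately show "green g 0 = 0" "green g 1 = 0" by (simp_all add: green_def)
qed

section \<open>Maximizing the L^q norm over the image of the unit ball of L^p\<close>

definition unit_ball :: "real \<Rightarrow> (real \<Rightarrow> real) set" where
  "unit_ball p = {g. (\<forall>x. 0 \<le> g x) \<and> g \<in> borel_measurable unitm \<and>
     integrable unitm (\<lambda>x. g x powr p) \<and> (\<integral>x. g x powr p \<partial>unitm) \<le> 1}"

lemma unit_ballD:
  assumes p: "1 < p" and g: "g \<in> unit_ball p"
  shows "integrable unitm g" "(\<integral>x. \<bar>g x\<bar> \<partial>unitm) \<le> 2"
    "\<And>x. 0 \<le> g x" "integrable unitm (\<lambda>x. g x powr p)" "(\<integral>x. g x powr p \<partial>unitm) \<le> 1"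
proof -
  have g': "\<And>x. 0 \<le> g x" "g \<in> borel_measurable unitm" "integrable unitm (\<lambda>x. g x powr p)"
    "(\<integral>x. g x powr p \<partial>unitm) \<le> 1" using g by (auto simp: unit_ball_def)
  have le: "g x \<le> 1 + g x powr p" for x
  proof (cases "g x \<le> 1")
    case False
    then have "g x powr 1 \<le> g x powr p" using p by (intro powr_mono) auto
    then show ?thesis using False by simp
  qed (simp add: add_increasing2)
  have i: "integrable unitm (\<lambda>x. 1 + g x powr p)" using g' by simp
  show int: "integrable unitm g"
    by (rule Bochner_Integration.integrable_bound[OF i g'(2)]) (use le g'(1) in \<open>auto simp: add_nonneg_nonneg\<close>)
  have "(\<integral>x. \<bar>g x\<bar> \<partial>unitm) \<le> (\<integral>x. 1 + g x powr p \<partial>unitm)"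
    using int i le g' by (intro integral_mono) auto
  also have "\<dots> \<le> 2" using g' by simp
  finally show "(\<integral>x. \<bar>g x\<bar> \<partial>unitm) \<le> 2" .
  show "\<And>x. 0 \<le> g x" "integrable unitm (\<lambda>x. g x powr p)" "(\<integral>x. g x powr p \<partial>unitm) \<le> 1"
    using g' by auto
qed

lemma green_lq_bounded:
  assumes p: "1 < p" "1 < q" and g: "g \<in> unit_ball p"
  shows "integrable unitm (\<lambda>x. green g x powr q)" "(\<integral>x. green g x powr q \<partial>unitm) \<le> 2 powr q"
    "x \<in> {0..1} \<Longrightarrow> 0 \<le> green g x" "x \<in> {0..1} \<Longrightarrow> green g x \<le> 2"
    "continuous_on {0..1} (\<lambda>x. green g x powr q)"
proof -
  note g' = unit_ballD[OF p(1) g]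
  show nonneg: "0 \<le> green g x" if "x \<in> {0..1}" for x using green_nonneg[OF g'(3) that] .
  show le: "green g x \<le> 2" if "x \<in> {0..1}" for x using green_bound[OF g'(1) that] g'(2) by linarith
  show c: "continuous_on {0..1} (\<lambda>x. green g x powr q)"
    using p by (intro continuous_on_powr' continuous_intros green_continuous g') (use nonneg in auto)
  show i: "integrable unitm (\<lambda>x. green g x powr q)" by (rule integrable_unitm_continuous[OF c])
  have "(\<integral>x. green g x powr q \<partial>unitm) \<le> (\<integral>x. 2 powr q \<partial>unitm)"
    by (rule integral_mono[OF i], simp, rule powr_mono2) (use p nonneg le in simp_all)
  then show "(\<integral>x. green g x powr q \<partial>unitm) \<le> 2 powr q" by simp
qed

text \<open>This is Sigma of the overview. The supremum over nonnegative g agrees with the one over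
  the whole ball: the kernel is nonnegative, so replacing g by \<bar>g\<bar> does not decrease the
  modulus of \<open>green g\<close>.\<close>

definition green_const :: "real \<Rightarrow> real \<Rightarrow> real" where
  "green_const p q = (SUP g\<in>unit_ball p. \<integral>x. green g x powr q \<partial>unitm)"

lemma unit_ball_nonempty: "(\<lambda>_. 1) \<in> unit_ball p"
  by (simp add: unit_ball_def)

lemma green_const_upper:
  assumes "1 < p" "1 < q" "g \<in> unit_ball p"
  shows "(\<integral>x. green g x powr q \<partial>unitm) \<le> green_const p q"
  unfolding green_const_def
  by (rule cSUP_upper[OF assms(3)]) (use green_lq_bounded(2)[OF assms(1,2)] in \<open>auto simp: bdd_above_def\<close>)

lemma green_const_pos:
  assumes p: "1 < p" "1 < q" shows "0 < green_const p q"
proof -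
  have "0 < green (\<lambda>_. 1) (1/2)" by (rule green_pos[where y = "1/2"]) auto
  then have "\<not> (\<integral>x. green (\<lambda>_. 1) x powr q \<partial>unitm) \<le> 0"
    using integral_unitm_eq_0_imp[OF green_lq_bounded(5)[OF p unit_ball_nonempty], of "1/2"] by auto
  then show ?thesis using green_const_upper[OF p unit_ball_nonempty] by linarith
qed

text \<open>Images of the unit ball are bounded and equi-Lipschitz, so Arzela-Ascoli gives a uniform
  limit of images along a maximizing sequence. No limit of the functions \<open>g n\<close>
  themselves is taken; that \<open>u\<close> is itself an image is deduced in
  \<open>green_maximizer\<close>.\<close>

lemma green_maximizing_limit:
  assumes p: "1 < p" "1 < q"
  obtains u g where "continuous_on {0..1} u" "\<And>n. g n \<in> unit_ball p"
    "\<And>x. x \<in> {0..1} \<Longrightarrow> (\<lambda>n. green (g n) x) \<longlonglongrightarrow> u x"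
    "(\<integral>x. u x powr q \<partial>unitm) = green_const p q" "\<And>x. x \<in> {0..1} \<Longrightarrow> 0 \<le> u x \<and> u x \<le> 2"
proof -
  let ?J = "\<lambda>g. \<integral>x. green g x powr q \<partial>unitm"
  have "\<exists>g\<in>unit_ball p. green_const p q - 1 / real (Suc n) < ?J g" for n
    unfolding green_const_def
    by (rule less_cSupE[of "(SUP g\<in>unit_ball p. ?J g) - 1 / real (Suc n)" "?J ` unit_ball p"])
       (use unit_ball_nonempty in auto)
  then obtain g where g: "\<And>n. g n \<in> unit_ball p" "\<And>n. green_const p q - 1 / real (Suc n) < ?J (g n)"
    by metis
  note g' = unit_ballD[OF p(1) g(1)]
  obtain u k where u: "continuous_on {0..1} u" "strict_mono (k :: nat \<Rightarrow> nat)"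
    "\<And>e. 0 < e \<Longrightarrow> \<exists>N. \<forall>n x. n \<ge> N \<and> x \<in> {0..1} \<longrightarrow> norm (green (g (k n)) x - u x) < e"
  proof (rule Arzela_Ascoli[of "{0..1::real}" "\<lambda>n. green (g n)" 2])
    show "norm (green (g n) x) \<le> 2" if "x \<in> {0..1}" for n x
      using green_lq_bounded(3,4)[OF p g(1) that, of n] by simp
    show "\<exists>d. 0 < d \<and> (\<forall>n y. y \<in> {0..1} \<and> norm (x - y) < d \<longrightarrow> norm (green (g n) x - green (g n) y) < e)"
      if x: "x \<in> {0..1}" and e: "0 < e" for x e :: real
    \<comment> \<open>The common Lipschitz constant is 4, twice the bound 2 on the L^1
      norms.\<close>
    proof (intro exI[of _ "e / 4"] conjI allI impI)
      fix n y assume y: "y \<in> {0..1} \<and> norm (x - y) < e / 4"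
      have "\<bar>green (g n) x - green (g n) y\<bar> \<le> 2 * \<bar>x - y\<bar> * (\<integral>s. \<bar>g n s\<bar> \<partial>unitm)"
        using green_lipschitz[OF g'(1) x] y by auto
      also have "\<dots> \<le> 2 * \<bar>x - y\<bar> * 2" using g'(2) by (intro mult_left_mono) auto
      also have "\<dots> < e" using y by simp
      finally show "norm (green (g n) x - green (g n) y) < e" by simp
    qed (use e in simp)
  qed auto
  have lim: "(\<lambda>n. green (g (k n)) x) \<longlonglongrightarrow> u x" if "x \<in> {0..1}" for x
    using u(3) that by (intro LIMSEQ_I) blast
  have bounds: "0 \<le> u x \<and> u x \<le> 2" if "x \<in> {0..1}" for x
    using LIMSEQ_le_const[OF lim[OF that], of 0] LIMSEQ_le_const2[OF lim[OF that], of 2]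
      green_lq_bounded(3,4)[OF p g(1) that] by auto
  have "(\<lambda>n. ?J (g (k n))) \<longlonglongrightarrow> (\<integral>x. u x powr q \<partial>unitm)"
  proof (rule integral_dominated_convergence[where w = "\<lambda>_. 2 powr q"])
    show "(\<lambda>x. u x powr q) \<in> borel_measurable unitm"
      using p bounds by (intro borel_measurable_unitm_continuous continuous_on_powr' continuous_intros u(1)) auto
    show "(\<lambda>x. green (g (k n)) x powr q) \<in> borel_measurable unitm" for n
      using green_lq_bounded(1)[OF p g(1)] by auto
    show "AE x in unitm. (\<lambda>n. green (g (k n)) x powr q) \<longlonglongrightarrow> u x powr q"
      using p by (intro AE_I2 tendsto_powr2 lim tendsto_const) (auto simp: green_lq_bounded(3)[OF p g(1)])
    show "AE x in unitm. norm (green (g (k n)) x powr q) \<le> 2 powr q" for n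
      using green_lq_bounded(3,4)[OF p g(1)] p by (intro AE_I2) (auto intro!: powr_mono2)
  qed simp
  moreover have "(\<lambda>n. ?J (g (k n))) \<longlonglongrightarrow> green_const p q"
  proof (rule tendsto_sandwich[of "\<lambda>n. green_const p q - 1 / real (Suc n)" _ _ "\<lambda>_. green_const p q"])
    show "\<forall>\<^sub>F n in sequentially. green_const p q - 1 / real (Suc n) \<le> ?J (g (k n))"
    proof (intro always_eventually allI)
      fix n
      have "1 / real (Suc (k n)) \<le> 1 / real (Suc n)"
        using seq_suble[OF u(2), of n] by (intro divide_left_mono) auto
      then show "green_const p q - 1 / real (Suc n) \<le> ?J (g (k n))" using g(2)[of "k n"] by linarith
    qed
    show "\<forall>\<^sub>F n in sequentially. ?J (g (k n)) \<le> green_const p q"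
      using green_const_upper[OF p g(1)] by simp
    show "(\<lambda>n. green_const p q - 1 / real (Suc n)) \<longlonglongrightarrow> green_const p q"
      using tendsto_diff[OF tendsto_const LIMSEQ_inverse_real_of_nat, of "green_const p q"]
      by (simp add: inverse_eq_divide)
  qed auto
  ultimately have "(\<integral>x. u x powr q \<partial>unitm) = green_const p q" by (rule LIMSEQ_unique)
  then show ?thesis using that[OF u(1), of "\<lambda>n. g (k n)"] g(1) lim bounds by auto
qed

text \<open>A maximizer \<open>u\<close> of the \<open>L\<^sup>q\<close> norm over the image of the unit ball of \<open>L\<^sup>p\<close> is reproduced by
  the nonlinear power iteration, whose steps never decrease the norm; equality in Young's
  inequality then turns this into the eigenvalue equation.\<close>

theorem green_maximizer:
  assumes p: "1 < p" "1 < q"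
  defines "\<Sigma> \<equiv> green_const p q"
  obtains u v where "continuous_on {0..1} u" "continuous_on {0..1} v"
    "\<And>x. x \<in> {0..1} \<Longrightarrow> u x = green (\<lambda>x. (v x / \<Sigma>) powr (1 / (p - 1))) x"
    "\<And>x. x \<in> {0..1} \<Longrightarrow> v x = green (\<lambda>x. u x powr (q - 1)) x"
    "\<And>x. 0 < x \<Longrightarrow> x < 1 \<Longrightarrow> 0 < u x \<and> 0 < v x"
    "(\<integral>x. u x powr q \<partial>unitm) = \<Sigma>" "(\<integral>x. (v x / \<Sigma>) powr (p / (p - 1)) \<partial>unitm) = 1"
proof -
  obtain u g where u: "continuous_on {0..1} u" "\<And>n. g n \<in> unit_ball p"
    "\<And>x. x \<in> {0..1} \<Longrightarrow> (\<lambda>n. green (g n) x) \<longlonglongrightarrow> u x"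
    "(\<integral>x. u x powr q \<partial>unitm) = \<Sigma>" "\<And>x. x \<in> {0..1} \<Longrightarrow> 0 \<le> u x \<and> u x \<le> 2"
    unfolding \<Sigma>_def using green_maximizing_limit[OF p] by blast
  have \<Sigma>: "0 < \<Sigma>" unfolding \<Sigma>_def by (rule green_const_pos[OF p])
  have cu: "continuous_on {0..1} (\<lambda>x. u x powr k)" if "0 < k" for k
    using that u by (intro continuous_on_powr' continuous_intros) auto
  have iu: "integrable unitm (\<lambda>x. u x powr k)" if "0 < k" for k
    by (rule integrable_unitm_continuous[OF cu[OF that]])
  \<comment> \<open>Up to the factor q, \<open>v\<close> is the gradient of the functional with
    respect to g at the image \<open>u\<close>, since \<open>green\<close> is symmetric.\<close>
  define v where "v = green (\<lambda>x. u x powr (q - 1))"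
  have q1: "0 < q - 1" using p by simp
  have cv: "continuous_on {0..1} v" unfolding v_def by (intro green_continuous iu q1)
  have v0: "0 \<le> v x" if "x \<in> {0..1}" for x unfolding v_def using that by (intro green_nonneg) auto
  have u_ne: "\<exists>y. 0 < y \<and> y < 1 \<and> u y \<noteq> 0"
  proof (rule ccontr)
    assume "\<not> ?thesis"
    then have *: "u y = 0" if "0 < y" "y < 1" for y using that by blast
    have "closed ({0..1} \<inter> u -` {0})" by (rule continuous_closed_preimage[OF u(1)]) auto
    moreover have "{0<..<1} \<subseteq> {0..1} \<inter> u -` {0}" using * by auto
    ultimately have "closure {0<..<1::real} \<subseteq> {0..1} \<inter> u -` {0}" by (rule closure_minimal[rotated])
    then have "u x = 0" if "x \<in> {0..1}" for x using that by auto
    then have "(\<integral>x. u x powr q \<partial>unitm) = (\<integral>x. 0 \<partial>unitm)"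
      by (intro Bochner_Integration.integral_cong) auto
    then show False using u(4) \<Sigma> by simp
  qed
  then obtain y where y: "0 < y" "y < 1" "u y \<noteq> 0" by blast
  have v_pos: "0 < v x" if "0 < x" "x < 1" for x
    unfolding v_def using y that by (intro green_pos[OF cu[OF q1], of y]) auto
  \<comment> \<open>The exponent conjugate to p.\<close>
  define P where "P = p / (p - 1)"
  have P: "1 < P" "1 + 1 / (p - 1) = P" "1 / (p - 1) * p = P" "(p - 1) * (1 / (p - 1)) = 1" "0 < 1 / (p - 1)"
    using p by (auto simp: P_def field_simps)
  have cvp: "continuous_on {0..1} (\<lambda>x. (v x / c) powr k)" if "0 < k" "0 < c" for k c
    using that v0 by (intro continuous_on_powr' continuous_intros cv) auto
  have ivp: "integrable unitm (\<lambda>x. (v x / c) powr k)" if "0 < k" "0 < c" for k c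
    by (rule integrable_unitm_continuous[OF cvp[OF that]])
  have "\<not> (\<integral>x. v x powr P \<partial>unitm) \<le> 0"
    using integral_unitm_eq_0_imp[of "\<lambda>x. v x powr P" "1/2"] v_pos[of "1/2"] cvp[of P 1] P by auto
  then have vP: "0 < (\<integral>x. v x powr P \<partial>unitm)" by simp
  define N where "N = (\<integral>x. v x powr P \<partial>unitm) powr (1 / P)"
  have N: "0 < N" using vP by (simp add: N_def)
  have NP: "N powr P = (\<integral>x. v x powr P \<partial>unitm)" 
    unfolding N_def powr_powr using P(1) vP by simp
  have vN: "(\<integral>x. (v x / N) powr P \<partial>unitm) = 1"
  proof -
    have "(\<integral>x. (v x / N) powr P \<partial>unitm) = (\<integral>x. v x powr P / N powr P \<partial>unitm)"
      using v0 N by (intro Bochner_Integration.integral_cong) (auto simp: powr_divide)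
    then show ?thesis using vP NP by simp
  qed
  have iuv: "integrable unitm (\<lambda>x. u x powr (q - 1) * green h x)" if "integrable unitm h" for h
    by (intro integrable_unitm_continuous continuous_intros cu q1 green_continuous that)
  \<comment> \<open>Hoelder's inequality for \<open>v\<close> and \<open>g n\<close>, obtained by
    integrating Young's inequality for \<open>v\<close> / N, whose L^P norm is 1, and
    \<open>g n\<close>, whose L^p norm is at most 1.\<close>
  have step: "(\<integral>x. u x powr (q - 1) * green (g n) x \<partial>unitm) \<le> N" for n
  proof -
    note gn = unit_ballD[OF p(1) u(2)[of n]]
    have "(\<integral>x. u x powr (q - 1) * green (g n) x \<partial>unitm) = (\<integral>x. v x * g n x \<partial>unitm)"
      unfolding v_def by (rule green_symmetric[OF iu[OF q1] gn(1)])
    also have "\<dots> \<le> (\<integral>x. N * ((1 - 1 / p) * (v x / N) powr P + g n x powr p / p) \<partial>unitm)"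
    proof (rule integral_mono_AE')
      show "integrable unitm (\<lambda>x. N * ((1 - 1 / p) * (v x / N) powr P + g n x powr p / p))"
        using gn(4) ivp[of P N] P N by auto
      show "AE x in unitm. v x * g n x \<le> N * ((1 - 1 / p) * (v x / N) powr P + g n x powr p / p)"
      proof (rule AE_I2)
        fix x assume "x \<in> space unitm"
        then have x: "0 \<le> v x / N" using v0 N by simp
        have "((v x / N) powr (1 / (p - 1))) powr (p - 1) * g n x
          \<le> (1 - 1 / p) * ((v x / N) powr (1 / (p - 1))) powr p + g n x powr p / p"
          by (rule young) (use p gn(3) in auto)
        then have "v x / N * g n x \<le> (1 - 1 / p) * (v x / N) powr P + g n x powr p / p"
          using P x p v0[of x] N \<open>x \<in> space unitm\<close> by (simp add: powr_powr P_def)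
        then have "N * (v x / N * g n x) \<le> N * ((1 - 1 / p) * (v x / N) powr P + g n x powr p / p)"
          using N by (intro mult_left_mono) auto
        then show "v x * g n x \<le> N * ((1 - 1 / p) * (v x / N) powr P + g n x powr p / p)"
          using N by simp
      qed
      show "AE x in unitm. 0 \<le> N * ((1 - 1 / p) * (v x / N) powr P + g n x powr p / p)"
        using N p by (intro AE_I2) auto
    qed
    also have "\<dots> = N * ((1 - 1 / p) + (\<integral>x. g n x powr p \<partial>unitm) / p)"
      using gn(4) ivp[of P N] P N vN by simp
    also have "\<dots> \<le> N * ((1 - 1 / p) + 1 / p)"
      using gn(5) N p by (intro mult_left_mono add_left_mono divide_right_mono) auto
    finally show ?thesis by simp
  qed
  \<comment> \<open>In the limit the left side of \<open>step\<close> becomes the integral of u powr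
    q, which is \<Sigma>; hence \<Sigma> \<le> N.\<close>
  have "(\<lambda>n. \<integral>x. u x powr (q - 1) * green (g n) x \<partial>unitm) \<longlonglongrightarrow> (\<integral>x. u x powr (q - 1) * u x \<partial>unitm)"
  proof (rule integral_dominated_convergence[where w = "\<lambda>x. u x powr (q - 1) * 2"])
    show "(\<lambda>x. u x powr (q - 1) * u x) \<in> borel_measurable unitm"
      by (intro borel_measurable_unitm_continuous continuous_intros cu q1 u(1))
    show "(\<lambda>x. u x powr (q - 1) * green (g n) x) \<in> borel_measurable unitm" for n
      using iuv[OF unit_ballD(1)[OF p(1) u(2)]] by auto
    show "AE x in unitm. (\<lambda>n. u x powr (q - 1) * green (g n) x) \<longlonglongrightarrow> u x powr (q - 1) * u x"
      by (intro AE_I2 tendsto_intros u(3)) auto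
    show "AE x in unitm. norm (u x powr (q - 1) * green (g n) x) \<le> u x powr (q - 1) * 2" for n
      using green_lq_bounded(3,4)[OF p u(2)] by (intro AE_I2) (auto simp: abs_mult intro!: mult_left_mono)
  qed (use iu[OF q1] in auto)
  moreover have "(\<integral>x. u x powr (q - 1) * u x \<partial>unitm) = \<Sigma>"
    unfolding u(4)[symmetric] using u(5)
    by (intro Bochner_Integration.integral_cong) (auto simp: powr_diff)
  ultimately have \<Sigma>N: "\<Sigma> \<le> N" using step by (auto intro: LIMSEQ_le_const2)
  \<comment> \<open>The unit vector of L^p for which Hoelder's inequality against \<open>v\<close>
    is an equality; its image \<open>w\<close> is the next iterate.\<close>
  define h where "h = (\<lambda>x. \<bar>v x / N\<bar> powr (1 / (p - 1)))"
  have heq: "h x = (v x / N) powr (1 / (p - 1))" if "x \<in> {0..1}" for x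
    using v0[OF that] N by (simp add: h_def)
  have hp: "h x powr p = (v x / N) powr P" if "x \<in> {0..1}" for x
    using heq[OF that] P by (simp add: powr_powr)
  have ch: "continuous_on {0..1} h"
    using cvp[of "1 / (p - 1)" N] P N by (subst continuous_on_cong[OF refl heq]) auto
  have ih: "integrable unitm h" by (rule integrable_unitm_continuous[OF ch])
  have "integrable unitm (\<lambda>x. h x powr p)"
    by (subst Bochner_Integration.integrable_cong[OF refl hp]) (use ivp[of P N] P N in auto)
  moreover have "(\<integral>x. h x powr p \<partial>unitm) = 1"
    unfolding vN[symmetric] by (rule Bochner_Integration.integral_cong) (auto simp: hp)
  ultimately have hB: "h \<in> unit_ball p" using ih by (auto simp: unit_ball_def h_def)
  define w where "w = green h"
  note wq = green_lq_bounded[OF p hB, folded w_def]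
  have wle: "(\<integral>x. w x powr q \<partial>unitm) \<le> \<Sigma>"
    unfolding w_def \<Sigma>_def by (rule green_const_upper[OF p hB])
  have "(\<integral>x. u x powr (q - 1) * w x \<partial>unitm) = (\<integral>x. v x * h x \<partial>unitm)"
    unfolding v_def w_def by (rule green_symmetric[OF iu[OF q1] ih])
  also have "\<dots> = (\<integral>x. N * (v x / N) powr P \<partial>unitm)"
  proof (intro Bochner_Integration.integral_cong refl)
    fix x assume "x \<in> space unitm"
    then have x: "x \<in> {0..1}" by simp
    have "(v x / N) powr (1 + 1 / (p - 1)) = (v x / N) * (v x / N) powr (1 / (p - 1))"
      using v0[OF x] N by (cases "v x = 0") (auto simp: powr_add)
    then show "v x * h x = N * (v x / N) powr P"
      using heq[OF x] P(2) N by simp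
  qed
  also have "\<dots> = N" using vN by simp
  finally have uw: "(\<integral>x. u x powr (q - 1) * w x \<partial>unitm) = N" .
  \<comment> \<open>The deficit in Young's inequality for \<open>u\<close> and \<open>w\<close>. It
    is nonnegative, and its integral is at most \<Sigma> - N, which is nonpositive; hence it
    vanishes and \<open>u\<close> agrees with \<open>w\<close>.\<close>
  define e where "e = (\<lambda>x. (1 - 1 / q) * u x powr q + w x powr q / q - u x powr (q - 1) * w x)"
  have q0: "0 < q" using p by simp
  have "(\<integral>x. e x \<partial>unitm) = (1 - 1 / q) * \<Sigma> + (\<integral>x. w x powr q \<partial>unitm) / q - N"
    unfolding e_def using iu[OF q0] wq(1) iuv[OF ih] uw u(4) by (simp add: w_def)
  moreover have "(\<integral>x. w x powr q \<partial>unitm) / q \<le> \<Sigma> / q"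
    using wle p by (intro divide_right_mono) auto
  ultimately have e_le: "(\<integral>x. e x \<partial>unitm) \<le> \<Sigma> - N" by (simp add: algebra_simps)
  have e0: "0 \<le> e x" if "x \<in> {0..1}" for x
    using young[OF p(2), of "u x" "w x"] u(5)[OF that] wq(3)[OF that] by (simp add: e_def)
  have ce: "continuous_on {0..1} e"
    unfolding e_def using q0 by (intro continuous_intros cu q1 q0 wq(5)) (auto simp: w_def intro: green_continuous ih)
  have "0 \<le> (\<integral>x. e x \<partial>unitm)" using e0 by (intro integral_nonneg_AE AE_I2) simp
  then have N\<Sigma>: "N = \<Sigma>" using e_le \<Sigma>N by simp
  have uw_eq: "u x = w x" if "x \<in> {0..1}" for x
  proof (rule ccontr)
    assume "u x \<noteq> w x"
    then have "e x \<noteq> 0"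
      using young_strict[OF p(2), of "u x" "w x"] u(5)[OF that] wq(3)[OF that] by (simp add: e_def)
    then show False using integral_unitm_eq_0_imp[OF ce e0 _ that] e_le N\<Sigma> by simp
  qed
  have w_eq: "w x = green (\<lambda>x. (v x / \<Sigma>) powr (1 / (p - 1))) x" for x
    unfolding w_def green_def by (rule Bochner_Integration.integral_cong) (auto simp: heq N\<Sigma>)
  show ?thesis
  proof (rule that[OF u(1) cv])
    show "u x = green (\<lambda>x. (v x / \<Sigma>) powr (1 / (p - 1))) x" if "x \<in> {0..1}" for x
      using uw_eq[OF that] w_eq by simp
    show "v x = green (\<lambda>x. u x powr (q - 1)) x" for x by (simp add: v_def)
    show "0 < u x \<and> 0 < v x" if x: "0 < x" "x < 1" for x
    proof -
      have "0 < green (\<lambda>x. (v x / \<Sigma>) powr (1 / (p - 1))) x"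
        using x v_pos[of "1/2"] \<Sigma> cvp[of "1 / (p - 1)" \<Sigma>] P by (intro green_pos[of _ "1/2"]) auto
      then show ?thesis using uw_eq[of x] w_eq x v_pos by auto
    qed
    show "(\<integral>x. u x powr q \<partial>unitm) = \<Sigma>" by (rule u(4))
    show "(\<integral>x. (v x / \<Sigma>) powr (p / (p - 1)) \<partial>unitm) = 1" using vN by (simp add: N\<Sigma> P_def)
  qed
qed

text \<open>Homogeneity transfers the bound from the unit ball to \<open>h\<close>: the function
  \<bar>h\<bar> / K lies in the ball as soon as K powr p is at least the integral I of \<bar>h\<bar>
  powr p.\<close>

theorem green_inequality:
  assumes p: "1 < p" "1 < q" and h: "h \<in> borel_measurable unitm" "integrable unitm (\<lambda>x. \<bar>h x\<bar> powr p)"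
  shows "(\<integral>x. \<bar>green h x\<bar> powr q \<partial>unitm) \<le> green_const p q * (\<integral>x. \<bar>h x\<bar> powr p \<partial>unitm) powr (q / p)"
    "integrable unitm h"
proof -
  have *: "(\<integral>x. \<bar>green h x\<bar> powr q \<partial>unitm) \<le> green_const p q * K powr q \<and> integrable unitm h"
    if K: "0 < K" "(\<integral>x. \<bar>h x\<bar> powr p \<partial>unitm) \<le> K powr p" for K
  proof -
    define g where "g = (\<lambda>x. \<bar>h x\<bar> / K)"
    have gp: "g x powr p = \<bar>h x\<bar> powr p / K powr p" for x using K by (simp add: g_def powr_divide)
    have [measurable]: "h \<in> borel_measurable unitm" by fact
    have gB: "g \<in> unit_ball p"
      using K h(2) by (auto simp: unit_ball_def gp) (auto simp: g_def)
    note g = unit_ballD[OF p(1) gB] green_lq_bounded[OF p gB]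
    have hg: "\<bar>h x\<bar> = K * g x" for x using K by (simp add: g_def)
    have "integrable unitm (\<lambda>x. \<bar>h x\<bar>)" unfolding hg using g(1) by simp
    then have ih: "integrable unitm h" using integrable_abs_cancel[OF _ h(1)] by simp
    have "(\<integral>x. \<bar>green h x\<bar> powr q \<partial>unitm) \<le> (\<integral>x. K powr q * green g x powr q \<partial>unitm)"
    proof (rule integral_mono_AE')
      show "AE x in unitm. \<bar>green h x\<bar> powr q \<le> K powr q * green g x powr q"
      proof (rule AE_I2)
        fix x assume "x \<in> space unitm"
        then have x: "x \<in> {0..1}" by simp
        have "\<bar>green h x\<bar> \<le> K * green g x"
          using green_abs_le[OF ih x] unfolding hg green_cmult .
        then have "\<bar>green h x\<bar> powr q \<le> (K * green g x) powr q" using p by (intro powr_mono2) auto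
        then show "\<bar>green h x\<bar> powr q \<le> K powr q * green g x powr q"
          using K g(8)[OF x] by (simp add: powr_mult)
      qed
    qed (use g in auto)
    also have "\<dots> \<le> K powr q * green_const p q"
      using green_const_upper[OF p gB] by (simp add: mult_left_mono)
    finally show ?thesis using ih by (simp add: mult.commute)
  qed
  define I where "I = (\<integral>x. \<bar>h x\<bar> powr p \<partial>unitm)"
  have I: "0 \<le> I" by (simp add: I_def)
  have p0: "0 < p" using p by simp
  show "integrable unitm h"
    using *[of "(I + 1) powr (1 / p)"] I p0 by (simp add: I_def[symmetric] powr_powr)
  \<comment> \<open>The excess 1 / (n + 1) keeps K positive when I = 0; it is removed in the
    limit.\<close>
  have "(\<integral>x. \<bar>green h x\<bar> powr q \<partial>unitm) \<le> green_const p q * (I + inverse (real (Suc n))) powr (q / p)" for n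
  proof -
    have "0 < I + inverse (real (Suc n))" using I by (intro add_nonneg_pos) simp_all
    then show ?thesis
      using *[of "(I + inverse (real (Suc n))) powr (1 / p)"] p0
      by (simp add: I_def[symmetric] powr_powr del: of_nat_Suc)
  qed
  moreover have "(\<lambda>n. green_const p q * (I + inverse (real (Suc n))) powr (q / p)) \<longlonglongrightarrow> green_const p q * (I + 0) powr (q / p)"
    using p I LIMSEQ_inverse_real_of_nat by (intro tendsto_intros tendsto_powr2) auto
  ultimately show "(\<integral>x. \<bar>green h x\<bar> powr q \<partial>unitm) \<le> green_const p q * (\<integral>x. \<bar>h x\<bar> powr p \<partial>unitm) powr (q / p)"
    unfolding I_def[symmetric] by (intro LIMSEQ_le_const) auto
qed

section \<open>Eigenfunctions and spectral numbers\<close>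

lemma has_real_derivative_affine:
  assumes "(f has_real_derivative d) (at (m * x + c) within T)" "\<And>y. y \<in> S \<Longrightarrow> m * y + c \<in> T"
  shows "((\<lambda>x. f (m * x + c)) has_real_derivative m * d) (at x within S)"
proof -
  have "((\<lambda>x. m * x + c) has_real_derivative m) (at x within S)"
    by (auto intro!: derivative_eq_intros)
  moreover have "(f has_real_derivative d) (at (m * x + c) within (\<lambda>x. m * x + c) ` S)"
    by (rule DERIV_subset[OF assms(1)]) (use assms(2) in auto)
  ultimately show ?thesis
    using DERIV_image_chain[of f d "\<lambda>x. m * x + c" x S m] by (simp add: o_def mult.commute)
qed

lemma has_real_derivative_glue:
  fixes f :: "real \<Rightarrow> real"
  assumes "a \<le> b" "b \<le> c"
    and "\<And>x. x \<in> {a..b} \<Longrightarrow> (f has_real_derivative g x) (at x within {a..b})"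
    and "\<And>x. x \<in> {b..c} \<Longrightarrow> (f has_real_derivative g x) (at x within {b..c})"
    and "x \<in> {a..c}"
  shows "(f has_real_derivative g x) (at x within {a..c})"
proof -
  have un: "{a..c} = {a..b} \<union> {b..c}" using assms(1,2) by auto
  consider "x < b" | "b < x" | "x = b" by linarith
  then show ?thesis
  proof cases
    case 1
    have "at x within {a..c} = at x within {a..b}"
      by (rule at_within_nhd[of _ "{..<b}"]) (use 1 assms in auto)
    then show ?thesis using assms 1 by simp
  next
    case 2
    have "at x within {a..c} = at x within {b..c}"
      by (rule at_within_nhd[of _ "{b<..}"]) (use 2 assms in auto)
    then show ?thesis using assms 2 by simp
  next
    case 3
    show ?thesis
      using assms(3,4)[of b] assms(1,2) 3 unfolding has_field_derivative_iff un
      by (auto intro: Lim_within_Un[THEN iffD2])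
  qed
qed

lemma derivative_nonneg_imp_le:
  fixes f :: "real \<Rightarrow> real"
  assumes "a \<le> b"
    and "\<And>x. x \<in> {a..b} \<Longrightarrow> (f has_real_derivative g x) (at x within {a..b})"
    and "\<And>x. a < x \<Longrightarrow> x < b \<Longrightarrow> 0 \<le> g x"
  shows "f a \<le> f b"
proof (rule DERIV_nonneg_imp_increasing_open[OF assms(1)])
  show "\<exists>y. (f has_real_derivative y) (at x) \<and> 0 \<le> y" if "a < x" "x < b" for x
    using assms(2)[of x] assms(3)[of x] that by (auto simp: at_within_Icc_at)
  show "continuous_on {a..b} f"
    by (rule DERIV_continuous_on[OF assms(2)])
qed

lemma derivative_bound_imp_le:
  fixes f :: "real \<Rightarrow> real"
  assumes "a \<le> b"
    and f: "\<And>x. x \<in> {a..b} \<Longrightarrow> (f has_real_derivative g x) (at x within {a..b})"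
    and B: "\<And>x. a < x \<Longrightarrow> x < b \<Longrightarrow> \<bar>g x\<bar> \<le> B"
  shows "\<bar>f b - f a\<bar> \<le> B * (b - a)"
proof -
  have "B * a - f a \<le> B * b - f b"
    by (rule derivative_nonneg_imp_le[OF assms(1), where g = "\<lambda>x. B - g x"])
       (use B in \<open>auto intro!: derivative_eq_intros f simp: abs_le_iff\<close>)
  moreover have "B * a + f a \<le> B * b + f b"
    by (rule derivative_nonneg_imp_le[OF assms(1), where g = "\<lambda>x. B + g x"])
       (use B in \<open>force intro!: derivative_eq_intros f simp: abs_le_iff\<close>)+
  ultimately show ?thesis by (simp add: algebra_simps abs_le_iff)
qed

section \<open>The first order system: continuation, comparison, uniqueness\<close>

text \<open>The eigenvalue equation as a system, with r = 1 / (p - 1), s = q - 1 and w =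
  \<open>spow (p - 1)\<close> u''. Only the conditions at 0 are included, so that solutions can be
  restricted and continued; those at the right end are stated separately.\<close>

definition sol ::
  "real \<Rightarrow> real \<Rightarrow> real \<Rightarrow> real \<Rightarrow> (real \<Rightarrow> real) \<Rightarrow> (real \<Rightarrow> real) \<Rightarrow> (real \<Rightarrow> real) \<Rightarrow> (real \<Rightarrow> real) \<Rightarrow> bool"
  where "sol r s l t u u1 w w1 \<longleftrightarrow>
    (\<forall>x\<in>{0..t}. (u has_real_derivative u1 x) (at x within {0..t}) \<and>
       (u1 has_real_derivative spow r (w x)) (at x within {0..t}) \<and>
       (w has_real_derivative w1 x) (at x within {0..t}) \<and>
       (w1 has_real_derivative l * spow s (u x)) (at x within {0..t})) \<and> u 0 = 0 \<and> w 0 = 0"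

lemma solD:
  assumes "sol r s l t u u1 w w1"
  shows "x \<in> {0..t} \<Longrightarrow> (u has_real_derivative u1 x) (at x within {0..t})"
    "x \<in> {0..t} \<Longrightarrow> (u1 has_real_derivative spow r (w x)) (at x within {0..t})"
    "x \<in> {0..t} \<Longrightarrow> (w has_real_derivative w1 x) (at x within {0..t})"
    "x \<in> {0..t} \<Longrightarrow> (w1 has_real_derivative l * spow s (u x)) (at x within {0..t})"
    "u 0 = 0" "w 0 = 0"
  using assms by (auto simp: sol_def)

lemma sol_subset:
  assumes "sol r s l t u u1 w w1" "0 \<le> a" "b \<le> t" "x \<in> {a..b}"
  shows "(u has_real_derivative u1 x) (at x within {a..b})"
    "(u1 has_real_derivative spow r (w x)) (at x within {a..b})"
    "(w has_real_derivative w1 x) (at x within {a..b})"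
    "(w1 has_real_derivative l * spow s (u x)) (at x within {a..b})"
  using assms by (auto intro: DERIV_subset[OF solD(1)] DERIV_subset[OF solD(2)]
      DERIV_subset[OF solD(3)] DERIV_subset[OF solD(4)])

lemma sol_continuous:
  assumes "sol r s l t u u1 w w1"
  shows "continuous_on {0..t} u" "continuous_on {0..t} u1"
    "continuous_on {0..t} w" "continuous_on {0..t} w1"
  by (rule DERIV_continuous_on[OF solD(1)[OF assms]] DERIV_continuous_on[OF solD(2)[OF assms]]
      DERIV_continuous_on[OF solD(3)[OF assms]] DERIV_continuous_on[OF solD(4)[OF assms]]; assumption)+

lemma sol_restrict:
  assumes "sol r s l t u u1 w w1" "t' \<le> t"
  shows "sol r s l t' u u1 w w1"
  unfolding sol_def
  using sol_subset[OF assms(1) order_refl assms(2)] solD(5,6)[OF assms(1)] by blast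

text \<open>Both nonlinearities are odd, so \<open>u\<close> and \<open>w\<close> can be continued
  through a common zero by odd reflection and their derivatives by even reflection. In
  \<open>R \<sigma> f\<close> the sign \<sigma> = -1 stands for odd and \<sigma> = 1 for even;
  differentiation exchanges the two.\<close>

lemma sol_double:
  assumes sol: "sol r s l t u u1 w w1" and "0 < t" "u t = 0" "w t = 0"
  defines "R \<equiv> \<lambda>\<sigma> f x. if x \<le> t then f x else \<sigma> * f (2 * t - x) :: real"
  shows "sol r s l (2 * t) (R (-1) u) (R 1 u1) (R (-1) w) (R 1 w1)"
proof -
  have glue: "(R \<sigma> f has_real_derivative R (-\<sigma>) g x) (at x within {0..2 * t})"
    if f: "\<And>x. x \<in> {0..t} \<Longrightarrow> (f has_real_derivative g x) (at x within {0..t})"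
      and \<sigma>: "\<sigma> * f t = f t" "-\<sigma> * g t = g t" and x: "x \<in> {0..2*t}" for \<sigma> f g x
  proof (rule has_real_derivative_glue[OF _ _ _ _ x, of t])
    show "(R \<sigma> f has_real_derivative R (-\<sigma>) g x) (at x within {0..t})" if "x \<in> {0..t}" for x
    proof -
      have "(R \<sigma> f has_real_derivative g x) (at x within {0..t})"
        by (rule has_field_derivative_transform_within[OF f zero_less_one])
           (use that in \<open>auto simp: R_def\<close>)
      then show ?thesis using that by (simp add: R_def)
    qed
    show "(R \<sigma> f has_real_derivative R (-\<sigma>) g x) (at x within {t..2*t})" if x: "x \<in> {t..2*t}" for x
    proof -
      have "((\<lambda>x. \<sigma> * f (- 1 * x + 2 * t)) has_real_derivative \<sigma> * (- 1 * g (- 1 * x + 2 * t))) (at x within {t..2*t})"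
        by (intro DERIV_cmult has_real_derivative_affine[OF f]) (use x in auto)
      then have "(R \<sigma> f has_real_derivative \<sigma> * (- 1 * g (- 1 * x + 2 * t))) (at x within {t..2*t})"
        by (rule has_field_derivative_transform_within[OF _ zero_less_one])
           (use x \<sigma> in \<open>auto simp: R_def\<close>)
      moreover have "\<sigma> * (- 1 * g (- 1 * x + 2 * t)) = R (-\<sigma>) g x"
        using x \<sigma> by (cases "x = t") (auto simp: R_def)
      ultimately show ?thesis by simp
    qed
  qed (use \<open>0 < t\<close> in auto)
  have sp: "spow r (R (-1) w x) = R (-1) (\<lambda>x. spow r (w x)) x" for x
    by (simp add: R_def)
  have sp': "l * spow s (R (-1) u x) = R (-1) (\<lambda>x. l * spow s (u x)) x" for x
    by (simp add: R_def)
  show ?thesis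
    unfolding sol_def sp sp'
    using glue[OF solD(1)[OF sol], of "-1"] glue[OF solD(2)[OF sol], of 1]
      glue[OF solD(3)[OF sol], of "-1"] glue[OF solD(4)[OF sol], of 1] assms(2-4) solD(5,6)[OF sol]
    by (auto simp: R_def)
qed

text \<open>Repeated doubling reaches arbitrarily long intervals with one bound M for \<bar>w\<bar>.
  Such a bound is incompatible with the linear growth in \<open>sol_comparison\<close>.\<close>

lemma sol_extend:
  assumes "sol r s l t u u1 w w1" "0 < t" "u t = 0" "w t = 0" "\<And>x. x \<in> {0..t} \<Longrightarrow> \<bar>w x\<bar> \<le> M"
  shows "\<exists>U U1 W W1. sol r s l (2 ^ k * t) U U1 W W1 \<and> U (2 ^ k * t) = 0 \<and> W (2 ^ k * t) = 0 \<and>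
    U1 0 = u1 0 \<and> W1 0 = w1 0 \<and> (\<forall>x\<in>{0..2 ^ k * t}. \<bar>W x\<bar> \<le> M)"
proof (induction k)
  case 0
  then show ?case using assms by (intro exI[of _ u] exI[of _ u1] exI[of _ w] exI[of _ w1]) auto
next
  case (Suc k)
  then obtain U U1 W W1 where *: "sol r s l (2 ^ k * t) U U1 W W1" "U (2 ^ k * t) = 0"
    "W (2 ^ k * t) = 0" "U1 0 = u1 0" "W1 0 = w1 0" "\<And>x. x\<in>{0..2 ^ k * t} \<Longrightarrow> \<bar>W x\<bar> \<le> M"
    by blast
  define R where "R = (\<lambda>\<sigma> f x. if x \<le> 2 ^ k * t then f x else \<sigma> * f (2 * (2 ^ k * t) - x) :: real)"
  have t: "0 < 2 ^ k * t" using assms(2) by simp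
  have "sol r s l (2 * (2 ^ k * t)) (R (-1) U) (R 1 U1) (R (-1) W) (R 1 W1)"
    unfolding R_def by (rule sol_double[OF *(1) t *(2,3)])
  moreover have "\<bar>R (-1) W x\<bar> \<le> M" if "x\<in>{0..2 * (2 ^ k * t)}" for x
  proof (cases "x \<le> 2 ^ k * t")
    case False
    then have "2 * (2 ^ k * t) - x \<in> {0..2 ^ k * t}" using that unfolding atLeastAtMost_iff by linarith
    then show ?thesis using False *(6) by (simp add: R_def)
  qed (use that *(6)[of x] in \<open>auto simp: R_def\<close>)
  moreover have "R (-1) U (2 * (2 ^ k * t)) = 0" "R (-1) W (2 * (2 ^ k * t)) = 0"
    "R 1 U1 0 = u1 0" "R 1 W1 0 = w1 0"
    using * solD(5,6)[OF *(1)] t assms(2) by (auto simp: R_def)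
  ultimately show ?case
    by (intro exI[of _ "R (-1) U"] exI[of _ "R 1 U1"] exI[of _ "R (-1) W"] exI[of _ "R 1 W1"])
       (simp add: mult.assoc)
qed

text \<open>The system is cooperative: the initial slopes order two solutions for all times.\<close>

lemma sol_comparison:
  assumes A: "sol r s l L U U1 W W1" and B: "sol r s l L u u1 w w1"
    and pos: "0 < r" "0 < s" "0 < l" and slopes: "u1 0 \<le> U1 0" "w1 0 < W1 0" and x: "x \<in> {0..L}"
  shows "(W1 0 - w1 0) * x \<le> W x - w x"
proof -
  define \<Delta> where "\<Delta> = W1 0 - w1 0"
  have \<Delta>: "0 < \<Delta>" using slopes by (simp add: \<Delta>_def)
  \<comment> \<open>The estimate up to \<open>y\<close> as long as w < W holds before
    \<open>y\<close>. Integrating once around the cycle of the four equations improves this order to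
    a linear gap.\<close>
  have *: "\<Delta> * y \<le> W y - w y" if y: "0 \<le> y" "y \<le> L" and gt: "\<And>z. 0 < z \<Longrightarrow> z < y \<Longrightarrow> w z < W z" for y
  proof -
    have d: "((\<lambda>x. U x - u x) has_real_derivative U1 z - u1 z) (at z within {0..b})"
      "((\<lambda>x. U1 x - u1 x) has_real_derivative spow r (W z) - spow r (w z)) (at z within {0..b})"
      "((\<lambda>x. W x - w x) has_real_derivative W1 z - w1 z) (at z within {0..b})"
      "((\<lambda>x. W1 x - w1 x) has_real_derivative l * spow s (U z) - l * spow s (u z)) (at z within {0..b})"
      if "z \<in> {0..b}" "b \<le> y" for z b
      using that y by (auto intro!: DERIV_diff sol_subset[OF A] sol_subset[OF B])
    have "U1 0 - u1 0 \<le> U1 z - u1 z" if "z \<in> {0..y}" for z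
      by (rule derivative_nonneg_imp_le[OF _ d(2)])
         (use that pos gt in \<open>auto intro!: spow_mono less_imp_le[OF gt]\<close>)
    then have d1: "0 \<le> U1 z - u1 z" if "z \<in> {0..y}" for z
      using that slopes by fastforce
    have "U 0 - u 0 \<le> U z - u z" if "z \<in> {0..y}" for z
      by (rule derivative_nonneg_imp_le[OF _ d(1)]) (use that d1 in auto)
    then have "W1 0 - w1 0 \<le> W1 z - w1 z" if "z \<in> {0..y}" for z
      by (intro derivative_nonneg_imp_le[OF _ d(4)])
         (use that pos solD(5)[OF A] solD(5)[OF B] in \<open>auto intro!: mult_left_mono spow_mono\<close>)
    then have "(W 0 - w 0) - \<Delta> * 0 \<le> (W y - w y) - \<Delta> * y"
      by (intro derivative_nonneg_imp_le[OF y(1), where f = "\<lambda>x. (W x - w x) - \<Delta> * x" and g = "\<lambda>z. W1 z - w1 z - \<Delta>"])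
         (rule DERIV_diff[OF d(3) DERIV_cmult_Id], auto simp: \<Delta>_def)
    then show ?thesis using solD(6)[OF A] solD(6)[OF B] by simp
  qed
  have "w z < W z" if z: "0 < z" "z \<le> L" for z
  proof (rule ccontr)
    assume neg: "\<not> w z < W z"
    have "((\<lambda>x. W x - w x) has_real_derivative \<Delta>) (at 0 within {0..L})"
      unfolding \<Delta>_def using z by (intro DERIV_diff solD(3)[OF A] solD(3)[OF B]) auto
    from has_real_derivative_pos_inc_right[OF this \<Delta>]
    obtain \<delta> where \<delta>: "0 < \<delta>" "\<And>h. 0 < h \<Longrightarrow> h \<in> {0..L} \<Longrightarrow> h < \<delta> \<Longrightarrow> 0 < W h - w h"
      using solD(6)[OF A] solD(6)[OF B] by auto
    \<comment> \<open>A first crossing is the least element of this compact set. The lower limit min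
      \<delta> z excludes 0, where both solutions vanish; before \<delta> the order holds by the
      slopes at 0.\<close>
    define S where "S = {x \<in> {min \<delta> z..L}. W x - w x \<le> 0}"
    have "continuous_on {min \<delta> z..L} (\<lambda>x. W x - w x)"
      using \<delta>(1) z by (intro continuous_intros continuous_on_subset[OF sol_continuous(3)[OF A]]
        continuous_on_subset[OF sol_continuous(3)[OF B]]) auto
    then have "closed ({min \<delta> z..L} \<inter> (\<lambda>x. W x - w x) -` {..0})"
      by (rule continuous_closed_preimage) auto
    also have "{min \<delta> z..L} \<inter> (\<lambda>x. W x - w x) -` {..0} = S" by (auto simp: S_def)
    finally have "closed S" .
    then have "compact S"
      by (rule compact_eq_bounded_closed[THEN iffD2, OF conjI, rotated])
       (auto intro: bounded_subset[OF bounded_closed_interval[of "min \<delta> z" L]] simp: S_def)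
    moreover have "z \<in> S" using neg z by (auto simp: S_def)
    ultimately obtain y where y: "y \<in> S" "\<And>x. x \<in> S \<Longrightarrow> y \<le> x"
      using compact_attains_inf[of S] by blast
    have "w x < W x" if "0 < x" "x < y" for x
    proof (cases "x < min \<delta> z")
      case True
      then show ?thesis using \<delta>(2)[of x] that z by auto
    next
      case False
      then have "x \<notin> S" using y(2)[of x] that by auto
      then show ?thesis using False y(1) that by (auto simp: S_def)
    qed
    then have "\<Delta> * y \<le> W y - w y"
      using y(1) \<delta>(1) z by (intro *) (auto simp: S_def)
    moreover have "0 < y" "W y - w y \<le> 0" using y(1) \<delta>(1) z by (auto simp: S_def)
    ultimately show False using \<Delta> by (smt (verit) mult_pos_pos)
  qed
  then show ?thesis using *[of x] x unfolding \<Delta>_def by auto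
qed

text \<open>If the slope of \<open>W\<close> were larger, the continuations by reflection would
  separate at least linearly, although both stay bounded.\<close>

lemma sol_slope_le:
  assumes A: "sol r s l T U U1 W W1" "0 < T" "U T = 0" "W T = 0"
    and B: "sol r s l t u u1 w w1" "0 < t" "u t = 0" "w t = 0"
    and pos: "0 < r" "0 < s" "0 < l" and eq: "U1 0 = u1 0"
  shows "W1 0 \<le> w1 0"
proof (rule ccontr)
  assume "\<not> W1 0 \<le> w1 0"
  then have \<Delta>: "0 < W1 0 - w1 0" by simp
  obtain M where M: "\<And>x. x \<in> {0..T} \<Longrightarrow> \<bar>W x\<bar> \<le> M"
    using compact_imp_bounded[OF compact_continuous_image[OF sol_continuous(3)[OF A(1)]]]
    unfolding bounded_iff by (metis compact_Icc image_eqI real_norm_def)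
  obtain m where m: "\<And>x. x \<in> {0..t} \<Longrightarrow> \<bar>w x\<bar> \<le> m"
    using compact_imp_bounded[OF compact_continuous_image[OF sol_continuous(3)[OF B(1)]]]
    unfolding bounded_iff by (metis compact_Icc image_eqI real_norm_def)
  \<comment> \<open>At distance L the gap forced by the comparison is M + m + 1, more than two
    functions bounded by M and m can have.\<close>
  define L where "L = (M + m + 1) / (W1 0 - w1 0)"
  have "0 \<le> M" "0 \<le> m" using M[of 0] m[of 0] A(2) B(2) by auto
  then have L: "0 < L" using \<Delta> by (simp add: L_def)
  obtain k where k: "L / min T t < 2 ^ k" using real_arch_pow[of 2 "L / min T t"] by auto
  then have "L < 2 ^ k * min T t" using A(2) B(2) by (simp add: field_simps min_def split: if_splits)
  then have kL: "L \<le> 2 ^ k * T" "L \<le> 2 ^ k * t"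
    by (smt (verit) min.cobounded1 min.cobounded2 mult_left_mono zero_le_power)+
  obtain U' U1' W' W1' where A': "sol r s l (2 ^ k * T) U' U1' W' W1'"
    "U1' 0 = U1 0" "W1' 0 = W1 0" "\<And>x. x\<in>{0..2 ^ k * T} \<Longrightarrow> \<bar>W' x\<bar> \<le> M"
    using sol_extend[OF A M] by blast
  obtain u' u1' w' w1' where B': "sol r s l (2 ^ k * t) u' u1' w' w1'"
    "u1' 0 = u1 0" "w1' 0 = w1 0" "\<And>x. x\<in>{0..2 ^ k * t} \<Longrightarrow> \<bar>w' x\<bar> \<le> m"
    using sol_extend[OF B m] by blast
  have "(W1' 0 - w1' 0) * L \<le> W' L - w' L"
    using A' B' eq \<Delta> L
    by (intro sol_comparison[OF sol_restrict[OF A'(1) kL(1)] sol_restrict[OF B'(1) kL(2)] pos]) auto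
  moreover have "\<bar>W' L\<bar> \<le> M" "\<bar>w' L\<bar> \<le> m" using A'(4)[of L] B'(4)[of L] L kL by auto
  moreover have "(W1' 0 - w1' 0) * L = M + m + 1" using \<Delta> A' B' by (simp add: L_def)
  ultimately show False by linarith
qed

text \<open>The system is Hamiltonian, and E is its conserved energy. Where \<open>u\<close> and
  \<open>w\<close> both vanish only the product of the derivatives is left.\<close>

lemma sol_energy:
  assumes A: "sol r s l t u u1 w w1" and "0 < t" "u t = 0" "w t = 0" and pos: "0 < r" "0 < s"
  shows "u1 t * w1 t = u1 0 * w1 0"
proof -
  define E where "E = (\<lambda>x. u1 x * w1 x - \<bar>w x\<bar> powr (r + 1) / (r + 1) - l * (\<bar>u x\<bar> powr (s + 1) / (s + 1)))"
  have "(E has_real_derivative 0) (at x within {0..t})" if x: "x \<in> {0..t}" for x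
  proof -
    have 1: "((\<lambda>x. \<bar>w x\<bar> powr (r + 1) / (r + 1)) has_real_derivative spow r (w x) * w1 x) (at x within {0..t})"
      by (rule DERIV_chain2[OF has_real_derivative_abs_powr[OF pos(1)] solD(3)[OF A x]])
    have 2: "((\<lambda>x. \<bar>u x\<bar> powr (s + 1) / (s + 1)) has_real_derivative spow s (u x) * u1 x) (at x within {0..t})"
      by (rule DERIV_chain2[OF has_real_derivative_abs_powr[OF pos(2)] solD(1)[OF A x]])
    show ?thesis unfolding E_def
      by (rule DERIV_cong[OF DERIV_diff[OF DERIV_diff[OF DERIV_mult[OF solD(2,4)[OF A x]] 1] DERIV_cmult[OF 2]]])
         (simp add: algebra_simps)
  qed
  then obtain c where "\<And>x. x \<in> {0..t} \<Longrightarrow> E x = c"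
    using has_field_derivative_zero_constant[of "{0..t}" E] by (auto simp: convex_real_interval)
  then have "E 0 = E t" using assms(2) by simp
  then show ?thesis using assms(3,4) pos solD(5,6)[OF A] by (simp add: E_def)
qed

text \<open>Near a simple zero of \<open>U\<close> or \<open>W\<close> the possibly singular slope of \<open>spow\<close> is compensated by the
  vanishing of the difference of the two solutions.\<close>

lemma sol_unique:
  assumes A: "sol r s l L U U1 W W1" and B: "sol r s l L u u1 w w1"
    and pos: "0 < r" "0 < s" "0 < l" "0 \<le> L" and init: "U1 0 = u1 0" "W1 0 = w1 0"
    and simple: "\<And>x. x \<in> {0..<L} \<Longrightarrow> U x = 0 \<Longrightarrow> U1 x \<noteq> 0"
      "\<And>x. x \<in> {0..<L} \<Longrightarrow> W x = 0 \<Longrightarrow> W1 x \<noteq> 0"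
    and x: "x \<in> {0..L}"
  shows "U x = u x \<and> U1 x = u1 x \<and> W x = w x \<and> W1 x = w1 x"
proof -
  \<comment> \<open>The distance of the two solutions in phase space; its vanishing is shown to
    propagate to the right.\<close>
  define D where "D = (\<lambda>x. \<bar>U x - u x\<bar> + \<bar>U1 x - u1 x\<bar> + \<bar>W x - w x\<bar> + \<bar>W1 x - w1 x\<bar>)"
  have contD: "continuous_on {0..L} D" unfolding D_def
    by (intro continuous_intros sol_continuous[OF A] sol_continuous[OF B])
  have D0: "D x = 0 \<longleftrightarrow> U x = u x \<and> U1 x = u1 x \<and> W x = w x \<and> W1 x = w1 x" for x
    by (auto simp: D_def)
  have step: "\<exists>\<delta>>0. y + \<delta> \<le> L \<and> (\<forall>x\<in>{y..y + \<delta>}. D x = 0)"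
    if y: "y \<in> {0..<L}" "D y = 0" for y
  proof -
    \<comment> \<open>A nonzero value and a simple zero at \<open>y\<close> are treated alike: in
      both cases \<bar>f\<bar> is at least c * (x - y) to the right of \<open>y\<close>.\<close>
    have lower: "\<exists>\<delta>>0. \<exists>c>0. \<forall>x\<in>{0..L}. y < x \<and> x < y + \<delta> \<longrightarrow> c * (x - y) \<le> \<bar>f x\<bar>"
      if f: "(f has_real_derivative f') (at y within {0..L})" and ne: "f y = 0 \<Longrightarrow> f' \<noteq> 0"
      for f f'
    proof (cases "f y = 0")
      case True
      then have "((\<lambda>x. (f x - f y) / (x - y)) \<longlongrightarrow> f') (at y within {0..L})"
        using f by (simp add: has_field_derivative_iff)
      then have "((\<lambda>x. \<bar>f x / (x - y)\<bar>) \<longlongrightarrow> \<bar>f'\<bar>) (at y within {0..L})"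
        using tendsto_rabs True by fastforce
      then have "\<forall>\<^sub>F x in at y within {0..L}. \<bar>f'\<bar> / 2 < \<bar>f x / (x - y)\<bar>"
        using ne True by (intro order_tendstoD(1)) auto
      then obtain \<delta> where \<delta>: "0 < \<delta>" "\<And>x. x \<in> {0..L} \<Longrightarrow> x \<noteq> y \<Longrightarrow> dist x y < \<delta> \<Longrightarrow> \<bar>f'\<bar> / 2 < \<bar>f x / (x - y)\<bar>"
        unfolding eventually_at by auto
      have "\<bar>f'\<bar> / 2 * (x - y) \<le> \<bar>f x\<bar>" if "x \<in> {0..L}" "y < x" "x < y + \<delta>" for x
        using \<delta>(2)[of x] that by (simp add: dist_real_def abs_divide field_simps)
      then show ?thesis using \<delta>(1) ne True by (intro exI[of _ \<delta>] conjI exI[of _ "\<bar>f'\<bar> / 2"]) auto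
    next
      case False
      have "(f \<longlongrightarrow> f y) (at y within {0..L})"
        using DERIV_continuous[OF f] by (simp add: continuous_within)
      then have "\<forall>\<^sub>F x in at y within {0..L}. \<bar>f y\<bar> / 2 < \<bar>f x\<bar>"
        using False by (intro order_tendstoD(1)[OF tendsto_rabs]) auto
      then obtain \<delta> where \<delta>: "0 < \<delta>" "\<And>x. x \<in> {0..L} \<Longrightarrow> x \<noteq> y \<Longrightarrow> dist x y < \<delta> \<Longrightarrow> \<bar>f y\<bar> / 2 < \<bar>f x\<bar>"
        unfolding eventually_at by auto
      have "\<bar>f y\<bar> / 2 * (x - y) \<le> \<bar>f x\<bar>" if "x \<in> {0..L}" "y < x" "x < y + min \<delta> 1" for x
      proof -
        have "\<bar>f y\<bar> / 2 * (x - y) \<le> \<bar>f y\<bar> / 2 * 1" using that by (intro mult_left_mono) auto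
        also have "\<dots> \<le> \<bar>f x\<bar>"
          using \<delta>(2)[of x] that by (auto simp: dist_real_def min_def split: if_splits)
        finally show ?thesis .
      qed
      then show ?thesis using \<delta>(1) False by (intro exI[of _ "min \<delta> 1"] conjI exI[of _ "\<bar>f y\<bar> / 2"]) auto
    qed
    have y0: "y \<in> {0..L}" using y by auto
    obtain \<delta>1 c1 where 1: "0 < \<delta>1" "0 < c1"
      "\<And>x. x \<in> {0..L} \<Longrightarrow> y < x \<Longrightarrow> x < y + \<delta>1 \<Longrightarrow> c1 * (x - y) \<le> \<bar>U x\<bar>"
      using lower[OF solD(1)[OF A y0] simple(1)[OF y(1)]] by blast
    obtain \<delta>2 c2 where 2: "0 < \<delta>2" "0 < c2"
      "\<And>x. x \<in> {0..L} \<Longrightarrow> y < x \<Longrightarrow> x < y + \<delta>2 \<Longrightarrow> c2 * (x - y) \<le> \<bar>W x\<bar>"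
      using lower[OF solD(3)[OF A y0] simple(2)[OF y(1)]] by blast
    have "bounded (U ` {0..L} \<union> W ` {0..L} \<union> u ` {0..L} \<union> w ` {0..L})"
      unfolding bounded_Un
      by (intro conjI compact_imp_bounded compact_continuous_image sol_continuous[OF A] sol_continuous[OF B]) auto
    then obtain M where M: "\<And>x. x \<in> {0..L} \<Longrightarrow> \<bar>U x\<bar> \<le> M" "\<And>x. x \<in> {0..L} \<Longrightarrow> \<bar>W x\<bar> \<le> M"
      "\<And>x. x \<in> {0..L} \<Longrightarrow> \<bar>u x\<bar> \<le> M" "\<And>x. x \<in> {0..L} \<Longrightarrow> \<bar>w x\<bar> \<le> M"
      unfolding bounded_iff by (metis UnCI imageI real_norm_def)
    \<comment> \<open>The singular slope is at most a constant times (x - y) powr (min k 1 - 1), and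
      the difference of the solutions is at most K * (x - y). The product is at most a constant
      times K, because the exponents add up to min k 1 > 0 and x - y < 1.\<close>
    have diff: "\<bar>spow k (f x) - spow k (g x)\<bar> \<le> (2 + k * M powr (k - 1)) * c powr (min k 1 - 1) * K"
      if k: "0 < k" and c: "0 < c" "c * (x - y) \<le> \<bar>f x\<bar>" and xy: "y < x" "x < y + 1"
        and MM: "\<bar>f x\<bar> \<le> M" "\<bar>g x\<bar> \<le> M" and K: "\<bar>f x - g x\<bar> \<le> K * (x - y)" for k c x K f g
    proof -
      have "0 < c * (x - y)" using c xy by simp
      have "0 \<le> K * (x - y)" using K by linarith
      then have K0: "0 \<le> K" using xy by (simp add: zero_le_mult_iff)
      have "f x \<noteq> 0" using \<open>0 < c * (x - y)\<close> c(2) by auto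
      have C: "0 \<le> 2 + k * M powr (k - 1)" using k by simp
      have "\<bar>spow k (f x) - spow k (g x)\<bar> \<le> (2 + k * M powr (k - 1)) * \<bar>f x\<bar> powr (min k 1 - 1) * \<bar>f x - g x\<bar>"
        by (rule spow_diff_le[OF k \<open>f x \<noteq> 0\<close> MM])
      also have "\<dots> \<le> (2 + k * M powr (k - 1)) * (c * (x - y)) powr (min k 1 - 1) * (K * (x - y))"
        using C c K \<open>0 < c * (x - y)\<close> by (intro mult_mono powr_mono2') auto
      also have "\<dots> = (2 + k * M powr (k - 1)) * c powr (min k 1 - 1) * K * (x - y) powr (min k 1)"
        using c xy by (simp add: powr_mult powr_diff)
      also have "\<dots> \<le> (2 + k * M powr (k - 1)) * c powr (min k 1 - 1) * K * 1"
        using C K0 xy k by (intro mult_left_mono powr_le1) auto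
      finally show ?thesis by simp
    qed
    define C where "C = 1 + (2 + r * M powr (r - 1)) * c2 powr (min r 1 - 1)
      + l * ((2 + s * M powr (s - 1)) * c1 powr (min s 1 - 1))"
    have C: "1 \<le> C" "(2 + r * M powr (r - 1)) * c2 powr (min r 1 - 1) \<le> C"
      "l * ((2 + s * M powr (s - 1)) * c1 powr (min s 1 - 1)) \<le> C"
      using pos by (auto simp: C_def)
    \<comment> \<open>Short enough that integrating the bound C * K over the interval gives at most
      K / 2; with K the maximum of the differences of the derivatives this forces K = 0.\<close>
    define \<delta> where "\<delta> = Min {\<delta>1 / 2, \<delta>2 / 2, L - y, 1 / (2 * C)}"
    have \<delta>: "0 < \<delta>" "\<delta> < \<delta>1" "\<delta> < \<delta>2" "\<delta> \<le> L - y" "\<delta> \<le> 1 / (2 * C)"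
      using 1(1) 2(1) y(1) C(1) unfolding \<delta>_def by (auto simp: min_less_iff_disj)
    have C\<delta>: "C * \<delta> \<le> 1 / 2" using \<delta>(5) C(1) by (simp add: field_simps)
    have "1 / (2 * C) \<le> 1 / 2" using C(1) by (simp add: field_simps)
    then have \<delta>1: "\<delta> < 1" using \<delta>(5) by linarith
    have dA: "z \<in> {y..b} \<Longrightarrow> b \<le> y + \<delta> \<Longrightarrow> (f has_real_derivative g z) (at z within {y..b})"
      if "\<And>z. z \<in> {0..L} \<Longrightarrow> (f has_real_derivative g z) (at z within {0..L})" for f g b z
      by (rule DERIV_subset[OF that]) (use y \<delta> in auto)
    define m where "m = (\<lambda>x. max \<bar>U1 x - u1 x\<bar> \<bar>W1 x - w1 x\<bar>)"
    have "continuous_on {0..L} m" unfolding m_def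
      by (intro continuous_intros sol_continuous[OF A] sol_continuous[OF B])
    then have "continuous_on {y..y+\<delta>} m" by (rule continuous_on_subset) (use y \<delta> in auto)
    then obtain x0 where x0: "x0 \<in> {y..y+\<delta>}" "\<And>x. x \<in> {y..y+\<delta>} \<Longrightarrow> m x \<le> m x0"
      using continuous_attains_sup[of "{y..y+\<delta>}" m] \<delta>(1) by auto
    define K where "K = m x0"
    have K: "\<bar>U1 x - u1 x\<bar> \<le> K" "\<bar>W1 x - w1 x\<bar> \<le> K" if "x \<in> {y..y+\<delta>}" for x
      using x0(2)[OF that] by (auto simp: K_def m_def)
    have K0: "0 \<le> K" using K(1)[of y] \<delta>(1) by auto
    have Dy: "U y = u y" "U1 y = u1 y" "W y = w y" "W1 y = w1 y" using y(2) D0 by auto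
    have e0: "\<bar>U x - u x\<bar> \<le> K * (x - y)" "\<bar>W x - w x\<bar> \<le> K * (x - y)" if x: "x \<in> {y..y+\<delta>}" for x
    proof -
      have "\<bar>(U x - u x) - (U y - u y)\<bar> \<le> K * (x - y)"
        by (rule derivative_bound_imp_le[where g = "\<lambda>x. U1 x - u1 x"])
           (use x K(1) in \<open>auto intro!: DERIV_diff dA solD(1)[OF A] solD(1)[OF B]\<close>)
      moreover have "\<bar>(W x - w x) - (W y - w y)\<bar> \<le> K * (x - y)"
        by (rule derivative_bound_imp_le[where g = "\<lambda>x. W1 x - w1 x"])
           (use x K(2) in \<open>auto intro!: DERIV_diff dA solD(3)[OF A] solD(3)[OF B]\<close>)
      ultimately show "\<bar>U x - u x\<bar> \<le> K * (x - y)" "\<bar>W x - w x\<bar> \<le> K * (x - y)" using Dy by auto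
    qed
    have sp: "\<bar>spow r (W x) - spow r (w x)\<bar> \<le> C * K"
      "\<bar>l * spow s (U x) - l * spow s (u x)\<bar> \<le> C * K" if x: "y < x" "x \<le> y + \<delta>" for x
    proof -
      have xL: "x \<in> {0..L}" using x y \<delta> by auto
      have "\<bar>spow r (W x) - spow r (w x)\<bar> \<le> (2 + r * M powr (r - 1)) * c2 powr (min r 1 - 1) * K"
        using x \<delta> \<delta>1 xL by (intro diff 2 M e0 pos) auto
      also have "\<dots> \<le> C * K" by (intro mult_right_mono C K0)
      finally show "\<bar>spow r (W x) - spow r (w x)\<bar> \<le> C * K" .
      have "\<bar>spow s (U x) - spow s (u x)\<bar> \<le> (2 + s * M powr (s - 1)) * c1 powr (min s 1 - 1) * K"
        using x \<delta> \<delta>1 xL by (intro diff 1 M e0 pos) auto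
      then have "l * \<bar>spow s (U x) - spow s (u x)\<bar> \<le> l * ((2 + s * M powr (s - 1)) * c1 powr (min s 1 - 1) * K)"
        using pos by (intro mult_left_mono) auto
      also have "\<dots> = l * ((2 + s * M powr (s - 1)) * c1 powr (min s 1 - 1)) * K" by simp
      also have "\<dots> \<le> C * K" by (intro mult_right_mono C K0)
      finally show "\<bar>l * spow s (U x) - l * spow s (u x)\<bar> \<le> C * K"
        using pos by (simp add: abs_mult flip: right_diff_distrib)
    qed
    have "m x \<le> K / 2" if x: "x \<in> {y..y+\<delta>}" for x
    proof -
      have "\<bar>(U1 x - u1 x) - (U1 y - u1 y)\<bar> \<le> C * K * (x - y)"
        by (rule derivative_bound_imp_le[where g = "\<lambda>x. spow r (W x) - spow r (w x)"])
           (use x sp(1) in \<open>auto intro!: DERIV_diff dA solD(2)[OF A] solD(2)[OF B]\<close>)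
      moreover have "\<bar>(W1 x - w1 x) - (W1 y - w1 y)\<bar> \<le> C * K * (x - y)"
        by (rule derivative_bound_imp_le[where g = "\<lambda>x. l * spow s (U x) - l * spow s (u x)"])
           (use x sp(2) in \<open>auto intro!: DERIV_diff dA solD(4)[OF A] solD(4)[OF B]\<close>)
      moreover have "C * K * (x - y) \<le> C * K * \<delta>"
        using x C(1) K0 by (intro mult_left_mono) auto
      moreover have "C * K * \<delta> \<le> 1 / 2 * K"
        using mult_right_mono[OF C\<delta> K0] by (simp add: mult_ac)
      ultimately have "\<bar>U1 x - u1 x\<bar> \<le> K / 2" "\<bar>W1 x - w1 x\<bar> \<le> K / 2" using Dy by simp_all
      then show ?thesis by (simp only: m_def max.bounded_iff)
    qed
    then have "K \<le> K / 2" using x0(1) by (simp add: K_def)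
    then have "K = 0" using K0 by simp
    then have "D x = 0" if "x \<in> {y..y+\<delta>}" for x
      using K[OF that] e0[OF that] by (simp add: D_def)
    then show ?thesis using \<delta> by (intro exI[of _ \<delta>]) auto
  qed
  \<comment> \<open>Continuation argument: z is the supremum of the times up to which the solutions
    agree. They agree at z by continuity, and if z < L then \<open>step\<close> extends the
    agreement beyond z.\<close>
  define S where "S = {y \<in> {0..L}. \<forall>x\<in>{0..y}. D x = 0}"
  have D00: "D 0 = 0" using init solD(5,6)[OF A] solD(5,6)[OF B] by (simp add: D_def)
  have S0: "0 \<in> S" using D00 pos by (auto simp: S_def)
  define z where "z = Sup S"
  have bdd: "bdd_above S" by (auto simp: S_def bdd_above_def)
  have zL: "0 \<le> z" "z \<le> L"
    unfolding z_def using S0 by (rule cSup_upper[OF _ bdd], intro cSup_least) (auto simp: S_def)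
  have lt: "D x = 0" if "0 \<le> x" "x < z" for x
  proof -
    have "\<exists>y\<in>S. x < y"
      by (rule less_cSupD) (use S0 that in \<open>auto simp: z_def\<close>)
    then obtain y where "y \<in> S" "x < y" ..
    then show ?thesis using that by (auto simp: S_def)
  qed
  have Dz: "D z = 0"
  proof (cases "z = 0")
    case False
    have "closed ({0..L} \<inter> D -` {0})"
      by (rule continuous_closed_preimage[OF contD]) auto
    moreover have "{0..<z} \<subseteq> {0..L} \<inter> D -` {0}" using lt zL by auto
    ultimately have "closure {0..<z} \<subseteq> {0..L} \<inter> D -` {0}" by (rule closure_minimal[rotated])
    then show ?thesis using False zL by auto
  qed (simp add: D00)
  have "z = L"
  proof (rule ccontr)
    assume "z \<noteq> L"
    then obtain \<delta> where \<delta>: "0 < \<delta>" "z + \<delta> \<le> L" "\<forall>x\<in>{z..z + \<delta>}. D x = 0"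
      using step[of z] zL Dz by auto
    have "D x = 0" if "x \<in> {0..z + \<delta>}" for x
      using lt[of x] \<delta>(3) that by (cases "x < z") auto
    then have "z + \<delta> \<in> S" using \<delta> zL by (auto simp: S_def)
    then have "z + \<delta> \<le> z" unfolding z_def using bdd by (rule cSup_upper)
    then show False using \<delta>(1) by simp
  qed
  then have "D x = 0" using lt[of x] Dz x by (cases "x = L") auto
  then show ?thesis using D0 by simp
qed

text \<open>The two conditions in \<open>eq\<close> say that division of \<open>u\<close> by a and
  of \<open>w\<close> by b, together with the dilation by c, keeps both nonlinear equations while m
  is replaced by l.\<close>

lemma sol_scale:
  assumes sol: "sol r s m t u u1 w w1" and pos: "0 < a" "0 < b" "0 < c"
    and eq: "a * c\<^sup>2 = b powr r" "m * a powr s = l * b * c\<^sup>2"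
  shows "sol r s l (c * t) (\<lambda>z. u (z / c) / a) (\<lambda>z. u1 (z / c) / (a * c))
    (\<lambda>z. w (z / c) / b) (\<lambda>z. w1 (z / c) / (b * c))"
proof -
  have scale: "((\<lambda>z. h (z / c) / k) has_real_derivative h' (z / c) / (k * c)) (at z within {0..c * t})"
    if h: "\<And>x. x \<in> {0..t} \<Longrightarrow> (h has_real_derivative h' x) (at x within {0..t})" and z: "z \<in> {0..c * t}"
    for h h' k z
  proof -
    have "((\<lambda>z. h (1 / c * z + 0)) has_real_derivative 1 / c * h' (1 / c * z + 0)) (at z within {0..c * t})"
      using pos z by (intro has_real_derivative_affine[OF h]) (auto simp: field_simps)
    from DERIV_cdivide[OF this, of k] show ?thesis by (simp add: mult.commute)
  qed
  have "spow r (w (z / c)) / (a * c * c) = spow r (w (z / c) / b)" for z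
    using spow_mult[of "1 / b" r "w (z / c)"] pos eq(1)
    by (simp add: power2_eq_square powr_divide mult.assoc)
  moreover have "m * spow s (u (z / c)) / (b * c * c) = l * spow s (u (z / c) / a)" for z
  proof -
    have "m / (b * c * c) = l / a powr s" using eq(2) pos by (simp add: field_simps power2_eq_square)
    moreover have "spow s (u (z / c) / a) = spow s (u (z / c)) / a powr s"
      using spow_mult[of "1 / a" s "u (z / c)"] pos by (simp add: powr_divide)
    ultimately show ?thesis
      by (metis (no_types) times_divide_eq_left times_divide_eq_right)
  qed
  ultimately show ?thesis
    using scale[OF solD(1)[OF sol], of _ a] scale[OF solD(2)[OF sol], of _ "a * c"]
      scale[OF solD(3)[OF sol], of _ b] scale[OF solD(4)[OF sol], of _ "b * c"] solD(5,6)[OF sol]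
    by (simp add: sol_def)
qed

section \<open>Positive solutions, their symmetry and antiperiodic continuation\<close>

text \<open>Concavity makes the slope decreasing, so an end slope of the wrong sign would make h
  monotone between that end and 1/2, against h (1/2) > 0.\<close>

lemma concave_end_slopes:
  fixes h :: "real \<Rightarrow> real"
  assumes h: "\<And>x. x \<in> {0..1} \<Longrightarrow> (h has_real_derivative h1 x) (at x within {0..1})"
    and h1: "\<And>x. x \<in> {0..1} \<Longrightarrow> (h1 has_real_derivative h2 x) (at x within {0..1})"
    and h2: "\<And>x. 0 < x \<Longrightarrow> x < 1 \<Longrightarrow> h2 x \<le> 0" and "h 0 = 0" "h 1 = 0" "0 < h (1/2)"
  shows "0 < h1 0" "h1 1 < 0" "x \<in> {0..1} \<Longrightarrow> h1 1 \<le> h1 x \<and> h1 x \<le> h1 0"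
proof -
  have sub: "(h has_real_derivative h1 x) (at x within {a..b})"
    "((\<lambda>x. - h x) has_real_derivative - h1 x) (at x within {a..b})"
    "((\<lambda>x. - h1 x) has_real_derivative - h2 x) (at x within {a..b})" if "0 \<le> a" "b \<le> 1" "x \<in> {a..b}" for x a b
    using that by (auto intro!: DERIV_minus DERIV_subset[OF h] DERIV_subset[OF h1])
  have anti: "h1 b \<le> h1 a" if "0 \<le> a" "a \<le> b" "b \<le> 1" for a b
    using derivative_nonneg_imp_le[OF that(2) sub(3)] that h2 by force
  then show "x \<in> {0..1} \<Longrightarrow> h1 1 \<le> h1 x \<and> h1 x \<le> h1 0" by auto
  show "0 < h1 0"
  proof (rule ccontr)
    assume "\<not> 0 < h1 0"
    then have "0 \<le> - h1 x" if "0 < x" "x < 1/2" for x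
      using anti[of 0 x] that by auto
    then have "- h 0 \<le> - h (1/2)"
      by (intro derivative_nonneg_imp_le[OF _ sub(2)]) auto
    then show False using assms by simp
  qed
  show "h1 1 < 0"
  proof (rule ccontr)
    assume "\<not> h1 1 < 0"
    then have "0 \<le> h1 x" if "1/2 < x" "x < 1" for x
      using anti[of x 1] that by auto
    then have "h (1/2) \<le> h 1"
      by (intro derivative_nonneg_imp_le[OF _ sub(1)]) auto
    then show False using assms by simp
  qed
qed

text \<open>At an integer the value comes from the cell to its right; when h 1 = - h 0, the formula
  of the cell to its left gives the same value, which is the content of
  \<open>antiper_eq\<close>.\<close>

definition antiper :: "(real \<Rightarrow> real) \<Rightarrow> real \<Rightarrow> real" where
  "antiper h x = (if even \<lfloor>x\<rfloor> then 1 else -1) * h (frac x)"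

lemma antiper_eq:
  assumes "h 1 = - h 0" "x \<in> {real k..real k + 1}"
  shows "antiper h x = (-1) ^ k * h (x - real k)"
proof (cases "x = real k + 1")
  case True
  then have "\<lfloor>x\<rfloor> = int k + 1" by linarith
  then show ?thesis using True assms by (simp add: antiper_def frac_def minus_one_power_iff)
next
  case False
  then have "\<lfloor>x\<rfloor> = int k" using assms(2) by (simp add: floor_eq_iff)
  then show ?thesis by (simp add: antiper_def frac_def minus_one_power_iff)
qed

lemma antiper_spow: "spow r (antiper h x) = antiper (\<lambda>x. spow r (h x)) x"
  by (simp add: antiper_def)

lemma antiper_cmult: "c * antiper h x = antiper (\<lambda>x. c * h x) x"
  by (simp add: antiper_def)

lemma has_real_derivative_pieces:
  fixes f :: "real \<Rightarrow> real"
  assumes "\<And>k x. k < n \<Longrightarrow> x \<in> {real k..real k + 1} \<Longrightarrow> (f has_real_derivative f' x) (at x within {real k..real k + 1})"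
    and "1 \<le> n" "x \<in> {0..real n}"
  shows "(f has_real_derivative f' x) (at x within {0..real n})"
proof -
  have "(f has_real_derivative f' x) (at x within {0..real (Suc N)})" if "Suc N \<le> n" "x \<in> {0..real (Suc N)}" for N x
    using that
  proof (induction N arbitrary: x)
    case 0
    then show ?case using assms(1)[of 0 x] by simp
  next
    case (Suc N)
    show ?case
      by (rule has_real_derivative_glue[of 0 "real (Suc N)"])
         (use Suc assms(1)[of "Suc N"] in \<open>auto simp: add.commute\<close>)
  qed
  from this[of "n - 1" x] show ?thesis using assms by simp
qed

lemma antiper_deriv:
  assumes h: "\<And>x. x \<in> {0..1} \<Longrightarrow> (h has_real_derivative h' x) (at x within {0..1})"
    and anti: "h 1 = - h 0" "h' 1 = - h' 0" and x: "x \<in> {0..real N}"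
  shows "(antiper h has_real_derivative antiper h' x) (at x within {0..real N})"
proof -
  have piece: "(antiper h has_real_derivative antiper h' x) (at x within {real k..real k + 1})"
    if x: "x \<in> {real k..real k + 1}" for x k
  proof -
    have "((\<lambda>x. (-1) ^ k * h (1 * x + - real k)) has_real_derivative (-1) ^ k * (1 * h' (1 * x + - real k))) (at x within {real k..real k + 1})"
      by (intro DERIV_cmult has_real_derivative_affine[OF h]) (use x in auto)
    then have "(antiper h has_real_derivative (-1) ^ k * (1 * h' (1 * x + - real k))) (at x within {real k..real k + 1})"
      by (rule has_field_derivative_transform_within[OF _ zero_less_one])
         (use x antiper_eq[OF anti(1)] in auto)
    then show ?thesis using antiper_eq[OF anti(2) x] by simp
  qed
  have "(antiper h has_real_derivative antiper h' x) (at x within {0..real (Suc N)})"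
    by (rule has_real_derivative_pieces) (use piece x in auto)
  then show ?thesis by (rule DERIV_subset) auto
qed

text \<open>Here \<open>g\<close> has the sign of f'', so negativity of \<open>g\<close> is
  concavity of the positive eigenfunction.\<close>

locale positive_sol =
  fixes r s l f f1 g g1
  assumes sol: "sol r s l 1 f f1 g g1" and pos: "0 < r" "0 < s" "0 < l"
    and ends: "f 1 = 0" "g 1 = 0"
    and f_pos: "\<And>x. 0 < x \<Longrightarrow> x < 1 \<Longrightarrow> 0 < f x"
    and g_neg: "\<And>x. 0 < x \<Longrightarrow> x < 1 \<Longrightarrow> g x < 0"
begin

lemma slopes:
  "0 < f1 0" "f1 1 < 0" "g1 0 < 0" "0 < g1 1"
  "x \<in> {0..1} \<Longrightarrow> f1 1 \<le> f1 x \<and> f1 x \<le> f1 0" "x \<in> {0..1} \<Longrightarrow> g1 0 \<le> g1 x \<and> g1 x \<le> g1 1"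
proof -
  have 1: "0 < x \<Longrightarrow> x < 1 \<Longrightarrow> spow r (g x) \<le> 0" "0 < x \<Longrightarrow> x < 1 \<Longrightarrow> - (l * spow s (f x)) \<le> 0" for x
    using spow_neg[OF g_neg] spow_pos[OF f_pos] pos by (auto intro: less_imp_le)
  note f = concave_end_slopes[OF solD(1,2)[OF sol] 1(1) solD(5)[OF sol] ends(1)]
  show "0 < f1 0" "f1 1 < 0" "x \<in> {0..1} \<Longrightarrow> f1 1 \<le> f1 x \<and> f1 x \<le> f1 0"
    using f f_pos[of "1/2"] by auto
  have g: "x \<in> {0..1} \<Longrightarrow> ((\<lambda>x. - g x) has_real_derivative - g1 x) (at x within {0..1})"
    "x \<in> {0..1} \<Longrightarrow> ((\<lambda>x. - g1 x) has_real_derivative - (l * spow s (f x))) (at x within {0..1})" for x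
    by (auto intro!: DERIV_minus solD[OF sol])
  note g = concave_end_slopes[OF g 1(2)]
  show "g1 0 < 0" "0 < g1 1" "x \<in> {0..1} \<Longrightarrow> g1 0 \<le> g1 x \<and> g1 x \<le> g1 1"
    using g(1,2) g(3)[of x] solD(6)[OF sol] ends(2) g_neg[of "1/2"] by auto
qed

lemma simple_zeros:
  assumes "x \<in> {0..1}"
  shows "f x = 0 \<Longrightarrow> f1 x \<noteq> 0" "g x = 0 \<Longrightarrow> g1 x \<noteq> 0"
proof -
  consider "x = 0" | "x = 1" | "0 < x" "x < 1" using assms by fastforce
  then show "f x = 0 \<Longrightarrow> f1 x \<noteq> 0" "g x = 0 \<Longrightarrow> g1 x \<noteq> 0"
    by (cases; use slopes f_pos[of x] g_neg[of x] in force)+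
qed

lemma sol_reflect: "sol r s l 1 (\<lambda>x. f (1 - x)) (\<lambda>x. - f1 (1 - x)) (\<lambda>x. g (1 - x)) (\<lambda>x. - g1 (1 - x))"
proof -
  have R: "((\<lambda>x. h (1 - x)) has_real_derivative - h' (1 - x)) (at x within {0..1})"
    if "\<And>x. x \<in> {0..1} \<Longrightarrow> (h has_real_derivative h' x) (at x within {0..1})" "x \<in> {0..1}" for h h' x
    using has_real_derivative_affine[of h "h' (-1 * x + 1)" "-1" x 1 "{0..1}" "{0..1}"] that by auto
  show ?thesis unfolding sol_def
    using R[OF solD(1)[OF sol]] R[OF solD(3)[OF sol]] DERIV_minus[OF R[OF solD(2)[OF sol]]]
      DERIV_minus[OF R[OF solD(4)[OF sol]]] ends by simp
qed

text \<open>By conservation of energy the end slopes of \<open>f\<close> and \<open>g\<close> have the same product at both ends,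
  so a solution and its reflection are comparable unless their initial slopes agree.\<close>

lemma symmetric:
  assumes "x \<in> {0..1}"
  shows "f (1 - x) = f x" "f1 (1 - x) = - f1 x" "g (1 - x) = g x" "g1 (1 - x) = - g1 x"
proof -
  have e: "f1 1 * g1 1 = f1 0 * g1 0"
    by (rule sol_energy[OF sol]) (use ends pos in auto)
  have "f1 0 = - f1 1"
  proof (rule antisym; rule ccontr)
    assume "\<not> f1 0 \<le> - f1 1"
    then have "(- f1 1) * g1 1 < f1 0 * g1 1" using slopes by (intro mult_strict_right_mono) auto
    then have "f1 0 * (- g1 0) < f1 0 * g1 1" using e by simp
    then have "- g1 0 < g1 1" using slopes(1) by (simp only: mult_less_cancel_left_pos)
    then have "- g1 1 < g1 0" by simp
    \<comment> \<open>Comparison over the whole interval would give a positive difference at 1,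
      where both functions vanish.\<close>
    then have "(g1 0 - - g1 (1 - 0)) * 1 \<le> g 1 - g (1 - 1)"
      using \<open>\<not> f1 0 \<le> - f1 1\<close> by (intro sol_comparison[OF sol sol_reflect pos]) auto
    then show False using \<open>- g1 1 < g1 0\<close> ends solD(6)[OF sol] by simp
  next
    assume "\<not> - f1 1 \<le> f1 0"
    then have "f1 0 * g1 1 < (- f1 1) * g1 1" using slopes by (intro mult_strict_right_mono) auto
    then have "f1 0 * g1 1 < f1 0 * (- g1 0)" using e by simp
    then have "g1 1 < - g1 0" using slopes(1) by (simp only: mult_less_cancel_left_pos)
    then have "g1 0 < - g1 1" by simp
    then have "(- g1 (1 - 0) - g1 0) * 1 \<le> g (1 - 1) - g 1"
      using \<open>\<not> - f1 1 \<le> f1 0\<close> by (intro sol_comparison[OF sol_reflect sol pos]) auto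
    then show False using \<open>g1 0 < - g1 1\<close> ends solD(6)[OF sol] by simp
  qed
  moreover have "g1 0 = - g1 1"
  proof -
    have "f1 1 * (g1 0 + g1 1) = 0" using e \<open>f1 0 = - f1 1\<close> by (simp add: algebra_simps)
    then show ?thesis using slopes(2) by simp
  qed
  ultimately have "f x = f (1 - x) \<and> f1 x = - f1 (1 - x) \<and> g x = g (1 - x) \<and> g1 x = - g1 (1 - x)"
    using assms simple_zeros pos by (intro sol_unique[OF sol sol_reflect]) auto
  then show "f (1 - x) = f x" "f1 (1 - x) = - f1 x" "g (1 - x) = g x" "g1 (1 - x) = - g1 x" by auto
qed

lemma antiperiodic: "f 1 = - f 0" "f1 1 = - f1 0" "g 1 = - g 0" "g1 1 = - g1 0"
  using symmetric[of 0] ends solD(5,6)[OF sol] by auto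

lemma sol_antiper: "sol r s l (real N) (antiper f) (antiper f1) (antiper g) (antiper g1)"
  unfolding sol_def antiper_spow antiper_cmult
  using antiper_deriv[OF solD(1)[OF sol]] antiper_deriv[OF solD(2)[OF sol]]
    antiper_deriv[OF solD(3)[OF sol]] antiper_deriv[OF solD(4)[OF sol]] antiperiodic solD(5,6)[OF sol]
  by (auto simp: antiper_def)

lemma antiper_zeros: "antiper f x = 0 \<longleftrightarrow> x \<in> \<int>" "antiper g x = 0 \<longleftrightarrow> x \<in> \<int>"
proof -
  have 0: "x \<in> \<int> \<longleftrightarrow> frac x = 0" by (simp add: frac_eq_0_iff)
  have "frac x = 0 \<or> 0 < frac x \<and> frac x < 1" using frac_ge_0[of x] frac_lt_1[of x] by linarith
  then have "f (frac x) = 0 \<longleftrightarrow> frac x = 0" "g (frac x) = 0 \<longleftrightarrow> frac x = 0"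
    using f_pos[of "frac x"] g_neg[of "frac x"] solD(5,6)[OF sol] by (auto simp del: frac_eq_0_iff)
  then show "antiper f x = 0 \<longleftrightarrow> x \<in> \<int>" "antiper g x = 0 \<longleftrightarrow> x \<in> \<int>"
    by (simp_all add: antiper_def 0 del: frac_eq_0_iff)
qed

lemma antiper_simple_zeros:
  "antiper f x = 0 \<Longrightarrow> antiper f1 x \<noteq> 0" "antiper g x = 0 \<Longrightarrow> antiper g1 x \<noteq> 0"
  unfolding antiper_zeros using slopes(1,3) frac_eq_0_iff[of x] by (auto simp: antiper_def simp del: frac_eq_0_iff)

text \<open>Scaling normalizes the eigenvalue to l and the slope of \<open>u\<close> to
  \<open>f1 0\<close>. \<open>sol_slope_le\<close>, applied in both directions, makes the slopes of
  \<open>w\<close> agree as well, so uniqueness identifies the scaled solution with the continuation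
  of \<open>f\<close>. Its zero at the right end forces an integer number of cells.\<close>

theorem classification:
  assumes u: "sol r s m t u u1 w w1" "0 < t" "u t = 0" "w t = 0" and m: "0 < m" and u1: "0 < u1 0"
  obtains k :: nat and a b where "1 \<le> k" "0 < a" "0 < b" "a * (k / t)\<^sup>2 = b powr r"
    "m * a powr s = l * b * (k / t)\<^sup>2"
    "\<And>x. x \<in> {0..t} \<Longrightarrow> u x = a * antiper f (k / t * x)"
    "\<And>x. x \<in> {0..t} \<Longrightarrow> w x = b * antiper g (k / t * x)"
proof -
  define \<rho> where "\<rho> = u1 0 / f1 0"
  have \<rho>: "0 < \<rho>" using u1 slopes by (simp add: \<rho>_def)
  \<comment> \<open>The relations a c = \<rho>, a c^2 = b powr r and m a powr s = l b c^2 leave a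
    single equation for c, namely c powr (2 + s + 1 / r) = m \<rho> powr (s - 1 / r) / l.\<close>
  define c where "c = (m * \<rho> powr (s - 1 / r) / l) powr (1 / (2 + s + 1 / r))"
  have c: "0 < c" using m \<rho> pos by (simp add: c_def)
  have "0 < 2 + s + 1 / r" using pos by (auto intro!: add_pos_pos)
  then have cpow: "c powr (2 + s + 1 / r) = m * \<rho> powr (s - 1 / r) / l"
    unfolding c_def powr_powr using m \<rho> pos by simp
  define a where "a = \<rho> / c"
  define b where "b = (\<rho> * c) powr (1 / r)"
  have ab: "0 < a" "0 < b" using \<rho> c by (auto simp: a_def b_def)
  have eq1: "a * c\<^sup>2 = b powr r"
    unfolding a_def b_def powr_powr using \<rho> c pos by (simp add: power2_eq_square)
  have eq2: "m * a powr s = l * b * c\<^sup>2"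
  proof -
    have "c\<^sup>2 * c powr s * c powr (1 / r) = m * (\<rho> powr s / \<rho> powr (1 / r)) / l"
      using cpow c by (simp add: powr_add powr_diff)
    then have "m * \<rho> powr s = l * \<rho> powr (1 / r) * (c\<^sup>2 * c powr s * c powr (1 / r))"
      using pos \<rho> by simp
    then have "m * \<rho> powr s / c powr s = l * (\<rho> powr (1 / r) * c powr (1 / r)) * c\<^sup>2"
      using c by simp
    then show ?thesis using \<rho> c by (simp add: a_def b_def powr_mult powr_divide)
  qed
  let ?u = "\<lambda>z. u (z / c) / a" and ?u1 = "\<lambda>z. u1 (z / c) / (a * c)"
    and ?w = "\<lambda>z. w (z / c) / b" and ?w1 = "\<lambda>z. w1 (z / c) / (b * c)"
  have sc: "sol r s l (c * t) ?u ?u1 ?w ?w1"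
    by (rule sol_scale[OF u(1) ab c eq1 eq2])
  have ct: "0 < c * t" using c u by simp
  have z: "?u (c * t) = 0" "?w (c * t) = 0" using u c by auto
  have s0: "?u1 0 = f1 0" using \<rho> c u1 slopes by (simp add: a_def \<rho>_def)
  have "?w1 0 \<le> g1 0" "g1 0 \<le> ?w1 0"
    using sol_slope_le[OF sc ct z sol _ ends pos s0] sol_slope_le[OF sol _ ends sc ct z pos s0[symmetric]] by auto
  then have s1: "?w1 0 = g1 0" by simp
  obtain N :: nat where N: "c * t \<le> real N" using real_arch_simple by blast
  have agree: "antiper f x = ?u x \<and> antiper f1 x = ?u1 x \<and> antiper g x = ?w x \<and> antiper g1 x = ?w1 x"
    if "x \<in> {0..c * t}" for x
    using that s0 s1 pos ct antiper_simple_zeros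
    by (intro sol_unique[OF sol_restrict[OF sol_antiper N] sc pos]) (auto simp: antiper_def)
  have "antiper f (c * t) = 0" using agree[of "c * t"] z ct by auto
  then have "c * t \<in> \<int>" by (simp add: antiper_zeros)
  then obtain i where i: "c * t = of_int i" by (auto elim: Ints_cases)
  define k where "k = nat i"
  have k: "real k = c * t" "1 \<le> k" using i ct by (auto simp: k_def)
  then have ck: "c = k / t" using u(2) by simp
  have in_range: "c * x \<in> {0..c * t}" if "x \<in> {0..t}" for x using that c by auto
  show ?thesis
    by (rule that[OF k(2) ab eq1[unfolded ck] eq2[unfolded ck], folded ck])
       (use agree[OF in_range] ab c in auto)
qed

end

text \<open>With f = u and g = - v / \<Sigma> from \<open>green_maximizer\<close>, the two Green
  representations become the system with l = 1 / \<Sigma>. The last integral says that f'' has L^p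
  norm 1, because \<bar>f''\<bar> powr p = \<bar>g\<bar> powr (p / (p - 1)).\<close>

theorem positive_sol_exists:
  assumes p: "1 < p" "1 < q"
  obtains f f1 g g1 where "positive_sol (1 / (p - 1)) (q - 1) (1 / green_const p q) f f1 g g1"
    "integral {0..1} (\<lambda>x. \<bar>f x\<bar> powr q) = green_const p q"
    "integral {0..1} (\<lambda>x. \<bar>g x\<bar> powr (p / (p - 1))) = 1"
proof -
  define \<Sigma> where "\<Sigma> = green_const p q"
  have \<Sigma>: "0 < \<Sigma>" unfolding \<Sigma>_def by (rule green_const_pos[OF p])
  obtain u v where uv: "continuous_on {0..1} u" "continuous_on {0..1} v"
    "\<And>x. x \<in> {0..1} \<Longrightarrow> u x = green (\<lambda>x. (v x / \<Sigma>) powr (1 / (p - 1))) x"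
    "\<And>x. x \<in> {0..1} \<Longrightarrow> v x = green (\<lambda>x. u x powr (q - 1)) x"
    "\<And>x. 0 < x \<Longrightarrow> x < 1 \<Longrightarrow> 0 < u x \<and> 0 < v x"
    "(\<integral>x. u x powr q \<partial>unitm) = \<Sigma>" "(\<integral>x. (v x / \<Sigma>) powr (p / (p - 1)) \<partial>unitm) = 1"
    using green_maximizer[OF p] unfolding \<Sigma>_def by blast
  have ends: "u 0 = 0" "u 1 = 0" "v 0 = 0" "v 1 = 0" using uv(3,4)[of 0] uv(3,4)[of 1] green_ends by auto
  have nn: "0 \<le> u x" "0 \<le> v x" if "x \<in> {0..1}" for x
    using that uv(5)[of x] ends by (cases "x = 0 \<or> x = 1"; force)+
  have c1: "continuous_on {0..1} (\<lambda>x. (v x / \<Sigma>) powr (1 / (p - 1)))"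
    using p nn \<Sigma> by (intro continuous_on_powr' continuous_intros uv) auto
  have c2: "continuous_on {0..1} (\<lambda>x. u x powr (q - 1))"
    using p nn by (intro continuous_on_powr' continuous_intros uv) auto
  obtain U1 where U1: "\<And>x. x \<in> {0..1} \<Longrightarrow> (green (\<lambda>x. (v x / \<Sigma>) powr (1 / (p - 1))) has_real_derivative U1 x) (at x within {0..1})"
    "\<And>x. x \<in> {0..1} \<Longrightarrow> (U1 has_real_derivative - ((v x / \<Sigma>) powr (1 / (p - 1)))) (at x within {0..1})"
    using green_derivative[OF c1] by blast
  obtain V1 where V1: "\<And>x. x \<in> {0..1} \<Longrightarrow> (green (\<lambda>x. u x powr (q - 1)) has_real_derivative V1 x) (at x within {0..1})"
    "\<And>x. x \<in> {0..1} \<Longrightarrow> (V1 has_real_derivative - (u x powr (q - 1))) (at x within {0..1})"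
    using green_derivative[OF c2] by blast
  define g where "g = (\<lambda>x. - (v x / \<Sigma>))"
  have u': "(u has_real_derivative U1 x) (at x within {0..1})" if "x \<in> {0..1}" for x
    by (rule has_field_derivative_transform_within[OF U1(1)[OF that] zero_less_one that]) (simp add: uv(3))
  have v': "(v has_real_derivative V1 x) (at x within {0..1})" if "x \<in> {0..1}" for x
    by (rule has_field_derivative_transform_within[OF V1(1)[OF that] zero_less_one that]) (simp add: uv(4))
  have spg: "spow (1 / (p - 1)) (g x) = - ((v x / \<Sigma>) powr (1 / (p - 1)))" if "x \<in> {0..1}" for x
    using nn[OF that] \<Sigma> by (simp add: g_def spow_nonneg)
  have "sol (1 / (p - 1)) (q - 1) (1 / \<Sigma>) 1 u U1 g (\<lambda>x. - (V1 x / \<Sigma>))"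
    unfolding sol_def
  proof (intro conjI ballI)
    fix x :: real assume x: "x \<in> {0..1}"
    show "(u has_real_derivative U1 x) (at x within {0..1})" by (rule u'[OF x])
    show "(U1 has_real_derivative spow (1 / (p - 1)) (g x)) (at x within {0..1})"
      using U1(2)[OF x] spg[OF x] by simp
    show "(g has_real_derivative - (V1 x / \<Sigma>)) (at x within {0..1})"
      unfolding g_def by (intro DERIV_minus DERIV_cdivide v'[OF x])
    have "((\<lambda>x. - (V1 x / \<Sigma>)) has_real_derivative - (- (u x powr (q - 1)) / \<Sigma>)) (at x within {0..1})"
      by (intro DERIV_minus DERIV_cdivide V1(2)[OF x])
    then show "((\<lambda>x. - (V1 x / \<Sigma>)) has_real_derivative 1 / \<Sigma> * spow (q - 1) (u x)) (at x within {0..1})"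
      using nn[OF x] by (simp add: spow_nonneg)
  qed (use ends in \<open>auto simp: g_def\<close>)
  then have "positive_sol (1 / (p - 1)) (q - 1) (1 / \<Sigma>) u U1 g (\<lambda>x. - (V1 x / \<Sigma>))"
    using p \<Sigma> ends uv(5) by unfold_locales (auto simp: g_def)
  moreover have "integral {0..1} (\<lambda>x. \<bar>u x\<bar> powr q) = \<Sigma>"
  proof -
    have "integral {0..1} (\<lambda>x. \<bar>u x\<bar> powr q) = (\<integral>x. \<bar>u x\<bar> powr q \<partial>unitm)"
      using p by (intro integral_unitm_continuous[symmetric] continuous_on_powr' continuous_intros uv) auto
    also have "\<dots> = (\<integral>x. u x powr q \<partial>unitm)"
      using nn by (intro Bochner_Integration.integral_cong) auto
    finally show ?thesis using uv(6) by simp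
  qed
  moreover have "integral {0..1} (\<lambda>x. \<bar>g x\<bar> powr (p / (p - 1))) = 1"
  proof -
    have "integral {0..1} (\<lambda>x. \<bar>g x\<bar> powr (p / (p - 1))) = (\<integral>x. \<bar>g x\<bar> powr (p / (p - 1)) \<partial>unitm)"
      using p \<Sigma> unfolding g_def
      by (intro integral_unitm_continuous[symmetric] continuous_on_powr' continuous_intros uv) auto
    also have "\<dots> = (\<integral>x. (v x / \<Sigma>) powr (p / (p - 1)) \<partial>unitm)"
      using nn \<Sigma> by (intro Bochner_Integration.integral_cong) (auto simp: g_def)
    finally show ?thesis using uv(7) by simp
  qed
  ultimately show ?thesis using that unfolding \<Sigma>_def by blast
qed

section \<open>Normalization, zeros and values of the spectral numbers\<close>

lemma has_integral_rescale:
  fixes h :: "real \<Rightarrow> real"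
  assumes "(h has_integral I) {a..b}" "0 < m"
  shows "((\<lambda>x. h (m * x + c)) has_integral I / m) {(a - c) / m..(b - c) / m}"
proof -
  have "((\<lambda>x. h (m * x + c)) has_integral I / m) ((\<lambda>x. (1 / m) * x + - ((1 / m) * c)) ` {a..b})"
    using has_integral_affinity[of h I a b m c] assms by (simp add: field_simps)
  moreover have "(\<lambda>x. (1 / m) * x + - ((1 / m) * c)) ` {a..b} = {(a - c) / m..(b - c) / m}" if "a \<le> b"
    using that assms(2) image_affinity_atLeastAtMost[of "1 / m" "- (c / m)" a b]
    by (simp add: diff_divide_distrib)
  moreover have "I = 0 \<and> {(a - c) / m..(b - c) / m} = {}" if "\<not> a \<le> b"
    using that assms by (auto simp: divide_right_mono not_le divide_strict_right_mono)
  ultimately show ?thesis by (cases "a \<le> b") auto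
qed

lemma has_integral_periodic:
  fixes h :: "real \<Rightarrow> real"
  assumes "(h has_integral I) {0..1}" "\<And>k x. x \<in> {real k..real k + 1} \<Longrightarrow> H x = h (x - real k)"
  shows "(H has_integral real n * I) {0..real n}"
proof (induction n)
  case (Suc n)
  have "((\<lambda>x. h (1 * x + - real n)) has_integral I / 1) {(0 - - real n) / 1..(1 - - real n) / 1}"
    by (rule has_integral_rescale[OF assms(1)]) simp
  then have "((\<lambda>x. h (x - real n)) has_integral I) {real n..real n + 1}" by (simp add: add.commute)
  then have "(H has_integral I) {real n..real n + 1}"
    by (rule has_integral_eq[rotated]) (use assms(2) in auto)
  from has_integral_combine[OF _ _ Suc this] show ?case by (simp add: algebra_simps)
qed (simp add: has_integral_refl)

text \<open>These are the interior zeros j t / k, 0 < j < k, of an eigenfunction with k cells; their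
  number determines k.\<close>

lemma rational_points:
  fixes t :: real and k :: nat
  assumes "0 < t" "1 \<le> k"
  shows "finite {x \<in> {0<..<t}. k / t * x \<in> \<int>}" "card {x \<in> {0<..<t}. k / t * x \<in> \<int>} = k - 1"
proof -
  have eq: "{x \<in> {0<..<t}. k / t * x \<in> \<int>} = (\<lambda>j. real j * t / k) ` {1..<k}"
  proof (intro set_eqI iffI)
    fix x assume "x \<in> {x \<in> {0<..<t}. k / t * x \<in> \<int>}"
    then obtain i where i: "0 < x" "x < t" "k / t * x = of_int i" by (auto elim: Ints_cases)
    have x: "x = of_int i * t / k" using i(3) assms by (simp add: field_simps)
    have "0 < real_of_int i" unfolding i(3)[symmetric] using i(1) assms by simp
    moreover have "real_of_int i < real k" unfolding i(3)[symmetric] using i(1,2) assms by (simp add: field_simps)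
    ultimately have "nat i \<in> {1..<k}" "x = real (nat i) * t / k" using x by auto
    then show "x \<in> (\<lambda>j. real j * t / k) ` {1..<k}" by blast
  next
    fix x assume "x \<in> (\<lambda>j. real j * t / k) ` {1..<k}"
    then obtain j where j: "1 \<le> j" "j < k" and x: "x = real j * t / k" by auto
    have "0 < x" "x < t" using j assms by (simp_all add: x field_simps)
    moreover have "k / t * x = real j" using assms by (simp add: x)
    ultimately show "x \<in> {x \<in> {0<..<t}. k / t * x \<in> \<int>}" by simp
  qed
  have "inj_on (\<lambda>j. real j * t / k) {1..<k}" using assms by (auto simp: inj_on_def)
  then show "finite {x \<in> {0<..<t}. k / t * x \<in> \<int>}" "card {x \<in> {0<..<t}. k / t * x \<in> \<int>} = k - 1"
    unfolding eq by (simp_all add: card_image)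
qed

definition sn_value :: "real \<Rightarrow> real \<Rightarrow> real \<Rightarrow> real \<Rightarrow> nat \<Rightarrow> real" where
  "sn_value l p q t n = l * real n powr (2 * q) * t powr (q / p - 1 - 2 * q)"

text \<open>The condition \<open>b powr (p / (p - 1)) * t = 1\<close> is the normalization of u''
  and fixes b; the relation for a then fixes a. Logarithms turn the remaining equation for m into a
  linear identity in ln k and ln t.\<close>

lemma sn_value_iff:
  fixes a b t p q l m :: real and k :: nat
  assumes p: "1 < p" and t: "0 < t" and k: "1 \<le> k" and b: "0 < b" "b powr (p / (p - 1)) * t = 1"
    and a: "0 < a" "a * (k / t)\<^sup>2 = b powr (1 / (p - 1))"
  shows "m * a powr (q - 1) = l * b * (k / t)\<^sup>2 \<longleftrightarrow> m = sn_value l p q t k"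
proof -
  have "ln (b powr (p / (p - 1)) * t) = p / (p - 1) * ln b + ln t"
    using b(1) t by (simp add: ln_mult ln_powr)
  then have "p / (p - 1) * ln b = - ln t" using b(2) by simp
  then have lb: "ln b = - ((p - 1) / p * ln t)" using p by (simp add: field_simps)
  have "ln (a * (k / t)\<^sup>2) = ln a + 2 * (ln k - ln t)"
    using a(1) k t by (simp add: ln_mult ln_div ln_realpow)
  then have "ln a + 2 * (ln k - ln t) = 1 / (p - 1) * ln b"
    unfolding a(2) using b(1) by (simp add: ln_powr)
  also have "\<dots> = - (ln t / p)" unfolding lb using p by (simp add: field_simps)
  finally have la: "ln a = - (ln t / p) - 2 * (ln k - ln t)" by simp
  have "ln (b * (k / t)\<^sup>2 / a powr (q - 1)) = ln b + 2 * (ln k - ln t) - (q - 1) * ln a"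
    using a k t b by (simp add: ln_mult ln_powr ln_div ln_realpow)
  also have "\<dots> = 2 * q * ln k + (q / p - 1 - 2 * q) * ln t"
    unfolding la lb using p by (simp add: field_simps)
  also have "\<dots> = ln (real k powr (2 * q) * t powr (q / p - 1 - 2 * q))"
    using k t by (simp add: ln_mult ln_powr)
  finally have *: "b * (k / t)\<^sup>2 / a powr (q - 1) = real k powr (2 * q) * t powr (q / p - 1 - 2 * q)"
    using a b k t by simp
  have "m * a powr (q - 1) = l * b * (k / t)\<^sup>2 \<longleftrightarrow> m = l * (b * (k / t)\<^sup>2 / a powr (q - 1))"
    using a(1) by (simp add: eq_divide_eq mult.assoc)
  then show ?thesis unfolding * sn_value_def by (simp add: mult.assoc)
qed

locale pq_sol = positive_sol "1 / (p - 1)" "q - 1" l f f1 g g1 for p q l f f1 g g1 +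
  assumes p: "1 < p" and norm_g: "integral {0..1} (\<lambda>x. \<bar>g x\<bar> powr (p / (p - 1))) = 1"
begin

lemma q: "1 < q" using pos by simp

text \<open>Since \<bar>u''\<bar> powr p is \<bar>w\<bar> powr (p / (p - 1)), \<open>norm_g\<close>
  gives b powr (p / (p - 1)) * t / k on each of the k cells.\<close>

lemma norm_scaled:
  fixes k :: nat
  assumes t: "0 < t" and k: "1 \<le> k" and b: "0 < b"
    and w: "\<And>x. x \<in> {0..t} \<Longrightarrow> w x = b * antiper g (k / t * x)"
  shows "(LINT x:{0..t}|lborel. \<bar>spow (1 / (p - 1)) (w x)\<bar> powr p) = b powr (p / (p - 1)) * t"
proof -
  have P: "0 < p / (p - 1)" using p by simp
  have "continuous_on {0..1} (\<lambda>x. \<bar>g x\<bar> powr (p / (p - 1)))"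
    using P by (intro continuous_on_powr' continuous_intros sol_continuous[OF sol]) auto
  then have "((\<lambda>x. \<bar>g x\<bar> powr (p / (p - 1))) has_integral 1) {0..1}"
    using norm_g integrable_continuous_real integrable_integral by metis
  then have "((\<lambda>x. \<bar>antiper g x\<bar> powr (p / (p - 1))) has_integral real k * 1) {0..real k}"
    by (rule has_integral_periodic) (simp add: antiper_eq[of g, OF antiperiodic(3)] abs_mult)
  then have "((\<lambda>x. \<bar>antiper g (k / t * x + 0)\<bar> powr (p / (p - 1))) has_integral real k * 1 / (k / t)) {(0 - 0) / (k / t)..(real k - 0) / (k / t)}"
    by (rule has_integral_rescale) (use t k in simp)
  then have "((\<lambda>x. \<bar>antiper g (k / t * x)\<bar> powr (p / (p - 1))) has_integral t) {0..t}"
    using t k by simp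
  then have "((\<lambda>x. b powr (p / (p - 1)) * \<bar>antiper g (k / t * x)\<bar> powr (p / (p - 1))) has_integral b powr (p / (p - 1)) * t) {0..t}"
    by (rule has_integral_mult_right)
  moreover have w_eq: "\<bar>spow (1 / (p - 1)) (w x)\<bar> powr p = b powr (p / (p - 1)) * \<bar>antiper g (k / t * x)\<bar> powr (p / (p - 1))"
    if "x \<in> {0..t}" for x
    using w[OF that] b by (simp add: abs_spow powr_powr abs_mult powr_mult)
  ultimately have I: "((\<lambda>x. \<bar>spow (1 / (p - 1)) (w x)\<bar> powr p) has_integral b powr (p / (p - 1)) * t) {0..t}"
    by (subst has_integral_cong[OF w_eq]) auto
  have "continuous_on {0..t} (\<lambda>x. antiper g (k / t * x))"
    by (rule continuous_on_compose2[OF sol_continuous(3)[OF sol_antiper[of k]]])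
       (use t k in \<open>auto intro!: continuous_intros simp: field_simps\<close>)
  then have "continuous_on {0..t} w"
    by (subst continuous_on_cong[OF refl w]) (auto intro!: continuous_intros)
  then have "continuous_on {0..t} (\<lambda>x. \<bar>spow (1 / (p - 1)) (w x)\<bar> powr p)"
    using p by (intro continuous_on_powr' continuous_intros) auto
  then have "set_integrable lborel {0..t} (\<lambda>x. \<bar>spow (1 / (p - 1)) (w x)\<bar> powr p)"
    by (rule borel_integrable_atLeastAtMost')
  from set_borel_integral_eq_integral(2)[OF this] show ?thesis using I by (simp add: integral_unique)
qed

text \<open>The normalization of u'' fixes b for given k, hence a, so k alone determines the
  eigenvalue; k itself is read off from the number of zeros.\<close>

lemma spectral_couple_unique:
  assumes sc: "spectral_couple p q t u m" and t: "0 < t"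
  obtains k :: nat where "1 \<le> k" "m = sn_value l p q t k"
    "finite {x \<in> {0<..<t}. u x = 0}" "card {x \<in> {0<..<t}. u x = 0} = k - 1"
proof -
  obtain u1 u2 w1 where e: "0 < m" "C1_deriv t u u1" "C1_deriv t u1 u2"
    "C1_deriv t (\<lambda>x. sgn (u2 x) * \<bar>u2 x\<bar> powr (p - 1)) w1"
    "C1_deriv t w1 (\<lambda>x. m * sgn (u x) * \<bar>u x\<bar> powr (q - 1))"
    "u 0 = 0" "u t = 0" "u2 0 = 0" "u2 t = 0" "0 < u1 0"
    "(LINT x:{0..t}|lborel. \<bar>u2 x\<bar> powr p) powr (1 / p) = 1"
    using sc unfolding spectral_couple_def eigenpair_def by auto
  define w where "w = (\<lambda>x. spow (p - 1) (u2 x))"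
  have wu: "spow (1 / (p - 1)) (w x) = u2 x" for x
    using p by (simp add: w_def spow_inverse)
  have s: "sol (1 / (p - 1)) (q - 1) m t u u1 w w1"
  proof -
    have "C1_deriv t w w1" "C1_deriv t w1 (\<lambda>x. m * spow (q - 1) (u x))" "w 0 = 0"
      using e(4,5,8) by (simp_all add: w_def spow_def mult.assoc)
    then show ?thesis using e(2,3,6) unfolding sol_def wu C1_deriv_def by blast
  qed
  have wt: "w t = 0" using e by (simp add: w_def)
  obtain k :: nat and a b where k: "1 \<le> k" "0 < a" "0 < b" "a * (k / t)\<^sup>2 = b powr (1 / (p - 1))"
    "m * a powr (q - 1) = l * b * (k / t)\<^sup>2"
    "\<And>x. x \<in> {0..t} \<Longrightarrow> u x = a * antiper f (k / t * x)"
    "\<And>x. x \<in> {0..t} \<Longrightarrow> w x = b * antiper g (k / t * x)"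
    using classification[OF s t e(7) wt e(1,10)] by blast
  have "(LINT x:{0..t}|lborel. \<bar>u2 x\<bar> powr p) = b powr (p / (p - 1)) * t"
    using norm_scaled[OF t k(1,3) k(7)] by (simp add: wu)
  then have "(b powr (p / (p - 1)) * t) powr (1 / p) = 1" using e(11) by simp
  then have "((b powr (p / (p - 1)) * t) powr (1 / p)) powr p = 1 powr p" by simp
  then have b: "b powr (p / (p - 1)) * t = 1" using p t k(3) by (simp add: powr_powr)
  have m: "m = sn_value l p q t k"
    using sn_value_iff[OF p t k(1,3) b k(2,4), of m q l] k(5) by simp
  have "{x \<in> {0<..<t}. u x = 0} = {x \<in> {0<..<t}. k / t * x \<in> \<int>}"
    using k(2,6) by (auto simp: antiper_zeros)
  then show ?thesis using that[OF k(1) m] rational_points[OF t k(1)] by simp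
qed

lemma spectral_couple_exists:
  fixes n :: nat
  assumes t: "0 < t" and n: "1 \<le> n"
  obtains u where "spectral_couple p q t u (sn_value l p q t n)"
    "{x \<in> {0<..<t}. u x = 0} = {x \<in> {0<..<t}. n / t * x \<in> \<int>}"
proof -
  \<comment> \<open>This solves the normalization b powr (p / (p - 1)) * t = 1; a then follows from
    the scaling relation.\<close>
  define b where "b = t powr (- ((p - 1) / p))"
  define a where "a = b powr (1 / (p - 1)) * (t / n)\<^sup>2"
  define m where "m = sn_value l p q t n"
  have ab: "0 < a" "0 < b" using t n by (auto simp: a_def b_def)
  have bt: "b powr (p / (p - 1)) * t = 1"
  proof -
    have "- ((p - 1) / p) * (p / (p - 1)) = - 1" using p by (simp add: field_simps)
    then show ?thesis unfolding b_def powr_powr using t by (simp only: powr_minus_divide) simp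
  qed
  have aeq: "a * (n / t)\<^sup>2 = b powr (1 / (p - 1))"
    using t n by (simp add: a_def field_simps)
  have meq: "m * a powr (q - 1) = l * b * (n / t)\<^sup>2"
    using sn_value_iff[OF p t n ab(2) bt ab(1) aeq] by (simp add: m_def)
  have m: "0 < m" using pos t n by (simp add: m_def sn_value_def)
  define c where "c = t / n"
  have c: "0 < c" "c * n = t" using t n by (auto simp: c_def)
  have s: "sol (1 / (p - 1)) (q - 1) m (c * n) (\<lambda>z. antiper f (z / c) / (1 / a)) (\<lambda>z. antiper f1 (z / c) / (1 / a * c))
    (\<lambda>z. antiper g (z / c) / (1 / b)) (\<lambda>z. antiper g1 (z / c) / (1 / b * c))"
  \<comment> \<open>\<open>sol_scale\<close> divides by its amplitudes, so it is applied with 1 / a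
    and 1 / b.\<close>
  proof (rule sol_scale[OF sol_antiper])
    show "1 / a * c\<^sup>2 = (1 / b) powr (1 / (p - 1))"
      using aeq ab t n by (simp add: c_def powr_divide field_simps)
    show "l * (1 / a) powr (q - 1) = m * (1 / b) * c\<^sup>2"
      using meq ab t n by (simp add: c_def powr_divide field_simps)
  qed (use ab c in auto)
  define u where "u = (\<lambda>z. a * antiper f (n / t * z))"
  define w where "w = (\<lambda>z. b * antiper g (n / t * z))"
  define u1 where "u1 = (\<lambda>z. antiper f1 (z / c) / (1 / a * c))"
  define w1 where "w1 = (\<lambda>z. antiper g1 (z / c) / (1 / b * c))"
  have uw: "(\<lambda>z. antiper f (z / c) / (1 / a)) = u" "(\<lambda>z. antiper g (z / c) / (1 / b)) = w"
    by (auto simp: u_def w_def c_def mult.commute)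
  have s: "sol (1 / (p - 1)) (q - 1) m t u u1 w w1"
    using s unfolding uw c(2) u1_def w1_def .
  have ut: "u t = 0" "w t = 0" using t by (auto simp: u_def w_def antiper_zeros)
  note cont = sol_continuous[OF s]
  define u2 where "u2 = (\<lambda>x. spow (1 / (p - 1)) (w x))"
  have w_eq: "(\<lambda>x. sgn (u2 x) * \<bar>u2 x\<bar> powr (p - 1)) = w"
    using p by (simp add: u2_def spow_def[symmetric] spow_inverse)
  have "eigenpair p q t u u1 u2 m"
    unfolding eigenpair_def
  proof (intro conjI exI[of _ w1])
    have ne: "u (t / (2 * n)) \<noteq> 0"
      using ab t n f_pos[of "1 / 2"] by (simp add: u_def antiper_def frac_def)
    have "t / (2 * n) \<in> {0..t}" using t n by (auto simp: field_simps)
    then show "\<exists>x\<in>{0..t}. u x \<noteq> 0" using ne by blast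
    show "C1_deriv t u u1" using solD(1)[OF s] cont by (auto simp: C1_deriv_def)
    show "C1_deriv t u1 u2"
      using solD(2)[OF s] cont p by (auto simp: C1_deriv_def u2_def intro!: continuous_intros)
    show "C1_deriv t (\<lambda>x. sgn (u2 x) * \<bar>u2 x\<bar> powr (p - 1)) w1"
      unfolding w_eq using solD(3)[OF s] cont by (auto simp: C1_deriv_def)
    have "(\<lambda>x. m * sgn (u x) * \<bar>u x\<bar> powr (q - 1)) = (\<lambda>x. m * spow (q - 1) (u x))"
      by (simp add: spow_def mult.assoc)
    then show "C1_deriv t w1 (\<lambda>x. m * sgn (u x) * \<bar>u x\<bar> powr (q - 1))"
      using solD(4)[OF s] cont q by (auto simp: C1_deriv_def intro!: continuous_intros)
  qed (use m ut solD(5,6)[OF s] in \<open>auto simp: u2_def\<close>)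
  moreover have "(LINT x:{0..t}|lborel. \<bar>u2 x\<bar> powr p) powr (1 / p) = 1"
    using norm_scaled[OF t n ab(2), of w] bt by (simp add: u2_def w_def)
  moreover have "0 < u1 0" using slopes ab c by (simp add: u1_def antiper_def)
  ultimately have "spectral_couple p q t u m" unfolding spectral_couple_def by blast
  moreover have "{x \<in> {0<..<t}. u x = 0} = {x \<in> {0<..<t}. n / t * x \<in> \<int>}"
    using ab by (auto simp: u_def antiper_zeros)
  ultimately show ?thesis using that unfolding m_def by blast
qed

lemma spectral_number_eq:
  assumes t: "0 < t" and n: "1 \<le> n"
  shows "spectral_number p q t n = sn_value l p q t n"
  unfolding spectral_number_def
proof (rule the_equality)
  obtain u where "spectral_couple p q t u (sn_value l p q t n)"
    "{x \<in> {0<..<t}. u x = 0} = {x \<in> {0<..<t}. n / t * x \<in> \<int>}"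
    using spectral_couple_exists[OF t n] .
  then show "\<exists>f. spectral_couple p q t f (sn_value l p q t n) \<and> finite {x \<in> {0<..<t}. f x = 0} \<and>
      card {x \<in> {0<..<t}. f x = 0} = n - 1"
    using rational_points[OF t n] by (intro exI[of _ u]) simp
next
  fix m assume "\<exists>f. spectral_couple p q t f m \<and> finite {x \<in> {0<..<t}. f x = 0} \<and> card {x \<in> {0<..<t}. f x = 0} = n - 1"
  then obtain u where u: "spectral_couple p q t u m" "card {x \<in> {0<..<t}. u x = 0} = n - 1" by blast
  obtain k where "1 \<le> k" "m = sn_value l p q t k" "card {x \<in> {0<..<t}. u x = 0} = k - 1"
    using spectral_couple_unique[OF u(1) t] by blast
  then show "m = sn_value l p q t n" using u(2) n by (metis diff_add_inverse2 le_add_diff_inverse2)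
qed

text \<open>A spectral function without zeros in (0, 1) consists of one cell, so its eigenvalue is
  \<open>sn_value\<close> at n = 1 and t = 1.\<close>

lemma lambda1_eq: "lambda1 p q = l"
  unfolding lambda1_def
proof (rule the_equality)
  have 1: "sn_value l p q 1 1 = l" by (simp add: sn_value_def)
  obtain u where u: "spectral_couple p q 1 u (sn_value l p q 1 1)"
    "{x \<in> {0<..<1}. u x = 0} = {x \<in> {0<..<1}. real 1 / 1 * x \<in> \<int>}"
    using spectral_couple_exists[of 1 1] by force
  have "{x \<in> {0<..<1::real}. real 1 / 1 * x \<in> \<int>} = {}"
    using rational_points[of 1 1] by simp
  then show "\<exists>f. spectral_couple p q 1 f l \<and> (\<forall>x\<in>{0<..<1}. f x \<noteq> 0)"
    using u 1 by (intro exI[of _ u]) auto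
  fix m assume "\<exists>f. spectral_couple p q 1 f m \<and> (\<forall>x\<in>{0<..<1}. f x \<noteq> 0)"
  then obtain u where u: "spectral_couple p q 1 u m" "\<forall>x\<in>{0<..<1}. u x \<noteq> 0" by blast
  obtain k where k: "1 \<le> k" "m = sn_value l p q 1 k" "card {x \<in> {0<..<1}. u x = 0} = k - 1"
    using spectral_couple_unique[OF u(1)] by auto
  have "{x \<in> {0<..<1}. u x = 0} = {}" using u(2) by auto
  then have "k - 1 = 0" using k(3) by (simp only: card.empty)
  then have "k = 1" using k(1) by simp
  then show "m = l" using k(2) 1 by simp
qed

lemma spectral_number_powr:
  assumes t: "0 < t" and n: "1 \<le> n"
  shows "spectral_number p q t n powr (- 1 / q) = t powr (1 / q + 2 - 1 / p) / ((real n)\<^sup>2 * lambda1 p q powr (1 / q))"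
proof -
  have e: "(q / p - 1 - 2 * q) * (- 1 / q) = 1 / q + 2 - 1 / p" "2 * q * (- 1 / q) = - 2"
    using q p by (simp_all add: field_simps)
  have "spectral_number p q t n powr (- 1 / q) = l powr (- 1 / q) * real n powr (2 * q * (- 1 / q)) * t powr ((q / p - 1 - 2 * q) * (- 1 / q))"
    unfolding spectral_number_eq[OF t n] sn_value_def using pos by (simp add: powr_mult powr_powr)
  also have "\<dots> = t powr (1 / q + 2 - 1 / p) / ((real n)\<^sup>2 * l powr (1 / q))"
    unfolding e using n by (simp add: powr_minus_divide field_simps)
  finally show ?thesis by (simp add: lambda1_eq)
qed

end

section \<open>Test functions and weak derivatives\<close>

text \<open>Recursion on the derivative instead of iterates of \<open>deriv\<close>: closure under
  sums, products and affine substitution follows by induction with the function generalized.\<close>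

fun times_diff :: "nat \<Rightarrow> (real \<Rightarrow> real) \<Rightarrow> bool" where
  "times_diff 0 f \<longleftrightarrow> f differentiable_on UNIV"
| "times_diff (Suc n) f \<longleftrightarrow> f differentiable_on UNIV \<and> times_diff n (deriv f)"

lemma times_diff_iff: "times_diff n f \<longleftrightarrow> (\<forall>k\<le>n. (deriv ^^ k) f differentiable_on UNIV)"
proof (induction n arbitrary: f)
  case (Suc n)
  have "(\<forall>k\<le>Suc n. (deriv ^^ k) f differentiable_on UNIV) \<longleftrightarrow>
      f differentiable_on UNIV \<and> (\<forall>k\<le>n. (deriv ^^ Suc k) f differentiable_on UNIV)"
    by (metis Suc_le_mono funpow_0 le_0_eq not0_implies_Suc zero_le)
  then show ?case using Suc[of "deriv f"] by (simp add: funpow_swap1)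
qed simp

lemma times_diff_imp_diff: "times_diff n f \<Longrightarrow> f differentiable_on UNIV"
  by (cases n) auto

lemma times_diff_Suc_imp: "times_diff (Suc n) f \<Longrightarrow> times_diff n f"
  by (auto simp: times_diff_iff)

lemma deriv_eqI: "(\<And>x. (f has_real_derivative f' x) (at x)) \<Longrightarrow> deriv f = f'"
  by (auto intro: DERIV_imp_deriv)

lemma differentiable_onI: "(\<And>x. (f has_real_derivative f' x) (at x)) \<Longrightarrow> f differentiable_on UNIV"
  by (metis differentiable_at_imp_differentiable_on real_differentiable_def)

lemma has_deriv: "f differentiable_on UNIV \<Longrightarrow> (f has_real_derivative deriv f x) (at x)" for f :: "real \<Rightarrow> real"
  by (simp add: DERIV_deriv_iff_real_differentiable differentiable_on_def)

lemma times_diff_SucI: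
  assumes "\<And>x. (f has_real_derivative f' x) (at x)" "times_diff n f'"
  shows "times_diff (Suc n) f"
  using differentiable_onI[OF assms(1)] deriv_eqI[OF assms(1)] assms(2) by simp

lemma times_diff_add: "times_diff n f \<Longrightarrow> times_diff n g \<Longrightarrow> times_diff n (\<lambda>x. f x + g x)"
proof (induction n arbitrary: f g)
  case (Suc n)
  show ?case
    by (rule times_diff_SucI[OF DERIV_add[OF has_deriv has_deriv]]) (use Suc in auto)
qed (auto intro: differentiable_on_add)

lemma times_diff_cmult: "times_diff n f \<Longrightarrow> times_diff n (\<lambda>x. c * f x)"
proof (induction n arbitrary: f)
  case (Suc n)
  show ?case
    by (rule times_diff_SucI[OF DERIV_cmult[OF has_deriv]]) (use Suc in auto)
qed (auto intro: differentiable_on_mult)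

lemma times_diff_mult: "times_diff n f \<Longrightarrow> times_diff n g \<Longrightarrow> times_diff n (\<lambda>x. f x * g x)"
proof (induction n arbitrary: f g)
  case (Suc n)
  have "times_diff n (\<lambda>x. deriv f x * g x + deriv g x * f x)"
    using Suc.prems times_diff_Suc_imp[OF Suc.prems(1)] times_diff_Suc_imp[OF Suc.prems(2)]
    by (intro times_diff_add Suc.IH) auto
  then show ?case
    by (intro times_diff_SucI[OF DERIV_mult[OF has_deriv has_deriv]]) (use Suc.prems in auto)
qed (auto intro: differentiable_on_mult)

lemma times_diff_affine: "times_diff n f \<Longrightarrow> times_diff n (\<lambda>x. f (m * x + c))"
proof (induction n arbitrary: f)
  case 0
  show ?case unfolding times_diff.simps
    by (rule differentiable_onI[where f' = "\<lambda>x. deriv f (m * x + c) * m"])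
       (use 0 in \<open>auto intro!: DERIV_chain2[OF has_deriv] derivative_eq_intros\<close>)
next
  case (Suc n)
  have "((\<lambda>x. f (m * x + c)) has_real_derivative deriv f (m * x + c) * m) (at x)" for x
    by (rule DERIV_chain2[OF has_deriv]) (use Suc.prems in \<open>auto intro!: derivative_eq_intros\<close>)
  then show ?case
    by (intro times_diff_SucI[where f' = "\<lambda>x. m * deriv f (m * x + c)"] times_diff_cmult Suc.IH)
       (use Suc.prems in \<open>auto simp: mult.commute\<close>)
qed

text \<open>The functions exp(-1/x) / x^m, extended by 0, form a family in which each derivative is
  a combination of two members, so smoothness follows without formulas for higher
  derivatives.\<close>

definition flat :: "nat \<Rightarrow> real \<Rightarrow> real" where
  "flat m x = (if 0 < x then exp (- 1 / x) / x ^ m else 0)"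

lemma flat_deriv: "(flat m has_real_derivative flat (m + 2) x - real m * flat (m + 1) x) (at x)"
proof -
  consider "x < 0" | "x = 0" | "0 < x" by linarith
  then show ?thesis
  proof cases
    case 1
    have "((\<lambda>_. 0) has_real_derivative flat (m + 2) x - real m * flat (m + 1) x) (at x)"
      using 1 by (simp add: flat_def)
    then show ?thesis
      by (rule has_field_derivative_transform_within_open[where S = "{..<0}"]) (use 1 in \<open>auto simp: flat_def\<close>)
  next
    case 3
    have "((\<lambda>x. exp (- 1 / x) / x ^ m) has_real_derivative flat (m + 2) x - real m * flat (m + 1) x) (at x)"
    proof (cases m)
      case 0
      show ?thesis
        unfolding flat_def 0 using 3 by (auto intro!: derivative_eq_intros simp: power2_eq_square)
    next
      case (Suc j)
      have "((\<lambda>x. exp (- 1 / x) / x ^ Suc j) has_real_derivative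
          (exp (- 1 / x) * (1 / x^2) * x ^ Suc j - exp (- 1 / x) * (real (Suc j) * x ^ j)) / (x ^ Suc j * x ^ Suc j)) (at x)"
      proof (rule DERIV_divide)
        show "((\<lambda>x. exp (- 1 / x)) has_real_derivative exp (- 1 / x) * (1 / x^2)) (at x)"
          using 3 by (auto intro!: derivative_eq_intros simp: power2_eq_square)
        show "((\<lambda>x. x ^ Suc j) has_real_derivative real (Suc j) * x ^ j) (at x)"
          using DERIV_pow[of "Suc j" x] by simp
      qed (use 3 in simp)
      moreover have "(exp (- 1 / x) * (1 / x^2) * x ^ Suc j - exp (- 1 / x) * (real (Suc j) * x ^ j)) / (x ^ Suc j * x ^ Suc j)
          = exp (- 1 / x) / x ^ (Suc j + 2) - real (Suc j) * (exp (- 1 / x) / x ^ (Suc j + 1))"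
        using 3 by (simp add: field_simps power_add power2_eq_square del: of_nat_Suc)
      ultimately show ?thesis using 3 by (simp add: Suc flat_def del: of_nat_Suc)
    qed
    then show ?thesis
      by (rule has_field_derivative_transform_within_open[where S = "{0<..}"]) (use 3 in \<open>auto simp: flat_def\<close>)
  next
    case 2
    have "((\<lambda>h. flat m h / h) \<longlongrightarrow> 0) (at_right 0)"
    proof -
      have "((\<lambda>h. inverse h ^ Suc m / exp (inverse h)) \<longlongrightarrow> (0::real)) (at_right 0)"
        by (rule filterlim_compose[OF tendsto_power_div_exp_0 filterlim_inverse_at_top_right])
      moreover have "\<forall>\<^sub>F h in at_right 0. inverse h ^ Suc m / exp (inverse h) = flat m h / h"
        unfolding eventually_at_right_field
        by (intro exI[of _ 1]) (auto simp: flat_def exp_minus power_inverse inverse_eq_divide field_simps)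
      ultimately show ?thesis by (rule Lim_transform_eventually)
    qed
    moreover have "((\<lambda>h. flat m h / h) \<longlongrightarrow> 0) (at_left 0)"
      by (rule tendsto_eventually)
         (auto simp: flat_def eventually_at_left_field intro!: exI[of _ "-1"])
    ultimately have "((\<lambda>h. flat m h / h) \<longlongrightarrow> 0) (at 0)" by (simp add: filterlim_split_at)
    then show ?thesis using 2 by (simp add: DERIV_def flat_def)
  qed
qed

lemma times_diff_flat: "times_diff n (flat m)"
proof (induction n arbitrary: m)
  case 0
  show ?case using differentiable_onI[OF flat_deriv] by simp
next
  case (Suc n)
  have "times_diff n (\<lambda>x. flat (m + 2) x + (- real m) * flat (m + 1) x)"
    by (intro times_diff_add times_diff_cmult Suc)
  then show ?case
    by (intro times_diff_SucI[OF flat_deriv]) simp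
qed

text \<open>The function vanishes outside [a + 1/k, b - 1/k], and as k grows both factors tend to 1
  inside (a, b): a smooth approximation of the indicator of the open interval.\<close>

definition bump :: "real \<Rightarrow> real \<Rightarrow> real \<Rightarrow> real \<Rightarrow> real" where
  "bump k a b x = flat 0 (k * x + (- k * a - 1)) * flat 0 (- k * x + (k * b - 1))"

lemma times_diff_bump: "times_diff n (bump k a b)"
  unfolding bump_def by (intro times_diff_mult times_diff_affine times_diff_flat)

lemma test_fun_iff:
  "test_fun t \<phi> \<longleftrightarrow> (\<forall>n. times_diff n \<phi>) \<and> (\<exists>a b. 0 < a \<and> b < t \<and> (\<forall>x. x \<notin> {a..b} \<longrightarrow> \<phi> x = 0))"
proof -
  have "(\<forall>k. (deriv ^^ k) \<phi> differentiable_on UNIV) \<longleftrightarrow> (\<forall>n. times_diff n \<phi>)"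
    unfolding times_diff_iff by (meson order_refl)
  then show ?thesis unfolding test_fun_def by simp
qed

lemma test_fun_bump:
  assumes "0 < k" "0 \<le> a" "b \<le> t" shows "test_fun t (bump k a b)"
  unfolding test_fun_iff
proof (intro conjI allI times_diff_bump exI)
  have "0 < 1 / k" using assms by simp
  then show "0 < a + 1 / k" "b - 1 / k < t" using assms by linarith+
  show "x \<notin> {a + 1 / k..b - 1 / k} \<longrightarrow> bump k a b x = 0" for x
    using assms by (auto simp: bump_def flat_def not_le field_simps)
qed

lemma flat_0_bounds: "0 \<le> flat 0 x" "flat 0 x \<le> 1"
  by (auto simp: flat_def)

lemma bump_bounds: "0 \<le> bump k a b x" "bump k a b x \<le> 1"
  using flat_0_bounds by (auto simp: bump_def intro: mult_le_one)

lemma bump_tendsto: "(\<lambda>n. bump (real n) a b x) \<longlonglongrightarrow> indicator {a<..<b} x"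
proof -
  have flat1: "(flat 0 \<longlongrightarrow> 1) at_top"
  proof -
    have "((\<lambda>x. exp (- 1 * inverse x)) \<longlongrightarrow> exp (- 1 * 0)) (at_top :: real filter)"
      by (intro tendsto_intros tendsto_inverse_0_at_top filterlim_ident)
    moreover have "\<forall>\<^sub>F x::real in at_top. exp (- 1 * inverse x) = flat 0 x"
      using eventually_gt_at_top[of 0] by eventually_elim (simp add: flat_def inverse_eq_divide)
    ultimately show ?thesis using Lim_transform_eventually by fastforce
  qed
  have to_top: "filterlim (\<lambda>n. real n * c - 1) at_top sequentially" if "0 < c" for c
    using filterlim_tendsto_add_at_top[OF tendsto_const[of "-1"]
      filterlim_tendsto_pos_mult_at_top[OF tendsto_const that filterlim_real_sequentially]]
    by (simp add: mult.commute)
  show ?thesis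
  proof (cases "x \<in> {a<..<b}")
    case True
    have "(\<lambda>n. flat 0 (real n * (x - a) - 1) * flat 0 (real n * (b - x) - 1)) \<longlonglongrightarrow> 1 * 1"
      using True by (intro tendsto_mult filterlim_compose[OF flat1] to_top) auto
    then show ?thesis using True by (simp add: bump_def algebra_simps)
  next
    case False
    then have neg: "real n * (x - a) \<le> 0 \<or> real n * (b - x) \<le> 0" for n
      by (auto simp: mult_le_0_iff)
    have "bump (real n) a b x = 0" for n
      using neg[of n] by (auto simp: bump_def flat_def algebra_simps)
    then show ?thesis using False by simp
  qed
qed

lemma test_fun_props:
  assumes "test_fun t \<phi>"
  shows "(\<phi> has_real_derivative deriv \<phi> x) (at x)" "test_fun t (deriv \<phi>)" "continuous_on A \<phi>"
    "x \<notin> {0<..<t} \<Longrightarrow> \<phi> x = 0" "\<phi> \<in> borel_measurable borel" "\<exists>C. \<forall>x. \<bar>\<phi> x\<bar> \<le> C"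
proof -
  obtain a b where ab: "0 < a" "b < t" "\<And>x. x \<notin> {a..b} \<Longrightarrow> \<phi> x = 0"
    using assms by (auto simp: test_fun_def)
  have d: "\<phi> differentiable_on UNIV" using assms by (auto simp: test_fun_iff dest: times_diff_imp_diff)
  show der: "(\<phi> has_real_derivative deriv \<phi> x) (at x)" for x using d by (rule has_deriv)
  have c: "continuous_on UNIV \<phi>" by (rule differentiable_imp_continuous_on[OF d])
  show cA: "continuous_on A \<phi>" for A by (rule continuous_on_subset[OF c]) simp
  show "x \<notin> {0<..<t} \<Longrightarrow> \<phi> x = 0" using ab by auto
  show "\<phi> \<in> borel_measurable borel" using c by (rule borel_measurable_continuous_onI)
  have "deriv \<phi> x = 0" if "x \<notin> {a..b}" for x
  proof -
    have "open (- {a..b})" by auto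
    have "((\<lambda>_. 0) has_real_derivative 0) (at x)" by simp
    then have "(\<phi> has_real_derivative 0) (at x)"
      by (rule has_field_derivative_transform_within_open[OF _ \<open>open (- {a..b})\<close>]) (use that ab(3) in auto)
    then show ?thesis by (rule DERIV_imp_deriv)
  qed
  moreover have "times_diff n (deriv \<phi>)" for n
    using assms by (auto simp: test_fun_iff dest: spec[of _ "Suc n"])
  ultimately show "test_fun t (deriv \<phi>)" unfolding test_fun_iff using ab by blast
  have "bounded (\<phi> ` {a..b})" by (intro compact_imp_bounded compact_continuous_image cA) simp
  then obtain C where C: "\<And>x. x \<in> {a..b} \<Longrightarrow> \<bar>\<phi> x\<bar> \<le> C" 
    unfolding bounded_iff by (metis image_eqI real_norm_def)
  have "\<bar>\<phi> x\<bar> \<le> max C 0" for x using C[of x] ab(3)[of x] by (cases "x \<in> {a..b}") auto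
  then show "\<exists>C. \<forall>x. \<bar>\<phi> x\<bar> \<le> C" by blast
qed

lemma integrable_mult_test_fun:
  assumes "test_fun t \<phi>" "integrable lborel g"
  shows "integrable lborel (\<lambda>x. g x * \<phi> x)"
proof -
  obtain C where C: "\<And>x. \<bar>\<phi> x\<bar> \<le> C" using test_fun_props(6)[OF assms(1)] by blast
  have [measurable]: "\<phi> \<in> borel_measurable borel" "g \<in> borel_measurable borel"
    using test_fun_props(5)[OF assms(1)] assms(2) by auto
  show ?thesis
    by (rule Bochner_Integration.integrable_bound[OF integrable_mult_left[OF assms(2), of C]])
       (use C abs_ge_self in \<open>auto simp: abs_mult intro!: AE_I2 mult_left_mono order.trans[OF C]\<close>)
qed

lemma set_integral_test_fun:
  assumes "test_fun t \<phi>" shows "(LINT x:{0<..<t}|lborel. g x * \<phi> x) = (LINT x|lborel. g x * \<phi> x)"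
  unfolding set_lebesgue_integral_def
  by (rule Bochner_Integration.integral_cong) (use test_fun_props(4)[OF assms] in \<open>auto simp: indicator_def\<close>)

section \<open>The fundamental lemma and functions with vanishing weak derivatives\<close>

text \<open>The positive and the negative part of g are densities of two finite measures that agree
  on all half-lines, hence coincide. On the set where g is positive the second measure vanishes, so
  the first does too; the negative part is treated alike.\<close>

lemma AE_eq_0_from_intervals:
  fixes g :: "real \<Rightarrow> real"
  assumes g: "integrable lborel g" and int: "\<And>x. (LINT y|lborel. indicator {x<..} y * g y) = 0"
  shows "AE x in lborel. g x = 0"
proof -
  have [measurable]: "g \<in> borel_measurable borel" using g by auto
  define P where "P = density lborel (\<lambda>x. ennreal (g x))"
  define N where "N = density lborel (\<lambda>x. ennreal (- g x))"
  have emP: "emeasure P A = ennreal (LINT y|lborel. indicator A y * max 0 (g y))"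
    "emeasure N A = ennreal (LINT y|lborel. indicator A y * max 0 (- g y))" if [measurable]: "A \<in> sets borel" for A
  proof -
    have "emeasure P A = (\<integral>\<^sup>+y. ennreal (indicator A y * max 0 (g y)) \<partial>lborel)"
      "emeasure N A = (\<integral>\<^sup>+y. ennreal (indicator A y * max 0 (- g y)) \<partial>lborel)"
      unfolding P_def N_def using that
      by (auto simp: emeasure_density indicator_def max_def ennreal_neg intro!: nn_integral_cong)
    moreover have "integrable lborel (\<lambda>y. indicator A y * max 0 (g y))" "integrable lborel (\<lambda>y. indicator A y * max 0 (- g y))"
      by (rule Bochner_Integration.integrable_bound[OF g]; auto simp: indicator_def)+
    ultimately show "emeasure P A = ennreal (LINT y|lborel. indicator A y * max 0 (g y))"
      "emeasure N A = ennreal (LINT y|lborel. indicator A y * max 0 (- g y))"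
      by (simp_all add: nn_integral_eq_integral)
  qed
  have "P = N"
  proof (rule measure_eqI_lessThan)
    show "emeasure P {x<..} < \<infinity>" for x by (simp add: emP)
    fix x
    have i: "integrable lborel (\<lambda>y. indicator {x<..} y * max 0 (g y))" "integrable lborel (\<lambda>y. indicator {x<..} y * max 0 (- g y))"
      by (rule Bochner_Integration.integrable_bound[OF g]; auto simp: indicator_def)+
    have "(LINT y|lborel. indicator {x<..} y * max 0 (g y)) - (LINT y|lborel. indicator {x<..} y * max 0 (- g y))
      = (LINT y|lborel. indicator {x<..} y * g y)"
      unfolding Bochner_Integration.integral_diff[OF i, symmetric]
      by (rule Bochner_Integration.integral_cong) (auto simp: indicator_def)
    then show "emeasure P {x<..} = emeasure N {x<..}" using int by (simp add: emP)
  qed (auto simp: P_def N_def)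
  have zero: "AE x in lborel. max 0 (c * g x) = 0" if c: "c = 1 \<or> c = - 1" for c
  proof -
    let ?A = "{x. 0 < c * g x}"
    have i: "integrable lborel (\<lambda>y. max 0 (c * g y))"
      by (rule Bochner_Integration.integrable_bound[OF g]) (use c in auto)
    have A: "?A \<in> sets borel" by measurable
    have eq0: "(\<lambda>y. indicator ?A y * max 0 (- c * g y)) = (\<lambda>_. 0)"
      by (auto simp: indicator_def)
    have "(LINT y|lborel. indicator ?A y * max 0 (- c * g y)) = 0" unfolding eq0 by simp
    then have "(LINT y|lborel. indicator ?A y * max 0 (c * g y)) \<le> 0"
      using emP[OF A] \<open>P = N\<close> c by (auto simp: ennreal_eq_0_iff)
    also have "(LINT y|lborel. indicator ?A y * max 0 (c * g y)) = (LINT y|lborel. max 0 (c * g y))"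
      by (rule Bochner_Integration.integral_cong) (auto simp: indicator_def)
    finally have "(LINT y|lborel. max 0 (c * g y)) = 0"
      by (intro antisym) (auto intro: integral_nonneg_AE)
    then show ?thesis using integral_nonneg_eq_0_iff_AE[OF i] by simp
  qed
  have "AE x in lborel. max 0 (1 * g x) = 0" "AE x in lborel. max 0 (-1 * g x) = 0"
    by (rule zero; simp)+
  then show ?thesis by eventually_elim (auto simp: max_def split: if_splits)
qed

theorem fundamental_lemma:
  fixes g :: "real \<Rightarrow> real"
  assumes g: "integrable lborel g" and t: "0 < t"
    and test: "\<And>\<phi>. test_fun t \<phi> \<Longrightarrow> (LINT x:{0<..<t}|lborel. g x * \<phi> x) = 0"
  shows "AE x in lborel. x \<in> {0<..<t} \<longrightarrow> g x = 0"
proof -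
  have [measurable]: "g \<in> borel_measurable borel" using g by auto
  have interval: "(LINT x|lborel. g x * indicator {a<..<b} x) = 0" if ab: "0 \<le> a" "b \<le> t" for a b
  proof -
    \<comment> \<open>The bumps lie between 0 and 1 and converge to the indicator, so \<bar>g\<bar>
      is a dominating function. \<open>Suc n\<close> keeps the parameter of the bump
      positive.\<close>
    have "(\<lambda>n. LINT x|lborel. g x * bump (real (Suc n)) a b x) \<longlonglongrightarrow> (LINT x|lborel. g x * indicator {a<..<b} x)"
    proof (rule integral_dominated_convergence[where w = "\<lambda>x. \<bar>g x\<bar>"])
      show "(\<lambda>x. g x * bump (real (Suc n)) a b x) \<in> borel_measurable lborel" for n
        using integrable_mult_test_fun[OF test_fun_bump[OF _ ab, of "real (Suc n)"] g] by auto
      show "AE x in lborel. (\<lambda>n. g x * bump (real (Suc n)) a b x) \<longlonglongrightarrow> g x * indicator {a<..<b} x"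
        by (intro AE_I2 tendsto_mult tendsto_const LIMSEQ_Suc[OF bump_tendsto])
      show "AE x in lborel. norm (g x * bump (real (Suc n)) a b x) \<le> \<bar>g x\<bar>" for n
        using bump_bounds by (intro AE_I2) (auto simp: abs_mult intro!: mult_right_le_one_le)
    qed (use g in auto)
    moreover have "(LINT x|lborel. g x * bump (real (Suc n)) a b x) = 0" for n
    proof -
      have tf: "test_fun t (bump (real (Suc n)) a b)" by (rule test_fun_bump[OF _ ab]) simp
      show ?thesis using test[OF tf] by (simp only: set_integral_test_fun[OF tf])
    qed
    ultimately have "(\<lambda>n. 0) \<longlonglongrightarrow> (LINT x|lborel. g x * indicator {a<..<b} x)" by simp
    then show ?thesis by (simp add: LIMSEQ_const_iff)
  qed
  have "AE x in lborel. indicator {0<..<t} x * g x = 0"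
  proof (rule AE_eq_0_from_intervals)
    show "integrable lborel (\<lambda>x. indicator {0<..<t} x * g x)"
      using integrable_mult_indicator[OF _ g, of "{0<..<t}"] by simp
    fix x
    have "(LINT y|lborel. indicator {x<..} y * (indicator {0<..<t} y * g y)) = (LINT y|lborel. g y * indicator {max x 0<..<t} y)"
      by (rule Bochner_Integration.integral_cong) (auto simp: indicator_def)
    then show "(LINT y|lborel. indicator {x<..} y * (indicator {0<..<t} y * g y)) = 0"
      using interval[of "max x 0" t] by simp
  qed
  then show ?thesis by eventually_elim auto
qed

lemma integrable_indicator_Icc: "integrable lborel (indicator {0..t::real} :: real \<Rightarrow> real)"
  by (rule integrable_real_indicator) (auto simp: emeasure_lborel_Icc_eq)

lemma test_fun_indicator: "test_fun t \<phi> \<Longrightarrow> indicator {0..t} x * \<phi> x = \<phi> x"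
  using test_fun_props(4)[of t \<phi> x] by (cases "x \<in> {0..t}") auto

lemma integrable_test_fun:
  assumes "test_fun t \<phi>" shows "integrable lborel \<phi>"
proof -
  have "set_integrable lborel {0..t} \<phi>"
    by (rule borel_integrable_atLeastAtMost') (rule test_fun_props(3)[OF assms])
  then show ?thesis by (simp add: set_integrable_def test_fun_indicator[OF assms])
qed

lemma test_fun_lincomb:
  assumes "test_fun t \<phi>" "test_fun t \<psi>" shows "test_fun t (\<lambda>x. \<phi> x + c * \<psi> x)"
proof -
  obtain a b where 1: "0 < a" "b < t" "\<And>x. x \<notin> {a..b} \<Longrightarrow> \<phi> x = 0" using assms by (auto simp: test_fun_def)
  obtain a' b' where 2: "0 < a'" "b' < t" "\<And>x. x \<notin> {a'..b'} \<Longrightarrow> \<psi> x = 0" using assms by (auto simp: test_fun_def)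
  have "\<phi> x + c * \<psi> x = 0" if "x \<notin> {min a a'..max b b'}" for x
  proof -
    have "x \<notin> {a..b}" "x \<notin> {a'..b'}" using that by auto
    then show ?thesis using 1(3) 2(3) by simp
  qed
  moreover have "0 < min a a'" "max b b' < t" using 1 2 by auto
  moreover have "times_diff n (\<lambda>x. \<phi> x + c * \<psi> x)" for n
    using assms by (intro times_diff_add times_diff_cmult) (auto simp: test_fun_iff)
  ultimately show ?thesis unfolding test_fun_iff by blast
qed

text \<open>Zero integral makes the primitive vanish to the right of the support. The lower limit -1
  lies to the left of the support, so the primitive has a two-sided derivative wherever \<psi> may
  be nonzero.\<close>

lemma test_fun_primitive:
  assumes tf: "test_fun t \<psi>" and zero: "(LINT x|lborel. \<psi> x) = 0"
  obtains \<phi> where "test_fun t \<phi>" "deriv \<phi> = \<psi>"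
proof -
  obtain a b where ab: "0 < a" "b < t" "\<And>x. x \<notin> {a..b} \<Longrightarrow> \<psi> x = 0" using tf by (auto simp: test_fun_def)
  define \<phi> where "\<phi> = (\<lambda>x. integral {-1..x} \<psi>)"
  have left: "\<phi> x = 0" if "x < a" for x
  proof -
    have "integral {-1..x} \<psi> = integral {-1..x} (\<lambda>_. 0)"
      by (rule integral_cong) (use that ab in auto)
    then show ?thesis by (simp add: \<phi>_def)
  qed
  have right: "\<phi> x = 0" if "b < x" for x
  proof -
    have "integral {-1..x} \<psi> = integral UNIV (\<lambda>y. if y \<in> {-1..x} then \<psi> y else 0)"
      by (rule integral_restrict_UNIV[symmetric])
    also have "(\<lambda>y. if y \<in> {-1..x} then \<psi> y else 0) = \<psi>"
      using ab that by (auto simp: fun_eq_iff)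
    also have "integral UNIV \<psi> = 0"
      using integral_lborel[OF integrable_test_fun[OF tf]] zero by simp
    finally show ?thesis by (simp add: \<phi>_def)
  qed
  have der: "(\<phi> has_real_derivative \<psi> x) (at x)" for x
  proof (cases "x < a")
    case True
    have "((\<lambda>_. 0) has_real_derivative \<psi> x) (at x)" using True ab(3)[of x] by simp
    then show ?thesis
      by (rule has_field_derivative_transform_within_open[where S = "{..<a}"]) (use True left in auto)
  next
    case False
    have "(\<phi> has_real_derivative \<psi> x) (at x within {-1..x + 1})"
      unfolding \<phi>_def by (rule integral_has_real_derivative[OF test_fun_props(3)[OF tf]]) (use False ab in auto)
    then show ?thesis using False ab by (simp add: at_within_Icc_at)
  qed
  have "times_diff n \<phi>" for n
    using times_diff_SucI[OF der, of n] tf times_diff_Suc_imp by (auto simp: test_fun_iff)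
  moreover have "\<forall>x. x \<notin> {a..b} \<longrightarrow> \<phi> x = 0" using left right by (auto simp: not_le)
  ultimately have "test_fun t \<phi>" unfolding test_fun_iff using ab by blast
  then show ?thesis using that deriv_eqI[OF der] by blast
qed

lemma test_fun_mass:
  assumes t: "0 < t" obtains \<rho> where "test_fun t \<rho>" "(LINT x|lborel. \<rho> x) = 1"
proof -
  have tf: "test_fun t (bump (real (Suc n)) 0 t)" for n by (rule test_fun_bump) auto
  have "(\<lambda>n. LINT x|lborel. bump (real (Suc n)) 0 t x) \<longlonglongrightarrow> (LINT x|lborel. indicator {0<..<t} x)"
  proof (rule integral_dominated_convergence[where w = "indicator {0..t}"])
    show "bump (real (Suc n)) 0 t \<in> borel_measurable lborel" for n
      using test_fun_props(5)[OF tf] by simp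
    show "AE x in lborel. (\<lambda>n. bump (real (Suc n)) 0 t x) \<longlonglongrightarrow> indicator {0<..<t} x"
      by (intro AE_I2 LIMSEQ_Suc[OF bump_tendsto])
    show "AE x in lborel. norm (bump (real (Suc n)) 0 t x) \<le> indicator {0..t} x" for n
      using bump_bounds test_fun_props(4)[OF tf] by (intro AE_I2) (auto simp: indicator_def)
    show "integrable lborel (indicator {0..t} :: real \<Rightarrow> real)" by (rule integrable_indicator_Icc)
  qed auto
  then have "\<forall>\<^sub>F n in sequentially. 0 < (LINT x|lborel. bump (real (Suc n)) 0 t x)"
    using t by (intro order_tendstoD(1)) auto
  then obtain n where n: "0 < (LINT x|lborel. bump (real (Suc n)) 0 t x)"
    by (auto simp: eventually_sequentially)
  define c where "c = (LINT x|lborel. bump (real (Suc n)) 0 t x)"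
  have "test_fun t (\<lambda>x. bump (real (Suc n)) 0 t x + (1 / c - 1) * bump (real (Suc n)) 0 t x)"
    by (rule test_fun_lincomb[OF tf tf])
  then have "test_fun t (\<lambda>x. bump (real (Suc n)) 0 t x / c)" by (simp add: left_diff_distrib)
  then show ?thesis using that[of "\<lambda>x. bump (real (Suc n)) 0 t x / c"] n by (simp add: c_def)
qed

text \<open>The argument of du Bois-Reymond: subtracting from \<psi> its integral times a fixed
  \<rho> of mass 1 leaves the derivative of a test function. Hence v - c integrates to 0 against
  every \<psi>, where c is the integral of v against \<rho>.\<close>

lemma weak_const:
  fixes v :: "real \<Rightarrow> real"
  assumes v: "integrable lborel v" and t: "0 < t"
    and weak: "\<And>\<phi>. test_fun t \<phi> \<Longrightarrow> (LINT x|lborel. v x * deriv \<phi> x) = 0"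
  obtains c where "AE x in lborel. x \<in> {0<..<t} \<longrightarrow> v x = c"
proof -
  obtain \<rho> where \<rho>: "test_fun t \<rho>" "(LINT x|lborel. \<rho> x) = 1" using test_fun_mass[OF t] .
  define c where "c = (LINT x|lborel. v x * \<rho> x)"
  have ind: "integrable lborel (indicator {0..t} :: real \<Rightarrow> real)"
    by (rule integrable_indicator_Icc)
  have "AE x in lborel. x \<in> {0<..<t} \<longrightarrow> v x - c * indicator {0..t} x = 0"
  proof (rule fundamental_lemma[OF _ t])
    show "integrable lborel (\<lambda>x. v x - c * indicator {0..t} x)" using v ind by simp
    fix \<psi> assume \<psi>: "test_fun t \<psi>"
    define r where "r = (LINT x|lborel. \<psi> x)"
    have i: "integrable lborel \<psi>" "integrable lborel \<rho>" "integrable lborel (\<lambda>x. v x * \<psi> x)" "integrable lborel (\<lambda>x. v x * \<rho> x)"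
      by (rule integrable_test_fun[OF \<psi>] integrable_test_fun[OF \<rho>(1)] integrable_mult_test_fun[OF \<psi> v]
          integrable_mult_test_fun[OF \<rho>(1) v])+
    have tf: "test_fun t (\<lambda>x. \<psi> x + - r * \<rho> x)" by (rule test_fun_lincomb[OF \<psi> \<rho>(1)])
    have "(LINT x|lborel. \<psi> x + - r * \<rho> x) = 0" using i \<rho>(2) by (simp add: r_def)
    then obtain \<phi> where "test_fun t \<phi>" "deriv \<phi> = (\<lambda>x. \<psi> x + - r * \<rho> x)"
      using test_fun_primitive[OF tf] by blast
    then have "(LINT x|lborel. v x * (\<psi> x + - r * \<rho> x)) = 0" using weak by metis
    also have "(\<lambda>x. v x * (\<psi> x + - r * \<rho> x)) = (\<lambda>x. v x * \<psi> x - r * (v x * \<rho> x))"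
      by (simp add: algebra_simps)
    also have "(LINT x|lborel. v x * \<psi> x - r * (v x * \<rho> x)) = (LINT x|lborel. v x * \<psi> x) - r * c"
      using i by (simp add: c_def)
    finally have eq: "(LINT x|lborel. v x * \<psi> x) = c * r" by simp
    have e: "(\<lambda>x. (v x - c * indicator {0..t} x) * \<psi> x) = (\<lambda>x. v x * \<psi> x - c * \<psi> x)"
      by (simp add: fun_eq_iff left_diff_distrib mult.assoc test_fun_indicator[OF \<psi>])
    show "(LINT x:{0<..<t}|lborel. (v x - c * indicator {0..t} x) * \<psi> x) = 0"
      unfolding set_integral_test_fun[OF \<psi>] unfolding e using i eq by (simp add: r_def)
  qed
  then have "AE x in lborel. x \<in> {0<..<t} \<longrightarrow> v x = c"
    by eventually_elim (auto simp: indicator_def)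
  then show ?thesis by (rule that)
qed

text \<open>The finite set S admits a derivative with jumps; continuity of f makes the boundary
  terms between neighbouring pieces cancel.\<close>

lemma integral_by_parts_test_fun:
  fixes f f' :: "real \<Rightarrow> real"
  assumes t: "0 < t" and f: "continuous_on {0..t} f" and S: "finite S"
    and der: "\<And>x. x \<in> {0<..<t} - S \<Longrightarrow> (f has_real_derivative f' x) (at x)"
    and f': "f' \<in> borel_measurable borel" "\<And>x. x \<in> {0..t} \<Longrightarrow> \<bar>f' x\<bar> \<le> C" and \<phi>: "test_fun t \<phi>"
  shows "(LINT x:{0<..<t}|lborel. f x * deriv \<phi> x) = - (LINT x:{0<..<t}|lborel. f' x * \<phi> x)"
proof -
  note \<phi>' = test_fun_props[OF \<phi>] and d\<phi> = test_fun_props[OF test_fun_props(2)[OF \<phi>]]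
  have [measurable]: "f' \<in> borel_measurable borel" "\<phi> \<in> borel_measurable borel" using f' \<phi>'(5) by auto
  obtain D where D: "\<And>x. \<bar>\<phi> x\<bar> \<le> D" using \<phi>'(6) by blast
  have i1: "set_integrable lborel {0..t} (\<lambda>x. f' x * \<phi> x)"
    unfolding set_integrable_def
  proof (rule Bochner_Integration.integrable_bound[of _ "\<lambda>x. C * D * indicator {0..t} x"])
    have "\<bar>f' x * \<phi> x\<bar> \<le> \<bar>C * D\<bar>" if "x \<in> {0..t}" for x
    proof -
      have "0 \<le> D" "0 \<le> C" using D[of x] f'(2)[OF that] by linarith+
      then show ?thesis using mult_mono[OF f'(2)[OF that] D[of x]] by (simp add: abs_mult)
    qed
    then show "AE x in lborel. norm (indicator {0..t} x *\<^sub>R (f' x * \<phi> x)) \<le> norm (C * D * indicator {0..t} x)"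
      by (intro AE_I2) (auto simp: indicator_def)
    show "integrable lborel (\<lambda>x. C * D * indicator {0..t} x)"
      by (intro integrable_mult_right integrable_indicator_Icc)
  qed auto
  have i2: "set_integrable lborel {0..t} (\<lambda>x. f x * deriv \<phi> x)"
    by (rule borel_integrable_atLeastAtMost') (intro continuous_intros f d\<phi>(3))
  have "((\<lambda>x. f' x * \<phi> x + f x * deriv \<phi> x) has_integral f t * \<phi> t - f 0 * \<phi> 0) {0..t}"
  proof (rule fundamental_theorem_of_calculus_interior_strong[OF S])
    show "((\<lambda>x. f x * \<phi> x) has_vector_derivative f' x * \<phi> x + f x * deriv \<phi> x) (at x)"
      if "x \<in> {0<..<t} - S" for x
      using DERIV_mult[OF der[OF that] \<phi>'(1)]
      by (simp add: has_real_derivative_iff_has_vector_derivative add.commute mult.commute)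
    show "continuous_on {0..t} (\<lambda>x. f x * \<phi> x)" by (intro continuous_intros f \<phi>'(3))
  qed (use t in simp)
  then have "integral {0..t} (\<lambda>x. f' x * \<phi> x + f x * deriv \<phi> x) = 0"
    using \<phi>'(4) by (simp add: integral_unique)
  then have "(LINT x:{0..t}|lborel. f' x * \<phi> x + f x * deriv \<phi> x) = 0"
    using set_borel_integral_eq_integral(2)[OF set_integral_add(1)[OF i1 i2]] by simp
  then have sum0: "(LINT x:{0..t}|lborel. f' x * \<phi> x) + (LINT x:{0..t}|lborel. f x * deriv \<phi> x) = 0"
    using set_integral_add(2)[OF i1 i2] by simp
  have "(LINT x:{0..t}|lborel. g x * \<psi> x) = (LINT x:{0<..<t}|lborel. g x * \<psi> x)" if "test_fun t \<psi>" for g \<psi>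
    unfolding set_integral_test_fun[OF that] set_lebesgue_integral_def
    by (rule Bochner_Integration.integral_cong) (use test_fun_props(4)[OF that] in \<open>auto simp: indicator_def\<close>)
  from this[OF \<phi>] this[OF test_fun_props(2)[OF \<phi>]] show ?thesis using sum0 by simp
qed

text \<open>The same argument one order higher: with C the integral of v against deriv \<rho>, the
  function v + C x has vanishing weak derivative and is constant, so the slope of v is - C.\<close>

lemma weak_affine:
  fixes v :: "real \<Rightarrow> real"
  assumes v: "integrable lborel v" and t: "0 < t"
    and weak: "\<And>\<phi>. test_fun t \<phi> \<Longrightarrow> (LINT x|lborel. v x * deriv (deriv \<phi>) x) = 0"
  obtains A B where "AE x in lborel. x \<in> {0<..<t} \<longrightarrow> v x = A + B * x"
proof -
  obtain \<rho> where \<rho>: "test_fun t \<rho>" "(LINT x|lborel. \<rho> x) = 1" using test_fun_mass[OF t] .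
  note d\<rho> = test_fun_props(2)[OF \<rho>(1)]
  define C where "C = (LINT x|lborel. v x * deriv \<rho> x)"
  have ix: "integrable lborel (\<lambda>x. indicator {0..t} x * x)"
    using borel_integrable_atLeastAtMost'[OF continuous_on_id, of 0 t] by (simp add: set_integrable_def)
  have "\<exists>c. AE x in lborel. x \<in> {0<..<t} \<longrightarrow> v x + C * (indicator {0..t} x * x) = c"
  proof -
    have W: "(LINT x|lborel. (v x + C * (indicator {0..t} x * x)) * deriv \<psi> x) = 0" if \<psi>: "test_fun t \<psi>" for \<psi>
    proof -
      note d\<psi> = test_fun_props(2)[OF \<psi>]
      define r where "r = (LINT x|lborel. \<psi> x)"
      have i: "integrable lborel \<psi>" "integrable lborel \<rho>" "integrable lborel (\<lambda>x. v x * deriv \<psi> x)"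
        "integrable lborel (\<lambda>x. v x * deriv \<rho> x)" "integrable lborel (\<lambda>x. indicator {0..t} x * x * deriv \<psi> x)"
        by (rule integrable_test_fun[OF \<psi>] integrable_test_fun[OF \<rho>(1)] integrable_mult_test_fun[OF d\<psi> v]
            integrable_mult_test_fun[OF d\<rho> v] integrable_mult_test_fun[OF d\<psi> ix])+
      have tf: "test_fun t (\<lambda>x. \<psi> x + - r * \<rho> x)" by (rule test_fun_lincomb[OF \<psi> \<rho>(1)])
      have "(LINT x|lborel. \<psi> x + - r * \<rho> x) = 0" using i \<rho>(2) by (simp add: r_def)
      then obtain \<phi> where \<phi>: "test_fun t \<phi>" "deriv \<phi> = (\<lambda>x. \<psi> x + - r * \<rho> x)"
        using test_fun_primitive[OF tf] by blast
      have "deriv (deriv \<phi>) = (\<lambda>x. deriv \<psi> x + - r * deriv \<rho> x)"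
        unfolding \<phi>(2) by (intro deriv_eqI DERIV_add DERIV_cmult test_fun_props(1)[OF \<psi>] test_fun_props(1)[OF \<rho>(1)])
      then have "(LINT x|lborel. v x * (deriv \<psi> x + - r * deriv \<rho> x)) = 0" using weak[OF \<phi>(1)] by simp
      also have "(\<lambda>x. v x * (deriv \<psi> x + - r * deriv \<rho> x)) = (\<lambda>x. v x * deriv \<psi> x - r * (v x * deriv \<rho> x))"
        by (simp add: algebra_simps)
      also have "(LINT x|lborel. v x * deriv \<psi> x - r * (v x * deriv \<rho> x)) = (LINT x|lborel. v x * deriv \<psi> x) - r * C"
        using i by (simp add: C_def)
      finally have eq: "(LINT x|lborel. v x * deriv \<psi> x) = C * r" by simp
      have "(LINT x:{0<..<t}|lborel. x * deriv \<psi> x) = - (LINT x:{0<..<t}|lborel. 1 * \<psi> x)"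
        by (rule integral_by_parts_test_fun[OF t _ finite.emptyI, where C = 1]) (auto intro: \<psi> continuous_intros)
      then have x\<psi>: "(LINT x|lborel. x * deriv \<psi> x) = - r"
        unfolding set_integral_test_fun[OF \<psi>] set_integral_test_fun[OF d\<psi>] by (simp add: r_def)
      have e: "indicator {0..t} x * x * deriv \<psi> x = x * deriv \<psi> x" for x
        using test_fun_indicator[OF d\<psi>, of x] by (metis mult.assoc mult.commute)
      have x\<psi>': "(LINT x|lborel. indicator {0..t} x * x * deriv \<psi> x) = - r" unfolding e by (rule x\<psi>)
      have "(\<lambda>x. (v x + C * (indicator {0..t} x * x)) * deriv \<psi> x) = (\<lambda>x. v x * deriv \<psi> x + C * (indicator {0..t} x * x * deriv \<psi> x))"
        by (simp add: algebra_simps)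
      then show ?thesis using i eq x\<psi>' by simp
    qed
    have "integrable lborel (\<lambda>x. v x + C * (indicator {0..t} x * x))"
      by (intro Bochner_Integration.integrable_add integrable_mult_right v ix)
    from weak_const[OF this t W] show ?thesis by blast
  qed
  then obtain c where "AE x in lborel. x \<in> {0<..<t} \<longrightarrow> v x + C * (indicator {0..t} x * x) = c" ..
  then have "AE x in lborel. x \<in> {0<..<t} \<longrightarrow> v x = c + (- C) * x"
    by eventually_elim (auto simp: indicator_def)
  then show ?thesis by (rule that)
qed

section \<open>The second primitive of an integrable function\<close>

text \<open>For w supported in [0, t] this is, on [0, t], the second primitive of w with value and
  slope 0 at 0.\<close>

definition potential :: "(real \<Rightarrow> real) \<Rightarrow> real \<Rightarrow> real" where
  "potential w x = (LINT s|lborel. max 0 (x - s) * w s)"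

lemma potential_integrable:
  fixes w :: "real \<Rightarrow> real"
  assumes w: "integrable lborel w" "\<And>s. s \<notin> {0..t} \<Longrightarrow> w s = 0"
  shows "integrable lborel (\<lambda>s. max 0 (x - s) * w s)"
proof (rule Bochner_Integration.integrable_bound)
  show "integrable lborel (\<lambda>s. \<bar>x\<bar> * w s)" using w(1) by simp
  have [measurable]: "w \<in> borel_measurable borel" using w by auto
  show "(\<lambda>s. max 0 (x - s) * w s) \<in> borel_measurable lborel" by measurable
  have "\<bar>max 0 (x - s)\<bar> * \<bar>w s\<bar> \<le> \<bar>x\<bar> * \<bar>w s\<bar>" for s
    using w(2)[of s] by (cases "s \<in> {0..t}") (auto intro!: mult_right_mono)
  then show "AE s in lborel. norm (max 0 (x - s) * w s) \<le> norm (\<bar>x\<bar> * w s)"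
    by (intro AE_I2) (simp add: abs_mult)
qed

lemma potential_0:
  assumes "\<And>s. s \<notin> {0..t} \<Longrightarrow> w s = 0" shows "potential w 0 = 0"
proof -
  have "max 0 (0 - s) * w s = 0" for s
    using assms[of s] by (cases "s \<in> {0..t}") (auto simp: max_def)
  then show ?thesis unfolding potential_def by (simp only: integral_zero)
qed

lemma continuous_on_potential:
  assumes w: "integrable lborel w" "\<And>s. s \<notin> {0..t} \<Longrightarrow> w s = 0"
  shows "continuous_on A (potential w)"
proof -
  define L where "L = (LINT s|lborel. \<bar>w s\<bar>)"
  have "\<bar>potential w x - potential w y\<bar> \<le> L * \<bar>x - y\<bar>" for x y
  proof -
    have eq: "potential w x - potential w y = (LINT s|lborel. max 0 (x - s) * w s - max 0 (y - s) * w s)"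
      unfolding potential_def
      by (rule Bochner_Integration.integral_diff[symmetric, OF potential_integrable[OF w] potential_integrable[OF w]])
    have "\<bar>potential w x - potential w y\<bar> \<le> (LINT s|lborel. \<bar>max 0 (x - s) * w s - max 0 (y - s) * w s\<bar>)"
      unfolding eq by (rule integral_abs_bound)
    also have "\<dots> \<le> (LINT s|lborel. \<bar>x - y\<bar> * \<bar>w s\<bar>)"
    proof (rule integral_mono)
      show "integrable lborel (\<lambda>s. \<bar>max 0 (x - s) * w s - max 0 (y - s) * w s\<bar>)"
        by (intro integrable_abs Bochner_Integration.integrable_diff potential_integrable[OF w])
      show "integrable lborel (\<lambda>s. \<bar>x - y\<bar> * \<bar>w s\<bar>)" using w(1) by simp
      fix s
      have "\<bar>max 0 (x - s) - max 0 (y - s)\<bar> * \<bar>w s\<bar> \<le> \<bar>x - y\<bar> * \<bar>w s\<bar>"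
        by (intro mult_right_mono) auto
      then show "\<bar>max 0 (x - s) * w s - max 0 (y - s) * w s\<bar> \<le> \<bar>x - y\<bar> * \<bar>w s\<bar>"
        by (simp only: left_diff_distrib[symmetric] abs_mult)
    qed
    finally show ?thesis by (simp add: L_def mult.commute)
  qed
  moreover have "0 \<le> L" by (simp add: L_def)
  ultimately have "L-lipschitz_on A (potential w)"
    by (intro lipschitz_onI) (auto simp: dist_real_def)
  then show ?thesis by (rule lipschitz_on_continuous_on)
qed

text \<open>Fubini lets the second derivative of \<phi> meet the kernel, and integration by parts
  against max 0 (x - s) returns \<phi> s.\<close>

lemma potential_weak:
  assumes w: "integrable lborel w" "\<And>s. s \<notin> {0..t} \<Longrightarrow> w s = 0" and t: "0 < t" and \<phi>: "test_fun t \<phi>"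
  shows "(LINT x|lborel. potential w x * deriv (deriv \<phi>) x) = (LINT x|lborel. w x * \<phi> x)"
proof -
  note d\<phi> = test_fun_props(2)[OF \<phi>]
  note dd\<phi> = test_fun_props(2)[OF d\<phi>]
  have inner: "(LINT x|lborel. deriv (deriv \<phi>) x * max 0 (x - s)) = \<phi> s" if s: "s \<in> {0..t}" for s
  proof -
    have i: "set_integrable lborel {0..t} (\<lambda>x. deriv (deriv \<phi>) x * max 0 (x - s))"
      by (rule borel_integrable_atLeastAtMost') (intro continuous_intros test_fun_props(3)[OF dd\<phi>])
    \<comment> \<open>A primitive of deriv (deriv \<phi>) x * max 0 (x - s) in x, equal to 0 to the
      left of s.\<close>
    define F where "F = (\<lambda>x. max 0 (x - s) * deriv \<phi> x - (\<phi> (max x s) - \<phi> s))"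
    have "((\<lambda>x. deriv (deriv \<phi>) x * max 0 (x - s)) has_integral F t - F 0) {0..t}"
    proof (rule fundamental_theorem_of_calculus_interior_strong[of "{s}"])
      show "continuous_on {0..t} F" unfolding F_def
        by (intro continuous_intros continuous_on_compose2[OF test_fun_props(3)[OF \<phi>, of UNIV]] test_fun_props(3)[OF d\<phi>]) auto
      fix x assume x: "x \<in> {0<..<t} - {s}"
      show "(F has_vector_derivative deriv (deriv \<phi>) x * max 0 (x - s)) (at x)"
        unfolding has_real_derivative_iff_has_vector_derivative[symmetric]
      proof (cases "x < s")
        case True
        have "((\<lambda>_. 0) has_real_derivative deriv (deriv \<phi>) x * max 0 (x - s)) (at x)" using True by simp
        then show "(F has_real_derivative deriv (deriv \<phi>) x * max 0 (x - s)) (at x)"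
          by (rule has_field_derivative_transform_within_open[where S = "{..<s}"]) (use True in \<open>auto simp: F_def\<close>)
      next
        case False
        have "((\<lambda>x. (x - s) * deriv \<phi> x - (\<phi> x - \<phi> s)) has_real_derivative deriv (deriv \<phi>) x * max 0 (x - s)) (at x)"
          using False by (auto intro!: derivative_eq_intros test_fun_props(1)[OF \<phi>] test_fun_props(1)[OF d\<phi>])
        then show "(F has_real_derivative deriv (deriv \<phi>) x * max 0 (x - s)) (at x)"
          by (rule has_field_derivative_transform_within_open[where S = "{s<..}"]) (use False x in \<open>auto simp: F_def\<close>)
      qed
    qed (use t in auto)
    then have "integral {0..t} (\<lambda>x. deriv (deriv \<phi>) x * max 0 (x - s)) = F t - F 0"
      by (rule integral_unique)
    also have "F t = \<phi> s"
      using s test_fun_props(4)[OF \<phi>, of t] test_fun_props(4)[OF d\<phi>, of t] 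
      by (simp add: F_def max_absorb1)
    also have "F 0 = 0"
      using s test_fun_props(4)[OF d\<phi>, of 0] by (simp add: F_def max_absorb2)
    finally have *: "(LINT x:{0..t}|lborel. deriv (deriv \<phi>) x * max 0 (x - s)) = \<phi> s"
      using set_borel_integral_eq_integral(2)[OF i] by simp
    have e: "indicator {0..t} x *\<^sub>R (deriv (deriv \<phi>) x * max 0 (x - s)) = deriv (deriv \<phi>) x * max 0 (x - s)" for x
      using test_fun_indicator[OF dd\<phi>, of x] by (simp add: mult.assoc[symmetric])
    show ?thesis using * unfolding set_lebesgue_integral_def e .
  qed
  have "(LINT x|lborel. potential w x * deriv (deriv \<phi>) x) = (LINT x|lborel. deriv (deriv \<phi>) x * (LINT s|lborel. max 0 (x - s) * w s))"
    by (simp add: potential_def mult.commute)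
  also have "\<dots> = (LINT s|lborel. (LINT x|lborel. deriv (deriv \<phi>) x * max 0 (x - s)) * w s)"
  proof (rule kernel_fubini[where C = t])
    show "\<bar>deriv (deriv \<phi>) x * (max 0 (x - s) * w s)\<bar> \<le> t * \<bar>deriv (deriv \<phi>) x\<bar> * \<bar>w s\<bar>" for x s
    proof (cases "x \<in> {0<..<t} \<and> s \<in> {0..t}")
      case True
      then have "\<bar>max 0 (x - s)\<bar> * (\<bar>deriv (deriv \<phi>) x\<bar> * \<bar>w s\<bar>) \<le> t * (\<bar>deriv (deriv \<phi>) x\<bar> * \<bar>w s\<bar>)"
        by (intro mult_right_mono) auto
      then show ?thesis by (simp add: abs_mult mult_ac)
    next
      case False
      then show ?thesis using w(2)[of s] test_fun_props(4)[OF dd\<phi>, of x] by auto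
    qed
  qed (use w(1) integrable_test_fun[OF dd\<phi>] lborel.sigma_finite_measure_axioms in auto)
  also have "(\<lambda>s. (LINT x|lborel. deriv (deriv \<phi>) x * max 0 (x - s)) * w s) = (\<lambda>s. w s * \<phi> s)"
  proof
    show "(LINT x|lborel. deriv (deriv \<phi>) x * max 0 (x - s)) * w s = w s * \<phi> s" for s
      using inner[of s] w(2)[of s] by (cases "s \<in> {0..t}") auto
  qed
  finally show ?thesis .
qed

lemma continuous_AE_eq_0:
  fixes d :: "real \<Rightarrow> real"
  assumes t: "0 < t" and d: "continuous_on {0..t} d" and ae: "AE x in lborel. x \<in> {0<..<t} \<longrightarrow> d x = 0"
    and x: "x \<in> {0..t}"
  shows "d x = 0"
proof -
  have c: "continuous_on {0..t} (\<lambda>x. \<bar>d x\<bar>)" by (intro continuous_intros d)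
  have i: "set_integrable lborel {0..t} (\<lambda>x. \<bar>d x\<bar>)" by (rule borel_integrable_atLeastAtMost'[OF c])
  have "AE x in lborel. x \<noteq> 0" "AE x in lborel. x \<noteq> t" by (rule AE_lborel_singleton)+
  with ae have "AE x in lborel. indicator {0..t} x *\<^sub>R \<bar>d x\<bar> = 0"
    by eventually_elim (auto simp: indicator_def)
  then have "(LINT x:{0..t}|lborel. \<bar>d x\<bar>) = 0"
    unfolding set_lebesgue_integral_def by (rule integral_eq_zero_AE)
  then have "integral {0..t} (\<lambda>x. \<bar>d x\<bar>) = 0" using set_borel_integral_eq_integral(2)[OF i] by simp
  then show ?thesis using integral_eq_0_iff[OF c t] x by auto
qed

section \<open>Approximation numbers\<close>

lemma ae_eq_refl: "ae_eq f f \<longleftrightarrow> f \<in> borel_measurable borel"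
  by (simp add: ae_eq_def)

lemma rep_L0_measurable [measurable]: "rep_L0 u \<in> borel_measurable borel"
  using Quotient_rep_reflp[OF Quotient_L0, of u] by (simp add: ae_eq_def)

lemma abs_rep_L0 [simp]: "abs_L0 (rep_L0 u) = u"
  by (rule Quotient_abs_rep[OF Quotient_L0])

lemma abs_L0_eqI:
  assumes "f \<in> borel_measurable borel" "g \<in> borel_measurable borel" "AE x in lborel. f x = g x"
  shows "abs_L0 f = abs_L0 g"
  by (rule Quotient_rel_abs[OF Quotient_L0]) (use assms in \<open>simp add: ae_eq_def\<close>)

lemma rep_abs_L0: "f \<in> borel_measurable borel \<Longrightarrow> AE x in lborel. rep_L0 (abs_L0 f) x = f x"
  using Quotient_rep_abs[OF Quotient_L0, of f] by (simp add: ae_eq_def)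

lemma abs_L0_add:
  "f \<in> borel_measurable borel \<Longrightarrow> g \<in> borel_measurable borel \<Longrightarrow> abs_L0 f + abs_L0 g = abs_L0 (\<lambda>x. f x + g x)"
  by (rule plus_L0.abs_eq) (simp_all add: ae_eq_refl)

lemma abs_L0_diff:
  "f \<in> borel_measurable borel \<Longrightarrow> g \<in> borel_measurable borel \<Longrightarrow> abs_L0 f - abs_L0 g = abs_L0 (\<lambda>x. f x - g x)"
  by (rule minus_L0.abs_eq) (simp_all add: ae_eq_refl)

lemma abs_L0_scaleR: "f \<in> borel_measurable borel \<Longrightarrow> c *\<^sub>R abs_L0 f = abs_L0 (\<lambda>x. c * f x)"
  by (rule scaleR_L0.abs_eq) (simp add: ae_eq_refl)

lemma abs_L0_sum:
  assumes "finite I" "\<And>i. i \<in> I \<Longrightarrow> f i \<in> borel_measurable borel"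
  shows "(\<Sum>i\<in>I. abs_L0 (f i)) = abs_L0 (\<lambda>x. \<Sum>i\<in>I. f i x)"
  using assms
proof (induction I rule: finite_induct)
  case empty
  then show ?case by (simp add: zero_L0.abs_eq)
next
  case (insert i I)
  then have "f i \<in> borel_measurable borel" "(\<lambda>x. \<Sum>i\<in>I. f i x) \<in> borel_measurable borel" by auto
  then show ?case using insert by (simp add: abs_L0_add)
qed

lemma carr_Lp: "u \<in> carr (Lp p t) \<longleftrightarrow> in_Lp p t u"
  by (simp add: Lp_def)

lemma nrm_Lp: "nrm (Lp p t) = Lp_norm p"
  by (simp add: Lp_def)

lemma abs_L0_in_Lp:
  assumes "f \<in> borel_measurable borel"
  shows "abs_L0 f \<in> carr (Lp p t) \<longleftrightarrow> (AE x in lborel. x \<notin> {0..t} \<longrightarrow> f x = 0) \<and> integrable lborel (\<lambda>x. \<bar>f x\<bar> powr p)"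
  unfolding carr_Lp by (rule in_Lp.abs_eq) (simp add: ae_eq_refl assms)

lemma abs_L0_norm:
  assumes "f \<in> borel_measurable borel"
  shows "Lp_norm p (abs_L0 f) = (LINT x|lborel. \<bar>f x\<bar> powr p) powr (1 / p)"
  by (rule Lp_norm.abs_eq) (simp add: ae_eq_refl assms)

lemma powr_le_1_plus: "1 \<le> p \<Longrightarrow> 0 \<le> a \<Longrightarrow> a \<le> 1 + a powr p" for a p :: real
proof (cases "a \<le> 1")
  case False
  assume "1 \<le> p"
  then have "a powr 1 \<le> a powr p" using False by (intro powr_mono) auto
  then show ?thesis using False by simp
qed (simp add: add_increasing2)

text \<open>Cutting off by the indicator replaces vanishing almost everywhere outside [0, t] by
  vanishing everywhere. Integrability of w follows from \<bar>w\<bar> \<le> 1 + \<bar>w\<bar> powr p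
  on the bounded interval.\<close>

lemma Lp_repr:
  assumes p: "1 < p" and u: "u \<in> carr (Lp p t)"
  obtains w where "w \<in> borel_measurable borel" "\<And>x. x \<notin> {0..t} \<Longrightarrow> w x = 0" "u = abs_L0 w"
    "integrable lborel (\<lambda>x. \<bar>w x\<bar> powr p)" "integrable lborel w"
    "Lp_norm p u = (LINT x|lborel. \<bar>w x\<bar> powr p) powr (1 / p)"
proof -
  define w where "w = (\<lambda>x. indicator {0..t} x * rep_L0 u x)"
  have m [measurable]: "w \<in> borel_measurable borel" unfolding w_def by measurable
  have u': "AE x in lborel. x \<notin> {0..t} \<longrightarrow> rep_L0 u x = 0" "integrable lborel (\<lambda>x. \<bar>rep_L0 u x\<bar> powr p)"
    using u by (auto simp: carr_Lp in_Lp.rep_eq)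
  have "AE x in lborel. rep_L0 u x = w x" using u'(1) by eventually_elim (auto simp: w_def indicator_def)
  then have eq: "u = abs_L0 w" using abs_L0_eqI[OF rep_L0_measurable m] by simp
  have i: "integrable lborel (\<lambda>x. \<bar>w x\<bar> powr p)" using u m abs_L0_in_Lp unfolding eq by blast
  have iw: "integrable lborel w"
  proof (rule Bochner_Integration.integrable_bound)
    show "integrable lborel (\<lambda>x. indicator {0..t} x + \<bar>w x\<bar> powr p)"
      by (intro Bochner_Integration.integrable_add integrable_indicator_Icc i)
    show "AE x in lborel. norm (w x) \<le> norm (indicator {0..t} x + \<bar>w x\<bar> powr p)"
      using powr_le_1_plus[of p] p by (intro AE_I2) (auto simp: w_def indicator_def)
  qed simp
  show ?thesis
    by (rule that[OF m _ eq i iw]) (simp_all add: eq abs_L0_norm[OF m], simp add: w_def)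
qed

lemma abs_L0_weak_deriv:
  assumes "f \<in> borel_measurable borel" "g \<in> borel_measurable borel"
  shows "weak_deriv t k (abs_L0 f) (abs_L0 g) \<longleftrightarrow> (\<forall>\<phi>. test_fun t \<phi> \<longrightarrow>
     (LINT x:{0<..<t}|lborel. f x * (deriv ^^ k) \<phi> x) = (-1) ^ k * (LINT x:{0<..<t}|lborel. g x * \<phi> x))"
  by (rule weak_deriv.abs_eq) (simp_all add: ae_eq_refl assms)

text \<open>Two weak derivatives have the same integrals against all test functions, so the
  fundamental lemma applies to their difference. This is what evaluates the definite description in
  the norm of \<open>W2D\<close>.\<close>

lemma weak_deriv_unique:
  assumes t: "0 < t" and p: "1 < p" and w: "w \<in> carr (Lp p t)" "weak_deriv t k u w"
    and w': "w' \<in> carr (Lp p t)" "weak_deriv t k u w'"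
  shows "w = w'"
proof -
  obtain f where f: "f \<in> borel_measurable borel" "\<And>x. x \<notin> {0..t} \<Longrightarrow> f x = 0" "w = abs_L0 f" "integrable lborel f"
    using Lp_repr[OF p w(1)] by metis
  obtain g where g: "g \<in> borel_measurable borel" "\<And>x. x \<notin> {0..t} \<Longrightarrow> g x = 0" "w' = abs_L0 g" "integrable lborel g"
    using Lp_repr[OF p w'(1)] by metis
  have ae: "AE x in lborel. x \<in> {0<..<t} \<longrightarrow> f x - g x = 0"
  proof (rule fundamental_lemma[OF _ t])
    show "integrable lborel (\<lambda>x. f x - g x)" using f g by simp
    fix \<phi> assume \<phi>: "test_fun t \<phi>"
    have W: "weak_deriv t k (abs_L0 (rep_L0 u)) (abs_L0 f)" "weak_deriv t k (abs_L0 (rep_L0 u)) (abs_L0 g)"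
      using w(2) w'(2) f(3) g(3) by simp_all
    have "(-1) ^ k * (LINT x:{0<..<t}|lborel. f x * \<phi> x) = (-1) ^ k * (LINT x:{0<..<t}|lborel. g x * \<phi> x)"
      using W(1)[unfolded abs_L0_weak_deriv[OF rep_L0_measurable f(1)], rule_format, OF \<phi>]
        W(2)[unfolded abs_L0_weak_deriv[OF rep_L0_measurable g(1)], rule_format, OF \<phi>] by (rule trans[OF sym])
    then have "(LINT x:{0<..<t}|lborel. f x * \<phi> x) = (LINT x:{0<..<t}|lborel. g x * \<phi> x)" by simp
    then have "(LINT x|lborel. f x * \<phi> x) = (LINT x|lborel. g x * \<phi> x)"
      unfolding set_integral_test_fun[OF \<phi>] .
    then show "(LINT x:{0<..<t}|lborel. (f x - g x) * \<phi> x) = 0"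
      unfolding set_integral_test_fun[OF \<phi>] unfolding left_diff_distrib
      using integrable_mult_test_fun[OF \<phi> f(4)] integrable_mult_test_fun[OF \<phi> g(4)] by simp
  qed
  have ends: "AE x in lborel. x \<noteq> 0" "AE x in lborel. x \<noteq> t" by (rule AE_lborel_singleton)+
  have pt: "f x = g x" if "x \<in> {0<..<t} \<longrightarrow> f x - g x = 0" "x \<noteq> 0" "x \<noteq> t" for x
    using that f(2)[of x] g(2)[of x] by (cases "x \<in> {0<..<t}") auto
  from ae ends have "AE x in lborel. f x = g x" by eventually_elim (rule pt)
  then show ?thesis unfolding f(3) g(3) by (rule abs_L0_eqI[OF f(1) g(1)])
qed

lemma nrm_W2D:
  assumes "0 < t" "1 < p" "w \<in> carr (Lp p t)" "weak_deriv t 2 u w"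
  shows "nrm (W2D p t) u = Lp_norm p w"
proof -
  have "(THE w. w \<in> carr (Lp p t) \<and> weak_deriv t 2 u w) = w"
    using assms weak_deriv_unique by (intro the_equality) blast+
  then show ?thesis by (simp add: W2D_def)
qed

text \<open>Subtracting \<open>potential w\<close> from u leaves a function whose second weak
  derivative vanishes, hence an affine one. The boundary condition at 0 removes its constant term,
  so that w and the slope B describe u completely; the condition at t ties B to w.\<close>

lemma W2D_repr:
  assumes t: "0 < t" and p: "1 < p" and u: "u \<in> carr (W2D p t)"
  obtains w B f where "w \<in> borel_measurable borel" "\<And>x. x \<notin> {0..t} \<Longrightarrow> w x = 0" "integrable lborel w"
    "integrable lborel (\<lambda>x. \<bar>w x\<bar> powr p)" "nrm (W2D p t) u = (LINT x|lborel. \<bar>w x\<bar> powr p) powr (1 / p)"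
    "f \<in> borel_measurable borel" "continuous_on {0..t} f" "\<And>x. x \<in> {0..t} \<Longrightarrow> f x = B * x + potential w x"
    "\<And>x. x \<notin> {0..t} \<Longrightarrow> f x = 0" "f t = 0" "u = abs_L0 f"
proof -
  have u': "u \<in> carr (Lp p t)" "\<exists>v\<in>carr (Lp p t). weak_deriv t 2 u v" "dirichlet t u"
    using u by (auto simp: W2D_def sobolev_def)
  then obtain v where v: "v \<in> carr (Lp p t)" "weak_deriv t 2 u v" by blast
  obtain w where w: "w \<in> borel_measurable borel" "\<And>x. x \<notin> {0..t} \<Longrightarrow> w x = 0" "v = abs_L0 w"
    "integrable lborel (\<lambda>x. \<bar>w x\<bar> powr p)" "integrable lborel w"
    "Lp_norm p v = (LINT x|lborel. \<bar>w x\<bar> powr p) powr (1 / p)"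
    using Lp_repr[OF p v(1)] by metis
  obtain g where g: "g \<in> borel_measurable borel" "\<And>x. x \<notin> {0..t} \<Longrightarrow> g x = 0" "u = abs_L0 g" "integrable lborel g"
    using Lp_repr[OF p u'(1)] by metis
  have cV: "continuous_on A (potential w)" for A by (rule continuous_on_potential[OF w(5,2)])
  have mV [measurable]: "potential w \<in> borel_measurable borel" by (rule borel_measurable_continuous_onI[OF cV])
  define d where "d = (\<lambda>x. g x - indicator {0..t} x * potential w x)"
  have iV: "integrable lborel (\<lambda>x. indicator {0..t} x * potential w x)"
    using borel_integrable_atLeastAtMost'[OF cV, of 0 t] by (simp add: set_integrable_def)
  have id: "integrable lborel d" unfolding d_def using g iV by simp
  have "(LINT x|lborel. d x * deriv (deriv \<phi>) x) = 0" if \<phi>: "test_fun t \<phi>" for \<phi>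
  proof -
    note d\<phi> = test_fun_props(2)[OF \<phi>]
    note dd\<phi> = test_fun_props(2)[OF d\<phi>]
    have "(LINT x:{0<..<t}|lborel. g x * (deriv ^^ 2) \<phi> x) = (-1) ^ 2 * (LINT x:{0<..<t}|lborel. w x * \<phi> x)"
      using v(2) \<phi> unfolding w(3) g(3) abs_L0_weak_deriv[OF g(1) w(1)] by blast
    then have "(LINT x:{0<..<t}|lborel. g x * deriv (deriv \<phi>) x) = (LINT x:{0<..<t}|lborel. w x * \<phi> x)"
      by (simp add: numeral_2_eq_2)
    then have 1: "(LINT x|lborel. g x * deriv (deriv \<phi>) x) = (LINT x|lborel. w x * \<phi> x)"
      unfolding set_integral_test_fun[OF \<phi>] set_integral_test_fun[OF dd\<phi>] .
    have e: "indicator {0..t} x * potential w x * deriv (deriv \<phi>) x = potential w x * deriv (deriv \<phi>) x" for x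
      using test_fun_indicator[OF dd\<phi>, of x] by (metis mult.assoc mult.commute)
    have 2: "(LINT x|lborel. indicator {0..t} x * potential w x * deriv (deriv \<phi>) x) = (LINT x|lborel. w x * \<phi> x)"
      unfolding e by (rule potential_weak[OF w(5,2) t \<phi>])
    show ?thesis
      unfolding d_def left_diff_distrib using 1 2 integrable_mult_test_fun[OF dd\<phi> g(4)] integrable_mult_test_fun[OF dd\<phi> iV]
      by simp
  qed
  then obtain A B where AB: "AE x in lborel. x \<in> {0<..<t} \<longrightarrow> d x = A + B * x"
    using weak_affine[OF id t] by blast
  obtain c where c: "continuous_on {0..t} c" "AE x in lborel. x \<in> {0..t} \<longrightarrow> g x = c x" "c 0 = 0" "c t = 0"
    using u'(3) unfolding g(3) dirichlet.abs_eq[of g, unfolded ae_eq_refl, OF g(1)] by blast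
  have ceq: "c x - (A + B * x + potential w x) = 0" if "x \<in> {0..t}" for x
  proof (rule continuous_AE_eq_0[OF t _ _ that])
    show "continuous_on {0..t} (\<lambda>x. c x - (A + B * x + potential w x))" by (intro continuous_intros c(1) cV)
    show "AE x in lborel. x \<in> {0<..<t} \<longrightarrow> c x - (A + B * x + potential w x) = 0"
      using AB c(2) by eventually_elim (auto simp: d_def)
  qed
  have A0: "A = 0" using ceq[of 0] c(3) potential_0[of t w, OF w(2)] t by simp
  define f where "f = (\<lambda>x. indicator {0..t} x * (B * x + potential w x))"
  have mf: "f \<in> borel_measurable borel" unfolding f_def by measurable
  have fc: "f x = c x" if "x \<in> {0..t}" for x using ceq[OF that] that A0 by (simp add: f_def)
  have "g x = f x" if "x \<in> {0..t} \<longrightarrow> g x = c x" for x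
    using that g(2)[of x] fc[of x] by (cases "x \<in> {0..t}") (auto simp: f_def)
  with c(2) have "AE x in lborel. g x = f x" by (rule eventually_mono)
  then have uf: "u = abs_L0 f" unfolding g(3) by (rule abs_L0_eqI[OF g(1) mf])
  show ?thesis
  proof (rule that[OF w(1,2,5,4) _ mf _ _ _ _ uf])
    show "nrm (W2D p t) u = (LINT x|lborel. \<bar>w x\<bar> powr p) powr (1 / p)"
      using nrm_W2D[OF t p v] w(6) by simp
    show "continuous_on {0..t} f" by (subst continuous_on_cong[OF refl fc]) (auto intro: c(1))
    show "f t = 0" using fc[of t] c(4) t by simp
  qed (auto simp: f_def)
qed

lemma abs_L0_bounded_in_Lp:
  assumes f: "f \<in> borel_measurable borel" "\<And>x. x \<notin> {0..t} \<Longrightarrow> f x = 0" "\<And>x. x \<in> {0..t} \<Longrightarrow> \<bar>f x\<bar> \<le> C"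
    and p: "0 < p"
  shows "abs_L0 f \<in> carr (Lp p t)"
  unfolding abs_L0_in_Lp[OF f(1)]
proof (intro conjI AE_I2)
  show "x \<notin> {0..t} \<longrightarrow> f x = 0" for x using f(2) by blast
  show "integrable lborel (\<lambda>x. \<bar>f x\<bar> powr p)"
  proof (rule Bochner_Integration.integrable_bound)
    show "integrable lborel (\<lambda>x. C powr p * indicator {0..t} x)"
      by (intro integrable_mult_right integrable_indicator_Icc)
    have "\<bar>f x\<bar> powr p \<le> C powr p * indicator {0..t} x" for x
      using f(2)[of x] f(3)[of x] p by (cases "x \<in> {0..t}") (auto intro!: powr_mono2)
    then show "AE x in lborel. norm (\<bar>f x\<bar> powr p) \<le> norm (C powr p * indicator {0..t} x)"
      by (intro AE_I2) (simp add: order.trans[OF _ abs_ge_self])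
    show "(\<lambda>x. \<bar>f x\<bar> powr p) \<in> borel_measurable lborel" using f(1) by simp
  qed
qed

text \<open>Membership from classical data: two integrations by parts show that u1 and w represent
  the weak derivatives, and the finite set S allows kinks of u1. Only the second conclusion concerns
  q, so its condition 0 < q stands inside that conclusion.\<close>

lemma W2D_intro:
  fixes u u1 w :: "real \<Rightarrow> real"
  assumes t: "0 < t" and p: "1 < p" and S: "finite S"
    and u: "continuous_on {0..t} u" "\<And>x. x \<in> {0<..<t} \<Longrightarrow> (u has_real_derivative u1 x) (at x)"
    and u1: "continuous_on {0..t} u1" "\<And>x. x \<in> {0<..<t} - S \<Longrightarrow> (u1 has_real_derivative w x) (at x)"
    and w: "w \<in> borel_measurable borel" "\<And>x. x \<in> {0..t} \<Longrightarrow> \<bar>w x\<bar> \<le> C"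
    and ends: "u 0 = 0" "u t = 0"
  defines "e \<equiv> abs_L0 (\<lambda>x. indicator {0..t} x * u x)"
  shows "e \<in> carr (W2D p t)" "e \<in> carr (Lp q t) \<or> \<not> 0 < q"
    "nrm (W2D p t) e = (LINT x:{0..t}|lborel. \<bar>w x\<bar> powr p) powr (1 / p)"
proof -
  have m: "(\<lambda>x. indicator {0..t} x * f x) \<in> borel_measurable borel" if "continuous_on {0..t} f" for f :: "real \<Rightarrow> real"
    using borel_measurable_continuous_on_indicator[OF _ that] by simp
  have mw: "(\<lambda>x. indicator {0..t} x * w x) \<in> borel_measurable borel" using w(1) by simp
  obtain Cu where Cu: "\<And>x. x \<in> {0..t} \<Longrightarrow> \<bar>u x\<bar> \<le> Cu"
    using compact_imp_bounded[OF compact_continuous_image[OF u(1)]]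
    unfolding bounded_iff by (metis compact_Icc image_eqI real_norm_def)
  obtain Cu1 where Cu1: "\<And>x. x \<in> {0..t} \<Longrightarrow> \<bar>u1 x\<bar> \<le> Cu1"
    using compact_imp_bounded[OF compact_continuous_image[OF u1(1)]]
    unfolding bounded_iff by (metis compact_Icc image_eqI real_norm_def)
  have inLp: "abs_L0 (\<lambda>x. indicator {0..t} x * f x) \<in> carr (Lp r t)"
    if "(\<lambda>x. indicator {0..t} x * f x) \<in> borel_measurable borel" "\<And>x. x \<in> {0..t} \<Longrightarrow> \<bar>f x\<bar> \<le> K" "0 < r" for f K r
    by (rule abs_L0_bounded_in_Lp[where C = K]) (use that in auto)
  have p0: "0 < p" using p by simp
  have uLp: "abs_L0 (\<lambda>x. indicator {0..t} x * u x) \<in> carr (Lp r t)" if "0 < r" for r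
    by (rule inLp[OF m[OF u(1)] _ that]) (rule Cu)
  have u1Lp: "abs_L0 (\<lambda>x. indicator {0..t} x * u1 x) \<in> carr (Lp p t)"
    by (rule inLp[OF m[OF u1(1)] _ p0]) (rule Cu1)
  have wLp: "abs_L0 (\<lambda>x. indicator {0..t} x * w x) \<in> carr (Lp p t)"
    by (rule inLp[OF mw _ p0]) (rule w(2))
  have ind: "(LINT x:{0<..<t}|lborel. (indicator {0..t} x * f x) * g x) = (LINT x:{0<..<t}|lborel. f x * g x)" for f g :: "real \<Rightarrow> real"
    unfolding set_lebesgue_integral_def by (rule Bochner_Integration.integral_cong) (auto simp: indicator_def)
  have ibp1: "(LINT x:{0<..<t}|lborel. u x * deriv \<phi> x) = - (LINT x:{0<..<t}|lborel. u1 x * \<phi> x)" if \<phi>: "test_fun t \<phi>" for \<phi>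
  proof -
    have "(LINT x:{0<..<t}|lborel. u x * deriv \<phi> x) = - (LINT x:{0<..<t}|lborel. (indicator {0..t} x * u1 x) * \<phi> x)"
      by (rule integral_by_parts_test_fun[OF t u(1) finite.emptyI _ m[OF u1(1)] _ \<phi>, where C = Cu1]) (use u(2) Cu1 in auto)
    then show ?thesis unfolding ind .
  qed
  have ibp2: "(LINT x:{0<..<t}|lborel. u1 x * deriv \<phi> x) = - (LINT x:{0<..<t}|lborel. w x * \<phi> x)" if \<phi>: "test_fun t \<phi>" for \<phi>
    by (rule integral_by_parts_test_fun[OF t u1(1) S u1(2) w(1) _ \<phi>]) (use w(2) in auto)
  have wd1: "weak_deriv t 1 e (abs_L0 (\<lambda>x. indicator {0..t} x * u1 x))"
    unfolding e_def abs_L0_weak_deriv[OF m[OF u(1)] m[OF u1(1)]] ind using ibp1 by simp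
  have wd2: "weak_deriv t 2 e (abs_L0 (\<lambda>x. indicator {0..t} x * w x))"
    unfolding e_def abs_L0_weak_deriv[OF m[OF u(1)] mw] ind
  proof (intro allI impI)
    fix \<phi> assume \<phi>: "test_fun t \<phi>"
    show "(LINT x:{0<..<t}|lborel. u x * (deriv ^^ 2) \<phi> x) = (-1) ^ 2 * (LINT x:{0<..<t}|lborel. w x * \<phi> x)"
      using ibp1[OF test_fun_props(2)[OF \<phi>]] ibp2[OF \<phi>] by (simp add: numeral_2_eq_2)
  qed
  have "dirichlet t e"
    unfolding e_def dirichlet.abs_eq[unfolded ae_eq_refl, OF m[OF u(1)]]
    by (intro exI[of _ u] conjI u(1) ends AE_I2) auto
  moreover have "e \<in> sobolev 2 p t"
  proof -
    have "\<exists>v\<in>carr (Lp p t). weak_deriv t k e v" if "k \<in> {1..2}" for k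
    proof -
      have "k = 1 \<or> k = 2" using that by auto
      then show ?thesis using u1Lp wLp wd1 wd2 by blast
    qed
    then show ?thesis using uLp[OF p0] by (simp add: sobolev_def e_def)
  qed
  ultimately show "e \<in> carr (W2D p t)" by (simp add: W2D_def)
  show "e \<in> carr (Lp q t) \<or> \<not> 0 < q" using uLp[of q] by (auto simp: e_def)
  have "nrm (W2D p t) e = (LINT x|lborel. \<bar>indicator {0..t} x * w x\<bar> powr p) powr (1 / p)"
    using nrm_W2D[OF t p wLp wd2] abs_L0_norm[OF mw] by simp
  also have "(LINT x|lborel. \<bar>indicator {0..t} x * w x\<bar> powr p) = (LINT x:{0..t}|lborel. \<bar>w x\<bar> powr p)"
    unfolding set_lebesgue_integral_def by (rule Bochner_Integration.integral_cong) (auto simp: indicator_def)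
  finally show "nrm (W2D p t) e = (LINT x:{0..t}|lborel. \<bar>w x\<bar> powr p) powr (1 / p)" .
qed

section \<open>The error of linear interpolation on cells\<close>

text \<open>Concavity of x powr \<theta>, in the form of Young's inequality with exponent 1 /
  \<theta> applied to powers of 1 / n and A k / S; both of these sum to 1 over k.\<close>

lemma power_mean:
  fixes A :: "nat \<Rightarrow> real"
  assumes A: "\<And>k. 0 \<le> A k" and \<theta>: "0 < \<theta>" "\<theta> \<le> 1" and n: "1 \<le> n"
  shows "(\<Sum>k<n. A k powr \<theta>) \<le> real n powr (1 - \<theta>) * (\<Sum>k<n. A k) powr \<theta>"
proof (cases "\<theta> = 1 \<or> (\<Sum>k<n. A k) = 0")
  case True
  then show ?thesis
  proof
    assume "\<theta> = 1"
    then show ?thesis using A n by (simp add: sum_nonneg)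
  next
    assume "(\<Sum>k<n. A k) = 0"
    then have "A k = 0" if "k < n" for k using sum_nonneg_eq_0_iff[of "{..<n}" A] A that by auto
    then show ?thesis by simp
  qed
next
  case False
  define S where "S = (\<Sum>k<n. A k)"
  have S: "0 < S" unfolding S_def using False sum_nonneg[of "{..<n}" A] A by fastforce
  have r: "1 < 1 / \<theta>" using False \<theta> by simp
  have each: "(1 / n) powr (1 - \<theta>) * (A k / S) powr \<theta> \<le> (1 - \<theta>) / n + \<theta> * (A k / S)" for k
  proof -
    have B: "0 \<le> A k / S" using A S by simp
    have "((1 / n) powr \<theta>) powr (1 / \<theta> - 1) * (A k / S) powr \<theta>
      \<le> (1 - 1 / (1 / \<theta>)) * ((1 / n) powr \<theta>) powr (1 / \<theta>) + ((A k / S) powr \<theta>) powr (1 / \<theta>) / (1 / \<theta>)"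
      by (rule young[OF r]) auto
    moreover have "((1 / n) powr \<theta>) powr (1 / \<theta> - 1) = (1 / n) powr (1 - \<theta>)"
      unfolding powr_powr using \<theta> by (simp add: right_diff_distrib)
    moreover have "((1 / n) powr \<theta>) powr (1 / \<theta>) = 1 / n" "((A k / S) powr \<theta>) powr (1 / \<theta>) = A k / S"
      unfolding powr_powr using \<theta> A[of k] S by simp_all
    ultimately show ?thesis by (simp add: mult.commute)
  qed
  have "(1 / n) powr (1 - \<theta>) * (\<Sum>k<n. (A k / S) powr \<theta>) \<le> (\<Sum>k<n. (1 - \<theta>) / n + \<theta> * (A k / S))"
    unfolding sum_distrib_left by (rule sum_mono) (rule each)
  also have "\<dots> = (1 - \<theta>) + \<theta> * ((\<Sum>k<n. A k) / S)"
    using n by (simp add: sum.distrib sum_distrib_left sum_divide_distrib)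
  also have "\<dots> = 1" using S by (simp add: S_def)
  finally have *: "(1 / n) powr (1 - \<theta>) * (\<Sum>k<n. (A k / S) powr \<theta>) \<le> 1" .
  have "(\<Sum>k<n. (A k / S) powr \<theta>) = (\<Sum>k<n. A k powr \<theta>) / S powr \<theta>"
    using A S by (simp add: powr_divide sum_divide_distrib)
  then have "(\<Sum>k<n. A k powr \<theta>) / (real n powr (1 - \<theta>) * S powr \<theta>) \<le> 1"
    using * n by (simp add: powr_divide mult.commute)
  then show ?thesis using S n by (simp add: S_def divide_le_eq split: if_splits)
qed

lemma set_integral_affine:
  fixes g :: "real \<Rightarrow> real"
  assumes "0 < h"
  shows "(LINT x:{a..a + h}|lborel. g x) = h * (\<integral>\<sigma>. g (a + h * \<sigma>) \<partial>unitm)"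
proof -
  have "(LINT x:{a..a + h}|lborel. g x) = \<bar>h\<bar> *\<^sub>R (LINT x|lborel. indicator {a..a + h} (a + h * x) *\<^sub>R g (a + h * x))"
    unfolding set_lebesgue_integral_def by (rule lborel_integral_real_affine) (use assms in simp)
  moreover have ind: "indicator {a..a + h} (a + h * x) = (indicator {0..1} x :: real)" for x
    using assms by (auto simp: indicator_def zero_le_mult_iff)
  ultimately show ?thesis using assms by (simp add: integral_unitm set_lebesgue_integral_def)
qed

lemma integrable_affine:
  fixes g :: "real \<Rightarrow> real"
  assumes "integrable lborel g" "0 < h"
  shows "integrable unitm (\<lambda>\<sigma>. g (a + h * \<sigma>))"
proof -
  have "integrable lborel (\<lambda>\<sigma>. g (a + h * \<sigma>))"
    using lborel_integrable_real_affine[OF assms(1), of h a] assms(2) by simp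
  from integrable_mult_indicator[OF _ this, of "{0..1}"] show ?thesis
    by (simp add: integrable_unitm set_integrable_def)
qed

lemma set_integral_split:
  fixes g :: "real \<Rightarrow> real"
  assumes h: "0 < h" and g: "set_integrable lborel {0..real n * h} g"
  shows "(LINT x:{0..real n * h}|lborel. g x) = (\<Sum>k<n. LINT x:{real k * h..real k * h + h}|lborel. g x)"
  using g
proof (induction n)
  case 0
  have "AE x in lborel. x \<noteq> (0::real)" by (rule AE_lborel_singleton)
  then have "AE x in lborel. indicator {0..0} x *\<^sub>R g x = 0" by eventually_elim auto
  then show ?case by (simp add: set_lebesgue_integral_def integral_eq_zero_AE)
next
  case (Suc n)
  have un: "{0..real (Suc n) * h} = {0..real n * h} \<union> {real n * h..real n * h + h}"
    by (subst ivl_disj_un_two_touch(4)) (use h in \<open>auto simp: distrib_right\<close>)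
  have s: "set_integrable lborel {0..real n * h} g" "set_integrable lborel {real n * h..real n * h + h} g"
    by (rule set_integrable_subset[OF Suc.prems]; use un in auto)+
  have "AE x in lborel. x \<noteq> real n * h" by (rule AE_lborel_singleton)
  then have "AE x in lborel. \<not> (x \<in> {0..real n * h} \<and> x \<in> {real n * h..real n * h + h})"
    by eventually_elim auto
  then have "(LINT x:{0..real (Suc n) * h}|lborel. g x)
      = (LINT x:{0..real n * h}|lborel. g x) + (LINT x:{real n * h..real n * h + h}|lborel. g x)"
    unfolding un by (rule set_integral_Un_AE) (use s in auto)
  then show ?case using Suc.IH[OF s(1)] by simp
qed

text \<open>Linear interpolation reproduces affine functions, so the kernel \<open>E\<close> of its
  error vanishes for s outside the cell; inside, rescaled to [0, 1], it is minus the Green kernel.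
  One factor h comes from the kernel and one from the substitution.\<close>

lemma interpolation_error:
  assumes w: "integrable lborel w" "\<And>s. s \<notin> {0..t} \<Longrightarrow> w s = 0" and h: "0 < h" and z: "z \<in> {0..1}"
  shows "potential w (a + h * z) - ((1 - z) * potential w a + z * potential w (a + h))
    = - (h\<^sup>2 * green (\<lambda>\<sigma>. w (a + h * \<sigma>)) z)"
proof -
  define E where "E = (\<lambda>s. max 0 (a + h * z - s) - ((1 - z) * max 0 (a - s) + z * max 0 (a + h - s)))"
  note pi = potential_integrable[OF w]
  have "potential w (a + h * z) - ((1 - z) * potential w a + z * potential w (a + h))
    = (LINT s|lborel. max 0 (a + h * z - s) * w s - ((1 - z) * (max 0 (a - s) * w s) + z * (max 0 (a + h - s) * w s)))"
    unfolding potential_def using pi by simp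
  also have "\<dots> = (LINT s|lborel. E s * w s)"
    by (rule Bochner_Integration.integral_cong[OF refl]) (simp add: E_def algebra_simps)
  also have "\<dots> = \<bar>h\<bar> *\<^sub>R (LINT \<sigma>|lborel. E (a + h * \<sigma>) * w (a + h * \<sigma>))"
    by (rule lborel_integral_real_affine) (use h in simp)
  finally have 1: "potential w (a + h * z) - ((1 - z) * potential w a + z * potential w (a + h))
    = \<bar>h\<bar> *\<^sub>R (LINT \<sigma>|lborel. E (a + h * \<sigma>) * w (a + h * \<sigma>))" .
  have E: "E (a + h * \<sigma>) = - h * (indicator {0..1} \<sigma> * (min z \<sigma> - z * \<sigma>))" for \<sigma>
  proof -
    have hm: "max 0 (h * y) = h * max 0 y" for y using h by (simp add: max_def zero_le_mult_iff)
    have a: "a + h * z - (a + h * \<sigma>) = h * (z - \<sigma>)" "a - (a + h * \<sigma>) = h * (- \<sigma>)"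
      "a + h - (a + h * \<sigma>) = h * (1 - \<sigma>)" by (simp_all add: algebra_simps)
    have "E (a + h * \<sigma>) = h * (max 0 (z - \<sigma>) - ((1 - z) * max 0 (- \<sigma>) + z * max 0 (1 - \<sigma>)))"
      unfolding E_def a hm by (simp add: algebra_simps)
    also have "max 0 (z - \<sigma>) - ((1 - z) * max 0 (- \<sigma>) + z * max 0 (1 - \<sigma>)) = - (indicator {0..1} \<sigma> * (min z \<sigma> - z * \<sigma>))"
    proof -
      consider "\<sigma> < 0" | "1 < \<sigma>" | "\<sigma> \<in> {0..1}" by fastforce
      then show ?thesis
      proof cases
        case 1
        then show ?thesis using z by (simp add: max_def algebra_simps)
      next
        case 2
        then show ?thesis using z by (simp add: max_def)
      next
        case 3
        then show ?thesis by (cases "z \<le> \<sigma>") (auto simp: algebra_simps)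
      qed
    qed
    finally show ?thesis by simp
  qed
  have "(LINT \<sigma>|lborel. - h * (indicator {0..1} \<sigma> * (min z \<sigma> - z * \<sigma>)) * w (a + h * \<sigma>))
      = - h * (LINT \<sigma>|lborel. indicator {0..1} \<sigma> * ((min z \<sigma> - z * \<sigma>) * w (a + h * \<sigma>)))"
    by (simp add: mult.assoc)
  then show ?thesis unfolding 1 E
    using h by (simp add: green_def integral_unitm set_lebesgue_integral_def power2_eq_square)
qed

text \<open>On each cell the sharp constant applies to the rescaled w. The power of h collects 1
  from the cell length, 2 q from the factor h^2 in the error and - q / p from rescaling the integral
  of \<bar>w\<bar> powr p. The cells are combined by \<open>power_mean\<close> with exponent q / p
  \<le> 1.\<close>

lemma interpolation_inequality:
  fixes n :: nat
  assumes p: "1 < p" "1 < q" "q \<le> p" and h: "0 < h" and n: "1 \<le> n"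
    and w: "w \<in> borel_measurable borel" "integrable lborel (\<lambda>x. \<bar>w x\<bar> powr p)" "(LINT x|lborel. \<bar>w x\<bar> powr p) \<le> 1"
    and err: "set_integrable lborel {0..real n * h} (\<lambda>x. \<bar>err x\<bar> powr q)"
      "\<And>k z. k < n \<Longrightarrow> z \<in> {0..1} \<Longrightarrow> err (real k * h + h * z) = - (h\<^sup>2 * green (\<lambda>\<sigma>. w (real k * h + h * \<sigma>)) z)"
  shows "(LINT x:{0..real n * h}|lborel. \<bar>err x\<bar> powr q) \<le> h powr (1 + 2 * q - q / p) * real n powr (1 - q / p) * green_const p q"
proof -
  define \<Sigma> where "\<Sigma> = green_const p q"
  have \<Sigma>: "0 < \<Sigma>" unfolding \<Sigma>_def by (rule green_const_pos[OF p(1,2)])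
  define I where "I = (\<lambda>k. LINT x:{real k * h..real k * h + h}|lborel. \<bar>w x\<bar> powr p)"
  have I0: "0 \<le> I k" for k unfolding I_def set_lebesgue_integral_def by (intro integral_nonneg_AE AE_I2) simp
  have piece: "(LINT x:{real k * h..real k * h + h}|lborel. \<bar>err x\<bar> powr q) \<le> h powr (1 + 2 * q - q / p) * \<Sigma> * I k powr (q / p)"
    if k: "k < n" for k
  proof -
    let ?\<omega> = "\<lambda>\<sigma>. w (real k * h + h * \<sigma>)"
    have "?\<omega> \<in> borel_measurable borel" using w(1) by measurable
    then have m\<omega>: "?\<omega> \<in> borel_measurable unitm" by (rule measurable_unitm)
    have i\<omega>: "integrable unitm (\<lambda>\<sigma>. \<bar>?\<omega> \<sigma>\<bar> powr p)" using integrable_affine[OF w(2) h] .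
    have I: "I k = h * (\<integral>\<sigma>. \<bar>?\<omega> \<sigma>\<bar> powr p \<partial>unitm)" unfolding I_def by (rule set_integral_affine[OF h])
    have "(LINT x:{real k * h..real k * h + h}|lborel. \<bar>err x\<bar> powr q) = h * (\<integral>\<sigma>. \<bar>err (real k * h + h * \<sigma>)\<bar> powr q \<partial>unitm)"
      by (rule set_integral_affine[OF h])
    also have "(\<integral>\<sigma>. \<bar>err (real k * h + h * \<sigma>)\<bar> powr q \<partial>unitm) = (\<integral>\<sigma>. h powr (2 * q) * \<bar>green ?\<omega> \<sigma>\<bar> powr q \<partial>unitm)"
    proof (rule Bochner_Integration.integral_cong[OF refl])
      fix \<sigma> assume "\<sigma> \<in> space unitm"
      then have "\<bar>err (real k * h + h * \<sigma>)\<bar> = h\<^sup>2 * \<bar>green ?\<omega> \<sigma>\<bar>" using err(2)[OF k, of \<sigma>] by (simp add: abs_mult)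
      moreover have "(h\<^sup>2) powr q = h powr (2 * q)" using h by (simp add: powr_powr[symmetric])
      ultimately show "\<bar>err (real k * h + h * \<sigma>)\<bar> powr q = h powr (2 * q) * \<bar>green ?\<omega> \<sigma>\<bar> powr q"
        by (simp add: powr_mult)
    qed
    also have "\<dots> = h powr (2 * q) * (\<integral>\<sigma>. \<bar>green ?\<omega> \<sigma>\<bar> powr q \<partial>unitm)" by simp
    also have "h * (h powr (2 * q) * (\<integral>\<sigma>. \<bar>green ?\<omega> \<sigma>\<bar> powr q \<partial>unitm))
        \<le> h * (h powr (2 * q) * (\<Sigma> * (\<integral>\<sigma>. \<bar>?\<omega> \<sigma>\<bar> powr p \<partial>unitm) powr (q / p)))"
      unfolding \<Sigma>_def using h green_inequality(1)[OF p(1,2) m\<omega> i\<omega>] by (intro mult_left_mono) auto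
    also have "(\<integral>\<sigma>. \<bar>?\<omega> \<sigma>\<bar> powr p \<partial>unitm) = I k / h" using I h by simp
    also have "h * (h powr (2 * q) * (\<Sigma> * (I k / h) powr (q / p))) = h powr (1 + 2 * q - q / p) * \<Sigma> * I k powr (q / p)"
      using h I0[of k] by (simp add: powr_divide powr_add powr_diff field_simps)
    finally show ?thesis .
  qed
  have sumI: "(\<Sum>k<n. I k) \<le> 1"
  proof -
    have s: "set_integrable lborel {0..real n * h} (\<lambda>x. \<bar>w x\<bar> powr p)"
      using integrable_mult_indicator[OF _ w(2), of "{0..real n * h}"] by (simp add: set_integrable_def)
    have "(\<Sum>k<n. I k) = (LINT x:{0..real n * h}|lborel. \<bar>w x\<bar> powr p)"
      unfolding I_def by (rule set_integral_split[OF h s, symmetric])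
    also have "\<dots> \<le> (LINT x|lborel. \<bar>w x\<bar> powr p)"
      unfolding set_lebesgue_integral_def using s w(2)
      by (intro integral_mono) (auto simp: set_integrable_def indicator_def)
    finally show ?thesis using w(3) by simp
  qed
  have "(LINT x:{0..real n * h}|lborel. \<bar>err x\<bar> powr q) \<le> (\<Sum>k<n. h powr (1 + 2 * q - q / p) * \<Sigma> * I k powr (q / p))"
    unfolding set_integral_split[OF h err(1)] by (rule sum_mono) (use piece in auto)
  also have "\<dots> = h powr (1 + 2 * q - q / p) * \<Sigma> * (\<Sum>k<n. I k powr (q / p))"
    by (simp add: sum_distrib_left)
  also have "\<dots> \<le> h powr (1 + 2 * q - q / p) * \<Sigma> * real n powr (1 - q / p)"
  proof (intro mult_left_mono)
    have "(\<Sum>k<n. I k powr (q / p)) \<le> real n powr (1 - q / p) * (\<Sum>k<n. I k) powr (q / p)"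
      by (rule power_mean) (use I0 p n in auto)
    also have "\<dots> \<le> real n powr (1 - q / p) * 1"
      using sumI p sum_nonneg[of "{..<n}" I] I0 by (intro mult_left_mono powr_le1) auto
    finally show "(\<Sum>k<n. I k powr (q / p)) \<le> real n powr (1 - q / p)" by simp
  qed (use \<Sigma> in auto)
  finally show ?thesis by (simp add: \<Sigma>_def mult_ac)
qed

section \<open>Interpolation as an operator of rank below n\<close>

text \<open>Interpolation acts on classes, so nodal values are those of the continuous
  representative; where one exists it is unique on [0, t], which makes the description well
  defined.\<close>

definition point_value :: "real \<Rightarrow> L0 \<Rightarrow> real \<Rightarrow> real" where
  "point_value t u x = (THE y. \<exists>f. continuous_on {0..t} f \<and> (AE x in lborel. x \<in> {0..t} \<longrightarrow> rep_L0 u x = f x) \<and> y = f x)"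

lemma point_value_eq:
  assumes t: "0 < t" and f: "f \<in> borel_measurable borel" "continuous_on {0..t} f" and x: "x \<in> {0..t}"
  shows "point_value t (abs_L0 f) x = f x"
  unfolding point_value_def
proof (rule the_equality)
  have ae: "AE x in lborel. rep_L0 (abs_L0 f) x = f x" by (rule rep_abs_L0[OF f(1)])
  then have "AE x in lborel. x \<in> {0..t} \<longrightarrow> rep_L0 (abs_L0 f) x = f x" by eventually_elim simp
  then show "\<exists>g. continuous_on {0..t} g \<and> (AE x in lborel. x \<in> {0..t} \<longrightarrow> rep_L0 (abs_L0 f) x = g x) \<and> f x = g x"
    using f(2) by blast
  fix y assume "\<exists>g. continuous_on {0..t} g \<and> (AE x in lborel. x \<in> {0..t} \<longrightarrow> rep_L0 (abs_L0 f) x = g x) \<and> y = g x"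
  then obtain g where g: "continuous_on {0..t} g" "AE x in lborel. x \<in> {0..t} \<longrightarrow> rep_L0 (abs_L0 f) x = g x" "y = g x"
    by blast
  have "g x - f x = 0"
  proof (rule continuous_AE_eq_0[OF t _ _ x])
    show "continuous_on {0..t} (\<lambda>x. g x - f x)" by (intro continuous_intros g(1) f(2))
    show "AE x in lborel. x \<in> {0<..<t} \<longrightarrow> g x - f x = 0" using ae g(2) by eventually_elim simp
  qed
  then show "y = f x" using g(3) by simp
qed

definition hat :: "real \<Rightarrow> nat \<Rightarrow> real \<Rightarrow> real" where
  "hat h i x = max 0 (1 - \<bar>x - real i * h\<bar> / h)"

lemma hat_measurable [measurable]: "hat h i \<in> borel_measurable borel"
  unfolding hat_def by measurable

lemma hat_bounds: "0 \<le> hat h i x" "0 < h \<Longrightarrow> hat h i x \<le> 1"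
  by (auto simp: hat_def)

lemma hat_continuous: "0 < h \<Longrightarrow> continuous_on A (hat h i)"
  unfolding hat_def by (intro continuous_intros) auto

lemma hat_outside:
  assumes h: "0 < h" and i: "1 \<le> i" "i < n" and x: "x \<notin> {0..real n * h}"
  shows "hat h i x = 0"
proof -
  have "1 * h \<le> real i * h" "(real i + 1) * h \<le> real n * h" using h i by (auto intro: mult_right_mono)
  moreover have "(real i + 1) * h = real i * h + h" by (simp add: distrib_right)
  moreover have "x < 0 \<or> real n * h < x" using x by auto
  ultimately have "h \<le> \<bar>x - real i * h\<bar>" by linarith
  then have "1 \<le> \<bar>x - real i * h\<bar> / h" using h by simp
  then show ?thesis by (simp add: hat_def)
qed

text \<open>Only interior nodes occur in the sum. Since \<open>c 0\<close> and \<open>c n\<close>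
  vanish, the indices 0 and n may be added, and then exactly the two hats at the ends of the cell
  contribute.\<close>

lemma hat_interpolation:
  assumes h: "0 < h" and k: "k < n" and z: "z \<in> {0..1}" and c: "c 0 = 0" "c n = 0"
  shows "(\<Sum>i\<in>{1..<n}. c i * hat h i (real k * h + h * z)) = (1 - z) * c k + z * c (Suc k)"
proof -
  have hat: "hat h i (real k * h + h * z) = max 0 (1 - \<bar>real k + z - real i\<bar>)" for i
  proof -
    have "real k * h + h * z - real i * h = h * (real k + z - real i)" by (simp add: algebra_simps)
    then show ?thesis using h by (simp add: hat_def abs_mult)
  qed
  have "(\<Sum>i\<in>{1..<n}. c i * hat h i (real k * h + h * z)) = (\<Sum>i\<in>{0..n}. c i * hat h i (real k * h + h * z))"
    by (rule sum.mono_neutral_left) (use c in \<open>auto simp: not_less le_less Suc_le_eq\<close>)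
  also have "\<dots> = (\<Sum>i\<in>{k, Suc k}. c i * hat h i (real k * h + h * z))"
  proof (rule sum.mono_neutral_right)
    show "\<forall>i\<in>{0..n} - {k, Suc k}. c i * hat h i (real k * h + h * z) = 0"
    proof
      fix i assume "i \<in> {0..n} - {k, Suc k}"
      then have "i + 1 \<le> k \<or> k + 2 \<le> i" by auto
      then have "real i + 1 \<le> real k \<or> real k + 2 \<le> real i" by linarith
      then have "1 \<le> \<bar>real k + z - real i\<bar>" using z by auto
      then show "c i * hat h i (real k * h + h * z) = 0" by (simp add: hat)
    qed
  qed (use k in auto)
  also have "\<dots> = (1 - z) * c k + z * c (Suc k)" using z by (simp add: hat)
  finally show ?thesis .
qed

text \<open>The element v shows that the real supremum in \<open>op_norm\<close> is over a nonempty
  set.\<close>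

lemma op_norm_le:
  assumes "\<And>x. x \<in> carr X \<Longrightarrow> nrm X x \<le> 1 \<Longrightarrow> nrm Y (T x) \<le> M" "v \<in> carr X" "nrm X v \<le> 1"
  shows "op_norm X Y T \<le> M"
  unfolding op_norm_def by (rule cSUP_least) (use assms in auto)

lemma zero_in_W2D:
  assumes "0 < t" "1 < p" shows "0 \<in> carr (W2D p t)" "nrm (W2D p t) 0 = 0"
proof -
  have "(\<lambda>x. indicator {0..t} x * (0::real)) = (\<lambda>_. 0)" by simp
  then have e: "abs_L0 (\<lambda>x. indicator {0..t} x * 0) = 0" by (simp add: zero_L0.abs_eq)
  have *: "abs_L0 (\<lambda>x. indicator {0..t} x * 0) \<in> carr (W2D p t)"
    "nrm (W2D p t) (abs_L0 (\<lambda>x. indicator {0..t} x * 0)) = (LINT x:{0..t}|lborel. \<bar>0\<bar> powr p) powr (1 / p)"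
    by (rule W2D_intro[of t p "{}" "\<lambda>_. 0" "\<lambda>_. 0" "\<lambda>_. 0" 0]; use assms in simp)+
  show "0 \<in> carr (W2D p t)" using *(1) unfolding e .
  show "nrm (W2D p t) 0 = 0" using *(2) unfolding e by (simp add: set_lebesgue_integral_def)
qed

lemma potential_bound:
  assumes w: "integrable lborel w" "\<And>s. s \<notin> {0..t} \<Longrightarrow> w s = 0" and x: "x \<in> {0..t}"
  shows "\<bar>potential w x\<bar> \<le> t * (LINT s|lborel. \<bar>w s\<bar>)"
proof -
  have "\<bar>potential w x\<bar> \<le> (LINT s|lborel. \<bar>max 0 (x - s) * w s\<bar>)"
    unfolding potential_def by (rule integral_abs_bound)
  also have "\<dots> \<le> (LINT s|lborel. t * \<bar>w s\<bar>)"
  proof (rule integral_mono)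
    show "integrable lborel (\<lambda>s. \<bar>max 0 (x - s) * w s\<bar>)" by (intro integrable_abs potential_integrable[OF w])
    show "integrable lborel (\<lambda>s. t * \<bar>w s\<bar>)" using w(1) by simp
    show "\<bar>max 0 (x - s) * w s\<bar> \<le> t * \<bar>w s\<bar>" for s
      unfolding abs_mult using w(2)[of s] x by (cases "s \<in> {0..t}") (auto intro!: mult_right_mono)
  qed
  finally show ?thesis by simp
qed

text \<open>A crude form of Hoelder's inequality, from a \<le> 1 + a powr p with a = \<bar>w\<bar> /
  K. Its constant is not sharp; it serves for boundedness of the interpolation operator and
  definiteness of the norm.\<close>

lemma L1_le_Lp:
  fixes w :: "real \<Rightarrow> real"
  assumes p: "1 < p" and t: "0 < t" and w: "integrable lborel w" "integrable lborel (\<lambda>x. \<bar>w x\<bar> powr p)" "\<And>s. s \<notin> {0..t} \<Longrightarrow> w s = 0"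
  shows "(LINT s|lborel. \<bar>w s\<bar>) \<le> (t + 1) * (LINT x|lborel. \<bar>w x\<bar> powr p) powr (1 / p)"
proof (cases "(LINT x|lborel. \<bar>w x\<bar> powr p) = 0")
  case True
  then have "AE x in lborel. \<bar>w x\<bar> powr p = 0" using integral_nonneg_eq_0_iff_AE[OF w(2)] by simp
  then have "AE x in lborel. \<bar>w x\<bar> = 0" by eventually_elim simp
  then have "(LINT s|lborel. \<bar>w s\<bar>) = 0" by (rule integral_eq_zero_AE)
  then show ?thesis using t by simp
next
  case False
  define J where "J = (LINT x|lborel. \<bar>w x\<bar> powr p)"
  have "0 \<le> J" unfolding J_def by (intro integral_nonneg_AE AE_I2) simp
  then have J: "0 < J" using False unfolding J_def by linarith
  define K where "K = J powr (1 / p)"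
  have K: "0 < K" "K powr p = J" using J p by (simp_all add: K_def powr_powr)
  have "(LINT s|lborel. \<bar>w s\<bar>) \<le> (LINT s|lborel. K * (indicator {0..t} s + \<bar>w s\<bar> powr p / J))"
  proof (rule integral_mono)
    show "integrable lborel (\<lambda>s. \<bar>w s\<bar>)" using w(1) by simp
    show "integrable lborel (\<lambda>s. K * (indicator {0..t} s + \<bar>w s\<bar> powr p / J))"
      by (intro integrable_mult_right Bochner_Integration.integrable_add integrable_indicator_Icc integrable_divide w(2))
    show "\<bar>w s\<bar> \<le> K * (indicator {0..t} s + \<bar>w s\<bar> powr p / J)" for s
    proof (cases "s \<in> {0..t}")
      case True
      have "\<bar>w s\<bar> / K \<le> 1 + (\<bar>w s\<bar> / K) powr p" using p K by (intro powr_le_1_plus) auto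
      then have "K * (\<bar>w s\<bar> / K) \<le> K * (1 + (\<bar>w s\<bar> / K) powr p)" using K by (intro mult_left_mono) auto
      moreover have "(\<bar>w s\<bar> / K) powr p = \<bar>w s\<bar> powr p / J" using K by (simp add: powr_divide)
      ultimately show ?thesis using True K by simp
    qed (use w(3)[of s] K J in simp)
  qed
  also have "\<dots> = K * (t + J / J)"
    using integrable_indicator_Icc[of t] w(2) t by (simp add: J_def)
  finally show ?thesis using J by (simp add: K_def J_def[symmetric] mult.commute)
qed

theorem approx_number_bound:
  fixes n :: nat
  assumes t: "0 < t" and p: "1 < p" "1 < q" "q \<le> p" and n: "1 \<le> n"
  shows "approx_number (W2D p t) (Lp q t) E2 n
    \<le> ennreal (t powr (1 / q + 2 - 1 / p) / (real n)\<^sup>2 * green_const p q powr (1 / q))"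
proof -
  define h where "h = t / n"
  have h: "0 < h" "real n * h = t" using t n by (auto simp: h_def)
  \<comment> \<open>Piecewise linear interpolation; the sum runs over interior nodes because the
    boundary values are 0.\<close>
  define F where "F = (\<lambda>u. \<Sum>i\<in>{1..<n}. point_value t u (real i * h) *\<^sub>R abs_L0 (hat h i))"
  have node: "real i * h \<in> {0..t}" if "i \<le> n" for i
    using that h mult_right_mono[of "real i" "real n" h] by auto
  have F_abs: "F u = abs_L0 (\<lambda>x. \<Sum>i\<in>{1..<n}. point_value t u (real i * h) * hat h i x)" for u
    unfolding F_def by (subst abs_L0_sum[symmetric]) (auto simp: abs_L0_scaleR)
  have F_meas: "(\<lambda>x. \<Sum>i\<in>{1..<n}. a i * hat h i x) \<in> borel_measurable borel" for a by measurable
  have F_out: "(\<Sum>i\<in>{1..<n}. a i * hat h i x) = 0" if "x \<notin> {0..t}" for a x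
    by (rule sum.neutral) (use hat_outside[OF h(1)] that h(2) in force)
  have F_Lp: "F u \<in> carr (Lp q t)" for u
    unfolding F_abs
  proof (rule abs_L0_bounded_in_Lp[OF F_meas F_out, where C = "\<Sum>i\<in>{1..<n}. \<bar>point_value t u (real i * h)\<bar>"])
    show "\<bar>\<Sum>i\<in>{1..<n}. point_value t u (real i * h) * hat h i x\<bar> \<le> (\<Sum>i\<in>{1..<n}. \<bar>point_value t u (real i * h)\<bar>)" for x
      using hat_bounds h(1)
      by (intro order.trans[OF sum_abs] sum_mono) (auto simp: abs_mult intro!: mult_right_le_one_le)
  qed (use p in auto)
  have point_value_add: "point_value t (u + v) x = point_value t u x + point_value t v x"
    and point_value_scale: "point_value t (c *\<^sub>R u) x = c * point_value t u x"
    if u: "u \<in> carr (W2D p t)" and v: "v \<in> carr (W2D p t)" and x: "x \<in> {0..t}" for u v c x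
  proof -
    obtain f where f: "f \<in> borel_measurable borel" "continuous_on {0..t} f" "u = abs_L0 f"
      by (rule W2D_repr[OF t p(1) u]) blast
    obtain g where g: "g \<in> borel_measurable borel" "continuous_on {0..t} g" "v = abs_L0 g"
      by (rule W2D_repr[OF t p(1) v]) blast
    have "point_value t (abs_L0 (\<lambda>x. f x + g x)) x = f x + g x"
      by (rule point_value_eq[OF t _ _ x]) (use f g in \<open>auto intro: continuous_intros\<close>)
    then show "point_value t (u + v) x = point_value t u x + point_value t v x"
      using point_value_eq[OF t f(1,2) x] point_value_eq[OF t g(1,2) x] f(1) g(1) by (simp add: f(3) g(3) abs_L0_add)
    have "point_value t (abs_L0 (\<lambda>x. c * f x)) x = c * f x"
      by (rule point_value_eq[OF t _ _ x]) (use f in \<open>auto intro: continuous_intros\<close>)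
    then show "point_value t (c *\<^sub>R u) x = c * point_value t u x"
      using point_value_eq[OF t f(1,2) x] f(1) by (simp add: f(3) abs_L0_scaleR)
  qed
  have "bounded_op (W2D p t) (Lp q t) F"
    unfolding bounded_op_def
  proof (intro conjI ballI allI)
    show "F u \<in> carr (Lp q t)" for u by (rule F_Lp)
    show "F (u + v) = F u + F v" if "u \<in> carr (W2D p t)" "v \<in> carr (W2D p t)" for u v
      unfolding F_def sum.distrib[symmetric]
      by (rule sum.cong) (use point_value_add[OF that node] in \<open>auto simp: scaleR_add_left\<close>)
    show "F (c *\<^sub>R u) = c *\<^sub>R F u" if "u \<in> carr (W2D p t)" for c u
      unfolding F_def scaleR_sum_right
      by (rule sum.cong) (use point_value_scale[OF that that node] in auto)
    show "\<exists>C. \<forall>u\<in>carr (W2D p t). nrm (Lp q t) (F u) \<le> C * nrm (W2D p t) u"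
    proof (intro exI ballI)
      fix u assume u: "u \<in> carr (W2D p t)"
      obtain w B f where r: "w \<in> borel_measurable borel" "\<And>x. x \<notin> {0..t} \<Longrightarrow> w x = 0" "integrable lborel w"
        "integrable lborel (\<lambda>x. \<bar>w x\<bar> powr p)" "nrm (W2D p t) u = (LINT x|lborel. \<bar>w x\<bar> powr p) powr (1 / p)"
        "f \<in> borel_measurable borel" "continuous_on {0..t} f" "\<And>x. x \<in> {0..t} \<Longrightarrow> f x = B * x + potential w x"
        "\<And>x. x \<notin> {0..t} \<Longrightarrow> f x = 0" "f t = 0" "u = abs_L0 f"
        by (rule W2D_repr[OF t p(1) u]) (rule that)
      \<comment> \<open>The factor 2 counts the two summands B x and \<open>potential w\<close>;
        since f t = 0, B t is minus the potential at t and has the same bound.\<close>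
      define K where "K = 2 * (t * ((t + 1) * nrm (W2D p t) u))"
      have pot: "\<bar>potential w x\<bar> \<le> t * ((t + 1) * nrm (W2D p t) u)" if "x \<in> {0..t}" for x
      proof -
        have "\<bar>potential w x\<bar> \<le> t * (LINT s|lborel. \<bar>w s\<bar>)" by (rule potential_bound[OF r(3,2) that])
        also have "\<dots> \<le> t * ((t + 1) * nrm (W2D p t) u)"
          unfolding r(5) using L1_le_Lp[OF p(1) t r(3,4,2)] t by (intro mult_left_mono) auto
        finally show ?thesis .
      qed
      have tr: "\<bar>point_value t u x\<bar> \<le> K" if x: "x \<in> {0..t}" for x
      proof -
        have "B * t = - potential w t" using r(8)[of t] r(10) t by simp
        then have "\<bar>B * t\<bar> = \<bar>potential w t\<bar>" by simp
        then have "\<bar>B\<bar> * t = \<bar>potential w t\<bar>" using t by (simp add: abs_mult)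
        then have "\<bar>B\<bar> * t \<le> t * ((t + 1) * nrm (W2D p t) u)"
          using pot[of t] t by simp
        moreover have "\<bar>B * x\<bar> \<le> \<bar>B\<bar> * t" using x by (auto simp: abs_mult intro: mult_left_mono)
        moreover have "point_value t u x = B * x + potential w x"
          unfolding r(11) using point_value_eq[OF t r(6,7) x] r(8)[OF x] by simp
        ultimately show ?thesis using pot[OF x] unfolding K_def by linarith
      qed
      have K0: "0 \<le> K" using tr[of 0] t by auto
      have bnd: "\<bar>\<Sum>i\<in>{1..<n}. point_value t u (real i * h) * hat h i x\<bar> \<le> real n * K" for x
      proof -
        have "\<bar>point_value t u (real i * h) * hat h i x\<bar> \<le> K * 1" if "i \<in> {1..<n}" for i
          unfolding abs_mult using tr[OF node[of i]] that hat_bounds(1)[of h i x] hat_bounds(2)[OF h(1), of i x] K0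
          by (intro mult_mono) auto
        then have "\<bar>\<Sum>i\<in>{1..<n}. point_value t u (real i * h) * hat h i x\<bar> \<le> (\<Sum>i\<in>{1..<n}. K * 1)"
          by (intro order.trans[OF sum_abs] sum_mono)
        also have "\<dots> = real (n - 1) * K" by simp
        also have "\<dots> \<le> real n * K" using K0 by (intro mult_right_mono) auto
        finally show ?thesis .
      qed
      have "(LINT x|lborel. \<bar>\<Sum>i\<in>{1..<n}. point_value t u (real i * h) * hat h i x\<bar> powr q)
          \<le> (LINT x|lborel. (real n * K) powr q * indicator {0..t} x)"
      proof (rule integral_mono_AE')
        show "integrable lborel (\<lambda>x. (real n * K) powr q * indicator {0..t} x)"
          by (intro integrable_mult_right integrable_indicator_Icc)
        have "\<bar>\<Sum>i\<in>{1..<n}. point_value t u (real i * h) * hat h i x\<bar> powr q \<le> (real n * K) powr q * indicator {0..t} x" for x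
        proof (cases "x \<in> {0..t}")
          case True
          then show ?thesis using bnd[of x] p by (simp add: powr_mono2)
        qed (use F_out in simp)
        then show "AE x in lborel. \<bar>\<Sum>i\<in>{1..<n}. point_value t u (real i * h) * hat h i x\<bar> powr q \<le> (real n * K) powr q * indicator {0..t} x"
          by (rule AE_I2)
      qed (use K0 in auto)
      also have "\<dots> = (real n * K) powr q * t" using t by simp
      finally have "(LINT x|lborel. \<bar>\<Sum>i\<in>{1..<n}. point_value t u (real i * h) * hat h i x\<bar> powr q) powr (1 / q) \<le> ((real n * K) powr q * t) powr (1 / q)"
        using p by (intro powr_mono2) (auto intro: integral_nonneg_AE)
      also have "((real n * K) powr q * t) powr (1 / q) = real n * K * t powr (1 / q)"
        using p K0 t by (simp add: powr_mult powr_powr)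
      also have "real n * K * t powr (1 / q) = (real n * (2 * (t * (t + 1))) * t powr (1 / q)) * nrm (W2D p t) u"
        by (simp only: K_def mult_ac)
      finally show "nrm (Lp q t) (F u) \<le> (real n * (2 * (t * (t + 1))) * t powr (1 / q)) * nrm (W2D p t) u"
        unfolding nrm_Lp F_abs abs_L0_norm[OF F_meas] .
    qed
  qed
  moreover have "\<not> dim_ge (F ` carr (W2D p t)) n"
  proof
    assume "dim_ge (F ` carr (W2D p t)) n"
    then obtain S where S: "S \<subseteq> F ` carr (W2D p t)" "finite S" "independent S" "card S = n"
      by (auto simp: dim_ge_def)
    \<comment> \<open>The range lies in the span of at most n - 1 hat functions, too few for n
      independent elements.\<close>
    let ?H = "(\<lambda>i. abs_L0 (hat h i)) ` {1..<n}"
    have "F u \<in> span ?H" for u unfolding F_def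
      by (intro span_sum span_scale span_base) auto
    then have "S \<subseteq> span ?H" using S(1) by blast
    then have "card S \<le> card ?H" using independent_span_bound[of ?H S] S(3) by auto
    also have "\<dots> \<le> card {1..<n}" by (rule card_image_le) simp
    finally show False using S(4) n by simp
  qed
  moreover have "op_norm (W2D p t) (Lp q t) (\<lambda>u. E2 u - F u)
      \<le> t powr (1 / q + 2 - 1 / p) / (real n)\<^sup>2 * green_const p q powr (1 / q)"
  proof (rule op_norm_le[where v = 0])
    fix u assume u: "u \<in> carr (W2D p t)" and le1: "nrm (W2D p t) u \<le> 1"
    obtain w B f where r: "w \<in> borel_measurable borel" "\<And>x. x \<notin> {0..t} \<Longrightarrow> w x = 0" "integrable lborel w"
      "integrable lborel (\<lambda>x. \<bar>w x\<bar> powr p)" "nrm (W2D p t) u = (LINT x|lborel. \<bar>w x\<bar> powr p) powr (1 / p)"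
      "f \<in> borel_measurable borel" "continuous_on {0..t} f" "\<And>x. x \<in> {0..t} \<Longrightarrow> f x = B * x + potential w x"
      "\<And>x. x \<notin> {0..t} \<Longrightarrow> f x = 0" "f t = 0" "u = abs_L0 f"
      by (rule W2D_repr[OF t p(1) u]) (rule that)
    have w1: "(LINT x|lborel. \<bar>w x\<bar> powr p) \<le> 1"
    proof (rule ccontr)
      assume "\<not> ?thesis"
      then have "1 < (LINT x|lborel. \<bar>w x\<bar> powr p) powr (1 / p)" using p by simp
      then show False using le1 r(5) by simp
    qed
    define err where "err = (\<lambda>x. f x - (\<Sum>i\<in>{1..<n}. f (real i * h) * hat h i x))"
    have m_err: "err \<in> borel_measurable borel" unfolding err_def using r(6) by measurable
    have tr: "point_value t u (real i * h) = f (real i * h)" if "i \<in> {1..<n}" for i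
      unfolding r(11) using point_value_eq[OF t r(6,7) node] that by auto
    have "F u = abs_L0 (\<lambda>x. \<Sum>i\<in>{1..<n}. f (real i * h) * hat h i x)"
    proof -
      have "(\<lambda>x. \<Sum>i\<in>{1..<n}. point_value t u (real i * h) * hat h i x) = (\<lambda>x. \<Sum>i\<in>{1..<n}. f (real i * h) * hat h i x)"
        by (intro ext sum.cong refl) (simp only: tr)
      then show ?thesis unfolding F_abs by (rule arg_cong)
    qed
    then have diff: "E2 u - F u = abs_L0 err"
      unfolding E2_def r(11) err_def by (simp only: abs_L0_diff[OF r(6) F_meas])
    have c_err: "continuous_on {0..t} err"
      unfolding err_def by (intro continuous_intros r(7) hat_continuous h(1))
    have c_errq: "continuous_on {0..t} (\<lambda>x. \<bar>err x\<bar> powr q)"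
      using p by (intro continuous_on_powr' continuous_intros c_err) auto
    have i_err: "set_integrable lborel {0..real n * h} (\<lambda>x. \<bar>err x\<bar> powr q)"
      unfolding h(2) by (rule borel_integrable_atLeastAtMost'[OF c_errq])
    have f0: "f 0 = 0" using r(8)[of 0] potential_0[of t w, OF r(2)] t by simp
    have e: "err (real k * h + h * z) = - (h\<^sup>2 * green (\<lambda>\<sigma>. w (real k * h + h * \<sigma>)) z)"
      if k: "k < n" and z: "z \<in> {0..1}" for k z
    proof -
      have kh: "real k * h \<in> {0..t}" "real k * h + h \<in> {0..t}"
        using node[of k] node[of "Suc k"] k by (auto simp: algebra_simps)
      have "h * z \<le> h * 1" "0 \<le> h * z" using z h(1) by (auto intro!: mult_left_mono)
      then have xk: "real k * h + h * z \<in> {0..t}" using kh by auto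
      have "err (real k * h + h * z) = f (real k * h + h * z) - ((1 - z) * f (real k * h) + z * f (real (Suc k) * h))"
        unfolding err_def
        by (subst hat_interpolation[OF h(1) k z, of "\<lambda>i. f (real i * h)"]) (use f0 r(10) h(2) in auto)
      also have "real (Suc k) * h = real k * h + h" by (simp add: algebra_simps)
      \<comment> \<open>The linear term B x is reproduced by the interpolation, so only the
        potential contributes to the error.\<close>
      also have "f (real k * h + h * z) - ((1 - z) * f (real k * h) + z * f (real k * h + h))
        = potential w (real k * h + h * z) - ((1 - z) * potential w (real k * h) + z * potential w (real k * h + h))"
        unfolding r(8)[OF xk] r(8)[OF kh(1)] r(8)[OF kh(2)] by (simp add: algebra_simps)
      also have "\<dots> = - (h\<^sup>2 * green (\<lambda>\<sigma>. w (real k * h + h * \<sigma>)) z)"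
        by (rule interpolation_error[OF r(3,2) h(1) z])
      finally show ?thesis .
    qed
    have "(LINT x:{0..real n * h}|lborel. \<bar>err x\<bar> powr q) \<le> h powr (1 + 2 * q - q / p) * real n powr (1 - q / p) * green_const p q"
      by (rule interpolation_inequality[OF p h(1) n r(1,4) w1 i_err e])
    also have "(LINT x:{0..real n * h}|lborel. \<bar>err x\<bar> powr q) = (LINT x|lborel. \<bar>err x\<bar> powr q)"
      unfolding h(2) set_lebesgue_integral_def
    proof (rule Bochner_Integration.integral_cong[OF refl])
      show "indicator {0..t} x *\<^sub>R \<bar>err x\<bar> powr q = \<bar>err x\<bar> powr q" for x
        using r(9)[of x] F_out[of x] by (cases "x \<in> {0..t}") (auto simp: err_def)
    qed
    finally have "(LINT x|lborel. \<bar>err x\<bar> powr q) powr (1 / q)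
      \<le> (h powr (1 + 2 * q - q / p) * real n powr (1 - q / p) * green_const p q) powr (1 / q)"
      using p by (intro powr_mono2) (auto intro: integral_nonneg_AE)
    also have "\<dots> = h powr (1 / q + 2 - 1 / p) * real n powr (1 / q - 1 / p) * green_const p q powr (1 / q)"
    proof -
      have "(1 + 2 * q - q / p) * (1 / q) = 1 / q + 2 - 1 / p" "(1 - q / p) * (1 / q) = 1 / q - 1 / p"
        using p by (simp_all add: field_simps)
      then show ?thesis using green_const_pos[OF p(1,2)] by (simp add: powr_mult powr_powr)
    qed
    \<comment> \<open>With h = t / n the power of n is - (1 / q + 2 - 1 / p) + (1 / q - 1 / p) =
      -2.\<close>
    also have "h powr (1 / q + 2 - 1 / p) * real n powr (1 / q - 1 / p) = t powr (1 / q + 2 - 1 / p) / (real n)\<^sup>2"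
    proof -
      have "real n powr (1 / q + 2 - 1 / p) = real n powr (1 / q - 1 / p) * (real n)\<^sup>2"
        using n by (simp add: powr_add powr_diff)
      then show ?thesis using n t by (simp add: h_def powr_divide)
    qed
    finally show "nrm (Lp q t) (E2 u - F u) \<le> t powr (1 / q + 2 - 1 / p) / (real n)\<^sup>2 * green_const p q powr (1 / q)"
      unfolding nrm_Lp diff abs_L0_norm[OF m_err] .
  qed (use zero_in_W2D[OF t p(1)] in auto)
  ultimately show ?thesis
    unfolding approx_number_def by (intro INF_lower2[of F]) (auto intro: ennreal_leI)
qed

section \<open>Isomorphism numbers\<close>

lemma spow_times: "spow r (a * b) = spow r a * spow r b"
  by (simp add: spow_def sgn_mult abs_mult powr_mult)

text \<open>The left side is the tangent of the convex function \<bar>x\<bar> powr q at x = m. That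
  it lies below the function is Young's inequality.\<close>

lemma powr_tangent:
  assumes q: "1 < q" shows "q * spow (q - 1) m * x - (q - 1) * \<bar>m\<bar> powr q \<le> \<bar>x\<bar> powr q"
proof -
  have "spow (q - 1) m * x \<le> \<bar>spow (q - 1) m\<bar> * \<bar>x\<bar>" by (metis abs_ge_self abs_mult)
  also have "\<dots> \<le> (1 - 1 / q) * \<bar>m\<bar> powr q + \<bar>x\<bar> powr q / q"
    unfolding abs_spow by (rule young[OF q]) auto
  finally have "q * (spow (q - 1) m * x) \<le> q * ((1 - 1 / q) * \<bar>m\<bar> powr q + \<bar>x\<bar> powr q / q)"
    using q by (intro mult_left_mono) auto
  then show ?thesis using q by (simp add: algebra_simps)
qed

lemma powr_convex_weighted:
  fixes a b p \<theta> :: real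
  assumes p: "1 < p" and \<theta>: "0 \<le> \<theta>" "\<theta> \<le> 1"
  shows "\<bar>\<theta> * a + (1 - \<theta>) * b\<bar> powr p \<le> \<theta> * \<bar>a\<bar> powr p + (1 - \<theta>) * \<bar>b\<bar> powr p"
proof -
  define m where "m = \<theta> * a + (1 - \<theta>) * b"
  have "\<theta> * (p * spow (p - 1) m * a - (p - 1) * \<bar>m\<bar> powr p) + (1 - \<theta>) * (p * spow (p - 1) m * b - (p - 1) * \<bar>m\<bar> powr p)
    \<le> \<theta> * \<bar>a\<bar> powr p + (1 - \<theta>) * \<bar>b\<bar> powr p"
    using \<theta> by (intro add_mono mult_left_mono powr_tangent[OF p]) auto
  moreover have "\<theta> * (p * spow (p - 1) m * a - (p - 1) * \<bar>m\<bar> powr p) + (1 - \<theta>) * (p * spow (p - 1) m * b - (p - 1) * \<bar>m\<bar> powr p)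
    = p * (m * spow (p - 1) m) - (p - 1) * \<bar>m\<bar> powr p"
    unfolding m_def by (simp add: algebra_simps)
  moreover have "\<dots> = \<bar>m\<bar> powr p" unfolding mult_spow by (simp add: algebra_simps)
  ultimately show ?thesis unfolding m_def by simp
qed

text \<open>First differences, with the value 0 at both ends. The difference of two successive jumps
  is therefore the discrete Laplacian of y with Neumann conditions.\<close>

definition jump :: "nat \<Rightarrow> (nat \<Rightarrow> real) \<Rightarrow> nat \<Rightarrow> real" where
  "jump n y j = (if j = 0 \<or> n \<le> j then 0 else y j - y (j - 1))"

lemma jump_0 [simp]: "jump n y 0 = 0" and jump_n [simp]: "jump n y n = 0"
  by (simp_all add: jump_def)

lemma jump_add: "jump n (\<lambda>k. y k + z k) j = jump n y j + jump n z j"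
  by (simp add: jump_def)

lemma jump_cmult: "jump n (\<lambda>k. c * y k) j = c * jump n y j"
  by (simp add: jump_def right_diff_distrib)

text \<open>With \<open>y\<close> continued by reflection at both ends, the argument of the norm on the left is
  \<open>y (k - 1) + 2 * y k + y (k + 1)\<close>, an average of the values \<open>4 * y j\<close>.\<close>

lemma averaging_contraction:
  assumes p: "1 < p"
  shows "(\<Sum>k<n. \<bar>4 * y k + (jump n y (Suc k) - jump n y k)\<bar> powr p) \<le> (\<Sum>k<n. \<bar>4 * y k\<bar> powr p)"
proof -
  define Z where "Z = (\<lambda>k. \<bar>4 * y k\<bar> powr p)"
  have "\<bar>4 * y k + (jump n y (Suc k) - jump n y k)\<bar> powr p \<le> Z k + (jump n Z (Suc k) - jump n Z k) / 4"
    if k: "k < n" for k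
  proof -
    \<comment> \<open>Four times the left neighbour of y k, and likewise \<open>b\<close> for the
      right neighbour; at an end the missing neighbour is y k itself.\<close>
    define a where "a = 4 * (y k - jump n y k)"
    define b where "b = 4 * (y k + jump n y (Suc k))"
    have Za: "\<bar>a\<bar> powr p = Z k - jump n Z k" using k by (simp add: a_def Z_def jump_def)
    have Zb: "\<bar>b\<bar> powr p = Z k + jump n Z (Suc k)" using k by (simp add: b_def Z_def jump_def)
    have "\<bar>1 / 2 * (1 / 2 * a + (1 - 1 / 2) * b) + (1 - 1 / 2) * (4 * y k)\<bar> powr p
      \<le> 1 / 2 * \<bar>1 / 2 * a + (1 - 1 / 2) * b\<bar> powr p + (1 - 1 / 2) * \<bar>4 * y k\<bar> powr p"
      by (rule powr_convex_weighted[OF p]) auto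
    also have "\<dots> \<le> 1 / 2 * (1 / 2 * \<bar>a\<bar> powr p + (1 - 1 / 2) * \<bar>b\<bar> powr p) + (1 - 1 / 2) * \<bar>4 * y k\<bar> powr p"
      by (intro add_right_mono mult_left_mono powr_convex_weighted[OF p]) auto
    also have "\<dots> = Z k + (jump n Z (Suc k) - jump n Z k) / 4"
      unfolding Za Zb by (simp add: Z_def field_simps)
    also have "1 / 2 * (1 / 2 * a + (1 - 1 / 2) * b) + (1 - 1 / 2) * (4 * y k) = 4 * y k + (jump n y (Suc k) - jump n y k)"
      by (simp add: a_def b_def field_simps)
    finally show ?thesis .
  qed
  then have "(\<Sum>k<n. \<bar>4 * y k + (jump n y (Suc k) - jump n y k)\<bar> powr p) \<le> (\<Sum>k<n. Z k + (jump n Z (Suc k) - jump n Z k) / 4)"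
    by (intro sum_mono) auto
  also have "\<dots> = (\<Sum>k<n. Z k) + (\<Sum>k<n. jump n Z (Suc k) - jump n Z k) / 4"
    by (simp add: sum.distrib sum_divide_distrib)
  \<comment> \<open>The averages redistribute the values Z without changing their sum: the second
    differences telescope to the two end jumps, which are 0.\<close>
  also have "(\<Sum>k<n. jump n Z (Suc k) - jump n Z k) = 0"
    by (subst sum_lessThan_telescope) simp
  finally show ?thesis by (simp add: Z_def)
qed

text \<open>Pairing m with spow (q - 1) (4 y), the duality map of l^q, gives after summation by
  parts the q-th power sum of 4 y plus a nonnegative term, because \<open>spow\<close> is
  increasing. The tangent inequality takes the place of Hoelder's.\<close>

lemma jump_accretive:
  assumes q: "1 < q" and \<nu>: "0 \<le> \<nu>" and m: "\<And>k. k < n \<Longrightarrow> m k = 4 * y k - \<nu> * (jump n y (Suc k) - jump n y k)"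
  shows "(\<Sum>k<n. \<bar>4 * y k\<bar> powr q) \<le> (\<Sum>k<n. \<bar>m k\<bar> powr q)"
proof -
  define \<phi> where "\<phi> = (\<lambda>k. spow (q - 1) (4 * y k))"
  let ?J = "jump n y"
  \<comment> \<open>Natural subtraction gives j - 1 = 0 at j = 0; the jump there is 0, so this term
    does not contribute.\<close>
  have abel: "(\<Sum>k<N. (?J (Suc k) - ?J k) * \<phi> k) = ?J N * \<phi> (N - 1) - (\<Sum>j<N. ?J j * (\<phi> j - \<phi> (j - 1)))" for N
    by (induction N) (simp_all add: algebra_simps)
  have "0 \<le> ?J j * (\<phi> j - \<phi> (j - 1))" for j
  proof (cases "y (j - 1) \<le> y j")
    case True
    then have "\<phi> (j - 1) \<le> \<phi> j" unfolding \<phi>_def using q by (intro spow_mono) auto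
    then show ?thesis using True by (auto simp: jump_def)
  next
    case False
    then have "\<phi> j \<le> \<phi> (j - 1)" unfolding \<phi>_def using q by (intro spow_mono) auto
    then show ?thesis using False by (auto simp: jump_def intro: mult_nonpos_nonpos)
  qed
  then have neg: "(\<Sum>k<n. (?J (Suc k) - ?J k) * \<phi> k) \<le> 0"
    unfolding abel by (simp add: sum_nonneg)
  have "(\<Sum>k<n. q * \<bar>4 * y k\<bar> powr q) \<le> (\<Sum>k<n. q * \<bar>4 * y k\<bar> powr q) - q * \<nu> * (\<Sum>k<n. (?J (Suc k) - ?J k) * \<phi> k)"
    using neg q \<nu> by (simp add: mult_nonneg_nonpos)
  also have "\<dots> = (\<Sum>k<n. q * \<bar>4 * y k\<bar> powr q - q * \<nu> * ((?J (Suc k) - ?J k) * \<phi> k))"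
    by (simp add: sum_subtractf sum_distrib_left)
  also have "\<dots> = (\<Sum>k<n. q * \<phi> k * m k)"
  proof (rule sum.cong[OF refl])
    fix k assume "k \<in> {..<n}"
    then have mk: "m k = 4 * y k - \<nu> * (?J (Suc k) - ?J k)" using m by simp
    have eq: "\<bar>4 * y k\<bar> powr q = 4 * y k * \<phi> k" unfolding \<phi>_def mult_spow by simp
    show "q * \<bar>4 * y k\<bar> powr q - q * \<nu> * ((?J (Suc k) - ?J k) * \<phi> k) = q * \<phi> k * m k"
      unfolding eq mk by (simp add: algebra_simps)
  qed
  also have "\<dots> \<le> (\<Sum>k<n. \<bar>m k\<bar> powr q + (q - 1) * \<bar>4 * y k\<bar> powr q)"
  proof (rule sum_mono)
    show "q * \<phi> k * m k \<le> \<bar>m k\<bar> powr q + (q - 1) * \<bar>4 * y k\<bar> powr q" for k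
      using powr_tangent[OF q, of "4 * y k" "m k"] by (simp add: \<phi>_def)
  qed
  also have "\<dots> = (\<Sum>k<n. \<bar>m k\<bar> powr q) + (q - 1) * (\<Sum>k<n. \<bar>4 * y k\<bar> powr q)"
    by (simp add: sum.distrib sum_distrib_left)
  finally show ?thesis by (simp add: sum_distrib_left[symmetric] algebra_simps)
qed

text \<open>Shooting from the left end: \<open>shoot\<close> produces the values of \<open>y\<close> together with its jumps, and the
  free value \<open>a\<close> of \<open>y 0\<close> is used to make the last jump vanish.\<close>

primrec shoot :: "real \<Rightarrow> real \<Rightarrow> (nat \<Rightarrow> real) \<Rightarrow> nat \<Rightarrow> real \<times> real" where
  "shoot \<nu> a m 0 = (a, 0)"
| "shoot \<nu> a m (Suc k) =
    (let D = snd (shoot \<nu> a m k) + (4 * fst (shoot \<nu> a m k) - m k) / \<nu> in (fst (shoot \<nu> a m k) + D, D))"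

lemma shoot_affine:
  "fst (shoot \<nu> a m k) = a * fst (shoot \<nu> 1 (\<lambda>_. 0) k) + fst (shoot \<nu> 0 m k) \<and>
   snd (shoot \<nu> a m k) = a * snd (shoot \<nu> 1 (\<lambda>_. 0) k) + snd (shoot \<nu> 0 m k)"
  by (induction k) (simp_all add: Let_def algebra_simps add_divide_distrib diff_divide_distrib)

lemma shoot_pos:
  assumes "0 < \<nu>" shows "0 < fst (shoot \<nu> 1 (\<lambda>_. 0) k) \<and> 0 \<le> snd (shoot \<nu> 1 (\<lambda>_. 0) k)"
  by (induction k) (use assms in \<open>auto simp: Let_def intro!: add_pos_nonneg add_nonneg_nonneg\<close>)

text \<open>The last jump depends affinely on the free value a. The coefficient of a is positive,
  since the homogeneous recursion started at 1 has nonnegative jumps and stays positive; so a can be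
  chosen to make the last jump 0. For \<nu> = 0 the system is diagonal.\<close>

lemma jump_system_solvable:
  assumes \<nu>: "0 \<le> \<nu>" and n: "1 \<le> n"
  obtains y where "\<And>k. k < n \<Longrightarrow> 4 * y k - \<nu> * (jump n y (Suc k) - jump n y k) = m k"
proof (cases "\<nu> = 0")
  case True
  then show ?thesis using that[of "\<lambda>k. m k / 4"] by simp
next
  case False
  then have \<nu>: "0 < \<nu>" using \<nu> by simp
  obtain n' where n': "n = Suc n'" using n by (cases n) auto
  have "0 < snd (shoot \<nu> 1 (\<lambda>_. 0) n)"
    using shoot_pos[OF \<nu>, of n'] \<nu> by (auto simp: n' Let_def intro!: add_nonneg_pos)
  then obtain a where "a * snd (shoot \<nu> 1 (\<lambda>_. 0) n) + snd (shoot \<nu> 0 m n) = 0"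
    by (metis add.commute add.right_inverse divide_eq_eq less_irrefl)
  then have Dn: "snd (shoot \<nu> a m n) = 0" using shoot_affine[of \<nu> a m n] by simp
  define y where "y = (\<lambda>k. fst (shoot \<nu> a m k))"
  have y: "y (Suc k) - y k = snd (shoot \<nu> a m (Suc k))" for k
    by (simp add: y_def Let_def)
  have J: "jump n y j = snd (shoot \<nu> a m j)" if "j \<le> n" for j
  proof (cases j)
    case (Suc i)
    then show ?thesis using y[of i] Dn that by (cases "j = n") (auto simp: jump_def)
  qed simp
  have "4 * y k - \<nu> * (jump n y (Suc k) - jump n y k) = m k" if "k < n" for k
    using J[of k] J[of "Suc k"] that \<nu> by (simp add: Let_def y_def)
  then show ?thesis by (rule that)
qed

section \<open>A weighted sequence space of dimension n\<close>

text \<open>The space of the parameters y, realized inside the bounded functions on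
  \<open>nat\<close>. The factor 4 is the one in \<open>averaging_contraction\<close> and
  \<open>jump_accretive\<close>, so that both hold in this norm without a constant.\<close>

definition seq_space :: "real \<Rightarrow> nat \<Rightarrow> (nat \<Rightarrow>\<^sub>C real) nspace" where
  "seq_space p n = \<lparr>carr = {y. \<forall>k\<ge>n. apply_bcontfun y k = 0},
     nrm = (\<lambda>y. (\<Sum>k<n. \<bar>4 * apply_bcontfun y k\<bar> powr p) powr (1 / p))\<rparr>"

lemma finite_support_bcontfun:
  fixes y :: "nat \<Rightarrow> real"
  assumes "\<And>k. n \<le> k \<Longrightarrow> y k = 0" shows "apply_bcontfun (Bcontfun y) = y"
proof -
  have "y k \<in> insert 0 (y ` {..<n})" for k using assms[of k] by (cases "k < n") auto
  then have "range y \<subseteq> insert 0 (y ` {..<n})" by blast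
  then have "bounded (range y)" using finite_imp_bounded finite_subset by blast
  then show ?thesis by (intro Bcontfun_inverse) (simp add: bcontfun_def)
qed

text \<open>Convexity of \<bar>x\<bar> powr p at a / A and b / B with weight A / (A + B), where A
  and B are the two norms; the cases A = 0 and B = 0 are separate.\<close>

lemma minkowski_sum:
  fixes a b :: "nat \<Rightarrow> real"
  assumes p: "1 < p"
  shows "(\<Sum>k<n. \<bar>a k + b k\<bar> powr p) powr (1 / p) \<le> (\<Sum>k<n. \<bar>a k\<bar> powr p) powr (1 / p) + (\<Sum>k<n. \<bar>b k\<bar> powr p) powr (1 / p)"
proof -
  define A where "A = (\<Sum>k<n. \<bar>a k\<bar> powr p) powr (1 / p)"
  define B where "B = (\<Sum>k<n. \<bar>b k\<bar> powr p) powr (1 / p)"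
  have nn: "0 \<le> (\<Sum>k<n. \<bar>c k\<bar> powr p)" for c :: "nat \<Rightarrow> real" by (intro sum_nonneg) auto
  have zero: "c k = 0" if "(\<Sum>k<n. \<bar>c k\<bar> powr p) powr (1 / p) = 0" "k < n" for c :: "nat \<Rightarrow> real" and k
  proof -
    have "(\<Sum>k<n. \<bar>c k\<bar> powr p) = 0" using that(1) by simp
    then have "\<bar>c k\<bar> powr p = 0" using that(2) by (subst (asm) sum_nonneg_eq_0_iff) auto
    then show ?thesis by simp
  qed
  have AB: "0 \<le> A" "0 \<le> B" by (auto simp: A_def B_def)
  show ?thesis
  proof (cases "A = 0 \<or> B = 0")
    case True
    then show ?thesis
    proof
      assume "A = 0"
      then have "(\<Sum>k<n. \<bar>a k + b k\<bar> powr p) = (\<Sum>k<n. \<bar>b k\<bar> powr p)"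
        using zero[of a, folded A_def, OF \<open>A = 0\<close>] by (intro sum.cong) simp_all
      then show ?thesis using AB by (simp only: A_def[symmetric])
    next
      assume "B = 0"
      then have "(\<Sum>k<n. \<bar>a k + b k\<bar> powr p) = (\<Sum>k<n. \<bar>a k\<bar> powr p)"
        using zero[of b, folded B_def, OF \<open>B = 0\<close>] by (intro sum.cong) simp_all
      then show ?thesis using AB by (simp only: B_def[symmetric])
    qed
  next
    case False
    then have AB: "0 < A" "0 < B" using AB by auto
    have Ap: "A powr p = (\<Sum>k<n. \<bar>a k\<bar> powr p)" "B powr p = (\<Sum>k<n. \<bar>b k\<bar> powr p)"
      using p nn by (simp_all add: A_def B_def powr_powr)
    define \<theta> where "\<theta> = A / (A + B)"
    have \<theta>: "0 \<le> \<theta>" "\<theta> \<le> 1" "1 - \<theta> = B / (A + B)" using AB by (auto simp: \<theta>_def field_simps)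
    have "(\<Sum>k<n. \<bar>a k + b k\<bar> powr p) / (A + B) powr p = (\<Sum>k<n. \<bar>\<theta> * (a k / A) + (1 - \<theta>) * (b k / B)\<bar> powr p)"
    proof -
      have "\<theta> * (a k / A) + (1 - \<theta>) * (b k / B) = (a k + b k) / (A + B)" for k
        unfolding \<theta>(3) using AB by (simp add: \<theta>_def add_divide_distrib)
      then show ?thesis using AB by (simp add: sum_divide_distrib powr_divide)
    qed
    also have "\<dots> \<le> (\<Sum>k<n. \<theta> * \<bar>a k / A\<bar> powr p + (1 - \<theta>) * \<bar>b k / B\<bar> powr p)"
      by (intro sum_mono powr_convex_weighted[OF p \<theta>(1,2)])
    also have "\<dots> = \<theta> * ((\<Sum>k<n. \<bar>a k\<bar> powr p) / A powr p) + (1 - \<theta>) * ((\<Sum>k<n. \<bar>b k\<bar> powr p) / B powr p)"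
      using AB by (simp add: sum.distrib sum_distrib_left sum_divide_distrib powr_divide)
    also have "\<dots> = 1" using AB unfolding Ap[symmetric] by simp
    finally have "(\<Sum>k<n. \<bar>a k + b k\<bar> powr p) \<le> (A + B) powr p" using AB by (simp add: divide_le_eq)
    then have "(\<Sum>k<n. \<bar>a k + b k\<bar> powr p) powr (1 / p) \<le> ((A + B) powr p) powr (1 / p)"
      using p nn by (intro powr_mono2) auto
    then show ?thesis using AB p by (simp add: powr_powr A_def B_def)
  qed
qed

lemma seq_space_coordinate:
  assumes p: "1 < p" and k: "k < n"
  shows "\<bar>4 * apply_bcontfun y k\<bar> \<le> nrm (seq_space p n) y"
proof -
  have "\<bar>4 * apply_bcontfun y k\<bar> powr p \<le> (\<Sum>k<n. \<bar>4 * apply_bcontfun y k\<bar> powr p)"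
    by (rule member_le_sum) (use k in auto)
  then have "(\<bar>4 * apply_bcontfun y k\<bar> powr p) powr (1 / p) \<le> (\<Sum>k<n. \<bar>4 * apply_bcontfun y k\<bar> powr p) powr (1 / p)"
    using p by (intro powr_mono2) auto
  then show ?thesis using p by (simp add: powr_powr seq_space_def)
qed

lemma seq_space_normed:
  assumes p: "1 < p" shows "normed_space (seq_space p n)"
  unfolding normed_space_def
proof (intro conjI ballI allI)
  show "subspace (carr (seq_space p n))"
    by (rule subspaceI) (auto simp: seq_space_def zero_bcontfun.rep_eq plus_bcontfun.rep_eq scaleR_bcontfun.rep_eq)
  fix y assume y: "y \<in> carr (seq_space p n)"
  show "0 \<le> nrm (seq_space p n) y" by (simp add: seq_space_def)
  show "nrm (seq_space p n) y = 0 \<longleftrightarrow> y = 0"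
  proof
    assume 0: "nrm (seq_space p n) y = 0"
    have "apply_bcontfun y k = 0" for k
      using seq_space_coordinate[OF p, of k n y] 0 y by (cases "k < n") (auto simp: seq_space_def)
    then show "y = 0" by (intro bcontfun_eqI) (simp add: zero_bcontfun.rep_eq)
  qed (simp add: seq_space_def zero_bcontfun.rep_eq)
  show "nrm (seq_space p n) (c *\<^sub>R y) = \<bar>c\<bar> * nrm (seq_space p n) y" for c
  proof -
    have "(\<Sum>k<n. \<bar>4 * apply_bcontfun (c *\<^sub>R y) k\<bar> powr p) = \<bar>c\<bar> powr p * (\<Sum>k<n. \<bar>4 * apply_bcontfun y k\<bar> powr p)"
      unfolding sum_distrib_left by (rule sum.cong) (auto simp: scaleR_bcontfun.rep_eq abs_mult powr_mult)
    then show ?thesis using p by (simp add: seq_space_def powr_mult powr_powr)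
  qed
  fix z assume z: "z \<in> carr (seq_space p n)"
  show "nrm (seq_space p n) (y + z) \<le> nrm (seq_space p n) y + nrm (seq_space p n) z"
    using minkowski_sum[OF p, where a = "\<lambda>k. 4 * apply_bcontfun y k" and b = "\<lambda>k. 4 * apply_bcontfun z k" and n = n]
    by (simp add: seq_space_def plus_bcontfun.rep_eq distrib_left)
qed

lemma seq_space_banach:
  assumes p: "1 < p" shows "banach_space (seq_space p n)"
  unfolding banach_space_def
proof (intro conjI allI impI seq_space_normed[OF p])
  fix s :: "nat \<Rightarrow> (nat \<Rightarrow>\<^sub>C real)"
  assume s: "(\<forall>k. s k \<in> carr (seq_space p n)) \<and>
    (\<forall>e>0. \<exists>N. \<forall>j\<ge>N. \<forall>k\<ge>N. nrm (seq_space p n) (s j - s k) < e)"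
  have "\<exists>L. (\<lambda>j. apply_bcontfun (s j) k) \<longlonglongrightarrow> L" if k: "k < n" for k
  proof -
    have "Cauchy (\<lambda>j. apply_bcontfun (s j) k)"
    proof (rule metric_CauchyI)
      fix e :: real assume "0 < e"
      then obtain N where N: "\<And>i j. N \<le> i \<Longrightarrow> N \<le> j \<Longrightarrow> nrm (seq_space p n) (s i - s j) < e" using s by blast
      have "dist (apply_bcontfun (s i) k) (apply_bcontfun (s j) k) < e" if "N \<le> i" "N \<le> j" for i j
      proof -
        have "\<bar>4 * apply_bcontfun (s i - s j) k\<bar> \<le> nrm (seq_space p n) (s i - s j)"
          by (rule seq_space_coordinate[OF p k])
        then show ?thesis using N[OF that] by (simp add: dist_real_def minus_bcontfun.rep_eq)
      qed
      then show "\<exists>N. \<forall>i\<ge>N. \<forall>j\<ge>N. dist (apply_bcontfun (s i) k) (apply_bcontfun (s j) k) < e" by blast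
    qed
    then show ?thesis using Cauchy_convergent_iff convergent_def by blast
  qed
  then obtain L where L: "\<And>k. k < n \<Longrightarrow> (\<lambda>j. apply_bcontfun (s j) k) \<longlonglongrightarrow> L k" by metis
  define y where "y = Bcontfun (\<lambda>k. if k < n then L k else 0)"
  have y: "apply_bcontfun y = (\<lambda>k. if k < n then L k else 0)"
    unfolding y_def by (rule finite_support_bcontfun[of n]) simp
  show "\<exists>x\<in>carr (seq_space p n). (\<lambda>k. nrm (seq_space p n) (s k - x)) \<longlonglongrightarrow> 0"
  proof (intro bexI)
    show "y \<in> carr (seq_space p n)" by (simp add: seq_space_def y)
    have "(\<lambda>j. (\<Sum>k<n. \<bar>4 * (apply_bcontfun (s j) k - L k)\<bar> powr p) powr (1 / p)) \<longlonglongrightarrow> (\<Sum>k<n. \<bar>4 * (L k - L k)\<bar> powr p) powr (1 / p)"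
      using p by (intro tendsto_powr2 tendsto_sum tendsto_intros L) (auto intro!: sum_nonneg always_eventually)
    moreover have "nrm (seq_space p n) (s j - y) = (\<Sum>k<n. \<bar>4 * (apply_bcontfun (s j) k - L k)\<bar> powr p) powr (1 / p)" for j
      by (auto simp: seq_space_def y minus_bcontfun.rep_eq intro!: arg_cong[where f = "\<lambda>x. x powr (1 / p)"] sum.cong)
    ultimately show "(\<lambda>j. nrm (seq_space p n) (s j - y)) \<longlonglongrightarrow> 0" by simp
  qed
qed

lemma seq_space_dim: "dim_ge (carr (seq_space p n)) n"
proof -
  define e where "e = (\<lambda>i::nat. Bcontfun (\<lambda>k. if k = i then 1 else 0 :: real))"
  have e: "apply_bcontfun (e i) = (\<lambda>k. if k = i then 1 else 0)" for i
    unfolding e_def by (rule finite_support_bcontfun[of "Suc i"]) simp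
  have inj: "inj_on e {..<n}"
  proof (rule inj_onI)
    fix i j assume "e i = e j"
    then have "apply_bcontfun (e i) i = apply_bcontfun (e j) i" by simp
    then show "i = j" by (simp add: e split: if_splits)
  qed
  have apply_sum: "apply_bcontfun (\<Sum>i\<in>I. c i *\<^sub>R e i) k = (\<Sum>i\<in>I. c i * (if k = i then 1 else 0))" if "finite I" for c I k
    using that by (induction I rule: finite_induct) (auto simp: zero_bcontfun.rep_eq plus_bcontfun.rep_eq scaleR_bcontfun.rep_eq e)
  have "independent (e ` {..<n})"
  proof
    assume "dependent (e ` {..<n})"
    then obtain c where c: "\<exists>v\<in>e ` {..<n}. c v \<noteq> 0" "(\<Sum>v\<in>e ` {..<n}. c v *\<^sub>R v) = 0"
      using dependent_finite[of "e ` {..<n}"] by auto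
    have "(\<Sum>i<n. c (e i) *\<^sub>R e i) = 0" using c(2) by (simp add: sum.reindex[OF inj])
    then have "(\<Sum>i<n. c (e i) * (if k = i then 1 else 0)) = 0" for k
      using apply_sum[of "{..<n}" "\<lambda>i. c (e i)" k] by (simp add: zero_bcontfun.rep_eq)
    moreover have "c (e i) * (if k = i then 1 else 0) = (if k = i then c (e i) else 0)" for i k by simp
    ultimately have F: "(if k < n then c (e k) else 0) = 0" for k by simp
    have "c (e k) = 0" if "k < n" for k using F[of k] that by simp
    then show False using c(1) by auto
  qed
  moreover have "e ` {..<n} \<subseteq> carr (seq_space p n)" by (auto simp: seq_space_def e)
  moreover have "card (e ` {..<n}) = n" by (simp add: card_image[OF inj])
  ultimately show ?thesis unfolding dim_ge_def by (intro exI[of _ "e ` {..<n}"]) auto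
qed

section \<open>Lower bounds for isomorphism numbers\<close>

text \<open>Upper bounds \<alpha> and \<beta> for the operators bound the inverse norms from below
  only if the operator norms are positive, because \<open>inverse 0\<close> is 0. A unit vector g of
  G, which exists as n \<ge> 1, satisfies A (B g) = g and excludes norm 0.\<close>

lemma iso_number_E2_ge:
  fixes G :: "'g::real_vector nspace"
  assumes Y: "\<And>c v. v \<in> carr Y \<Longrightarrow> c *\<^sub>R v \<in> carr Y" "\<And>c v. v \<in> carr Y \<Longrightarrow> nrm Y (c *\<^sub>R v) = \<bar>c\<bar> * nrm Y v"
    and X: "\<And>x. x \<in> carr X \<Longrightarrow> 0 \<le> nrm X x" "\<And>x. x \<in> carr X \<Longrightarrow> nrm X x = 0 \<Longrightarrow> x = 0"
    and fac: "id_factorization X Y E2 G A B" and dim: "dim_ge (carr G) n" "1 \<le> n"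
    and TB: "\<And>g. g \<in> carr G \<Longrightarrow> B g \<in> carr Y"
    and \<alpha>: "0 < \<alpha>" "\<And>v. v \<in> carr Y \<Longrightarrow> nrm G (A v) \<le> \<alpha> * nrm Y v"
    and \<beta>: "0 < \<beta>" "\<And>g. g \<in> carr G \<Longrightarrow> nrm X (B g) \<le> \<beta> * nrm G g"
  shows "ennreal (1 / (\<alpha> * \<beta>)) \<le> iso_number X Y E2 n"
proof -
  have nG: "normed_space G" and A: "bounded_op Y G A" and B: "bounded_op G X B"
    and id: "\<And>g. g \<in> carr G \<Longrightarrow> A (B g) = g"
    using fac by (auto simp: id_factorization_def banach_space_def E2_def)
  have G: "subspace (carr G)" "\<And>g. g \<in> carr G \<Longrightarrow> 0 \<le> nrm G g" "\<And>g. g \<in> carr G \<Longrightarrow> nrm G g = 0 \<longleftrightarrow> g = 0"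
    "\<And>c g. g \<in> carr G \<Longrightarrow> nrm G (c *\<^sub>R g) = \<bar>c\<bar> * nrm G g"
    using nG by (auto simp: normed_space_def)
  obtain S where S: "S \<subseteq> carr G" "finite S" "independent S" "card S = n" using dim by (auto simp: dim_ge_def)
  then obtain v where v: "v \<in> S" using dim(2) by fastforce
  then have v0: "v \<noteq> 0" "v \<in> carr G" using S dependent_zero[of S] by auto
  define g where "g = (1 / nrm G v) *\<^sub>R v"
  have nv: "0 < nrm G v" using G(2,3)[OF v0(2)] v0(1) by linarith
  have g: "g \<in> carr G" "nrm G g = 1" using subspace_scale[OF G(1) v0(2)] G(4)[OF v0(2)] nv by (auto simp: g_def)
  have g0: "g \<noteq> 0" using G(3)[OF g(1)] g(2) by simp
  have Bg: "B g \<in> carr X" using B g(1) by (simp add: bounded_op_def)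
  have A0: "A 0 = 0"
  proof -
    have "A (0 *\<^sub>R B g) = 0 *\<^sub>R A (B g)" using A TB[OF g(1)] unfolding bounded_op_def by blast
    then show ?thesis by simp
  qed
  have nB: "0 < nrm X (B g)"
    using X(1)[OF Bg] X(2)[OF Bg] id[OF g(1)] A0 g0 by (metis less_eq_real_def)
  have opB: "0 < op_norm G X B" "op_norm G X B \<le> \<beta>"
  proof -
    have bnd: "nrm X (B x) \<le> \<beta>" if "x \<in> carr G" "nrm G x \<le> 1" for x
    proof -
      have "\<beta> * nrm G x \<le> \<beta> * 1" using that(2) \<beta>(1) by (intro mult_left_mono) auto
      then show ?thesis using \<beta>(2)[OF that(1)] by linarith
    qed
    then show "op_norm G X B \<le> \<beta>" using g by (intro op_norm_le[where v = g]) auto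
    have "nrm X (B g) \<le> op_norm G X B"
      unfolding op_norm_def by (rule cSUP_upper) (use g bnd in \<open>auto simp: bdd_above_def\<close>)
    then show "0 < op_norm G X B" using nB by simp
  qed
  have Ag: "1 \<le> \<alpha> * nrm Y (B g)" using \<alpha>(2)[OF TB[OF g(1)]] id[OF g(1)] g(2) by simp
  then have nY: "0 < nrm Y (B g)" using \<alpha>(1) by (smt (verit) mult_nonneg_nonpos)
  define y where "y = (1 / nrm Y (B g)) *\<^sub>R B g"
  have y: "y \<in> carr Y" "nrm Y y = 1" using Y(1,2)[OF TB[OF g(1)]] nY by (auto simp: y_def)
  have Ay: "nrm G (A y) = 1 / nrm Y (B g)"
  proof -
    have "A y = (1 / nrm Y (B g)) *\<^sub>R g"
      using A TB[OF g(1)] id[OF g(1)] unfolding bounded_op_def y_def by metis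
    then show ?thesis using G(4)[OF g(1)] g(2) nY by simp
  qed
  have opA: "0 < op_norm Y G A" "op_norm Y G A \<le> \<alpha>"
  proof -
    have bnd: "nrm G (A x) \<le> \<alpha>" if "x \<in> carr Y" "nrm Y x \<le> 1" for x
    proof -
      have "\<alpha> * nrm Y x \<le> \<alpha> * 1" using that(2) \<alpha>(1) by (intro mult_left_mono) auto
      then show ?thesis using \<alpha>(2)[OF that(1)] by linarith
    qed
    then show "op_norm Y G A \<le> \<alpha>" using y by (intro op_norm_le[where v = y]) auto
    have "nrm G (A y) \<le> op_norm Y G A"
      unfolding op_norm_def by (rule cSUP_upper) (use y bnd in \<open>auto simp: bdd_above_def\<close>)
    moreover have "0 < 1 / nrm Y (B g)" using nY by simp
    ultimately show "0 < op_norm Y G A" unfolding Ay by linarith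
  qed
  have "1 / (\<alpha> * \<beta>) = inverse \<alpha> * inverse \<beta>" by (simp add: field_simps)
  also have "\<dots> \<le> inverse (op_norm Y G A) * inverse (op_norm G X B)"
    using opA opB \<alpha>(1) \<beta>(1) by (intro mult_mono le_imp_inverse_le) auto
  finally have "ennreal (1 / (\<alpha> * \<beta>)) \<le> ennreal (inverse (op_norm Y G A) * inverse (op_norm G X B))"
    by (rule ennreal_leI)
  also have "\<dots> \<le> iso_number X Y E2 n" by (rule iso_number_universal[OF fac dim(1)])
  finally show ?thesis .
qed

text \<open>Norm 0 makes w vanish in L^1, hence the potential vanishes, and f t = 0 then makes the
  slope B vanish.\<close>

lemma W2D_norm_definite:
  assumes t: "0 < t" and p: "1 < p" and u: "u \<in> carr (W2D p t)"
  shows "0 \<le> nrm (W2D p t) u" "nrm (W2D p t) u = 0 \<Longrightarrow> u = 0"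
proof -
  obtain w f B where r: "w \<in> borel_measurable borel" "\<And>x. x \<notin> {0..t} \<Longrightarrow> w x = 0" "integrable lborel w"
    "integrable lborel (\<lambda>x. \<bar>w x\<bar> powr p)" "nrm (W2D p t) u = (LINT x|lborel. \<bar>w x\<bar> powr p) powr (1 / p)"
    "f \<in> borel_measurable borel" "continuous_on {0..t} f" "\<And>x. x \<in> {0..t} \<Longrightarrow> f x = B * x + potential w x"
    "\<And>x. x \<notin> {0..t} \<Longrightarrow> f x = 0" "f t = 0" "u = abs_L0 f"
    by (rule W2D_repr[OF t p u]) (rule that)
  show "0 \<le> nrm (W2D p t) u" unfolding r(5) by simp
  assume "nrm (W2D p t) u = 0"
  then have J: "(LINT x|lborel. \<bar>w x\<bar> powr p) = 0" unfolding r(5) by simp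
  have w1: "(LINT s|lborel. \<bar>w s\<bar>) \<le> 0" using L1_le_Lp[OF p t r(3,4,2)] J by simp
  have pot: "potential w x = 0" if "x \<in> {0..t}" for x
  proof -
    have "\<bar>potential w x\<bar> \<le> t * (LINT s|lborel. \<bar>w s\<bar>)" by (rule potential_bound[OF r(3,2) that])
    also have "\<dots> \<le> 0" using w1 t by (simp add: mult_nonneg_nonpos)
    finally show ?thesis by simp
  qed
  have "B = 0" using r(8)[of t] r(10) pot[of t] t by simp
  then have "f x = 0" for x using r(8)[of x] r(9)[of x] pot[of x] by (cases "x \<in> {0..t}") auto
  then have "f = (\<lambda>_. 0)" by auto
  then show "u = 0" unfolding r(11) by (simp add: zero_L0.abs_eq)
qed

lemma Lp_scale:
  assumes p: "1 < p" and v: "v \<in> carr (Lp p t)"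
  shows "c *\<^sub>R v \<in> carr (Lp p t)" "Lp_norm p (c *\<^sub>R v) = \<bar>c\<bar> * Lp_norm p v"
proof -
  obtain w where w: "w \<in> borel_measurable borel" "\<And>x. x \<notin> {0..t} \<Longrightarrow> w x = 0" "v = abs_L0 w"
    "integrable lborel (\<lambda>x. \<bar>w x\<bar> powr p)" "integrable lborel w"
    "Lp_norm p v = (LINT x|lborel. \<bar>w x\<bar> powr p) powr (1 / p)"
    by (rule Lp_repr[OF p v]) (rule that)
  have m: "(\<lambda>x. c * w x) \<in> borel_measurable borel" using w(1) by simp
  have e: "\<bar>c * w x\<bar> powr p = \<bar>c\<bar> powr p * \<bar>w x\<bar> powr p" for x by (simp add: abs_mult powr_mult)
  have cv: "c *\<^sub>R v = abs_L0 (\<lambda>x. c * w x)" unfolding w(3) by (rule abs_L0_scaleR[OF w(1)])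
  show "c *\<^sub>R v \<in> carr (Lp p t)"
    unfolding cv abs_L0_in_Lp[OF m] e using w(2,4) by auto
  show "Lp_norm p (c *\<^sub>R v) = \<bar>c\<bar> * Lp_norm p v"
    unfolding cv abs_L0_norm[OF m] e w(6) using p by (simp add: powr_mult powr_powr)
qed

section \<open>The n-dimensional space of splines\<close>

text \<open>The minimum with n - 1 assigns the right end x = n to the last cell; an interior node
  belongs to the cell on its right.\<close>

definition cell :: "nat \<Rightarrow> real \<Rightarrow> nat" where
  "cell n x = min (nat \<lfloor>x\<rfloor>) (n - 1)"

lemma cell_measurable [measurable]: "cell n \<in> measurable borel (count_space UNIV)"
  unfolding cell_def by measurable

lemma cell_eq:
  assumes "k < n" "x \<in> {real k..real k + 1}"
  shows "cell n x = k \<or> x = real k + 1 \<and> Suc k < n \<and> cell n x = Suc k"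
proof (cases "x = real k + 1")
  case True
  then have "\<lfloor>x\<rfloor> = int (Suc k)" by linarith
  then have "nat \<lfloor>x\<rfloor> = Suc k" by simp
  then show ?thesis using True assms(1) by (auto simp: cell_def)
next
  case False
  then have "\<lfloor>x\<rfloor> = int k" using assms(2) by (simp add: floor_eq_iff)
  then show ?thesis using assms(1) by (simp add: cell_def)
qed

context pq_sol
begin

text \<open>On \<open>[k, k + 1]\<close> the function \<open>spline n y\<close> is a multiple of the antiperiodic eigenfunction plus the
  affine function with the values \<open>node n y\<close> at the ends; \<open>coef\<close> and \<open>node\<close> are chosen such that the
  first derivatives match at the nodes.\<close>

definition coef :: "nat \<Rightarrow> (nat \<Rightarrow> real) \<Rightarrow> nat \<Rightarrow> real" where
  "coef n y k = 4 * y k + (jump n y (Suc k) - jump n y k)"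

definition node :: "nat \<Rightarrow> (nat \<Rightarrow> real) \<Rightarrow> nat \<Rightarrow> real" where
  "node n y j = (-1) ^ j * f1 0 * jump n y j"

definition piece :: "nat \<Rightarrow> (nat \<Rightarrow> real) \<Rightarrow> nat \<Rightarrow> real \<Rightarrow> real" where
  "piece n y k z = coef n y k * antiper f z + (node n y k * (1 - (z - real k)) + node n y (Suc k) * (z - real k))"

definition piece1 :: "nat \<Rightarrow> (nat \<Rightarrow> real) \<Rightarrow> nat \<Rightarrow> real \<Rightarrow> real" where
  "piece1 n y k z = coef n y k * antiper f1 z + (node n y (Suc k) - node n y k)"

definition spline :: "nat \<Rightarrow> (nat \<Rightarrow> real) \<Rightarrow> real \<Rightarrow> real" where
  "spline n y z = piece n y (cell n z) z"

definition spline1 :: "nat \<Rightarrow> (nat \<Rightarrow> real) \<Rightarrow> real \<Rightarrow> real" where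
  "spline1 n y z = piece1 n y (cell n z) z"

definition spline2 :: "nat \<Rightarrow> (nat \<Rightarrow> real) \<Rightarrow> real \<Rightarrow> real" where
  "spline2 n y z = coef n y (cell n z) * spow (1 / (p - 1)) (antiper g z)"

lemma antiper_nat: "antiper f (real k) = 0" "antiper f1 (real k) = (-1) ^ k * f1 0" "antiper g (real k) = 0"
  using antiper_eq[of f1 "real k" k] antiperiodic(2) antiper_zeros[of "real k"] by auto

text \<open>The definitions take the right cell at an interior node; the formulas of the left cell
  give the same values there. For the second derivative this holds because \<open>antiper g\<close>
  vanishes at integers.\<close>

lemma spline_on:
  assumes k: "k < n" and z: "z \<in> {real k..real k + 1}"
  shows "spline n y z = piece n y k z" "spline1 n y z = piece1 n y k z"
    "spline2 n y z = coef n y k * spow (1 / (p - 1)) (antiper g z)"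
proof -
  consider "cell n z = k" | "z = real k + 1" "Suc k < n" "cell n z = Suc k" using cell_eq[OF k z] by blast
  then have "spline n y z = piece n y k z \<and> spline1 n y z = piece1 n y k z \<and>
    spline2 n y z = coef n y k * spow (1 / (p - 1)) (antiper g z)"
  proof cases
    case 2
    have z': "z = real (Suc k)" using 2 by simp
    have J: "jump n y (Suc k) = y (Suc k) - y k" using 2 by (simp add: jump_def)
    \<comment> \<open>With J the jumps, the coefficients of the two cells differ by J k + 2 J (k +
      1) + J (k + 2), and the slopes of the affine parts differ by the same sum times - (-1)^(k + 1)
      f1 0. The 4 in \<open>coef\<close> is what makes the two sums equal.\<close>
    have "piece1 n y (Suc k) z = piece1 n y k z"
      unfolding piece1_def z' antiper_nat coef_def node_def J by (simp add: algebra_simps)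
    moreover have "piece n y (Suc k) z = piece n y k z"
      unfolding piece_def z' antiper_nat by simp
    moreover have "antiper g z = 0" unfolding z' by (rule antiper_nat)
    ultimately show ?thesis using 2 by (simp add: spline_def spline1_def spline2_def)
  qed (simp add: spline_def spline1_def spline2_def)
  then show "spline n y z = piece n y k z" "spline1 n y z = piece1 n y k z"
    "spline2 n y z = coef n y k * spow (1 / (p - 1)) (antiper g z)" by auto
qed

lemma piece_deriv:
  assumes "k < n" "z \<in> {real k..real k + 1}"
  shows "(piece n y k has_real_derivative piece1 n y k z) (at z within {real k..real k + 1})"
    "(piece1 n y k has_real_derivative coef n y k * spow (1 / (p - 1)) (antiper g z)) (at z within {real k..real k + 1})"
proof -
  have sub: "{real k..real k + 1} \<subseteq> {0..real n}" using assms(1) by auto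
  have z: "z \<in> {0..real n}" using assms(2) sub by blast
  have d: "(antiper f has_real_derivative antiper f1 z) (at z within {real k..real k + 1})"
    "(antiper f1 has_real_derivative spow (1 / (p - 1)) (antiper g z)) (at z within {real k..real k + 1})"
    by (rule DERIV_subset[OF solD(1)[OF sol_antiper z] sub] DERIV_subset[OF solD(2)[OF sol_antiper z] sub])+
  show "(piece n y k has_real_derivative piece1 n y k z) (at z within {real k..real k + 1})"
    unfolding piece_def piece1_def by (auto intro!: derivative_eq_intros d)
  show "(piece1 n y k has_real_derivative coef n y k * spow (1 / (p - 1)) (antiper g z)) (at z within {real k..real k + 1})"
    unfolding piece1_def by (auto intro!: derivative_eq_intros d)
qed

lemma spline_deriv:
  assumes n: "1 \<le> n" and z: "z \<in> {0..real n}"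
  shows "(spline n y has_real_derivative spline1 n y z) (at z within {0..real n})"
    "(spline1 n y has_real_derivative spline2 n y z) (at z within {0..real n})"
proof -
  have 1: "(spline n y has_real_derivative spline1 n y z) (at z within {real k..real k + 1})"
    "(spline1 n y has_real_derivative spline2 n y z) (at z within {real k..real k + 1})"
    if k: "k < n" and z: "z \<in> {real k..real k + 1}" for k z
  proof -
    have "(spline n y has_real_derivative piece1 n y k z) (at z within {real k..real k + 1})"
      by (rule has_field_derivative_transform_within[OF piece_deriv(1)[OF k z] zero_less_one z]) (simp add: spline_on[OF k])
    then show "(spline n y has_real_derivative spline1 n y z) (at z within {real k..real k + 1})"
      by (simp add: spline_on[OF k z])
    have "(spline1 n y has_real_derivative coef n y k * spow (1 / (p - 1)) (antiper g z)) (at z within {real k..real k + 1})"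
      by (rule has_field_derivative_transform_within[OF piece_deriv(2)[OF k z] zero_less_one z]) (simp add: spline_on[OF k])
    then show "(spline1 n y has_real_derivative spline2 n y z) (at z within {real k..real k + 1})"
      by (simp add: spline_on[OF k z])
  qed
  show "(spline n y has_real_derivative spline1 n y z) (at z within {0..real n})"
    "(spline1 n y has_real_derivative spline2 n y z) (at z within {0..real n})"
    by (rule has_real_derivative_pieces[OF _ n z]; rule 1; assumption)+
qed

lemma spline_add: "spline n (\<lambda>k. y k + z k) x = spline n y x + spline n z x"
  by (simp add: spline_def piece_def coef_def node_def jump_add algebra_simps)

lemma spline_cmult: "spline n (\<lambda>k. c * y k) x = c * spline n y x"
  by (simp add: spline_def piece_def coef_def node_def jump_cmult algebra_simps)

lemma spline_ends:
  assumes n: "1 \<le> n" shows "spline n y 0 = 0" "spline n y (real n) = 0"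
proof -
  have "spline n y 0 = piece n y 0 0" by (rule spline_on) (use n in auto)
  also have "\<dots> = 0" using antiper_nat(1)[of 0] by (simp add: piece_def node_def)
  finally show "spline n y 0 = 0" .
  obtain m where m: "n = Suc m" using n by (cases n) auto
  have "spline n y (real n) = piece n y m (real n)" by (rule spline_on) (auto simp: m)
  also have "\<dots> = 0" unfolding piece_def antiper_nat by (simp add: m node_def)
  finally show "spline n y (real n) = 0" .
qed

lemma antiper_cell: "\<sigma> \<in> {0..1} \<Longrightarrow> antiper f (real k + \<sigma>) = (-1) ^ k * f \<sigma>"
  "\<sigma> \<in> {0..1} \<Longrightarrow> antiper g (real k + \<sigma>) = (-1) ^ k * g \<sigma>"
  using antiper_eq[OF antiperiodic(1), of "real k + \<sigma>" k] antiper_eq[OF antiperiodic(3), of "real k + \<sigma>" k] by auto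

text \<open>Integrating the derivative of g f1 over [0, 1] shows, by \<open>norm_g\<close>, that the
  integral of g1 f1 is -1, while the end slopes are the largest values of \<bar>g1\<bar> and
  \<bar>f1\<bar>. This makes the parameter \<nu> of the tridiagonal system nonnegative.\<close>

lemma gamma_ge_1: "1 \<le> - (f1 0 * g1 0)"
proof -
  have der: "((\<lambda>x. g x * f1 x) has_real_derivative g x * spow (1 / (p - 1)) (g x) + g1 x * f1 x) (at x within {0..1})"
    if "x \<in> {0..1}" for x
    by (rule DERIV_cong[OF DERIV_mult[OF solD(3)[OF sol that] solD(2)[OF sol that]]]) (simp add: algebra_simps)
  have i1: "(\<lambda>x. \<bar>g x\<bar> powr (p / (p - 1))) integrable_on {0..1}"
    using p by (intro integrable_continuous_real continuous_on_powr' continuous_intros sol_continuous[OF sol]) auto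
  have i2: "(\<lambda>x. g1 x * f1 x) integrable_on {0..1}"
    by (intro integrable_continuous_real continuous_intros sol_continuous[OF sol])
  have "((\<lambda>x. g x * spow (1 / (p - 1)) (g x) + g1 x * f1 x) has_integral g 1 * f1 1 - g 0 * f1 0) {0..1}"
    by (rule fundamental_theorem_of_calculus)
       (use der in \<open>auto simp: has_real_derivative_iff_has_vector_derivative[symmetric]\<close>)
  moreover have "g x * spow (1 / (p - 1)) (g x) = \<bar>g x\<bar> powr (p / (p - 1))" for x
  proof -
    have "1 / (p - 1) + 1 = p / (p - 1)" using p by (simp add: field_simps)
    then show ?thesis by (simp add: mult_spow)
  qed
  ultimately have "((\<lambda>x. \<bar>g x\<bar> powr (p / (p - 1)) + g1 x * f1 x) has_integral 0) {0..1}"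
    using ends solD(6)[OF sol] by simp
  then have "integral {0..1} (\<lambda>x. \<bar>g x\<bar> powr (p / (p - 1)) + g1 x * f1 x) = 0" by (rule integral_unique)
  then have "1 + integral {0..1} (\<lambda>x. g1 x * f1 x) = 0"
    by (simp only: Henstock_Kurzweil_Integration.integral_add[OF i1 i2] norm_g)
  moreover have "f1 0 * g1 0 \<le> integral {0..1} (\<lambda>x. g1 x * f1 x)"
  proof -
    have "integral {0..1} (\<lambda>_::real. f1 0 * g1 0) \<le> integral {0..1} (\<lambda>x. g1 x * f1 x)"
    proof (rule Henstock_Kurzweil_Integration.integral_le)
      fix x :: real assume x: "x \<in> {0..1}"
      have "\<bar>g1 x\<bar> \<le> - g1 0" "\<bar>f1 x\<bar> \<le> f1 0"
        using slopes(5,6)[OF x] antiperiodic slopes(1-4) by auto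
      then have "\<bar>g1 x\<bar> * \<bar>f1 x\<bar> \<le> (- g1 0) * f1 0" by (rule mult_mono) (use slopes in auto)
      then have "\<bar>g1 x * f1 x\<bar> \<le> - (f1 0 * g1 0)" by (simp add: abs_mult mult.commute)
      then show "f1 0 * g1 0 \<le> g1 x * f1 x" by linarith
    qed (auto intro: i2)
    then show ?thesis by simp
  qed
  ultimately show ?thesis by linarith
qed

text \<open>The multiple of f contributes \<open>coef n y k\<close>, by \<open>norm_f\<close>. For
  the affine part l * spow (q - 1) f is the derivative of g1, so integration by parts leaves only
  the end slopes of g, that is, \<open>f1 0 * g1 0\<close> times a difference of jumps. The sign of
  the cell cancels against the alternating signs in \<open>node\<close>.\<close>

lemma piece_pairing:
  assumes norm_f: "integral {0..1} (\<lambda>x. \<bar>f x\<bar> powr q) = 1 / l" and k: "k < n"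
  shows "l * (\<integral>\<sigma>. piece n y k (real k + \<sigma>) * spow (q - 1) (antiper f (real k + \<sigma>)) \<partial>unitm)
    = 4 * y k - (- (f1 0 * g1 0) - 1) * (jump n y (Suc k) - jump n y k)"
proof -
  define \<epsilon> where "\<epsilon> = (-1 :: real) ^ k"
  have \<epsilon>: "\<epsilon> * \<epsilon> = 1" by (simp add: \<epsilon>_def flip: power_mult_distrib)
  define a where "a = node n y k"
  define b where "b = node n y (Suc k)"
  have q1: "0 < q - 1" by (rule pos(2))
  have c1: "continuous_on {0..1} (\<lambda>\<sigma>. \<bar>f \<sigma>\<bar> powr q)"
    using q by (intro continuous_on_powr' continuous_intros sol_continuous[OF sol]) auto
  have c2: "continuous_on {0..1} (\<lambda>\<sigma>. (a + (b - a) * \<sigma>) * (l * spow (q - 1) (f \<sigma>)))"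
    by (intro continuous_intros sol_continuous[OF sol] q1)
  have "((\<lambda>\<sigma>. (a + (b - a) * \<sigma>) * (l * spow (q - 1) (f \<sigma>))) has_integral
      ((a + (b - a) * 1) * g1 1 - (b - a) * g 1) - ((a + (b - a) * 0) * g1 0 - (b - a) * g 0)) {0..1}"
  proof (rule fundamental_theorem_of_calculus)
    fix x :: real assume x: "x \<in> {0..1}"
    show "((\<lambda>\<sigma>. (a + (b - a) * \<sigma>) * g1 \<sigma> - (b - a) * g \<sigma>) has_vector_derivative (a + (b - a) * x) * (l * spow (q - 1) (f x))) (at x within {0..1})"
      unfolding has_real_derivative_iff_has_vector_derivative[symmetric]
      by (auto intro!: derivative_eq_intros solD(3,4)[OF sol x])
  qed simp
  then have i2: "integral {0..1} (\<lambda>\<sigma>. (a + (b - a) * \<sigma>) * (l * spow (q - 1) (f \<sigma>))) = - (g1 0 * (a + b))"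
    using ends solD(6)[OF sol] antiperiodic(4) by (simp add: integral_unique algebra_simps)
  have "l * (\<integral>\<sigma>. piece n y k (real k + \<sigma>) * spow (q - 1) (antiper f (real k + \<sigma>)) \<partial>unitm)
    = (\<integral>\<sigma>. l * coef n y k * \<bar>f \<sigma>\<bar> powr q + \<epsilon> * ((a + (b - a) * \<sigma>) * (l * spow (q - 1) (f \<sigma>))) \<partial>unitm)"
    unfolding integral_mult_right_zero[symmetric]
  proof (rule Bochner_Integration.integral_cong[OF refl])
    fix \<sigma> assume "\<sigma> \<in> space unitm"
    then have \<sigma>: "\<sigma> \<in> {0..1}" by simp
    have F: "antiper f (real k + \<sigma>) = \<epsilon> * f \<sigma>" using antiper_cell(1)[OF \<sigma>] by (simp add: \<epsilon>_def)
    have S: "spow (q - 1) (antiper f (real k + \<sigma>)) = \<epsilon> * spow (q - 1) (f \<sigma>)"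
      unfolding F by (cases "even k") (simp_all add: \<epsilon>_def)
    have fq: "\<bar>f \<sigma>\<bar> powr q = f \<sigma> * spow (q - 1) (f \<sigma>)" by (simp add: mult_spow)
    have "l * (piece n y k (real k + \<sigma>) * spow (q - 1) (antiper f (real k + \<sigma>)))
      = l * coef n y k * ((\<epsilon> * \<epsilon>) * (f \<sigma> * spow (q - 1) (f \<sigma>))) + \<epsilon> * ((a + (b - a) * \<sigma>) * (l * spow (q - 1) (f \<sigma>)))"
      unfolding piece_def S unfolding F a_def[symmetric] b_def[symmetric] by (simp add: algebra_simps)
    then show "l * (piece n y k (real k + \<sigma>) * spow (q - 1) (antiper f (real k + \<sigma>)))
      = l * coef n y k * \<bar>f \<sigma>\<bar> powr q + \<epsilon> * ((a + (b - a) * \<sigma>) * (l * spow (q - 1) (f \<sigma>)))"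
      unfolding fq \<epsilon> by simp
  qed
  also have "\<dots> = l * coef n y k * (\<integral>\<sigma>. \<bar>f \<sigma>\<bar> powr q \<partial>unitm) + \<epsilon> * (\<integral>\<sigma>. (a + (b - a) * \<sigma>) * (l * spow (q - 1) (f \<sigma>)) \<partial>unitm)"
    using integrable_unitm_continuous[OF c1] integrable_unitm_continuous[OF c2] by simp
  also have "\<dots> = coef n y k - \<epsilon> * (a + b) * g1 0"
    unfolding integral_unitm_continuous[OF c1] integral_unitm_continuous[OF c2] norm_f i2 using pos(3) by simp
  also have "\<epsilon> * (a + b) = (\<epsilon> * \<epsilon>) * f1 0 * (jump n y k - jump n y (Suc k))"
    unfolding a_def b_def node_def by (simp add: \<epsilon>_def algebra_simps)
  finally show ?thesis unfolding \<epsilon> coef_def by (simp add: algebra_simps)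
qed

end

lemma cell_less: "1 \<le> n \<Longrightarrow> cell n x < n"
  by (simp add: cell_def)

context pq_sol
begin

definition spline_class :: "nat \<Rightarrow> real \<Rightarrow> (nat \<Rightarrow> real) \<Rightarrow> L0" where
  "spline_class n h y = abs_L0 (\<lambda>x. indicator {0..real n * h} x * spline n y (x / h))"

lemma scaled_mem: "0 < h \<Longrightarrow> x \<in> {0..real n * h} \<longleftrightarrow> x / h \<in> {0..real n}"
  by (simp add: field_simps)

lemma continuous_scaled:
  assumes "0 < h" "continuous_on {0..real n} F"
  shows "continuous_on {0..real n * h} (\<lambda>x. F (x / h))"
  by (rule continuous_on_compose2[OF assms(2)]) (use assms(1) in \<open>auto intro!: continuous_intros simp: field_simps\<close>)

lemma continuous_spline:
  assumes n: "1 \<le> n"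
  shows "continuous_on {0..real n} (spline n y)" "continuous_on {0..real n} (spline1 n y)"
  by (rule DERIV_continuous_on[OF spline_deriv(1)[OF n]] DERIV_continuous_on[OF spline_deriv(2)[OF n]]; assumption)+

lemma measurable_scaled:
  assumes "0 < h" "continuous_on {0..real n} F"
  shows "(\<lambda>x. indicator {0..real n * h} x * F (x / h) :: real) \<in> borel_measurable borel"
  using borel_measurable_continuous_on_indicator[OF _ continuous_scaled[OF assms]] by simp

text \<open>By \<open>norm_g\<close> the second derivative on a cell has L^p norm h powr (1 / p - 2)
  times the modulus of the coefficient. The full norm is thus an l^p norm of coefficients, to which
  \<open>averaging_contraction\<close> applies.\<close>

lemma spline_class_in:
  assumes h: "0 < h" and n: "1 \<le> n"
  defines "t \<equiv> real n * h"
  shows "spline_class n h y \<in> carr (W2D p t)" "spline_class n h y \<in> carr (Lp q t)"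
    "nrm (W2D p t) (spline_class n h y) \<le> h powr (1 / p - 2) * (\<Sum>k<n. \<bar>4 * y k\<bar> powr p) powr (1 / p)"
proof -
  have t: "0 < t" using h n by (simp add: t_def)
  \<comment> \<open>The second derivative, with \<open>antiper g\<close> cut off outside the
    interval so that w is measurable on the whole line.\<close>
  define w where "w = (\<lambda>x. coef n y (cell n (x / h)) * spow (1 / (p - 1)) (indicator {0..real n * h} x * antiper g (x / h)) / h\<^sup>2)"
  have w_eq: "w x = spline2 n y (x / h) / h\<^sup>2" if "x \<in> {0..t}" for x
    using that by (simp add: w_def spline2_def t_def)
  have [measurable]: "(\<lambda>x. indicator {0..real n * h} x * antiper g (x / h)) \<in> borel_measurable borel"
    by (rule measurable_scaled[OF h sol_continuous(3)[OF sol_antiper]])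
  have [measurable]: "(\<lambda>x. coef n y (cell n (x / h))) \<in> borel_measurable borel"
  proof -
    have "(\<lambda>x. cell n (x / h)) \<in> measurable borel (count_space UNIV)" by measurable
    then show ?thesis by (rule measurable_compose) simp
  qed
  have mw: "w \<in> borel_measurable borel" unfolding w_def by measurable
  obtain K where K: "\<And>z. z \<in> {0..real n} \<Longrightarrow> \<bar>antiper g z\<bar> \<le> K"
    using compact_imp_bounded[OF compact_continuous_image[OF sol_continuous(3)[OF sol_antiper]]]
    unfolding bounded_iff by (metis compact_Icc image_eqI real_norm_def)
  define C where "C = (\<Sum>k<n. \<bar>coef n y k\<bar>) * K powr (1 / (p - 1)) / h\<^sup>2"
  have w_le: "\<bar>w x\<bar> \<le> C" if x: "x \<in> {0..t}" for x
  proof -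
    have z: "x / h \<in> {0..real n}" using x scaled_mem[OF h] by (simp add: t_def)
    have 1: "\<bar>coef n y (cell n (x / h))\<bar> \<le> (\<Sum>k<n. \<bar>coef n y k\<bar>)"
      by (rule member_le_sum) (use cell_less[OF n] in auto)
    have 2: "\<bar>spow (1 / (p - 1)) (antiper g (x / h))\<bar> \<le> K powr (1 / (p - 1))"
      unfolding abs_spow using K[OF z] p by (intro powr_mono2) auto
    have "\<bar>coef n y (cell n (x / h))\<bar> * \<bar>spow (1 / (p - 1)) (antiper g (x / h))\<bar> \<le> (\<Sum>k<n. \<bar>coef n y k\<bar>) * K powr (1 / (p - 1))"
      by (rule mult_mono[OF 1 2]) (auto intro: sum_nonneg)
    then show ?thesis unfolding w_eq[OF x] spline2_def C_def by (simp add: abs_mult divide_right_mono)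
  qed
  have d: "(spline n y has_real_derivative spline1 n y (x / h)) (at (x / h))"
    "(spline1 n y has_real_derivative spline2 n y (x / h)) (at (x / h))" if "x \<in> {0<..<t}" for x
  proof -
    have z: "0 < x / h" "x / h < real n" using that h by (auto simp: t_def field_simps)
    then have z': "x / h \<in> {0..real n}" by simp
    show "(spline n y has_real_derivative spline1 n y (x / h)) (at (x / h))"
      "(spline1 n y has_real_derivative spline2 n y (x / h)) (at (x / h))"
      using spline_deriv[OF n z', of y] unfolding at_within_Icc_at[OF z] by auto
  qed
  have d1: "((\<lambda>x. spline n y (x / h)) has_real_derivative spline1 n y (x / h) / h) (at x)" if "x \<in> {0<..<t}" for x
    using DERIV_chain2[OF d(1)[OF that] DERIV_cdivide[OF DERIV_ident, of h]] by simp
  have d2: "((\<lambda>x. spline1 n y (x / h) / h) has_real_derivative w x) (at x)" if x: "x \<in> {0<..<t} - {}" for x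
  proof -
    have x': "x \<in> {0<..<t}" "x \<in> {0..t}" using x by auto
    show ?thesis unfolding w_eq[OF x'(2)]
      by (rule DERIV_cong[OF DERIV_cdivide[OF DERIV_chain2[OF d(2)[OF x'(1)] DERIV_cdivide[OF DERIV_ident, of h]], of h]])
         (simp add: power2_eq_square)
  qed
  have c: "continuous_on {0..t} (\<lambda>x. spline n y (x / h))" "continuous_on {0..t} (\<lambda>x. spline1 n y (x / h) / h)"
    unfolding t_def using h by (intro continuous_intros continuous_scaled[OF h] continuous_spline[OF n]; simp)+
  have e: "spline n y (0 / h) = 0" "spline n y (t / h) = 0" using spline_ends[OF n] h by (simp_all add: t_def)
  note W = W2D_intro[OF t p finite.emptyI c(1) d1 c(2) d2 mw w_le e]
  show "spline_class n h y \<in> carr (W2D p t)" using W(1) unfolding spline_class_def t_def .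
  show "spline_class n h y \<in> carr (Lp q t)" using W(2)[of q] q unfolding spline_class_def t_def by simp
  have nrm: "nrm (W2D p t) (spline_class n h y) = (LINT x:{0..t}|lborel. \<bar>w x\<bar> powr p) powr (1 / p)"
    using W(3) unfolding spline_class_def t_def .
  have i: "set_integrable lborel {0..real n * h} (\<lambda>x. \<bar>w x\<bar> powr p)"
  proof -
    have m: "(\<lambda>x. indicator {0..t} x * w x) \<in> borel_measurable borel" using mw by simp
    have "abs_L0 (\<lambda>x. indicator {0..t} x * w x) \<in> carr (Lp p t)"
      by (rule abs_L0_bounded_in_Lp[OF m, where C = C]) (use w_le p in auto)
    then have "integrable lborel (\<lambda>x. \<bar>indicator {0..t} x * w x\<bar> powr p)" unfolding abs_L0_in_Lp[OF m] by blast
    moreover have "\<bar>indicator {0..t} x * w x\<bar> powr p = indicator {0..t} x *\<^sub>R \<bar>w x\<bar> powr p" for x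
      by (cases "x \<in> {0..t}") simp_all
    ultimately show ?thesis unfolding set_integrable_def t_def by simp
  qed
  have cg: "continuous_on {0..1} (\<lambda>\<sigma>. \<bar>g \<sigma>\<bar> powr (p / (p - 1)))"
    using p by (intro continuous_on_powr' continuous_intros sol_continuous[OF sol]) auto
  have piece: "(LINT x:{real k * h..real k * h + h}|lborel. \<bar>w x\<bar> powr p) = h powr (1 - 2 * p) * \<bar>coef n y k\<bar> powr p"
    if k: "k < n" for k
  proof -
    have "(LINT x:{real k * h..real k * h + h}|lborel. \<bar>w x\<bar> powr p) = h * (\<integral>\<sigma>. \<bar>w (real k * h + h * \<sigma>)\<bar> powr p \<partial>unitm)"
      by (rule set_integral_affine[OF h])
    also have "(\<integral>\<sigma>. \<bar>w (real k * h + h * \<sigma>)\<bar> powr p \<partial>unitm) = (\<integral>\<sigma>. \<bar>coef n y k / h\<^sup>2\<bar> powr p * \<bar>g \<sigma>\<bar> powr (p / (p - 1)) \<partial>unitm)"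
    proof (rule Bochner_Integration.integral_cong[OF refl])
      fix \<sigma> assume "\<sigma> \<in> space unitm"
      then have \<sigma>: "\<sigma> \<in> {0..1}" by simp
      have z: "(real k * h + h * \<sigma>) / h = real k + \<sigma>" using h by (simp add: field_simps)
      have zk: "real k + \<sigma> \<in> {real k..real k + 1}" using \<sigma> by simp
      have x: "real k * h + h * \<sigma> \<in> {0..t}" unfolding t_def scaled_mem[OF h] z using \<sigma> k by auto
      have "\<bar>spow (1 / (p - 1)) (antiper g (real k + \<sigma>))\<bar> powr p = \<bar>g \<sigma>\<bar> powr (p / (p - 1))"
        unfolding abs_spow antiper_cell(2)[OF \<sigma>] using p by (simp add: powr_powr abs_mult power_abs)
      then show "\<bar>w (real k * h + h * \<sigma>)\<bar> powr p = \<bar>coef n y k / h\<^sup>2\<bar> powr p * \<bar>g \<sigma>\<bar> powr (p / (p - 1))"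
        unfolding w_eq[OF x] z spline_on(3)[OF k zk] by (simp add: abs_mult powr_mult powr_divide)
    qed
    also have "\<dots> = \<bar>coef n y k / h\<^sup>2\<bar> powr p"
      by (simp add: integral_unitm_continuous[OF cg] norm_g)
    also have "\<dots> = h powr (- 2 * p) * \<bar>coef n y k\<bar> powr p"
    proof -
      have "h\<^sup>2 powr p = h powr (2 * p)" using h by (simp add: powr_powr flip: powr_numeral)
      then show ?thesis using h by (simp add: powr_divide abs_divide powr_minus_divide)
    qed
    also have "h * (h powr (- 2 * p) * \<bar>coef n y k\<bar> powr p) = h powr (1 - 2 * p) * \<bar>coef n y k\<bar> powr p"
      using h by (simp add: powr_diff powr_minus_divide)
    finally show ?thesis .
  qed
  have "(LINT x:{0..t}|lborel. \<bar>w x\<bar> powr p) = (\<Sum>k<n. h powr (1 - 2 * p) * \<bar>coef n y k\<bar> powr p)"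
    unfolding t_def set_integral_split[OF h i] by (rule sum.cong[OF refl]) (simp add: piece)
  also have "\<dots> = h powr (1 - 2 * p) * (\<Sum>k<n. \<bar>coef n y k\<bar> powr p)" by (rule sum_distrib_left[symmetric])
  also have "\<dots> \<le> h powr (1 - 2 * p) * (\<Sum>k<n. \<bar>4 * y k\<bar> powr p)"
    unfolding coef_def by (intro mult_left_mono averaging_contraction[OF p]) auto
  finally have "(LINT x:{0..t}|lborel. \<bar>w x\<bar> powr p) powr (1 / p) \<le> (h powr (1 - 2 * p) * (\<Sum>k<n. \<bar>4 * y k\<bar> powr p)) powr (1 / p)"
    using p by (intro powr_mono2) (auto simp: set_lebesgue_integral_def intro!: integral_nonneg_AE)
  also have "\<dots> = h powr (1 / p - 2) * (\<Sum>k<n. \<bar>4 * y k\<bar> powr p) powr (1 / p)"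
  proof -
    have "(1 - 2 * p) * (1 / p) = 1 / p - 2" using p by (simp add: field_simps)
    then show ?thesis by (simp add: powr_mult powr_powr sum_nonneg)
  qed
  finally show "nrm (W2D p t) (spline_class n h y) \<le> h powr (1 / p - 2) * (\<Sum>k<n. \<bar>4 * y k\<bar> powr p) powr (1 / p)"
    unfolding nrm .
qed

end

section \<open>Moments against the dual eigenfunction\<close>

lemma rep_L0_integrable:
  assumes q: "1 < q" and v: "v \<in> carr (Lp q t)"
  shows "integrable lborel (rep_L0 v)" "integrable lborel (\<lambda>x. \<bar>rep_L0 v x\<bar> powr q)"
    "Lp_norm q v = (LINT x|lborel. \<bar>rep_L0 v x\<bar> powr q) powr (1 / q)"
proof -
  obtain w where w: "w \<in> borel_measurable borel" "\<And>x. x \<notin> {0..t} \<Longrightarrow> w x = 0" "v = abs_L0 w"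
    "integrable lborel (\<lambda>x. \<bar>w x\<bar> powr q)" "integrable lborel w"
    "Lp_norm q v = (LINT x|lborel. \<bar>w x\<bar> powr q) powr (1 / q)"
    by (rule Lp_repr[OF q v]) (rule that)
  have "AE x in lborel. w x = rep_L0 v x" using rep_abs_L0[OF w(1)] unfolding w(3) by eventually_elim simp
  then show "integrable lborel (rep_L0 v)" by (rule integrable_cong_AE_imp[OF w(5), rotated]) (simp add: rep_L0_measurable)
  show "integrable lborel (\<lambda>x. \<bar>rep_L0 v x\<bar> powr q)" using v by (simp add: carr_Lp in_Lp.rep_eq)
  show "Lp_norm q v = (LINT x|lborel. \<bar>rep_L0 v x\<bar> powr q) powr (1 / q)" by (rule Lp_norm.rep_eq)
qed

lemma rep_L0_add: "AE x in lborel. rep_L0 (u + v) x = rep_L0 u x + rep_L0 v x"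
proof -
  have "u + v = abs_L0 (\<lambda>x. rep_L0 u x + rep_L0 v x)"
    using abs_L0_add[OF rep_L0_measurable rep_L0_measurable, of u v] by simp
  then show ?thesis using rep_abs_L0[of "\<lambda>x. rep_L0 u x + rep_L0 v x"] by simp
qed

lemma rep_L0_scaleR: "AE x in lborel. rep_L0 (c *\<^sub>R v) x = c * rep_L0 v x"
proof -
  have "c *\<^sub>R v = abs_L0 (\<lambda>x. c * rep_L0 v x)"
    using abs_L0_scaleR[OF rep_L0_measurable, of c v] by simp
  then show ?thesis using rep_abs_L0[of "\<lambda>x. c * rep_L0 v x"] by simp
qed

context pq_sol
begin

text \<open>Up to a factor this is the norming functional of the eigenfunction in L^q, for cells of
  length h.\<close>

definition weight :: "nat \<Rightarrow> real \<Rightarrow> real \<Rightarrow> real" where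
  "weight n h x = spow (q - 1) (indicator {0..real n * h} x * antiper f (x / h))"

text \<open>The factor l / h gives the eigenfunction moment 1 on each cell, once the integral of
  \<bar>f\<bar> powr q is 1 / l.\<close>

definition moment :: "nat \<Rightarrow> real \<Rightarrow> L0 \<Rightarrow> nat \<Rightarrow> real" where
  "moment n h v k = l / h * (LINT x:{real k * h..real k * h + h}|lborel. rep_L0 v x * weight n h x)"

lemma weight_bounded:
  assumes h: "0 < h"
  obtains K where "\<And>x. \<bar>weight n h x\<bar> \<le> K"
proof -
  obtain K where K: "\<And>z. z \<in> {0..real n} \<Longrightarrow> \<bar>antiper f z\<bar> \<le> K"
    using compact_imp_bounded[OF compact_continuous_image[OF sol_continuous(1)[OF sol_antiper]]]
    unfolding bounded_iff by (metis compact_Icc image_eqI real_norm_def)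
  have "\<bar>weight n h x\<bar> \<le> K powr (q - 1)" for x
  proof (cases "x \<in> {0..real n * h}")
    case True
    then have "x / h \<in> {0..real n}" using scaled_mem[OF h] by blast
    then show ?thesis using True K q unfolding weight_def abs_spow by (simp add: powr_mono2)
  qed (simp add: weight_def)
  then show ?thesis by (rule that)
qed

lemma weight_measurable:
  assumes h: "0 < h" shows "weight n h \<in> borel_measurable borel"
proof -
  have [measurable]: "(\<lambda>x. indicator {0..real n * h} x * antiper f (x / h)) \<in> borel_measurable borel"
    by (rule measurable_scaled[OF h sol_continuous(1)[OF sol_antiper]])
  show ?thesis unfolding weight_def by measurable
qed

lemma moment_integrable:
  assumes h: "0 < h" and v: "v \<in> carr (Lp q t)"
  shows "set_integrable lborel {a..b} (\<lambda>x. rep_L0 v x * weight n h x)"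
proof -
  obtain K where K: "\<And>x. \<bar>weight n h x\<bar> \<le> K" using weight_bounded[OF h, of n] by blast
  have m: "(\<lambda>x. rep_L0 v x * weight n h x) \<in> borel_measurable borel"
    by (intro borel_measurable_times rep_L0_measurable weight_measurable[OF h])
  have "integrable lborel (\<lambda>x. rep_L0 v x * weight n h x)"
  proof (rule Bochner_Integration.integrable_bound)
    show "integrable lborel (\<lambda>x. K * rep_L0 v x)" using rep_L0_integrable(1)[OF q v] by simp
    have "norm (rep_L0 v x * weight n h x) \<le> norm (K * rep_L0 v x)" for x
    proof -
      have "\<bar>rep_L0 v x\<bar> * \<bar>weight n h x\<bar> \<le> \<bar>rep_L0 v x\<bar> * \<bar>K\<bar>"
        using K[of x] by (intro mult_left_mono) auto
      then show ?thesis by (simp add: abs_mult mult.commute)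
    qed
    then show "AE x in lborel. norm (rep_L0 v x * weight n h x) \<le> norm (K * rep_L0 v x)" by simp
  qed (use m in simp)
  then show ?thesis unfolding set_integrable_def by (intro integrable_mult_indicator) auto
qed

lemma moment_add:
  assumes h: "0 < h" and uv: "u \<in> carr (Lp q t)" "v \<in> carr (Lp q t)"
  shows "moment n h (u + v) k = moment n h u k + moment n h v k"
proof -
  note [measurable] = weight_measurable[OF h]
  have "(LINT x:{real k * h..real k * h + h}|lborel. rep_L0 (u + v) x * weight n h x)
    = (LINT x:{real k * h..real k * h + h}|lborel. rep_L0 u x * weight n h x + rep_L0 v x * weight n h x)"
    unfolding set_lebesgue_integral_def
    by (rule integral_cong_AE) (use rep_L0_add[of u v] in \<open>auto simp: algebra_simps\<close>)
  also have "\<dots> = (LINT x:{real k * h..real k * h + h}|lborel. rep_L0 u x * weight n h x)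
    + (LINT x:{real k * h..real k * h + h}|lborel. rep_L0 v x * weight n h x)"
    by (rule set_integral_add(2)[OF moment_integrable[OF h uv(1)] moment_integrable[OF h uv(2)]])
  finally show ?thesis by (simp add: moment_def distrib_left)
qed

lemma moment_scaleR:
  assumes h: "0 < h"
  shows "moment n h (c *\<^sub>R v) k = c * moment n h v k"
proof -
  note [measurable] = weight_measurable[OF h]
  have "(LINT x:{real k * h..real k * h + h}|lborel. rep_L0 (c *\<^sub>R v) x * weight n h x)
    = (LINT x:{real k * h..real k * h + h}|lborel. c * (rep_L0 v x * weight n h x))"
    unfolding set_lebesgue_integral_def
    by (rule integral_cong_AE) (use rep_L0_scaleR[of c v] in \<open>auto simp: algebra_simps\<close>)
  then show ?thesis by (simp add: moment_def)
qed

lemma moment_spline_class: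
  assumes norm_f: "integral {0..1} (\<lambda>x. \<bar>f x\<bar> powr q) = 1 / l"
    and h: "0 < h" and n: "1 \<le> n" and k: "k < n"
  shows "moment n h (spline_class n h y) k = 4 * y k - (- (f1 0 * g1 0) - 1) * (jump n y (Suc k) - jump n y k)"
proof -
  note [measurable] = weight_measurable[OF h]
  define u where "u = (\<lambda>x. indicator {0..real n * h} x * spline n y (x / h))"
  have [measurable]: "u \<in> borel_measurable borel"
    unfolding u_def by (rule measurable_scaled[OF h continuous_spline(1)[OF n]])
  have "AE x in lborel. rep_L0 (spline_class n h y) x = u x"
    unfolding spline_class_def u_def[symmetric] by (rule rep_abs_L0) measurable
  then have "(LINT x:{real k * h..real k * h + h}|lborel. rep_L0 (spline_class n h y) x * weight n h x)
    = (LINT x:{real k * h..real k * h + h}|lborel. u x * weight n h x)"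
    unfolding set_lebesgue_integral_def by (intro integral_cong_AE) auto
  also have "\<dots> = h * (\<integral>\<sigma>. u (real k * h + h * \<sigma>) * weight n h (real k * h + h * \<sigma>) \<partial>unitm)"
    by (rule set_integral_affine[OF h])
  also have "(\<integral>\<sigma>. u (real k * h + h * \<sigma>) * weight n h (real k * h + h * \<sigma>) \<partial>unitm)
    = (\<integral>\<sigma>. piece n y k (real k + \<sigma>) * spow (q - 1) (antiper f (real k + \<sigma>)) \<partial>unitm)"
  proof (rule Bochner_Integration.integral_cong[OF refl])
    fix \<sigma> assume "\<sigma> \<in> space unitm"
    then have \<sigma>: "\<sigma> \<in> {0..1}" by simp
    have z: "(real k * h + h * \<sigma>) / h = real k + \<sigma>" using h by (simp add: field_simps)
    have zk: "real k + \<sigma> \<in> {real k..real k + 1}" using \<sigma> by simp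
    have x: "real k * h + h * \<sigma> \<in> {0..real n * h}" unfolding scaled_mem[OF h] z using \<sigma> k by auto
    show "u (real k * h + h * \<sigma>) * weight n h (real k * h + h * \<sigma>)
      = piece n y k (real k + \<sigma>) * spow (q - 1) (antiper f (real k + \<sigma>))"
      unfolding u_def weight_def z spline_on(1)[OF k zk] using x by simp
  qed
  finally have "moment n h (spline_class n h y) k = l * (\<integral>\<sigma>. piece n y k (real k + \<sigma>) * spow (q - 1) (antiper f (real k + \<sigma>)) \<partial>unitm)"
    using h by (simp add: moment_def)
  then show ?thesis unfolding piece_pairing[OF norm_f k] .
qed

text \<open>The tangent inequality for \<open>\<bar>_\<bar> powr q\<close> at the projection of \<open>v\<close> to the multiples of the
  eigenfunction.\<close>

lemma moment_bound:
  assumes norm_f: "integral {0..1} (\<lambda>x. \<bar>f x\<bar> powr q) = 1 / l"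
    and h: "0 < h" and v: "v \<in> carr (Lp q (real n * h))"
  shows "(\<Sum>k<n. \<bar>moment n h v k\<bar> powr q) \<le> l / h * (LINT x|lborel. \<bar>rep_L0 v x\<bar> powr q)"
proof -
  have iv: "set_integrable lborel A (\<lambda>x. \<bar>rep_L0 v x\<bar> powr q)" if "A \<in> sets borel" for A
    unfolding set_integrable_def using rep_L0_integrable(2)[OF q v] that by (intro integrable_mult_indicator) auto
  define F where "F = (\<lambda>x. indicator {0..real n * h} x * antiper f (x / h))"
  have cF: "continuous_on {0..real n * h} (\<lambda>x. \<bar>antiper f (x / h)\<bar> powr q)"
    using q by (intro continuous_on_powr' continuous_intros continuous_scaled[OF h sol_continuous(1)[OF sol_antiper]]) auto
  have iF: "set_integrable lborel {0..real n * h} (\<lambda>x. \<bar>F x\<bar> powr q)"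
  proof -
    have e: "indicator {0..real n * h} x *\<^sub>R \<bar>F x\<bar> powr q = indicator {0..real n * h} x *\<^sub>R \<bar>antiper f (x / h)\<bar> powr q" for x
      by (cases "x \<in> {0..real n * h}") (simp_all add: F_def)
    show ?thesis using borel_integrable_atLeastAtMost'[OF cF] unfolding set_integrable_def e .
  qed
  have cf: "continuous_on {0..1} (\<lambda>\<sigma>. \<bar>f \<sigma>\<bar> powr q)"
    using q by (intro continuous_on_powr' continuous_intros sol_continuous[OF sol]) auto
  have each: "h / l * \<bar>moment n h v k\<bar> powr q \<le> (LINT x:{real k * h..real k * h + h}|lborel. \<bar>rep_L0 v x\<bar> powr q)"
    if k: "k < n" for k
  proof -
    define I where "I = {real k * h..real k * h + h}"
    define m where "m = moment n h v k"
    have "real (Suc k) * h \<le> real n * h" using k h by (intro mult_right_mono) auto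
    then have sub: "I \<subseteq> {0..real n * h}" unfolding I_def using h by (auto simp: distrib_right intro: order.trans[rotated])
    have FI: "(LINT x:I|lborel. \<bar>F x\<bar> powr q) = h / l"
    proof -
      have "(LINT x:I|lborel. \<bar>F x\<bar> powr q) = h * (\<integral>\<sigma>. \<bar>F (real k * h + h * \<sigma>)\<bar> powr q \<partial>unitm)"
        unfolding I_def by (rule set_integral_affine[OF h])
      also have "(\<integral>\<sigma>. \<bar>F (real k * h + h * \<sigma>)\<bar> powr q \<partial>unitm) = (\<integral>\<sigma>. \<bar>f \<sigma>\<bar> powr q \<partial>unitm)"
      proof (rule Bochner_Integration.integral_cong[OF refl])
        fix \<sigma> assume "\<sigma> \<in> space unitm"
        then have \<sigma>: "\<sigma> \<in> {0..1}" by simp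
        have z: "(real k * h + h * \<sigma>) / h = real k + \<sigma>" using h by (simp add: field_simps)
        have x: "real k * h + h * \<sigma> \<in> {0..real n * h}" unfolding scaled_mem[OF h] z using \<sigma> k by auto
        show "\<bar>F (real k * h + h * \<sigma>)\<bar> powr q = \<bar>f \<sigma>\<bar> powr q"
          unfolding F_def z antiper_cell(1)[OF \<sigma>] using x by (simp add: abs_mult power_abs)
      qed
      also have "\<dots> = 1 / l" unfolding integral_unitm_continuous[OF cf] norm_f ..
      finally show ?thesis by simp
    qed
    have iFI: "set_integrable lborel I (\<lambda>x. \<bar>F x\<bar> powr q)" by (rule set_integrable_subset[OF iF _ sub]) (simp add: I_def)
    have iW: "set_integrable lborel I (\<lambda>x. rep_L0 v x * weight n h x)" unfolding I_def by (rule moment_integrable[OF h v])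
    have i1: "set_integrable lborel I (\<lambda>x. q * spow (q - 1) m * (rep_L0 v x * weight n h x))"
      and i2: "set_integrable lborel I (\<lambda>x. (q - 1) * \<bar>m\<bar> powr q * \<bar>F x\<bar> powr q)"
      using set_integrable_mult_right[OF iW] set_integrable_mult_right[OF iFI] by auto
    have W: "(LINT x:I|lborel. rep_L0 v x * weight n h x) = h / l * m"
      using h pos by (simp add: m_def moment_def I_def)
    have "(LINT x:I|lborel. q * spow (q - 1) m * (rep_L0 v x * weight n h x) - (q - 1) * \<bar>m\<bar> powr q * \<bar>F x\<bar> powr q)
      = q * spow (q - 1) m * (h / l * m) - (q - 1) * \<bar>m\<bar> powr q * (h / l)"
      unfolding set_integral_diff(2)[OF i1 i2] by (simp only: set_integral_mult_right W FI)
    also have "\<dots> = h / l * (q * (m * spow (q - 1) m) - (q - 1) * \<bar>m\<bar> powr q)" by (simp add: algebra_simps)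
    also have "\<dots> = h / l * \<bar>m\<bar> powr q" unfolding mult_spow by (simp add: algebra_simps)
    finally have "h / l * \<bar>m\<bar> powr q = (LINT x:I|lborel. q * spow (q - 1) m * (rep_L0 v x * weight n h x) - (q - 1) * \<bar>m\<bar> powr q * \<bar>F x\<bar> powr q)" ..
    also have "\<dots> \<le> (LINT x:I|lborel. \<bar>rep_L0 v x\<bar> powr q)"
    proof (rule set_integral_mono[OF set_integral_diff(1)[OF i1 i2] iv])
      fix x
      \<comment> \<open>The tangent point is m * F x with F the eigenfunction. As
        \<open>spow\<close> is multiplicative, the linear term is a multiple of the weight, and the
        integral over the cell is known exactly from the moment m and the integral of \<bar>F\<bar>
        powr q.\<close>
      have "q * spow (q - 1) (m * F x) * rep_L0 v x - (q - 1) * \<bar>m * F x\<bar> powr q \<le> \<bar>rep_L0 v x\<bar> powr q"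
        by (rule powr_tangent[OF q])
      then show "q * spow (q - 1) m * (rep_L0 v x * weight n h x) - (q - 1) * \<bar>m\<bar> powr q * \<bar>F x\<bar> powr q \<le> \<bar>rep_L0 v x\<bar> powr q"
        unfolding weight_def F_def[symmetric] by (simp add: spow_times abs_mult powr_mult mult_ac F_def)
    qed (simp add: I_def)
    finally show ?thesis unfolding m_def I_def .
  qed
  have "h / l * (\<Sum>k<n. \<bar>moment n h v k\<bar> powr q) \<le> (\<Sum>k<n. LINT x:{real k * h..real k * h + h}|lborel. \<bar>rep_L0 v x\<bar> powr q)"
    unfolding sum_distrib_left by (rule sum_mono) (use each in auto)
  also have "\<dots> = (LINT x:{0..real n * h}|lborel. \<bar>rep_L0 v x\<bar> powr q)"
    by (rule set_integral_split[OF h iv, symmetric]) simp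
  also have "\<dots> \<le> (LINT x|lborel. \<bar>rep_L0 v x\<bar> powr q)"
    unfolding set_lebesgue_integral_def
    by (rule integral_mono[OF _ rep_L0_integrable(2)[OF q v]])
       (use iv[of "{0..real n * h}"] in \<open>auto simp: set_integrable_def indicator_def\<close>)
  finally show ?thesis using h pos by (simp add: field_simps)
qed

end

section \<open>Inverting the tridiagonal system\<close>

text \<open>The difference of two solutions solves the system with right side 0, and accretivity,
  taken with exponent 2, forces it to be 0.\<close>

lemma jump_system_unique:
  assumes \<nu>: "0 \<le> \<nu>" and k: "k < n"
    and eq: "\<And>k. k < n \<Longrightarrow> 4 * y k - \<nu> * (jump n y (Suc k) - jump n y k) = 4 * z k - \<nu> * (jump n z (Suc k) - jump n z k)"
  shows "y k = z k"
proof -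
  define d where "d = (\<lambda>k. y k + (-1) * z k)"
  have J: "jump n d j = jump n y j - jump n z j" for j
    by (simp add: d_def jump_def)
  have "0 = 4 * d k - \<nu> * (jump n d (Suc k) - jump n d k)" if "k < n" for k
    unfolding J using eq[OF that] by (simp add: d_def algebra_simps)
  then have "(\<Sum>k<n. \<bar>4 * d k\<bar> powr 2) \<le> (\<Sum>k<n. \<bar>0\<bar> powr 2)"
    by (intro jump_accretive[OF _ \<nu>]) auto
  moreover have "0 \<le> (\<Sum>k<n. \<bar>4 * d k\<bar> powr 2)" by (rule sum_nonneg) simp
  ultimately have "(\<Sum>k<n. \<bar>4 * d k\<bar> powr 2) = 0" by simp
  then have "\<bar>4 * d k\<bar> powr 2 = 0" using k by (subst (asm) sum_nonneg_eq_0_iff) auto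
  then show ?thesis by (simp add: d_def)
qed

text \<open>Fixing the values from n on to be 0 makes the solution unique as a sequence, and hence
  linear in m.\<close>

definition jump_solution :: "real \<Rightarrow> nat \<Rightarrow> (nat \<Rightarrow> real) \<Rightarrow> nat \<Rightarrow> real" where
  "jump_solution \<nu> n m = (SOME y. (\<forall>k\<ge>n. y k = 0) \<and>
     (\<forall>k<n. 4 * y k - \<nu> * (jump n y (Suc k) - jump n y k) = m k))"

lemma jump_solution:
  assumes \<nu>: "0 \<le> \<nu>" and n: "1 \<le> n"
  shows "n \<le> k \<Longrightarrow> jump_solution \<nu> n m k = 0"
    "k < n \<Longrightarrow> 4 * jump_solution \<nu> n m k
      - \<nu> * (jump n (jump_solution \<nu> n m) (Suc k) - jump n (jump_solution \<nu> n m) k) = m k"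
proof -
  obtain y where y: "\<And>k. k < n \<Longrightarrow> 4 * y k - \<nu> * (jump n y (Suc k) - jump n y k) = m k"
    using jump_system_solvable[OF \<nu> n] by metis
  define y' where "y' = (\<lambda>k. if k < n then y k else 0)"
  have J: "jump n y' j = jump n y j" for j by (cases j) (auto simp: jump_def y'_def)
  let ?P = "\<lambda>y. (\<forall>k\<ge>n. y k = 0) \<and> (\<forall>k<n. 4 * y k - \<nu> * (jump n y (Suc k) - jump n y k) = m k)"
  have "?P y'" unfolding J using y by (simp add: y'_def)
  then have "?P (jump_solution \<nu> n m)" unfolding jump_solution_def by (rule someI[of ?P])
  then show "n \<le> k \<Longrightarrow> jump_solution \<nu> n m k = 0"
    "k < n \<Longrightarrow> 4 * jump_solution \<nu> n m k
      - \<nu> * (jump n (jump_solution \<nu> n m) (Suc k) - jump n (jump_solution \<nu> n m) k) = m k" by blast+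
qed

lemma jump_solution_eqI:
  assumes "0 \<le> \<nu>" "1 \<le> n" "\<And>k. n \<le> k \<Longrightarrow> y k = 0"
    and "\<And>k. k < n \<Longrightarrow> 4 * y k - \<nu> * (jump n y (Suc k) - jump n y k) = m k"
  shows "jump_solution \<nu> n m = y"
proof
  fix k show "jump_solution \<nu> n m k = y k"
  proof (cases "k < n")
    case True
    then show ?thesis
      by (rule jump_system_unique[OF assms(1)]) (simp add: jump_solution(2)[OF assms(1,2)] assms(4))
  next
    case False
    then show ?thesis using jump_solution(1)[OF assms(1,2)] assms(3) by simp
  qed
qed

lemma jump_solution_add:
  assumes \<nu>: "0 \<le> \<nu>" and n: "1 \<le> n"
  shows "jump_solution \<nu> n (\<lambda>k. a k + b k) = (\<lambda>k. jump_solution \<nu> n a k + jump_solution \<nu> n b k)"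
proof (rule jump_solution_eqI[OF \<nu> n])
  fix k assume "k < n"
  from jump_solution(2)[OF \<nu> n this, of a] jump_solution(2)[OF \<nu> n this, of b]
  show "4 * (jump_solution \<nu> n a k + jump_solution \<nu> n b k)
    - \<nu> * (jump n (\<lambda>k. jump_solution \<nu> n a k + jump_solution \<nu> n b k) (Suc k)
        - jump n (\<lambda>k. jump_solution \<nu> n a k + jump_solution \<nu> n b k) k) = a k + b k"
    unfolding jump_add by (simp add: algebra_simps)
qed (simp add: jump_solution(1)[OF \<nu> n])

lemma jump_solution_cmult:
  assumes \<nu>: "0 \<le> \<nu>" and n: "1 \<le> n"
  shows "jump_solution \<nu> n (\<lambda>k. c * a k) = (\<lambda>k. c * jump_solution \<nu> n a k)"
proof (rule jump_solution_eqI[OF \<nu> n])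
  fix k assume k: "k < n"
  have "4 * (c * jump_solution \<nu> n a k) - \<nu> * (c * jump n (jump_solution \<nu> n a) (Suc k) - c * jump n (jump_solution \<nu> n a) k)
    = c * (4 * jump_solution \<nu> n a k - \<nu> * (jump n (jump_solution \<nu> n a) (Suc k) - jump n (jump_solution \<nu> n a) k))"
    by (simp add: algebra_simps)
  then show "4 * (c * jump_solution \<nu> n a k) - \<nu> * (jump n (\<lambda>k. c * jump_solution \<nu> n a k) (Suc k)
      - jump n (\<lambda>k. c * jump_solution \<nu> n a k) k) = c * a k"
    unfolding jump_cmult jump_solution(2)[OF \<nu> n k] .
qed (simp add: jump_solution(1)[OF \<nu> n])

text \<open>Accretivity bounds 4 y by m in l^q; the passage to the smaller exponent p costs the
  factor n powr (1 / p - 1 / q).\<close>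

lemma jump_solution_bound:
  assumes \<nu>: "0 \<le> \<nu>" and n: "1 \<le> n" and pq: "1 < p" "p < q"
  shows "(\<Sum>k<n. \<bar>4 * jump_solution \<nu> n m k\<bar> powr p) powr (1 / p)
    \<le> real n powr (1 / p - 1 / q) * (\<Sum>k<n. \<bar>m k\<bar> powr q) powr (1 / q)"
proof -
  let ?y = "jump_solution \<nu> n m"
  have e: "\<bar>4 * ?y k\<bar> powr p = (\<bar>4 * ?y k\<bar> powr q) powr (p / q)" for k using pq by (simp add: powr_powr)
  have "(\<Sum>k<n. \<bar>4 * ?y k\<bar> powr p) \<le> real n powr (1 - p / q) * (\<Sum>k<n. \<bar>4 * ?y k\<bar> powr q) powr (p / q)"
    unfolding e by (rule power_mean) (use pq n in auto)
  also have "\<dots> \<le> real n powr (1 - p / q) * (\<Sum>k<n. \<bar>m k\<bar> powr q) powr (p / q)"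
  proof (intro mult_left_mono powr_mono2)
    show "(\<Sum>k<n. \<bar>4 * ?y k\<bar> powr q) \<le> (\<Sum>k<n. \<bar>m k\<bar> powr q)"
      by (rule jump_accretive[OF _ \<nu>]) (use pq jump_solution(2)[OF \<nu> n] in auto)
  qed (use pq in \<open>auto intro: sum_nonneg\<close>)
  finally have "(\<Sum>k<n. \<bar>4 * ?y k\<bar> powr p) powr (1 / p)
    \<le> (real n powr (1 - p / q) * (\<Sum>k<n. \<bar>m k\<bar> powr q) powr (p / q)) powr (1 / p)"
    using pq by (intro powr_mono2) (auto intro: sum_nonneg)
  also have "\<dots> = real n powr (1 / p - 1 / q) * (\<Sum>k<n. \<bar>m k\<bar> powr q) powr (1 / q)"
  proof -
    have "(1 - p / q) * (1 / p) = 1 / p - 1 / q" using pq by (simp add: field_simps)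
    then show ?thesis using pq by (simp add: powr_mult powr_powr)
  qed
  finally show ?thesis .
qed

section \<open>The factorization of the identity and the two estimates\<close>

context pq_sol
begin

lemma spline_class_add:
  assumes "0 < h" "1 \<le> n"
  shows "spline_class n h (\<lambda>k. y k + z k) = spline_class n h y + spline_class n h z"
  unfolding spline_class_def
    abs_L0_add[OF measurable_scaled[OF assms(1) continuous_spline(1)[OF assms(2)]] measurable_scaled[OF assms(1) continuous_spline(1)[OF assms(2)]]]
  by (simp add: spline_add distrib_left)

lemma spline_class_cmult:
  assumes "0 < h" "1 \<le> n"
  shows "spline_class n h (\<lambda>k. c * y k) = c *\<^sub>R spline_class n h y"
  unfolding spline_class_def abs_L0_scaleR[OF measurable_scaled[OF assms(1) continuous_spline(1)[OF assms(2)]]]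
  by (simp add: spline_cmult mult.left_commute)

text \<open>The identity of \<open>seq_space\<close> factors through the embedding: B forms the
  spline with parameters y, and A solves the tridiagonal system for the moments. A is defined on all
  of L^q, with a bound obtained from the moment estimate and the inverse of the system.\<close>

theorem iso_number_bound:
  assumes norm_f: "integral {0..1} (\<lambda>x. \<bar>f x\<bar> powr q) = 1 / l"
    and t: "0 < t" and n: "1 \<le> n" and pq: "p < q"
  shows "ennreal (t powr (1 / q + 2 - 1 / p) / ((real n)\<^sup>2 * l powr (1 / q))) \<le> iso_number (W2D p t) (Lp q t) E2 n"
proof -
  define h where "h = t / n"
  have h: "0 < h" and t_eq: "t = real n * h" using t n by (auto simp: h_def)
  define \<nu> where "\<nu> = - (f1 0 * g1 0) - 1"
  have \<nu>: "0 \<le> \<nu>" using gamma_ge_1 by (simp add: \<nu>_def)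
  let ?G = "seq_space p n"
  define A where "A = (\<lambda>v. Bcontfun (jump_solution \<nu> n (moment n h v)))"
  define B where "B = (\<lambda>y. spline_class n h (apply_bcontfun y))"
  have A_apply: "apply_bcontfun (A v) = jump_solution \<nu> n (moment n h v)" for v
    unfolding A_def by (rule finite_support_bcontfun[of n]) (rule jump_solution(1)[OF \<nu> n])
  have A_carr: "A v \<in> carr ?G" for v using jump_solution(1)[OF \<nu> n] by (simp add: seq_space_def A_apply)
  \<comment> \<open>The first factor is the cost of passing from l^q to l^p, the second bounds the
    moment map from L^q to l^q.\<close>
  define \<alpha> where "\<alpha> = real n powr (1 / p - 1 / q) * (l / h) powr (1 / q)"
  define \<beta> where "\<beta> = h powr (1 / p - 2)"
  have \<alpha>\<beta>: "0 < \<alpha>" "0 < \<beta>" using n h pos by (simp_all add: \<alpha>_def \<beta>_def)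
  have A_bound: "nrm ?G (A v) \<le> \<alpha> * nrm (Lp q t) v" if v: "v \<in> carr (Lp q t)" for v
  proof -
    have "nrm ?G (A v) \<le> real n powr (1 / p - 1 / q) * (\<Sum>k<n. \<bar>moment n h v k\<bar> powr q) powr (1 / q)"
      using jump_solution_bound[OF \<nu> n p pq] by (simp add: seq_space_def A_apply)
    also have "\<dots> \<le> real n powr (1 / p - 1 / q) * (l / h * (LINT x|lborel. \<bar>rep_L0 v x\<bar> powr q)) powr (1 / q)"
      using q v unfolding t_eq
      by (intro mult_left_mono powr_mono2 moment_bound[OF norm_f h]) (auto intro: sum_nonneg)
    also have "\<dots> = \<alpha> * nrm (Lp q t) v"
      unfolding nrm_Lp rep_L0_integrable(3)[OF q v] \<alpha>_def
      by (simp only: powr_mult mult.assoc)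
    finally show ?thesis .
  qed
  have A_op: "bounded_op (Lp q t) ?G A"
    unfolding bounded_op_def
  proof (intro conjI ballI allI exI[of _ \<alpha>] A_bound A_carr)
    fix u v assume "u \<in> carr (Lp q t)" "v \<in> carr (Lp q t)"
    then have "moment n h (u + v) = (\<lambda>k. moment n h u k + moment n h v k)"
      by (intro ext moment_add[OF h])
    then show "A (u + v) = A u + A v"
      by (intro bcontfun_eqI) (simp add: A_apply plus_bcontfun.rep_eq jump_solution_add[OF \<nu> n])
  next
    fix c v
    have "moment n h (c *\<^sub>R v) = (\<lambda>k. c * moment n h v k)" by (intro ext moment_scaleR[OF h])
    then show "A (c *\<^sub>R v) = c *\<^sub>R A v"
      by (intro bcontfun_eqI) (simp add: A_apply scaleR_bcontfun.rep_eq jump_solution_cmult[OF \<nu> n])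
  qed
  have B_bound: "nrm (W2D p t) (B y) \<le> \<beta> * nrm ?G y" for y
    using spline_class_in(3)[OF h n] by (simp add: B_def \<beta>_def seq_space_def t_eq)
  have B_carr: "B y \<in> carr (W2D p t)" "B y \<in> carr (Lp q t)" for y
    unfolding B_def t_eq by (rule spline_class_in[OF h n])+
  have B_op: "bounded_op ?G (W2D p t) B"
    unfolding bounded_op_def
  proof (intro conjI ballI allI exI[of _ \<beta>] B_bound B_carr)
    show "B (y + z) = B y + B z" for y z
      unfolding B_def spline_class_add[OF h n, symmetric] by (simp add: plus_bcontfun.rep_eq)
    show "B (c *\<^sub>R y) = c *\<^sub>R B y" for c y
      unfolding B_def spline_class_cmult[OF h n, symmetric] by (simp add: scaleR_bcontfun.rep_eq)
  qed
  have AB: "A (E2 (B y)) = y" if y: "y \<in> carr ?G" for y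
  proof -
    have "jump_solution \<nu> n (moment n h (B y)) = apply_bcontfun y"
    proof (rule jump_solution_eqI[OF \<nu> n])
      show "n \<le> k \<Longrightarrow> apply_bcontfun y k = 0" for k using y by (simp add: seq_space_def)
      show "k < n \<Longrightarrow> 4 * apply_bcontfun y k - \<nu> * (jump n (apply_bcontfun y) (Suc k) - jump n (apply_bcontfun y) k) = moment n h (B y) k" for k
        unfolding B_def \<nu>_def by (rule moment_spline_class[OF norm_f h n, symmetric])
    qed
    then show ?thesis by (intro bcontfun_eqI) (simp add: E2_def A_apply)
  qed
  have fac: "id_factorization (W2D p t) (Lp q t) E2 ?G A B"
    unfolding id_factorization_def using seq_space_banach[OF p] A_op B_op AB by blast
  have "ennreal (1 / (\<alpha> * \<beta>)) \<le> iso_number (W2D p t) (Lp q t) E2 n"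
  proof (rule iso_number_E2_ge[OF _ _ _ _ fac seq_space_dim n B_carr(2) \<alpha>\<beta>(1) A_bound \<alpha>\<beta>(2) B_bound])
    show "v \<in> carr (Lp q t) \<Longrightarrow> nrm (Lp q t) (c *\<^sub>R v) = \<bar>c\<bar> * nrm (Lp q t) v" for c v
      unfolding nrm_Lp by (rule Lp_scale(2)[OF q])
  qed (use Lp_scale(1)[OF q] W2D_norm_definite[OF t p] in auto)
  also have "1 / (\<alpha> * \<beta>) = t powr (1 / q + 2 - 1 / p) / ((real n)\<^sup>2 * l powr (1 / q))"
  proof -
    \<comment> \<open>From h = t / n; the factor n powr (1 / q - 1 / p) cancels against the power of
      n in \<alpha>, which leaves n^2.\<close>
    have hn: "h powr (1 / q + 2 - 1 / p) = t powr (1 / q + 2 - 1 / p) / (real n powr (1 / q - 1 / p) * (real n)\<^sup>2)"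
      using n t by (simp add: h_def powr_divide powr_add powr_diff)
    have "1 / (\<alpha> * \<beta>) = h powr (1 / q + 2 - 1 / p) * real n powr (1 / q - 1 / p) / l powr (1 / q)"
    proof -
      have "1 / (a * (b / c) * d) = c * (1 / d) * (1 / a) / b" for a b c d :: real by simp
      moreover have "(l / h) powr (1 / q) = l powr (1 / q) / h powr (1 / q)" by (rule powr_divide)
      moreover have "h powr (1 / q + 2 - 1 / p) = h powr (1 / q) * (1 / h powr (1 / p - 2))"
        "real n powr (1 / q - 1 / p) = 1 / real n powr (1 / p - 1 / q)"
        using h n by (simp_all add: powr_add powr_diff)
      ultimately show ?thesis unfolding \<alpha>_def \<beta>_def by simp
    qed
    then show ?thesis unfolding hn using n by simp
  qed
  finally show ?thesis .
qed

end

theorem theorem7p2: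
  fixes t0 p q :: real and n :: nat
  assumes "0 < t0" and "1 < p" and "1 < q" and "1 \<le> n"
  shows "(p < q \<longrightarrow>
            iso_number (W2D p t0) (Lp q t0) E2 n
              \<ge> ennreal (spectral_number p q t0 n powr (- 1 / q)) \<and>
            spectral_number p q t0 n powr (- 1 / q) =
              t0 powr (1 / q + 2 - 1 / p) / ((real n)\<^sup>2 * lambda1 p q powr (1 / q))) \<and>
         (p \<ge> q \<longrightarrow>
            approx_number (W2D p t0) (Lp q t0) E2 n
              \<le> ennreal (spectral_number p q t0 n powr (- 1 / q)) \<and>
            spectral_number p q t0 n powr (- 1 / q) =
              t0 powr (1 / q + 2 - 1 / p) / ((real n)\<^sup>2 * lambda1 p q powr (1 / q)))"
proof -
  obtain f f1 g g1 where P: "positive_sol (1 / (p - 1)) (q - 1) (1 / green_const p q) f f1 g g1"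
    and norm_f: "integral {0..1} (\<lambda>x. \<bar>f x\<bar> powr q) = green_const p q"
    and norm_g: "integral {0..1} (\<lambda>x. \<bar>g x\<bar> powr (p / (p - 1))) = 1"
    using positive_sol_exists[OF assms(2,3)] by blast
  \<comment> \<open>By \<open>lambda1_eq\<close> the first spectral number is 1 /
    \<open>green_const p q\<close>. The approximation bound, stated with \<open>green_const\<close>,
    and the isomorphism bound, stated with l, thus both refer to it.\<close>
  interpret pq_sol p q "1 / green_const p q" f f1 g g1
    using P by (simp add: pq_sol_def pq_sol_axioms_def assms(2) norm_g)
  have sn: "spectral_number p q t0 n powr (- 1 / q) = t0 powr (1 / q + 2 - 1 / p) / ((real n)\<^sup>2 * lambda1 p q powr (1 / q))"
    by (rule spectral_number_powr[OF assms(1,4)])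
  have "t0 powr (1 / q + 2 - 1 / p) / (real n)\<^sup>2 * green_const p q powr (1 / q)
    = t0 powr (1 / q + 2 - 1 / p) / ((real n)\<^sup>2 * lambda1 p q powr (1 / q))"
    unfolding lambda1_eq using green_const_pos[OF assms(2,3)] by (simp add: powr_divide)
  then have "approx_number (W2D p t0) (Lp q t0) E2 n \<le> ennreal (spectral_number p q t0 n powr (- 1 / q))" if "q \<le> p"
    using approx_number_bound[OF assms(1-3) that assms(4)] unfolding sn by simp
  moreover have "ennreal (spectral_number p q t0 n powr (- 1 / q)) \<le> iso_number (W2D p t0) (Lp q t0) E2 n" if "p < q"
    unfolding sn lambda1_eq by (rule iso_number_bound[OF _ assms(1,4) that]) (simp add: norm_f)
  ultimately show ?thesis using sn by blast
qed

end
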